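(* Assume that (a) $\theta\mapsto H^\alpha$ and $\theta\mapsto L_k^\beta$ ($k=1,\dots,r$) are three times continuously differentiable on $\Theta$; (b) (identifiability) for every $\theta=(\alpha,\beta)\in\Theta$ with $\theta\neq\theta_0$ there is at least one $t\in[0,T]$ with $b(\mathbf L^\beta,\bar\rho_t^\theta)\neq b(\mathbf L^{\beta_0},\bar\rho_t^{\theta_0})$; (c) the $p\times p$ matrix $I(\theta_0)=\int_0^T\nabla_\theta h(t,\theta_0)\nabla_\theta h(t,\theta_0)^\top dt$ is positive definite. For $n\ge1$ let $\Delta_n=T/n$, $t_j=j\Delta_n$, $\Delta_j\overline{\mathbf Y}^N=\overline{\mathbf Y}^N_{t_j}-\overline{\mathbf Y}^N_{t_{j-1}}$, and $$\Phi_{N,n}(\theta)=\sum_{j=1}^n h(t_{j-1},\theta)\cdot\Delta_j\overline{\mathbf Y}^N-\frac12\sum_{j=1}^n\|h(t_{j-1},\theta)\|_{\mathbb R^r}^2\Delta_n,\qquad \hat\theta_{N,n}=\operatorname{arg\,max}_{\theta\in\Theta}\Phi_{N,n}(\theta).$$ Let $\Sigma=\mathbb E[\eta_1(\theta_0)\eta_1(\theta_0)^\top]$ with $\eta_i(\theta)=\int_0^T\nabla_\theta h(t,\theta)\{d\mathbf Y^{(i)}_t-h(t,\theta)\,dt\}$. If $N\to\infty$, $n\to\infty$ and $\sqrt N\,\Delta_n\to0$ (i.e. along any sequence of pairs $(N,n)$ with these properties), then $$\sqrt N(\hat\theta_{N,n}-\theta_0)\xrightarrow{d}\mathcal N\big(0,\,I(\theta_0)^{-1}\Sigma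 I(\theta_0)^{-1}\big).$$
   Context: Fix $T>0$ and integers $d,r,p\ge1$. Let $\Theta^\circ\subset\mathbb R^p$ be a bounded convex open set, $\Theta=\overline{\Theta^\circ}$ (compact), and let the true parameter $\theta_0=(\alpha_0,\beta_0)$ lie in $\Theta^\circ$. Each $\theta\in\Theta$ is written $\theta=(\alpha,\beta)$ with $\alpha,\beta$ vector-valued. For each $\theta$ there are given a self-adjoint matrix $H^\alpha\in M_d(\mathbb C)$ and matrices $L_1^\beta,\dots,L_r^\beta\in M_d(\mathbb C)$; $\mathbf L^\beta=(L_1^\beta,\dots,L_r^\beta)$. "$\ell$-times continuously differentiable on $\Theta$" means on $\Theta^\circ$, with all derivatives of order at most $\ell$ extending continuously to $\Theta$. Put $b(A,B)=2\operatorname{Re}\operatorname{Tr}(A^*B)$ for $A,B\in M_d(\mathbb C)$ and $b(\mathbf L^\beta,\rho)=(b(L_1^\beta,\rho),\dots,b(L_r^\beta,\rho))^\top\in\mathbb R^r$. With $[A,B]=AB-BA$, $\{A,B\}=AB+BA$, put $$\mathcal L^\theta(\rho)=-i[H^\alpha,\rho]+\sum_{k=1}^r\Big(L_k^\beta\rho(L_k^\beta)^*-\tfrac12\{(L_k^\beta)^*L_k^\beta,\rho\}\Big),\qquad \mathcal H_k^\beta(\rho)=L_k^\beta\rho+\rho(L_k^\beta)^*-b(L_k^\beta,\rho)\rho.$$ Let $\mathbf W^{(1)},\mathbf W^{(2)},\dots$ be independent $r$-dimensional standard Wiener processes on $[0,T]$, $\mathbf W^{(i)}=(W^{(i,1)},\dots,W^{(i,r)})^\top$,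 and let $\rho_0\in M_d(\mathbb C)$ be a fixed (known) density matrix (positive semidefinite, trace one). For $\theta\in\Theta$, $i\ge1$, $\rho_t^{\theta,(i)}$ is the unique solution of $$d\rho_t^{\theta,(i)}=\mathcal L^\theta(\rho_t^{\theta,(i)})\,dt+\sum_{k=1}^r\mathcal H_k^\beta(\rho_t^{\theta,(i)})\,dW_t^{(i,k)},\qquad \rho_0^{\theta,(i)}=\rho_0;$$ it is known that it exists, is unique and is density-matrix valued. Put $\bar\rho_t^\theta=\mathbb E[\rho_t^{\theta,(i)}]$ (independent of $i$) and $h(t,\theta)=b(\mathbf L^\beta,\bar\rho_t^\theta)\in\mathbb R^r$; $\nabla_\theta h(t,\theta)$ is the $p\times r$ matrix whose $k$-th column is the gradient in $\theta$ of the $k$-th component of $h$. Observations: the records are generated under $\theta_0$, i.e. $d\mathbf Y^{(i)}_t=b(\mathbf L^{\beta_0},\rho_t^{\theta_0,(i)})\,dt+d\mathbf W^{(i)}_t$, $\mathbf Y_0^{(i)}=0$; $\overline{\mathbf Y}^N=\frac1N\sum_{i=1}^N\mathbf Y^{(i)}$. $\hat\theta_{N,n}$ is a measurable choice of a maximizer. $\xrightarrow{d}$ denotes convergence in distribution. *)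

theory Defs
  imports "HOL-Probability.Probability"
begin

section \<open>Matrices and the quantum filtering coefficients\<close>

definition ctranspose :: "complex^'n^'m \<Rightarrow> complex^'m^'n" where
  "ctranspose A = (\<chi> i j. cnj (A $ j $ i))"

definition self_adjoint :: "complex^'d^'d \<Rightarrow> bool" where
  "self_adjoint A \<longleftrightarrow> ctranspose A = A"

definition density_matrix :: "complex^'d^'d \<Rightarrow> bool" where
  "density_matrix A \<longleftrightarrow> self_adjoint A
     \<and> (\<forall>v :: complex^'d. 0 \<le> Re (\<Sum>i\<in>UNIV. cnj (v $ i) * (A *v v) $ i))
     \<and> trace A = 1"

definition commutator :: "complex^'d^'d \<Rightarrow> complex^'d^'d \<Rightarrow> complex^'d^'d" where
  "commutator A B = A ** B - B ** A"

definition anticommutator :: "complex^'d^'d \<Rightarrow> complex^'d^'d \<Rightarrow> complex^'d^'d" where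
  "anticommutator A B = A ** B + B ** A"

definition bform :: "complex^'d^'d \<Rightarrow> complex^'d^'d \<Rightarrow> real" where
  "bform A B = 2 * Re (trace (ctranspose A ** B))"

definition bvec :: "('r::finite \<Rightarrow> complex^'d^'d) \<Rightarrow> complex^'d^'d \<Rightarrow> real^'r" where
  "bvec Ls A = (\<chi> k. bform (Ls k) A)"

text \<open>The factor \<^term>\<open>mat c\<close> is the scalar matrix, so \<^term>\<open>mat c ** A\<close> is complex
  scalar multiplication.\<close>

definition lindblad ::
  "complex^'d^'d \<Rightarrow> ('r::finite \<Rightarrow> complex^'d^'d) \<Rightarrow> complex^'d^'d \<Rightarrow> complex^'d^'d" where
  "lindblad H Ls A = mat (- \<i>) ** commutator H A
     + (\<Sum>k\<in>UNIV. Ls k ** A ** ctranspose (Ls k)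
          - (1/2) *\<^sub>R anticommutator (ctranspose (Ls k) ** Ls k) A)"

definition diffusion_coeff :: "complex^'d^'d \<Rightarrow> complex^'d^'d \<Rightarrow> complex^'d^'d" where
  "diffusion_coeff B A = B ** A + A ** ctranspose B - bform B A *\<^sub>R A"

definition pos_def_matrix :: "real^'p^'p \<Rightarrow> bool" where
  "pos_def_matrix A \<longleftrightarrow> transpose A = A \<and> (\<forall>v. v \<noteq> 0 \<longrightarrow> 0 < v \<bullet> (A *v v))"

definition outer :: "real^'p \<Rightarrow> real^'p^'p" where
  "outer x = (\<chi> i j. x $ i * x $ j)"

section \<open>Dependence on the parameter\<close>

text \<open>A parameter in $\mathbb R^p$ is split into two sub-vectors by a set of coordinate indices;
  either of the two may be empty.\<close>

definition depends_only_on :: "'p set \<Rightarrow> (real^'p) set \<Rightarrow> (real^'p \<Rightarrow> 'v) \<Rightarrow> bool" where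
  "depends_only_on A S f \<longleftrightarrow>
     (\<forall>x\<in>S. \<forall>y\<in>S. (\<forall>i\<in>A. x $ i = y $ i) \<longrightarrow> f x = f y)"

text \<open>Here \<open>D i\<close> is the continuous extension to the closure of the \<open>i\<close>-th
  partial derivative on the open set \<open>U\<close>.\<close>

primrec cont_diff_closure ::
  "nat \<Rightarrow> (real^'p) set \<Rightarrow> (real^'p \<Rightarrow> 'v::real_normed_vector) \<Rightarrow> bool" where
  "cont_diff_closure 0 U f \<longleftrightarrow> continuous_on (closure U) f"
| "cont_diff_closure (Suc l) U f \<longleftrightarrow> continuous_on (closure U) f \<and>
     (\<exists>D :: 'p \<Rightarrow> real^'p \<Rightarrow> 'v.
        (\<forall>x\<in>U. (f has_derivative (\<lambda>v. \<Sum>i\<in>UNIV. v $ i *\<^sub>R D i x)) (at x)) \<and>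
        (\<forall>i. cont_diff_closure l U (D i)))"

section \<open>Wiener processes and Ito integrals\<close>

definition wiener_process :: "'a measure \<Rightarrow> real \<Rightarrow> (real \<Rightarrow> 'a \<Rightarrow> real^'r) \<Rightarrow> bool" where
  "wiener_process M T W \<longleftrightarrow>
     (\<forall>t\<in>{0..T}. W t \<in> borel_measurable M) \<and>
     (AE \<omega> in M. W 0 \<omega> = 0) \<and>
     (AE \<omega> in M. continuous_on {0..T} (\<lambda>t. W t \<omega>)) \<and>
     (\<forall>s t. 0 \<le> s \<and> s < t \<and> t \<le> T \<longrightarrow>
        prob_space.indep_set M
          (sigma_sets (space M) {W u -` B \<inter> space M | u B. 0 \<le> u \<and> u \<le> s \<and> B \<in> sets borel})
          (sigma_sets (space M) {(\<lambda>\<omega>. W t \<omega> - W s \<omega>) -` B \<inter> space M | B. B \<in> sets borel}) \<and>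
        distributed M lborel (\<lambda>\<omega>. W t \<omega> - W s \<omega>)
          (\<lambda>x. ennreal (\<Prod>k\<in>UNIV. normal_density 0 (sqrt (t - s)) (x $ k))))"

definition aug_filtration :: "'a measure \<Rightarrow> (real \<Rightarrow> 'a \<Rightarrow> real^'r) \<Rightarrow> real \<Rightarrow> 'a measure" where
  "aug_filtration M W t = sigma (space M)
     ({W s -` B \<inter> space M | s B. 0 \<le> s \<and> s \<le> t \<and> B \<in> sets borel} \<union> null_sets M)"

definition simple_process ::
  "'a measure \<Rightarrow> (real \<Rightarrow> 'a measure) \<Rightarrow> real \<Rightarrow> nat \<Rightarrow> (nat \<Rightarrow> real)
     \<Rightarrow> (nat \<Rightarrow> 'a \<Rightarrow> 'v::euclidean_space) \<Rightarrow> bool" where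
  "simple_process M F t m \<tau> \<xi> \<longleftrightarrow>
     \<tau> 0 = 0 \<and> \<tau> m = t \<and> (\<forall>j<m. \<tau> j \<le> \<tau> (Suc j)) \<and>
     (\<forall>j<m. \<xi> j \<in> borel_measurable (F (\<tau> j)) \<and> (\<exists>C. \<forall>\<omega>\<in>space M. norm (\<xi> j \<omega>) \<le> C))"

definition simple_process_val ::
  "nat \<Rightarrow> (nat \<Rightarrow> real) \<Rightarrow> (nat \<Rightarrow> 'a \<Rightarrow> 'v::euclidean_space) \<Rightarrow> real \<Rightarrow> 'a \<Rightarrow> 'v" where
  "simple_process_val m \<tau> \<xi> s \<omega> = (\<Sum>j<m. indicator {\<tau> j<..\<tau> (Suc j)} s *\<^sub>R \<xi> j \<omega>)"

definition simple_process_integral ::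
  "nat \<Rightarrow> (nat \<Rightarrow> real) \<Rightarrow> (nat \<Rightarrow> 'a \<Rightarrow> 'v::euclidean_space) \<Rightarrow> (real \<Rightarrow> 'a \<Rightarrow> real)
     \<Rightarrow> 'a \<Rightarrow> 'v" where
  "simple_process_integral m \<tau> \<xi> W \<omega> =
     (\<Sum>j<m. (W (\<tau> (Suc j)) \<omega> - W (\<tau> j) \<omega>) *\<^sub>R \<xi> j \<omega>)"

text \<open>\<open>I\<close> is (a version of) the integral of \<open>f\<close> over $[0,t]$ against the real Wiener process
  \<open>W\<close>, by the usual $L^2$-extension from simple processes. Approximability forces \<open>f\<close> to be
  square integrable; no localisation is needed, since all integrands below are bounded.\<close>

definition has_ito_integral ::
  "'a measure \<Rightarrow> (real \<Rightarrow> 'a measure) \<Rightarrow> (real \<Rightarrow> 'a \<Rightarrow> real)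
     \<Rightarrow> (real \<Rightarrow> 'a \<Rightarrow> 'v::euclidean_space) \<Rightarrow> real \<Rightarrow> ('a \<Rightarrow> 'v) \<Rightarrow> bool" where
  "has_ito_integral M F W f t I \<longleftrightarrow>
     (\<forall>u\<in>{0..t}. (\<lambda>(s, \<omega>). f s \<omega>)
        \<in> borel_measurable (restrict_space borel {0..u} \<Otimes>\<^sub>M F u)) \<and>
     I \<in> borel_measurable M \<and>
     (\<exists>m \<tau> \<xi>. (\<forall>n::nat. simple_process M F t (m n) (\<tau> n) (\<xi> n)) \<and>
        (\<lambda>n. \<integral>\<^sup>+\<omega>. (\<integral>\<^sup>+s\<in>{0..t}.
             ennreal ((norm (f s \<omega> - simple_process_val (m n) (\<tau> n) (\<xi> n) s \<omega>))\<^sup>2) \<partial>lborel) \<partial>M)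
          \<longlonglongrightarrow> 0 \<and>
        (\<lambda>n. \<integral>\<^sup>+\<omega>.
             ennreal ((norm (I \<omega> - simple_process_integral (m n) (\<tau> n) (\<xi> n) W \<omega>))\<^sup>2) \<partial>M)
          \<longlonglongrightarrow> 0)"

text \<open>Integral of \<open>f\<close> over $[0,t]$ against the Ito process $dY = a\,dt + dW$.\<close>

definition has_ito_process_integral ::
  "'a measure \<Rightarrow> (real \<Rightarrow> 'a measure) \<Rightarrow> (real \<Rightarrow> 'a \<Rightarrow> real) \<Rightarrow> (real \<Rightarrow> 'a \<Rightarrow> real)
     \<Rightarrow> (real \<Rightarrow> 'a \<Rightarrow> 'v::euclidean_space) \<Rightarrow> real \<Rightarrow> ('a \<Rightarrow> 'v) \<Rightarrow> bool" where
  "has_ito_process_integral M F a W f t I \<longleftrightarrow> I \<in> borel_measurable M \<and>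
     (\<exists>J. has_ito_integral M F W f t J \<and>
        (AE \<omega> in M. I \<omega> = (LINT s:{0..t}|lborel. a s \<omega> *\<^sub>R f s \<omega>) + J \<omega>))"

text \<open>Strong solutions: adapted to the augmented filtration of the driving process.\<close>

definition belavkin_solution ::
  "'a measure \<Rightarrow> real \<Rightarrow> complex^'d^'d \<Rightarrow> ('r::finite \<Rightarrow> complex^'d^'d) \<Rightarrow> complex^'d^'d
     \<Rightarrow> (real \<Rightarrow> 'a \<Rightarrow> real^'r) \<Rightarrow> (real \<Rightarrow> 'a \<Rightarrow> complex^'d^'d) \<Rightarrow> bool" where
  "belavkin_solution M T H Ls \<rho>0 W \<rho> \<longleftrightarrow>
     (\<forall>t\<in>{0..T}. \<rho> t \<in> borel_measurable (aug_filtration M W t)) \<and>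
     (\<forall>\<omega>\<in>space M. continuous_on {0..T} (\<lambda>t. \<rho> t \<omega>)) \<and>
     (AE \<omega> in M. \<forall>t\<in>{0..T}. density_matrix (\<rho> t \<omega>)) \<and>
     (\<forall>t\<in>{0..T}. \<exists>J :: 'r \<Rightarrow> 'a \<Rightarrow> complex^'d^'d.
        (\<forall>k. has_ito_integral M (aug_filtration M W) (\<lambda>s \<omega>. W s \<omega> $ k)
               (\<lambda>s \<omega>. diffusion_coeff (Ls k) (\<rho> s \<omega>)) t (J k)) \<and>
        (AE \<omega> in M. \<rho> t \<omega> = \<rho>0 + (LINT s:{0..t}|lborel. lindblad H Ls (\<rho> s \<omega>))
               + (\<Sum>k\<in>UNIV. J k \<omega>)))"

section \<open>Multivariate normal law and convergence in distribution\<close>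

definition std_normal_law :: "(real^'p) measure" where
  "std_normal_law = density lborel (\<lambda>x. ennreal (\<Prod>i\<in>UNIV. std_normal_density (x $ i)))"

text \<open>The law of $m + AZ$ with $Z$ standard normal and $AA^\top = V$; it does not depend on the
  choice of $A$, and $V$ may be singular.\<close>

definition normal_law :: "real^'p \<Rightarrow> real^'p^'p \<Rightarrow> (real^'p) measure" where
  "normal_law m V =
     distr std_normal_law borel (\<lambda>z. m + (SOME A :: real^'p^'p. A ** transpose A = V) *v z)"

definition converges_in_distribution ::
  "'a measure \<Rightarrow> (nat \<Rightarrow> 'a \<Rightarrow> 'v::topological_space) \<Rightarrow> 'v measure \<Rightarrow> bool" where
  "converges_in_distribution M X \<mu> \<longleftrightarrow>
     (\<forall>f :: 'v \<Rightarrow> real. continuous_on UNIV f \<and> bounded (range f) \<longrightarrow>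
        (\<lambda>n. LINT \<omega>|M. f (X n \<omega>)) \<longlonglongrightarrow> (LINT x|\<mu>. f x))"

section \<open>The statistical model\<close>

text \<open>The independent copies are numbered from $0$, and \<open>\<rho> \<theta> i t \<omega>\<close> is the state of copy \<open>i\<close>
  at time \<open>t\<close> under the parameter \<open>\<theta>\<close>. The mean does not depend on the copy.\<close>

definition mean_state ::
  "'a measure \<Rightarrow> (real^'p \<Rightarrow> nat \<Rightarrow> real \<Rightarrow> 'a \<Rightarrow> complex^'d^'d)
     \<Rightarrow> real^'p \<Rightarrow> real \<Rightarrow> complex^'d^'d" where
  "mean_state M \<rho> \<theta> t = (LINT \<omega>|M. \<rho> \<theta> 0 t \<omega>)"

definition mean_signal ::
  "'a measure \<Rightarrow> (real^'p \<Rightarrow> 'r::finite \<Rightarrow> complex^'d^'d)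
     \<Rightarrow> (real^'p \<Rightarrow> nat \<Rightarrow> real \<Rightarrow> 'a \<Rightarrow> complex^'d^'d) \<Rightarrow> real \<Rightarrow> real^'p \<Rightarrow> real^'r" where
  "mean_signal M L \<rho> t \<theta> = bvec (L \<theta>) (mean_state M \<rho> \<theta> t)"

text \<open>The $p \times r$ matrix whose columns are the gradients of the components.\<close>

definition grad :: "(real^'p \<Rightarrow> real^'r) \<Rightarrow> real^'p \<Rightarrow> real^'r^'p" where
  "grad f \<theta> = transpose (jacobian f (at \<theta>))"

definition information_matrix :: "real \<Rightarrow> (real \<Rightarrow> real^'p \<Rightarrow> real^'r) \<Rightarrow> real^'p \<Rightarrow> real^'p^'p" where
  "information_matrix T h \<theta> =
     (LINT t:{0..T}|lborel. grad (h t) \<theta> ** transpose (grad (h t) \<theta>))"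

definition obs_record ::
  "(real^'p \<Rightarrow> 'r::finite \<Rightarrow> complex^'d^'d)
     \<Rightarrow> (real^'p \<Rightarrow> nat \<Rightarrow> real \<Rightarrow> 'a \<Rightarrow> complex^'d^'d)
     \<Rightarrow> (nat \<Rightarrow> real \<Rightarrow> 'a \<Rightarrow> real^'r) \<Rightarrow> real^'p \<Rightarrow> nat \<Rightarrow> real \<Rightarrow> 'a \<Rightarrow> real^'r" where
  "obs_record L \<rho> W \<theta>0 i t \<omega> =
     (LINT s:{0..t}|lborel. bvec (L \<theta>0) (\<rho> \<theta>0 i s \<omega>)) + W i t \<omega>"

definition mean_record ::
  "(nat \<Rightarrow> real \<Rightarrow> 'a \<Rightarrow> real^'r) \<Rightarrow> nat \<Rightarrow> real \<Rightarrow> 'a \<Rightarrow> real^'r" where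
  "mean_record Y N t \<omega> = (1 / real N) *\<^sub>R (\<Sum>i<N. Y i t \<omega>)"

definition contrast ::
  "real \<Rightarrow> (real \<Rightarrow> real^'p \<Rightarrow> real^'r) \<Rightarrow> (real \<Rightarrow> real^'r) \<Rightarrow> nat \<Rightarrow> real^'p \<Rightarrow> real" where
  "contrast T h y n \<theta> =
     (let \<Delta> = T / real n; \<tau> = (\<lambda>j. real j * \<Delta>) in
        (\<Sum>j=1..n. h (\<tau> (j - 1)) \<theta> \<bullet> (y (\<tau> j) - y (\<tau> (j - 1))))
        - (1/2) * (\<Sum>j=1..n. (norm (h (\<tau> (j - 1)) \<theta>))\<^sup>2 * \<Delta>))"

text \<open>\<open>\<eta>\<close> is (a version of) $\int_0^T \nabla_\theta h(t,\theta)\,\{dY^{(i)}_t - h(t,\theta)\,dt\}$,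
  where the record $Y^{(i)}$ of copy \<open>i\<close> is generated under \<open>\<theta>0\<close>.\<close>

definition has_score ::
  "'a measure \<Rightarrow> real \<Rightarrow> (real^'p \<Rightarrow> 'r::finite \<Rightarrow> complex^'d^'d)
     \<Rightarrow> (real^'p \<Rightarrow> nat \<Rightarrow> real \<Rightarrow> 'a \<Rightarrow> complex^'d^'d)
     \<Rightarrow> (nat \<Rightarrow> real \<Rightarrow> 'a \<Rightarrow> real^'r) \<Rightarrow> real^'p \<Rightarrow> real^'p \<Rightarrow> nat \<Rightarrow> ('a \<Rightarrow> real^'p) \<Rightarrow> bool" where
  "has_score M T L \<rho> W \<theta>0 \<theta> i \<eta> \<longleftrightarrow> \<eta> \<in> borel_measurable M \<and>
     (\<exists>J :: 'r \<Rightarrow> 'a \<Rightarrow> real^'p.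
        (\<forall>k. has_ito_process_integral M (aug_filtration M (W i))
               (\<lambda>t \<omega>. bform (L \<theta>0 k) (\<rho> \<theta>0 i t \<omega>)) (\<lambda>t \<omega>. W i t \<omega> $ k)
               (\<lambda>t \<omega>. column k (grad (mean_signal M L \<rho> t) \<theta>)) T (J k)) \<and>
        (AE \<omega> in M. \<eta> \<omega> = (\<Sum>k\<in>UNIV. J k \<omega>)
           - (LINT t:{0..T}|lborel.
                grad (mean_signal M L \<rho> t) \<theta> *v mean_signal M L \<rho> t \<theta>)))"

end

theory Submission
  imports Defs "HOL-Real_Asymp.Real_Asymp"
begin

text \<open>Why the theorem holds. Write \<open>h t \<theta>\<close> for the mean signal and \<open>z\<close> for the fluctuation of the averaged
record, $z_t = \overline Y_t - \int_0^t h(s,\theta_0)\,ds$. Completing the square turns the contrast into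
\[ \Phi(\theta) - \Phi(\theta_0) = \sum_j (h(t_j,\theta) - h(t_j,\theta_0)) \cdot (z_{t_{j+1}} - z_{t_j})
   - \tfrac12 \sum_j \|h(t_j,\theta) - h(t_j,\theta_0)\|^2 \Delta + O(\Delta) . \]
The function \<open>h\<close> is deterministic and Lipschitz in time, uniformly in the parameter. Summation by parts
therefore bounds the first sum, for all parameters at once, by the single random number
\<open>fluct n z\<close>, whose expectation is of order $N^{-1/2}$. After this reduction the analysis of the maximizer is
a statement about one fixed path. Identifiability and compactness make the second sum dominate away
from $\theta_0$ (\<open>consistency\<close>). Near $\theta_0$ the first order condition, linearized with the positive
definite information matrix, shows that $\hat\theta - \theta_0$ equals $I(\theta_0)^{-1}$ times the discrete score
$\sum_j \nabla h(t_j,\theta_0)(z_{t_{j+1}} - z_{t_j})$, up to an error that is small compared with the size of the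
fluctuation plus a multiple of $\Delta$ (\<open>estimator_expansion\<close>). The condition $\sqrt N \Delta \to 0$ removes the latter.

Regularity of \<open>h\<close>. Ito integrals have mean zero and the drift is linear in the state, so the mean state solves a
linear differential equation and is the exponential series of \<open>t\<close> times the Lindblad generator applied to the initial
state (\<open>sde_mean\<close>). The generator is continuously differentiable in the parameter, and termwise
differentiation of the series gives the derivative of \<open>h\<close> together with all uniform bounds (\<open>regular\<close>).

Central limit theorem. The discrete score is $N^{-1}$ times a sum of scores of the single copies. These are
independent, because each copy is measurable with respect to its own Wiener process. They are also
nearly identically distributed: a strong solution is within mean square distance $O(1/n)$ of an
Euler scheme, and the Euler scheme is one fixed function of the Gaussian increments, hence has the same
law for every copy (\<open>euler_copy\<close>). The score of copy \<open>0\<close> is moreover within $O(1/n)$ of the Ito integral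
\<open>\<eta>\<close> (\<open>eta_close\<close>). Characteristic functions then converge as in the classical theorem for the
identically distributed variable \<open>\<eta>\<close> (\<open>score_clt\<close>).

From characteristic functions to convergence in distribution. Levy's theorem on $\mathbb R^p$ is obtained by convolving
with a small Gaussian: the smoothed densities are Fourier integrals of the characteristic functions and converge
pointwise, hence in $L^1$ (\<open>levy_continuity_vec\<close>). The limit is identified through the characteristic function
of the possibly degenerate normal law (\<open>normal_law_char\<close>).\<close>

section \<open>Gaussian densities on Euclidean space\<close>

lemma bij_betw_axis_Basis: "bij_betw (%i. axis i (1::real)) (UNIV::'n::finite set) (Basis::(real^'n) set)"
 unfolding bij_betw_def inj_on_def by (auto simp: Basis_vec_def axis_eq_axis)

text \<open>Lebesgue measure on $\mathbb R^n$ is by definition a product over the orthonormal basis; re-indexing the basis by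
coordinates makes integrals of coordinate products factorize.\<close>

lemma lborel_vec_prod:
 fixes f :: "'n::finite => real => 'b::{real_normed_field,banach,second_countable_topology}"
 assumes f: "!!i. integrable lborel (f i)"
 shows "integrable lborel (%x::real^'n. \<Prod>i\<in>UNIV. f i (x $ i))"
  and "(LINT x|(lborel :: (real^'n) measure). (\<Prod>i\<in>UNIV. f i (x $ i))) = (\<Prod>i\<in>UNIV. LINT y|lborel. f i y)"
proof -
 have [measurable]: "f i \<in> borel_measurable borel" for i
  using borel_measurable_integrable[OF f[of i]] by simp
 interpret P: product_sigma_finite "%_::real^'n. lborel :: real measure"
  by unfold_locales
 define idx :: "real^'n => 'n" where "idx = inv_into UNIV (%i. axis i (1::real))"
 have idx: "idx (axis i 1) = i" for i
  unfolding idx_def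
  by (rule inv_into_f_f[of "%i. axis i (1::real)" UNIV i, OF bij_betw_imp_inj_on[OF bij_betw_axis_Basis] UNIV_I])
 have comp: "(\<Sum>b\<in>Basis. g b *\<^sub>R b) $ i = g (axis i (1::real))" for g :: "real^'n => real" and i
 proof -
  have "(\<Sum>b\<in>Basis. g b *\<^sub>R b) = (\<Sum>j\<in>UNIV. g (axis j 1) *\<^sub>R axis j (1::real))"
   by (rule sum.reindex_bij_betw[OF bij_betw_axis_Basis, symmetric])
  then show ?thesis
   by (simp add: axis_def if_distrib[where f="%x. _ * x"] cong: if_cong)
 qed
 have prod: "(\<Prod>i\<in>UNIV. f i ((\<Sum>b\<in>Basis. g b *\<^sub>R b) $ i)) = (\<Prod>b\<in>Basis. f (idx b) (g b))"
  for g :: "real^'n => real"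
  by (subst prod.reindex_bij_betw[OF bij_betw_axis_Basis, symmetric]) (simp only: comp idx)
 have fi: "!!b. b \<in> Basis ==> integrable lborel (f (idx b))" using f by simp
 have meas: "(%g. \<Sum>b\<in>Basis. g b *\<^sub>R b) \<in> Pi\<^sub>M (Basis::(real^'n) set) (%_. lborel) \<rightarrow>\<^sub>M borel"
  by measurable
 have mp: "(%x::real^'n. \<Prod>i\<in>UNIV. f i (x $ i)) \<in> borel_measurable borel"
  by measurable
 show "integrable lborel (%x::real^'n. \<Prod>i\<in>UNIV. f i (x $ i))"
  unfolding lborel_eq[where 'a="real^'n"]
  apply (subst integrable_distr_eq[OF meas mp])
  unfolding prod by (rule P.product_integrable_prod[OF finite_Basis fi])
 show "(LINT x|(lborel :: (real^'n) measure). (\<Prod>i\<in>UNIV. f i (x $ i))) = (\<Prod>i\<in>UNIV. LINT y|lborel. f i y)"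
  unfolding lborel_eq[where 'a="real^'n"]
  apply (subst integral_distr[OF meas mp])
  unfolding prod apply (subst P.product_integral_prod[OF finite_Basis fi], assumption)
  by (subst prod.reindex_bij_betw[OF bij_betw_axis_Basis, symmetric]) (simp only: idx)
qed

text \<open>The scale \<open>s\<close> is the standard deviation of each coordinate.\<close>

definition gauss_density :: "real => real^'n => real" where
 "gauss_density s x = (\<Prod>i\<in>UNIV. normal_density 0 s (x $ i))"

lemma gauss_density_measurable[measurable]: "gauss_density s \<in> borel_measurable borel"
 unfolding gauss_density_def by measurable

lemma gauss_density_nonneg: "0 <= gauss_density s x"
 unfolding gauss_density_def by (simp add: prod_nonneg)

lemma gauss_density_integral:
 assumes "0 < s"
 shows "integrable lborel (gauss_density s :: real^'n => real)"
  "(LINT x|lborel. gauss_density s (x::real^'n)) = 1"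
 using lborel_vec_prod[of "%_::'n. normal_density 0 s"] assms
 unfolding gauss_density_def by auto

lemma gauss_density_moment:
 assumes s: "0 < s"
 shows "integrable lborel (%x::real^'n. gauss_density s x * (x $ k))"
  "(LINT x|lborel. gauss_density s (x::real^'n) * (x $ k)) = 0"
  "integrable lborel (%x::real^'n. gauss_density s x * (x $ k)\<^sup>2)"
  "(LINT x|lborel. gauss_density s (x::real^'n) * (x $ k)\<^sup>2) = s\<^sup>2"
proof -
 define f where "f = (%m i y. normal_density 0 s y * (if i = k then y ^ m else 1))"
 have fi: "integrable lborel (f m i)" for m i
 proof (cases "i = k")
  case True
  then show ?thesis using integrable_normal_moment[OF s, of 0 m] by (simp add: f_def)
 next
  case False
  then show ?thesis using integrable_normal_density[OF s, of 0] by (simp add: f_def)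
 qed
 have pr: "gauss_density s x * (x $ k) ^ m = (\<Prod>i\<in>UNIV. f m i (x $ i))" for m and x :: "real^'n"
 proof -
  have "(\<Prod>i\<in>UNIV. f m i (x $ i)) = gauss_density s x * (\<Prod>i\<in>UNIV. if i = k then (x $ i) ^ m else 1)"
   unfolding f_def gauss_density_def by (rule prod.distrib)
  then show ?thesis by simp
 qed
 note F = lborel_vec_prod[where f="f m" for m, OF fi, folded pr]
 have int: "(LINT y|lborel. f m i y) = (if i = k then (LINT y|lborel. normal_density 0 s y * y ^ m) else 1)" for m i
  using s by (simp add: f_def)
 have *: "(LINT x|lborel. gauss_density s (x::real^'n) * (x $ k) ^ m) = (LINT y|lborel. normal_density 0 s y * y ^ m)" for m
  unfolding F(2) int by simp
 have 1: "(LINT y|lborel. normal_density 0 s y * y ^ 1) = 0"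
  using integral_normal_moment_nz_1[OF s, of 0] by simp
 have 2: "(LINT y|lborel. normal_density 0 s y * y ^ 2) = s\<^sup>2"
  using integral_normal_moment_even[OF s, of 0 1] by (simp add: fact_numeral)
 show "(LINT x|lborel. gauss_density s (x::real^'n) * (x $ k)) = 0"
  using *[of 1] 1 by simp
 show "(LINT x|lborel. gauss_density s (x::real^'n) * (x $ k)\<^sup>2) = s\<^sup>2"
  using *[of 2] 2 by simp
 show "integrable lborel (%x::real^'n. gauss_density s x * (x $ k))"
  "integrable lborel (%x::real^'n. gauss_density s x * (x $ k)\<^sup>2)"
  using F(1)[of 1] F(1)[of 2] by simp_all
qed

lemma std_normal_law_eq: "std_normal_law = density lborel (%x::real^'n. ennreal (gauss_density 1 x))"
 unfolding std_normal_law_def gauss_density_def ..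

lemma sets_std_normal_law[simp, measurable_cong]: "sets (std_normal_law :: (real^'n) measure) = sets borel"
 "space (std_normal_law :: (real^'n) measure) = UNIV"
 unfolding std_normal_law_def by simp_all

lemma prob_space_gauss:
 assumes "0 < s"
 shows "prob_space (density lborel (%x::real^'n. ennreal (gauss_density s x)))"
proof
 have "emeasure (density lborel (%x::real^'n. ennreal (gauss_density s x))) UNIV
  = (\<integral>\<^sup>+x. ennreal (gauss_density s (x::real^'n)) \<partial>lborel)"
  by (simp add: emeasure_density)
 also have "... = ennreal 1"
  using gauss_density_integral[OF assms, where 'n='n]
  by (subst nn_integral_eq_integral) (auto simp: gauss_density_nonneg)
 finally show "emeasure (density lborel (%x::real^'n. ennreal (gauss_density s x)))
   (space (density lborel (%x::real^'n. ennreal (gauss_density s x)))) = 1" by simp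
qed

lemma prob_space_std_normal_law: "prob_space (std_normal_law :: (real^'n) measure)"
 unfolding std_normal_law_eq by (rule prob_space_gauss) simp

lemma std_normal_law_char:
 "(LINT z|std_normal_law. iexp (u \<bullet> (z::real^'n))) = exp (- (u \<bullet> u) / 2)"
proof -
 define f where "f = (%i y. complex_of_real (std_normal_density y) * iexp (u $ i * y))"
 have f1: "integrable lborel (f i)" for i
 proof -
  have "integrable lborel (%y. norm (f i y))"
   unfolding f_def by (simp add: norm_mult)
  then show ?thesis
   unfolding f_def by (subst (asm) integrable_norm_iff) auto
 qed
 have f2: "(LINT y|lborel. f i y) = exp (- (u $ i * u $ i) / 2)" for i
 proof -
  have "char std_normal_distribution (u $ i) = (LINT y|lborel. f i y)"
   unfolding char_def f_def
   by (subst integral_density) (auto simp: scaleR_conv_of_real)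
  then show ?thesis
   by (simp add: char_std_normal_distribution power2_eq_square)
 qed
 have "(LINT z|std_normal_law. iexp (u \<bullet> (z::real^'n)))
   = (LINT z|lborel. gauss_density 1 z *\<^sub>R iexp (u \<bullet> (z::real^'n)))"
  unfolding std_normal_law_eq by (subst integral_density) (auto simp: gauss_density_nonneg)
 also have "... = (LINT z|lborel. (\<Prod>i\<in>UNIV. f i ((z::real^'n) $ i)))"
 proof (rule Bochner_Integration.integral_cong[OF refl])
  fix z :: "real^'n"
  have "iexp (u \<bullet> z) = (\<Prod>i\<in>UNIV. iexp (u $ i * z $ i))"
   by (simp add: inner_vec_def sum_distrib_left exp_sum)
  then show "gauss_density 1 z *\<^sub>R iexp (u \<bullet> z) = (\<Prod>i\<in>UNIV. f i (z $ i))"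
   unfolding f_def gauss_density_def prod.distrib scaleR_conv_of_real by simp
 qed
 also have "... = (\<Prod>i\<in>UNIV. exp (- (u $ i * u $ i) / 2))"
  unfolding lborel_vec_prod(2)[OF f1] f2 by simp
 also have "... = exp (- (u \<bullet> u) / 2)"
  by (simp add: exp_sum[symmetric] inner_vec_def sum_negf sum_divide_distrib)
 finally show ?thesis .
qed

text \<open>A Gaussian density is, up to a constant, the characteristic function of a Gaussian. This self-duality is what
expresses smoothed densities through characteristic functions in \<open>gauss_kernel_limit\<close>.\<close>

lemma gauss_density_char:
 assumes s: "0 < s"
 obtains c :: real where "0 < c" "!!w::real^'n. complex_of_real (gauss_density s w) = c * (LINT z|std_normal_law. iexp (((1/s) *\<^sub>R w) \<bullet> z))"
proof -
 define c where "c = (1 / sqrt (2 * pi * s\<^sup>2)) ^ CARD('n)"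
 have "0 < c" unfolding c_def using s by simp
 moreover have "complex_of_real (gauss_density s w) = c * (LINT z|std_normal_law. iexp (((1/s) *\<^sub>R w) \<bullet> z))" for w :: "real^'n"
 proof -
  have "gauss_density s w = c * (\<Prod>i\<in>UNIV. exp (- (w $ i)\<^sup>2 / (2 * s\<^sup>2)))"
   unfolding gauss_density_def normal_density_def c_def prod.distrib by (simp add: )
  also have "(\<Prod>i\<in>UNIV. exp (- (w $ i)\<^sup>2 / (2 * s\<^sup>2))) = exp (- (((1/s) *\<^sub>R w) \<bullet> ((1/s) *\<^sub>R w)) / 2)"
   using s by (simp add: exp_sum[symmetric] inner_vec_def sum_negf sum_divide_distrib sum_distrib_left power2_eq_square mult.commute)
  finally have "gauss_density s w = c * exp (- (((1/s) *\<^sub>R w) \<bullet> ((1/s) *\<^sub>R w)) / 2)" .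
  then show ?thesis unfolding std_normal_law_char of_real_mult[symmetric] by (rule arg_cong)
 qed
 ultimately show thesis by (rule that[of c])
qed

section \<open>Weak convergence from characteristic functions\<close>

lemma integral_norm_le:
 fixes f :: "'a => 'b::{banach,second_countable_topology}"
 assumes "integrable M f" "integrable M g" "!!x. x \<in> space M ==> norm (f x) <= g x"
 shows "norm (integral\<^sup>L M f) <= integral\<^sup>L M g"
 by (rule order_trans[OF integral_norm_bound integral_mono]) (use assms in auto)

lemma integral_abs_le:
 fixes f :: "'a => real"
 assumes "integrable M f" "integrable M g" "!!x. x \<in> space M ==> \<bar>f x\<bar> <= g x"
 shows "\<bar>integral\<^sup>L M f\<bar> <= integral\<^sup>L M g"
 using integral_norm_le[of M f g] assms by simp

lemma iexp_integrable:
 fixes X :: "'a => 'v::euclidean_space"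
 assumes "prob_space M" "X \<in> borel_measurable M"
 shows "integrable M (%om. iexp (u \<bullet> X om))"
proof -
 interpret prob_space M by fact
 have [measurable]: "X \<in> borel_measurable M" by fact
 show ?thesis
  by (rule integrable_const_bound[of _ 1]) auto
qed

text \<open>The expectation of \<open>f\<close> at the point \<open>x\<close> perturbed by independent Gaussian noise of scale \<open>s\<close>.\<close>

definition smoothing :: "real => (real^'n => real) => real^'n => real" where
 "smoothing s f x = (LINT w|lborel. f (x + w) * gauss_density s w)"

text \<open>Chebyshev's inequality for the squared norm.\<close>

lemma gauss_tail:
 assumes s: "0 < s" and d: "0 < d"
 shows "(LINT w|lborel. indicator {w. d <= norm w} w * gauss_density s (w::real^'n)) <= real CARD('n) * s\<^sup>2 / d\<^sup>2"
proof -
 have i: "integrable lborel (%w::real^'n. gauss_density s w * (w \<bullet> w))"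
  and e: "(LINT w|lborel. gauss_density s w * ((w::real^'n) \<bullet> w)) = real CARD('n) * s\<^sup>2"
  using gauss_density_moment(3,4)[OF s, where 'n='n]
  by (simp_all add: inner_vec_def sum_distrib_left power2_eq_square)
 have "(LINT w|lborel. indicator {w. d <= norm w} w * gauss_density s (w::real^'n))
  <= (LINT w|lborel. gauss_density s w * ((w::real^'n) \<bullet> w) / d\<^sup>2)"
 proof (rule integral_mono)
  show "integrable lborel (%w::real^'n. indicator {w. d <= norm w} w * gauss_density s w)"
   by (rule Bochner_Integration.integrable_bound[OF gauss_density_integral(1)[OF s]])
    (auto simp: indicator_def)
  show "integrable lborel (%w::real^'n. gauss_density s w * (w \<bullet> w) / d\<^sup>2)" using i by simp
  fix w :: "real^'n"
  show "indicator {w. d <= norm w} w * gauss_density s w <= gauss_density s w * (w \<bullet> w) / d\<^sup>2"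
  proof (cases "d <= norm w")
   case True
   then have "d\<^sup>2 <= w \<bullet> w" using d by (simp add: dot_square_norm power_mono)
   then have "1 <= (w \<bullet> w) / d\<^sup>2" using d by simp
   then show ?thesis using True gauss_density_nonneg[of s w] mult_left_mono[of 1 "(w \<bullet> w) / d\<^sup>2" "gauss_density s w"]
    by simp
  qed (simp add: gauss_density_nonneg)
 qed
 also have "... = real CARD('n) * s\<^sup>2 / d\<^sup>2" using e by simp
 finally show ?thesis .
qed

text \<open>Noise of small scale stays within the modulus of continuity of \<open>f\<close>, except on a tail event whose probability is
controlled by \<open>gauss_tail\<close>; on it the bound \<open>B\<close> is used.\<close>

lemma smoothing_close:
 fixes f :: "real^'n => real"
 assumes f: "uniformly_continuous_on UNIV f" and B: "!!x. \<bar>f x\<bar> <= B" and e: "0 < e"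
 obtains s where "0 < s" "!!x. \<bar>smoothing s f x - f x\<bar> <= e"
proof -
 have B0: "0 <= B" using B[of 0] by linarith
 obtain d where d: "0 < d" "!!x y. dist y x < d ==> dist (f y) (f x) < e / 2"
  using f e unfolding uniformly_continuous_on_def by (metis UNIV_I half_gt_zero)
 \<comment> \<open>this scale makes twice the bound times the tail at most half of the tolerance\<close>
 define s where "s = sqrt (e * d\<^sup>2 / (4 * (B + 1) * real CARD('n)))"
 have s: "0 < s" unfolding s_def using e d B0 by simp
 have s2: "s\<^sup>2 = e * d\<^sup>2 / (4 * (B + 1) * real CARD('n))" unfolding s_def using e d B0 by simp
 have [measurable]: "f \<in> borel_measurable borel"
  by (intro borel_measurable_continuous_onI uniformly_continuous_imp_continuous f)
 note g = gauss_density_integral[OF s, where 'n='n]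
 have "\<bar>smoothing s f x - f x\<bar> <= e" for x
 proof -
  have i1: "integrable lborel (%w. f (x + w) * gauss_density s w)"
   by (rule Bochner_Integration.integrable_bound[of _ "%w. B * gauss_density s w"])
    (use g B B0 in \<open>auto simp: abs_mult gauss_density_nonneg intro!: mult_mono\<close>)
  have i2: "integrable lborel (%w::real^'n. indicator {w. d <= norm w} w * gauss_density s w)"
   by (rule Bochner_Integration.integrable_bound[OF g(1)])
    (auto simp: indicator_def)
  have "smoothing s f x - f x = (LINT w|lborel. f (x + w) * gauss_density s w - f x * gauss_density s w)"
   unfolding smoothing_def using i1 g by simp
  also have "\<bar>...\<bar> <= (LINT w|lborel. e / 2 * gauss_density s w + 2 * B * (indicator {w. d <= norm w} w * gauss_density s (w::real^'n)))"
  proof (rule integral_abs_le)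
   show "integrable lborel (%w. f (x + w) * gauss_density s w - f x * gauss_density s w)"
    using i1 g by simp
   show "integrable lborel (%w::real^'n. e / 2 * gauss_density s w + 2 * B * (indicator {w. d <= norm w} w * gauss_density s w))"
    using i2 g by (intro Bochner_Integration.integrable_add integrable_mult_right) auto
   fix w :: "real^'n"
   have "\<bar>f (x + w) - f x\<bar> <= e / 2 + 2 * B * indicator {w. d <= norm w} w"
   proof (cases "d <= norm w")
    case True then show ?thesis using B[of "x + w"] B[of x] e by (simp add: abs_le_iff)
   next
    case False then show ?thesis using d(2)[of "x + w" x] by (simp add: dist_norm)
   qed
   then have "\<bar>f (x + w) - f x\<bar> * gauss_density s w <= (e / 2 + 2 * B * indicator {w. d <= norm w} w) * gauss_density s w"
    by (intro mult_right_mono gauss_density_nonneg)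
   moreover have "\<bar>f (x + w) * gauss_density s w - f x * gauss_density s w\<bar> = \<bar>f (x + w) - f x\<bar> * gauss_density s w"
    by (simp add: left_diff_distrib[symmetric] abs_mult gauss_density_nonneg)
   ultimately show "\<bar>f (x + w) * gauss_density s w - f x * gauss_density s w\<bar>
    <= e / 2 * gauss_density s w + 2 * B * (indicator {w. d <= norm w} w * gauss_density s w)"
    by (simp add: algebra_simps)
  qed
  also have "... = e / 2 + 2 * B * (LINT w|lborel. indicator {w. d <= norm w} w * gauss_density s (w::real^'n))"
   using i2 g by (subst Bochner_Integration.integral_add) auto
  also have "... <= e / 2 + 2 * B * (real CARD('n) * s\<^sup>2 / d\<^sup>2)"
   using gauss_tail[OF s d(1), where 'n='n] B0 by (intro add_left_mono mult_left_mono) auto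
  also have "real CARD('n) * s\<^sup>2 / d\<^sup>2 = e / (4 * (B + 1))"
  proof -
   have "4 * (B + 1) * real CARD('n) ~= 0" "d ~= 0" "B + 1 ~= 0" using d B0 by auto
   then show ?thesis unfolding s2 by (simp add: divide_simps)
  qed
  also have "e / 2 + 2 * B * (e / (4 * (B + 1))) <= e"
   using B0 e by (simp add: field_simps)
  finally show ?thesis .
 qed
 with s show thesis by (rule that)
qed

text \<open>By Fubini and translation invariance, smoothing the test function amounts to integrating it against the density of
$X$ plus independent noise.\<close>

lemma smoothing_expectation:
 fixes f :: "real^'n => real" and X :: "'a => real^'n"
 assumes M: "prob_space M" and X[measurable]: "X \<in> borel_measurable M"
  and f[measurable]: "f \<in> borel_measurable borel" and B: "!!x. \<bar>f x\<bar> <= B" and s: "0 < s"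
 shows "(LINT om|M. smoothing s f (X om)) = (LINT y|lborel. f y * (LINT om|M. gauss_density s (y - X om)))"
  "integrable lborel (%y. (LINT om|M. gauss_density s (y - X om)))"
  "(LINT y|lborel. (LINT om|M. gauss_density s (y - X om))) = 1"
proof -
 interpret prob_space M by fact
 interpret P: pair_sigma_finite M "lborel :: (real^'n) measure" ..
 note g = gauss_density_integral[OF s, where 'n='n]
 have tr: "(LINT w|lborel. q (x + w) * gauss_density s w) = (LINT y|lborel. q y * gauss_density s (y - x))"
  "integrable lborel (%y. q y * gauss_density s (y - x)) \<longleftrightarrow> integrable lborel (%w. q (x + w) * gauss_density s w)"
  if [measurable]: "q \<in> borel_measurable borel" for q :: "real^'n => real" and x
 proof -
  have m: "(+) x \<in> lborel \<rightarrow>\<^sub>M borel" "(%y. q y * gauss_density s (y - x)) \<in> borel_measurable borel" by measurable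
  show "(LINT w|lborel. q (x + w) * gauss_density s w) = (LINT y|lborel. q y * gauss_density s (y - x))"
   using integral_distr[OF m] by (simp add: lborel_distr_plus)
  show "integrable lborel (%y. q y * gauss_density s (y - x)) \<longleftrightarrow> integrable lborel (%w. q (x + w) * gauss_density s w)"
   using integrable_distr_eq[OF m] by (simp add: lborel_distr_plus)
 qed
 have ip: "integrable (M \<Otimes>\<^sub>M lborel) (%(om, y). q y * gauss_density s (y - X om))"
  if [measurable]: "q \<in> borel_measurable borel" and C: "!!x. \<bar>q x\<bar> <= C" for q C
 proof -
  have C0: "0 <= C" using C[of 0] by linarith
  have "integrable (M \<Otimes>\<^sub>M lborel) (%(om, y). gauss_density s (y - X om))"
  proof (rule P.Fubini_integrable)
   have *: "(LINT y|lborel. norm (gauss_density s (y - X om))) = 1"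
    "integrable lborel (%y. gauss_density s (y - X om))" for om
    using tr[of "%_. 1" "X om"] g by (simp_all add: gauss_density_nonneg)
   show "integrable M (%om. LINT y|lborel. norm (case (om, y) of (om, y) => gauss_density s (y - X om)))"
    using * by simp
   show "AE om in M. integrable lborel (%y. case (om, y) of (om, y) => gauss_density s (y - X om))"
    using * by simp
  qed simp
  then show ?thesis
   by (rule Bochner_Integration.integrable_bound[OF integrable_mult_right[of C]])
    (use C C0 in \<open>auto simp: abs_mult gauss_density_nonneg intro!: AE_I2 mult_right_mono\<close>)
 qed
 have sw: "(LINT om|M. LINT y|lborel. q y * gauss_density s (y - X om)) = (LINT y|lborel. LINT om|M. q y * gauss_density s (y - X om))"
  if "q \<in> borel_measurable borel" and C: "!!x. \<bar>q x\<bar> <= C" for q C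
  using P.Fubini_integral[OF ip[OF that]] by simp
 show "(LINT om|M. smoothing s f (X om)) = (LINT y|lborel. f y * (LINT om|M. gauss_density s (y - X om)))"
  unfolding smoothing_def tr(1)[OF f] sw[OF f B] by simp
 show "integrable lborel (%y. (LINT om|M. gauss_density s (y - X om)))"
  using P.integrable_snd[OF ip[of "%_. 1" 1]] by simp
 have "(LINT y|lborel. (LINT om|M. gauss_density s (y - X om))) = (LINT om|M. LINT y|lborel. 1 * gauss_density s (y - X om))"
  using sw[of "%_. 1" 1] by simp
 also have "... = 1"
  unfolding tr(1)[of "%_. 1", OF borel_measurable_const, symmetric] using g by (simp add: prob_space)
 finally show "(LINT y|lborel. (LINT om|M. gauss_density s (y - X om))) = 1" .
qed

text \<open>Writing the Gaussian kernel as a Fourier integral and exchanging the integrals shows the density of the noisy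
variable as an integral of its characteristic function against a fixed finite measure. Dominated convergence
applies, since characteristic functions are bounded by one.\<close>

lemma gauss_kernel_limit:
 fixes X :: "nat => 'a => real^'n" and \<mu> :: "(real^'n) measure"
 assumes M: "prob_space M" and X: "!!n. X n \<in> borel_measurable M"
  and mu: "prob_space \<mu>" "sets \<mu> = sets borel"
  and lim: "!!u. (%n. LINT om|M. iexp (u \<bullet> X n om)) \<longlonglongrightarrow> (LINT x|\<mu>. iexp (u \<bullet> x))"
  and s: "0 < s"
 shows "(%n. LINT om|M. gauss_density s (y - X n om)) \<longlonglongrightarrow> (LINT x|\<mu>. gauss_density s (y - x))"
proof -
 obtain c :: real where c: "0 < c" "!!w::real^'n. complex_of_real (gauss_density s w) = c * (LINT z|std_normal_law. iexp (((1/s) *\<^sub>R w) \<bullet> z))"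
  using gauss_density_char[OF s] by blast
 have rep: "complex_of_real (LINT om|N. gauss_density s (y - Z om))
  = c * (LINT z|std_normal_law. iexp (((1/s) *\<^sub>R y) \<bullet> z) * (LINT om|N. iexp ((- (1/s) *\<^sub>R z) \<bullet> Z om)))"
  if N: "prob_space N" and Z[measurable]: "Z \<in> borel_measurable N" for N :: "'c measure" and Z :: "'c => real^'n"
 proof -
  interpret N: prob_space N by fact
  interpret S: prob_space "std_normal_law :: (real^'n) measure" by (rule prob_space_std_normal_law)
  interpret P: pair_prob_space N "std_normal_law :: (real^'n) measure" ..
  have "integrable (N \<Otimes>\<^sub>M std_normal_law) (%(om, z). iexp (((1/s) *\<^sub>R (y - Z om)) \<bullet> z))"
   by (rule P.integrable_const_bound[of _ 1]) auto
  note F = P.Fubini_integral[OF this]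
  have "complex_of_real (LINT om|N. gauss_density s (y - Z om)) = (LINT om|N. complex_of_real (gauss_density s (y - Z om)))"
   by (simp add: integral_complex_of_real)
  also have "... = c * (LINT om|N. LINT z|std_normal_law. iexp (((1/s) *\<^sub>R (y - Z om)) \<bullet> z))"
   unfolding c(2) by simp
  also have "(LINT om|N. LINT z|std_normal_law. iexp (((1/s) *\<^sub>R (y - Z om)) \<bullet> z))
   = (LINT z|std_normal_law. LINT om|N. iexp (((1/s) *\<^sub>R (y - Z om)) \<bullet> z))"
   using F by simp
  also have "... = (LINT z|std_normal_law. LINT om|N. iexp (((1/s) *\<^sub>R y) \<bullet> z) * iexp ((- (1/s) *\<^sub>R z) \<bullet> Z om))"
   by (intro Bochner_Integration.integral_cong refl)
    (simp add: exp_add[symmetric] inner_diff_left inner_diff_right inner_commute algebra_simps)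
  finally show ?thesis by simp
 qed
 interpret M: prob_space M by fact
 interpret mu: prob_space \<mu> by fact
 interpret S: prob_space "std_normal_law :: (real^'n) measure" by (rule prob_space_std_normal_law)
 note [measurable] = X
 note [measurable_cong] = mu(2)
 have "(%n. LINT z|std_normal_law. iexp (((1/s) *\<^sub>R y) \<bullet> z) * (LINT om|M. iexp ((- (1/s) *\<^sub>R z) \<bullet> X n om)))
  \<longlonglongrightarrow> (LINT z|std_normal_law. iexp (((1/s) *\<^sub>R y) \<bullet> z) * (LINT x|\<mu>. iexp ((- (1/s) *\<^sub>R z) \<bullet> x)))"
 proof (rule integral_dominated_convergence[where w="%_. 1"])
  show "AE z in std_normal_law. (%n. iexp (((1/s) *\<^sub>R y) \<bullet> z) * (LINT om|M. iexp ((- (1/s) *\<^sub>R z) \<bullet> X n om)))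
   \<longlonglongrightarrow> iexp (((1/s) *\<^sub>R y) \<bullet> z) * (LINT x|\<mu>. iexp ((- (1/s) *\<^sub>R z) \<bullet> x))"
   by (intro AE_I2 tendsto_mult tendsto_const lim)
  show "AE z in std_normal_law. norm (iexp (((1/s) *\<^sub>R y) \<bullet> z) * (LINT om|M. iexp ((- (1/s) *\<^sub>R z) \<bullet> X n om))) <= 1" for n
  proof (rule AE_I2)
   fix z
   have "norm (LINT om|M. iexp ((- (1/s) *\<^sub>R z) \<bullet> X n om)) <= (LINT om|M. 1)"
    by (rule integral_norm_le[OF iexp_integrable[OF M X]]) auto
   then show "norm (iexp (((1/s) *\<^sub>R y) \<bullet> z) * (LINT om|M. iexp ((- (1/s) *\<^sub>R z) \<bullet> X n om))) <= 1"
    by (simp add: norm_mult M.prob_space)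
  qed
 qed simp_all
 then have "(%n. complex_of_real (LINT om|M. gauss_density s (y - X n om))) \<longlonglongrightarrow> complex_of_real (LINT x|\<mu>. gauss_density s (y - x))"
  unfolding rep[OF M X] rep[OF mu(1) measurable_ident_sets[OF mu(2)]] by (intro tendsto_mult tendsto_const)
 then show ?thesis by (simp only: tendsto_of_real_iff)
qed

text \<open>Two probability densities satisfy $\int |p - q| = 2\int (q-p)^+$, and the positive part is dominated by the limit
density \<open>q\<close>.\<close>

lemma scheffe:
 fixes p :: "nat => 'b => real"
 assumes p: "!!n. integrable N (p n)" "!!n x. 0 <= p n x" "integrable N q" "!!x. 0 <= q x"
  and one: "!!n. integral\<^sup>L N (p n) = 1" "integral\<^sup>L N q = 1"
  and lim: "!!x. (%n. p n x) \<longlonglongrightarrow> q x"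
 shows "(%n. LINT x|N. \<bar>p n x - q x\<bar>) \<longlonglongrightarrow> 0"
proof -
 have [measurable]: "p n \<in> borel_measurable N" "q \<in> borel_measurable N" for n using p by auto
 have "(%n. LINT x|N. 2 * max 0 (q x - p n x)) \<longlonglongrightarrow> (LINT x|N. 2 * max 0 (q x - q x))"
 proof (rule integral_dominated_convergence[where w="%x. 2 * q x"])
  show "integrable N (%x. 2 * q x)" using p by simp
  show "AE x in N. norm (2 * max 0 (q x - p n x)) <= 2 * q x" for n using p(2,4) by (auto simp: max_def)
  show "AE x in N. (%n. 2 * max 0 (q x - p n x)) \<longlonglongrightarrow> 2 * max 0 (q x - q x)"
   by (intro AE_I2 tendsto_intros lim)
 qed auto
 moreover have "(LINT x|N. 2 * max 0 (q x - p n x)) = (LINT x|N. \<bar>p n x - q x\<bar>)" for n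
 proof -
  have "(LINT x|N. \<bar>p n x - q x\<bar>) = (LINT x|N. 2 * max 0 (q x - p n x) + (p n x - q x))"
   by (intro Bochner_Integration.integral_cong) (auto simp: max_def)
  also have "... = (LINT x|N. 2 * max 0 (q x - p n x)) + ((LINT x|N. p n x) - (LINT x|N. q x))"
   using p by simp
  finally show ?thesis using one by simp
 qed
 ultimately show ?thesis by (simp del: integral_mult_right_zero integral_mult_right)
qed

text \<open>Replace \<open>f\<close> by its smoothing at the cost of a small uniform error; the smoothed expectations converge because the
densities converge in $L^1$.\<close>

lemma expectation_limit_uniformly_continuous:
 fixes X :: "nat => 'a => real^'n" and \<mu> :: "(real^'n) measure" and f :: "real^'n => real"
 assumes M: "prob_space M" and X: "!!n. X n \<in> borel_measurable M"
  and mu: "prob_space \<mu>" "sets \<mu> = sets borel"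
  and lim: "!!u. (%n. LINT om|M. iexp (u \<bullet> X n om)) \<longlonglongrightarrow> (LINT x|\<mu>. iexp (u \<bullet> x))"
  and f: "uniformly_continuous_on UNIV f" and B: "!!x. \<bar>f x\<bar> <= B"
 shows "(%n. LINT om|M. f (X n om)) \<longlonglongrightarrow> (LINT x|\<mu>. f x)"
proof (rule LIMSEQ_I)
 interpret M: prob_space M by fact
 interpret mu: prob_space \<mu> by fact
 note [measurable] = X
 note [measurable_cong] = mu(2)
 have fb[measurable]: "f \<in> borel_measurable borel"
  by (intro borel_measurable_continuous_onI uniformly_continuous_imp_continuous f)
 have B0: "0 <= B" using B[of undefined] by linarith
 fix r :: real assume r: "0 < r"
 obtain s where s: "0 < s" and sc: "!!x. \<bar>smoothing s f x - f x\<bar> <= r / 4"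
  using smoothing_close[OF f B, of "r/4"] r by (metis zero_less_divide_iff zero_less_numeral)
 have [measurable]: "smoothing s f \<in> borel_measurable borel"
  unfolding smoothing_def[abs_def] by measurable
 have sb: "\<bar>smoothing s f x\<bar> <= B + r" for x using sc[of x] B[of x] r by linarith
 have diff: "\<bar>(LINT om|N. f (Z om)) - (LINT om|N. smoothing s f (Z om))\<bar> <= r / 4"
  if N: "prob_space N" and Z[measurable]: "Z \<in> borel_measurable N" for N :: "'c measure" and Z :: "'c => real^'n"
 proof -
  interpret N: prob_space N by fact
  have i: "integrable N (%om. f (Z om))" "integrable N (%om. smoothing s f (Z om))"
   using N.integrable_const_bound[of "%om. f (Z om)" B] N.integrable_const_bound[of "%om. smoothing s f (Z om)" "B + r"] B sb
   by auto
  then have "\<bar>(LINT om|N. f (Z om)) - (LINT om|N. smoothing s f (Z om))\<bar> = \<bar>LINT om|N. f (Z om) - smoothing s f (Z om)\<bar>"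
   by simp
  also have "... <= (LINT om|N. r / 4)"
   using i sc by (intro integral_abs_le) (auto simp: abs_minus_commute)
  finally show ?thesis by (simp add: N.prob_space)
 qed
 define p where "p = (%n y. LINT om|M. gauss_density s (y - X n om))"
 define q where "q = (%y. LINT x|\<mu>. gauss_density s (y - x))"
 note sm = smoothing_expectation[OF M X fb B s, folded p_def]
 note sq = smoothing_expectation[OF mu(1) _ fb B s, of "%x. x", simplified, folded q_def]
 have "(%n. LINT y|lborel. \<bar>p n y - q y\<bar>) \<longlonglongrightarrow> 0"
 proof (rule scheffe)
  show "(%n. p n x) \<longlonglongrightarrow> q x" for x
   unfolding p_def q_def by (rule gauss_kernel_limit[OF M X mu lim s])
  show "0 <= p n x" "0 <= q x" for n x
   unfolding p_def q_def by (simp_all add: integral_nonneg gauss_density_nonneg)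
 qed (use sm(2,3) sq(2,3) in \<open>auto simp: p_def q_def\<close>)
 then have "(%n. B * (LINT y|lborel. \<bar>p n y - q y\<bar>)) \<longlonglongrightarrow> 0" by (rule tendsto_mult_right_zero)
 then obtain n0 where n0: "!!n. n0 <= n ==> \<bar>B * (LINT y|lborel. \<bar>p n y - q y\<bar>)\<bar> < r / 4"
  using r by (fastforce dest: LIMSEQ_D[where r="r/4"])
 have "norm ((LINT om|M. f (X n om)) - (LINT x|\<mu>. f x)) < r" if "n0 <= n" for n
 proof -
  have ip: "integrable lborel (p n)" "integrable lborel q" using sm(2) sq(2) by (simp_all add: p_def q_def)
  have ifp: "integrable lborel (%y. f y * w y)" if "integrable lborel w" for w
  proof (rule Bochner_Integration.integrable_bound[of _ "%y. B * w y"])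
   show "integrable lborel (%y. B * w y)" using that by simp
   show "(%y. f y * w y) \<in> borel_measurable lborel" using that by measurable
   show "AE y in lborel. norm (f y * w y) <= norm (B * w y)"
    by (rule AE_I2) (use B B0 in \<open>simp add: abs_mult mult_right_mono\<close>)
  qed
  have "\<bar>(LINT om|M. smoothing s f (X n om)) - (LINT x|\<mu>. smoothing s f x)\<bar>
   = \<bar>LINT y|lborel. f y * (p n y - q y)\<bar>"
   unfolding sm(1) sq(1) using ifp[OF ip(1)] ifp[OF ip(2)] by (simp add: right_diff_distrib p_def q_def)
  also have "... <= (LINT y|lborel. B * \<bar>p n y - q y\<bar>)"
   using ifp ip B by (intro integral_abs_le) (simp_all add: abs_mult mult_right_mono)
  also have "... < r / 4" using n0[OF that] by simp
  finally show ?thesis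
   using diff[OF M X, of n] diff[OF mu(1) measurable_ident_sets[OF mu(2)]] r unfolding real_norm_def by linarith
 qed
 then show "\<exists>n0. \<forall>n\<ge>n0. norm ((LINT om|M. f (X n om)) - (LINT x|\<mu>. f x)) < r" by blast
qed

text \<open>It remains to pass from uniformly continuous to bounded continuous test functions. The limit law puts almost all
its mass on a large ball, so a continuous cutoff makes the test function uniformly continuous; the mass of the
approximating laws outside the ball is controlled by applying the previous lemma to the cutoff itself.\<close>

theorem levy_continuity_vec:
 fixes X :: "nat => 'a => real^'n" and \<mu> :: "(real^'n) measure"
 assumes M: "prob_space M" and X: "!!n. X n \<in> borel_measurable M"
  and mu: "prob_space \<mu>" "sets \<mu> = sets borel"
  and lim: "!!u. (%n. LINT om|M. iexp (u \<bullet> X n om)) \<longlonglongrightarrow> (LINT x|\<mu>. iexp (u \<bullet> x))"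
 shows "converges_in_distribution M X \<mu>"
 unfolding converges_in_distribution_def
proof (intro allI impI LIMSEQ_I)
 interpret M: prob_space M by fact
 interpret mu: prob_space \<mu> by fact
 note [measurable] = X
 note [measurable_cong] = mu(2)
 fix f :: "real^'n => real" and r :: real
 assume f: "continuous_on UNIV f \<and> bounded (range f)" and r: "0 < r"
 have [measurable]: "f \<in> borel_measurable borel" using f by (intro borel_measurable_continuous_onI) auto
 obtain B where B: "!!x. \<bar>f x\<bar> <= B" and B1: "0 < B"
  using f unfolding bounded_pos by auto
 define cut where "cut = (%K (x::real^'n). max 0 (min 1 (K + 1 - norm x)))"
 have cut01: "0 <= cut K x" "cut K x <= 1" for K x unfolding cut_def by auto
 have cutc: "continuous_on A (cut K)" for K A unfolding cut_def by (intro continuous_intros)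
 have [measurable]: "cut K \<in> borel_measurable borel" for K
  by (intro borel_measurable_continuous_onI cutc)
 have supp: "uniformly_continuous_on UNIV (%x. g x * cut K x)" if g: "continuous_on UNIV g" for g :: "real^'n => real" and K
  unfolding uniformly_continuous_on_def
 proof (intro allI impI)
  fix e :: real assume e: "0 < e"
  have "uniformly_continuous_on (cball 0 (K + 3)) (%x. g x * cut K x)"
   by (intro compact_uniformly_continuous continuous_intros cutc continuous_on_subset[OF g]) auto
  then obtain d where d: "0 < d" "!!x y. x \<in> cball 0 (K+3) ==> y \<in> cball 0 (K+3) ==> dist y x < d ==> dist (g y * cut K y) (g x * cut K x) < e"
   using e unfolding uniformly_continuous_on_def by metis
  have "dist (g y * cut K y) (g x * cut K x) < e" if "dist y x < min d 1" for x y
  proof (cases "norm x <= K + 3 \<and> norm y <= K + 3")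
   case True
   then show ?thesis using d(2)[of x y] that by auto
  next
   case False
   have "\<bar>norm y - norm x\<bar> < 1" using that norm_triangle_ineq3[of y x] by (simp add: dist_norm)
   then have "K + 1 <= norm x" "K + 1 <= norm y" using False by auto
   then have "cut K x = 0" "cut K y = 0" unfolding cut_def by auto
   then show ?thesis using e by simp
  qed
  then show "\<exists>d>0. \<forall>x\<in>UNIV. \<forall>x'\<in>UNIV. dist x' x < d --> dist (g x' * cut K x') (g x * cut K x) < e"
   using d(1) by (intro exI[of _ "min d 1"]) auto
 qed
 have "(%K. LINT x|\<mu>. cut (real K) x) \<longlonglongrightarrow> (LINT x|\<mu>. 1)"
 proof (rule integral_dominated_convergence[where w="%_. 1"])
  show "AE x in \<mu>. (%K. cut (real K) x) \<longlonglongrightarrow> 1"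
  proof (rule AE_I2, rule tendsto_eventually)
   fix x :: "real^'n"
   obtain k where k: "norm x <= real k" using real_arch_simple by blast
   show "\<forall>\<^sub>F K in sequentially. cut (real K) x = 1"
    using eventually_ge_at_top[of k] by eventually_elim (use k in \<open>auto simp: cut_def\<close>)
  qed
 qed (use cut01 in auto)
 then have "\<forall>\<^sub>F K in sequentially. 1 - r / (8 * B) < (LINT x|\<mu>. cut (real K) x)"
  using r B1 by (intro order_tendstoD) (auto simp: mu.prob_space)
 then obtain K where K: "1 - r / (8 * B) < (LINT x|\<mu>. cut (real K) x)"
  by (auto simp: eventually_sequentially)
 have fcut: "\<bar>f x * cut (real K) x\<bar> <= B" for x
  using mult_mono[OF B[of x] cut01(2)[of "real K" x]] cut01(1)[of "real K" x] B1 by (simp add: abs_mult)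
 have l1: "(%n. LINT om|M. cut (real K) (X n om)) \<longlonglongrightarrow> (LINT x|\<mu>. cut (real K) x)"
  using supp[of "%_. 1"] cut01 by (intro expectation_limit_uniformly_continuous[OF M X mu lim, of _ 1]) auto
 have l2: "(%n. LINT om|M. f (X n om) * cut (real K) (X n om)) \<longlonglongrightarrow> (LINT x|\<mu>. f x * cut (real K) x)"
  using supp[of f] f cut01 B B1 fcut
  by (intro expectation_limit_uniformly_continuous[OF M X mu lim, of _ B]) (auto simp: abs_mult)
 have split: "\<bar>(LINT om|N. f (Z om)) - (LINT om|N. f (Z om) * cut (real K) (Z om))\<bar> <= B * (1 - (LINT om|N. cut (real K) (Z om)))"
  if N: "prob_space N" and Z[measurable]: "Z \<in> borel_measurable N" for N :: "'c measure" and Z :: "'c => real^'n"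
 proof -
  interpret N: prob_space N by fact
  have i: "integrable N (%om. f (Z om))" "integrable N (%om. cut (real K) (Z om))" "integrable N (%om. f (Z om) * cut (real K) (Z om))"
   using B cut01 B1 fcut
   using N.integrable_const_bound[of "%om. f (Z om)" B] N.integrable_const_bound[of "%om. cut (real K) (Z om)" 1]
    N.integrable_const_bound[of "%om. f (Z om) * cut (real K) (Z om)" B]
   by auto
  then have "\<bar>(LINT om|N. f (Z om)) - (LINT om|N. f (Z om) * cut (real K) (Z om))\<bar> = \<bar>LINT om|N. f (Z om) - f (Z om) * cut (real K) (Z om)\<bar>"
   by simp
  also have "... <= (LINT om|N. B * (1 - cut (real K) (Z om)))"
  proof (rule integral_abs_le)
   fix om
   have "\<bar>f (Z om) - f (Z om) * cut (real K) (Z om)\<bar> = \<bar>f (Z om)\<bar> * (1 - cut (real K) (Z om))"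
   proof -
    have "f (Z om) - f (Z om) * cut (real K) (Z om) = f (Z om) * (1 - cut (real K) (Z om))"
     by (simp add: right_diff_distrib)
    then show ?thesis using cut01[of "real K" "Z om"] by (simp add: abs_mult)
   qed
   then show "\<bar>f (Z om) - f (Z om) * cut (real K) (Z om)\<bar> <= B * (1 - cut (real K) (Z om))"
    using B cut01 by (auto intro: mult_right_mono)
  qed (use i in auto)
  also have "... = B * (1 - (LINT om|N. cut (real K) (Z om)))" using i by (simp add: N.prob_space)
  finally show ?thesis .
 qed
 obtain n1 where n1: "!!n. n1 <= n ==> \<bar>(LINT om|M. cut (real K) (X n om)) - (LINT x|\<mu>. cut (real K) x)\<bar> < r / (8 * B)"
  using LIMSEQ_D[OF l1, of "r / (8 * B)"] r B1 by auto
 obtain n2 where n2: "!!n. n2 <= n ==> \<bar>(LINT om|M. f (X n om) * cut (real K) (X n om)) - (LINT x|\<mu>. f x * cut (real K) x)\<bar> < r / 4"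
  using LIMSEQ_D[OF l2, of "r / 4"] r by auto
 have "norm ((LINT om|M. f (X n om)) - (LINT x|\<mu>. f x)) < r" if n: "max n1 n2 <= n" for n
 proof -
  have "1 - (LINT om|M. cut (real K) (X n om)) <= r / (4 * B)"
   using n1[of n] n K by (simp add: abs_less_iff field_simps)
  then have a: "B * (1 - (LINT om|M. cut (real K) (X n om))) <= B * (r / (4 * B))"
   using B1 by (intro mult_left_mono) auto
  have b: "B * (1 - (LINT x|\<mu>. cut (real K) x)) <= B * (r / (8 * B))"
   using K B1 by (intro mult_left_mono) auto
  have "B * (r / (4 * B)) = r / 4" "B * (r / (8 * B)) = r / 8" using B1 by auto
  then show ?thesis
   using a b split[OF M X, of n] split[OF mu(1) measurable_ident_sets[OF mu(2)]] n2[of n] n r unfolding real_norm_def by linarith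
 qed
 then show "\<exists>n0. \<forall>n\<ge>n0. norm ((LINT om|M. f (X n om)) - (LINT x|\<mu>. f x)) < r" by blast
qed

section \<open>Normal laws with possibly singular covariance\<close>

definition psd_matrix :: "real^'n^'n => bool" where
 "psd_matrix V \<longleftrightarrow> transpose V = V \<and> (\<forall>v. 0 <= v \<bullet> (V *v v))"

lemma psd_matrix_entries:
 assumes "psd_matrix V"
 shows "V $ j $ i = V $ i $ j" "0 <= V $ i $ i" "V $ i $ i = 0 ==> V $ i $ j = 0"
proof -
 show sym: "V $ j $ i = V $ i $ j" for i j
  using assms unfolding psd_matrix_def transpose_def by (metis vec_lambda_beta)
 have q: "axis a (1::real) \<bullet> (V *v axis b 1) = V $ a $ b" for a b
  by (simp add: inner_axis' matrix_vector_mul_component inner_axis)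
 show ii: "0 <= V $ i $ i" for i
  using assms q[of i i] unfolding psd_matrix_def by metis
 assume 0: "V $ i $ i = 0"
 have "0 <= 2 * t * V $ i $ j + V $ j $ j" for t
 proof -
  let ?v = "t *\<^sub>R axis i (1::real) + axis j 1"
  have "0 <= ?v \<bullet> (V *v ?v)" using assms unfolding psd_matrix_def by blast
  also have "... = 2 * t * V $ i $ j + V $ j $ j"
   using 0 sym[of i j] by (simp add: matrix_vector_right_distrib matrix_vector_mult_scaleR inner_add_left inner_add_right q)
  finally show ?thesis .
 qed
 from this[of "- (V $ j $ j + 1) / (2 * V $ i $ j)"] show "V $ i $ j = 0"
  by (cases "V $ i $ j = 0") (auto simp: field_simps)
qed

text \<open>A Gaussian elimination (Cholesky) argument: the induction clears one more coordinate from the matrix at each step by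
subtracting a rank one matrix, or does nothing when the pivot vanishes, in which case the whole row vanishes. This
supplies the root that the definition of the normal law selects, also for singular matrices.\<close>

lemma psd_matrix_root:
 fixes V :: "real^'n^'n"
 assumes "psd_matrix V"
 shows "\<exists>A :: real^'n^'n. A ** transpose A = V"
proof -
 have "\<exists>A :: real^'n^'n. A ** transpose A = V \<and> (\<forall>k. k \<notin> S --> (\<forall>i. A $ i $ k = 0))"
  if "finite S" "psd_matrix V" "\<forall>k. k \<notin> S --> V $ k $ k = 0" for S and V :: "real^'n^'n"
  using that
 proof (induction S arbitrary: V rule: finite_induct)
  case empty
  then have "V = 0" using psd_matrix_entries(3)[OF empty(1)] by (simp add: vec_eq_iff)
  then show ?case by (intro exI[of _ 0]) (simp add: matrix_matrix_mult_def vec_eq_iff)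
 next
  case (insert k S)
  note ent = psd_matrix_entries[OF insert.prems(1)]
  define d where "d = sqrt (V $ k $ k)"
  define v where "v = (\<chi> i. V $ i $ k / d)"
  have dd: "d * d = V $ k $ k" unfolding d_def using ent(2)[of k] by simp
  have vk: "v $ i * v $ j = V $ i $ k * V $ j $ k / V $ k $ k" for i j
   unfolding v_def using dd by simp
  define V' where "V' = (\<chi> i j. V $ i $ j - v $ i * v $ j)"
  have V'k: "V' $ i $ k = 0" for i
   using ent(1)[of k i] ent(3)[of k i] unfolding V'_def vec_lambda_beta vk by (cases "V $ k $ k = 0") auto
  have q: "w \<bullet> (V' *v w) = w \<bullet> (V *v w) - (v \<bullet> w)\<^sup>2" for w
  proof -
   have "V' *v w = V *v w - (v \<bullet> w) *\<^sub>R v"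
    unfolding V'_def by (simp add: vec_eq_iff matrix_vector_mult_def inner_vec_def left_diff_distrib sum_subtractf
      right_diff_distrib sum_distrib_left mult.assoc mult.left_commute mult.commute)
   then show ?thesis by (simp add: inner_diff_right power2_eq_square inner_commute)
  qed
  have "psd_matrix V'"
   unfolding psd_matrix_def
  proof (intro conjI allI)
   show "transpose V' = V'" unfolding V'_def transpose_def using ent(1) by (simp add: vec_eq_iff mult.commute)
   fix w
   \<comment> \<open>shift w along the k-th axis so that v is orthogonal to it\<close>
   let ?w = "w - (if V $ k $ k = 0 then 0 else (v \<bullet> w) / d) *\<^sub>R axis k 1"
   have vax: "v \<bullet> axis k 1 = V $ k $ k / d" by (simp add: v_def inner_axis)
   have V'ax: "V' *v axis k 1 = 0"
    using V'k by (simp add: vec_eq_iff matrix_vector_mul_component inner_axis)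
   have axV': "axis k 1 \<bullet> (V' *v x) = 0" for x
   proof -
    have "V' $ k $ i = 0" for i
     using V'k[of i] ent(1)[of i k] unfolding V'_def by (simp add: mult.commute)
    then show ?thesis by (simp add: inner_axis' matrix_vector_mult_def)
   qed
   have "w \<bullet> (V' *v w) = ?w \<bullet> (V' *v ?w)"
    by (simp add: matrix_vector_mult_diff_distrib matrix_vector_mult_scaleR V'ax inner_diff_left axV')
   also have "... = ?w \<bullet> (V *v ?w) - (v \<bullet> ?w)\<^sup>2" by (rule q)
   also have "v \<bullet> ?w = 0"
   proof (cases "V $ k $ k = 0")
    case True
    then have "v = 0" unfolding v_def d_def by (simp add: vec_eq_iff)
    then show ?thesis by simp
   next
    case False
    then show ?thesis using dd by (auto simp: inner_diff_right vax)
   qed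
   finally show "0 <= w \<bullet> (V' *v w)"
    using insert.prems(1) unfolding psd_matrix_def by simp
  qed
  moreover have "V' $ i $ i = 0" if "i \<notin> S" for i
  proof (cases "i = k")
   case False
   then have "V $ i $ i = 0" using insert.prems(2) that by simp
   then show ?thesis using ent(3)[of i k] unfolding V'_def vec_lambda_beta vk by simp
  qed (simp add: V'k)
  ultimately obtain A where A: "A ** transpose A = V'" "!!j i. j \<notin> S ==> A $ i $ j = 0"
   using insert.IH[of V'] by blast
  define A' where "A' = (\<chi> i j. if j = k then v $ i else A $ i $ j)"
  have "(A' ** transpose A') $ i $ j = V $ i $ j" for i j
  proof -
   have "(A' ** transpose A') $ i $ j = (\<Sum>l\<in>UNIV. (if l = k then v $ i * v $ j else A $ i $ l * A $ j $ l))"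
    unfolding A'_def matrix_matrix_mult_def transpose_def by (auto intro!: sum.cong)
   also have "... = (\<Sum>l\<in>UNIV. (if l = k then v $ i * v $ j else 0) + A $ i $ l * A $ j $ l)"
    using A(2) insert.hyps(2) by (intro sum.cong) auto
   also have "... = v $ i * v $ j + (A ** transpose A) $ i $ j"
    by (simp add: sum.distrib matrix_matrix_mult_def transpose_def)
   finally show ?thesis unfolding A(1) V'_def by simp
  qed
  moreover have "A' $ i $ j = 0" if "j \<notin> insert k S" for i j
   using that A(2) unfolding A'_def by auto
  ultimately show ?case by (intro exI[of _ A']) (auto simp: vec_eq_iff)
 qed
 from this[of UNIV V] assms show ?thesis by auto
qed

text \<open>The law is the image of the standard normal law under a root $A$ of $V$, and $|A^\top u|^2 = u \cdot V u$.\<close>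

lemma normal_law_char:
 fixes V :: "real^'n^'n"
 assumes "psd_matrix V"
 shows "prob_space (normal_law 0 V)" "sets (normal_law 0 V) = sets borel"
  "(LINT x|normal_law 0 V. iexp (u \<bullet> x)) = exp (- (u \<bullet> (V *v u)) / 2)"
proof -
 define A where "A = (SOME A :: real^'n^'n. A ** transpose A = V)"
 have A: "A ** transpose A = V"
  unfolding A_def by (rule someI_ex[OF psd_matrix_root[OF assms]])
 have nl: "normal_law 0 V = distr std_normal_law borel (%z. A *v z)"
  unfolding normal_law_def A_def by simp
 have [measurable]: "(*v) A \<in> borel_measurable borel"
  by (intro borel_measurable_continuous_onI linear_continuous_on matrix_vector_mul_bounded_linear)
 have m: "(*v) A \<in> borel_measurable std_normal_law" by measurable
 interpret S: prob_space "std_normal_law :: (real^'n) measure" by (rule prob_space_std_normal_law)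
 show "prob_space (normal_law 0 V)" unfolding nl by (rule S.prob_space_distr[OF m])
 show "sets (normal_law 0 V) = sets borel" unfolding nl by simp
 have tr: "u \<bullet> (A *v z) = (transpose A *v u) \<bullet> z" for z
  by (simp add: dot_lmul_matrix flip: vector_transpose_matrix)
 have "(LINT x|normal_law 0 V. iexp (u \<bullet> x)) = (LINT z|std_normal_law. iexp ((transpose A *v u) \<bullet> z))"
  unfolding nl by (subst integral_distr[OF m]) (simp_all add: tr)
 also have "... = exp (- ((transpose A *v u) \<bullet> (transpose A *v u)) / 2)"
  by (rule std_normal_law_char)
 also have "(transpose A *v u) \<bullet> (transpose A *v u) = u \<bullet> (V *v u)"
  unfolding tr[symmetric] A[symmetric] by (simp only: matrix_vector_mul_assoc)
 finally show "(LINT x|normal_law 0 V. iexp (u \<bullet> x)) = exp (- (u \<bullet> (V *v u)) / 2)" .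
qed

section \<open>Powers of characteristic functions\<close>

text \<open>The classical central limit theorem for independent copies of $X$, stated for the characteristic function alone, so
that no copies have to be constructed: second order Taylor expansion with a dominated remainder.\<close>

lemma char_power_limit:
 fixes X :: "'a => real"
 assumes M: "prob_space M" and X[measurable]: "X \<in> borel_measurable M"
  and sq: "integrable M (%om. (X om)\<^sup>2)" and mean: "(LINT om|M. X om) = 0"
 shows "(%n. (LINT om|M. iexp (X om / sqrt (real n))) ^ n) \<longlonglongrightarrow> exp (- (LINT om|M. (X om)\<^sup>2) / 2)"
proof -
 interpret prob_space M by fact
 define \<sigma> where "\<sigma> = (LINT om|M. (X om)\<^sup>2)"
 define \<psi> where "\<psi> n = (LINT om|M. iexp (X om / sqrt (real n)))" for n :: nat
 define r where "r n = expectation (%x. min (6 * (X x)^2) (\<bar>1 / sqrt (real n)\<bar> * \<bar>X x\<bar>^3))" for n :: nat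
 have iX: "integrable M X" by (rule square_integrable_imp_integrable[OF X sq])
 have \<psi>: "\<psi> n = char (distr M borel X) (1 / sqrt (real n))" for n
  unfolding \<psi>_def char_def by (subst integral_distr) auto
 have ap: "norm (\<psi> n - (1 - (1 / sqrt (real n))\<^sup>2 * \<sigma> / 2)) <= ((1 / sqrt (real n))\<^sup>2 / 6) * r n" for n
  unfolding \<psi> r_def using mean sq iX by (intro char_approx3') (auto simp: \<sigma>_def)
 have \<psi>1: "norm (\<psi> n) <= 1" for n
 proof -
  interpret D: real_distribution "distr M borel X" by (rule real_distribution_distr) simp
  show ?thesis unfolding \<psi> by (rule D.cmod_char_le_1)
 qed
 have \<sigma>0: "0 <= \<sigma>" unfolding \<sigma>_def by simp
 have main: "\<forall>\<^sub>F n in sequentially. norm (\<psi> n ^ n - (complex_of_real (1 + (- \<sigma> / 2) / real n)) ^ n) <= r n / 6"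
 proof (rule eventually_sequentiallyI)
  fix n :: nat
  assume n: "n \<ge> nat (ceiling \<sigma>) + 1"
  then have n\<sigma>: "real n \<ge> \<sigma>" and n0: "real n > 0" by linarith+
  have ap': "norm (\<psi> n - complex_of_real (1 + (- \<sigma> / 2) / real n)) <= r n / (6 * real n)"
   using ap[of n] n0 by (simp add: power_divide field_simps)
  have "\<bar>1 + (- \<sigma> / 2) / real n\<bar> <= 1"
   using n\<sigma> n0 \<sigma>0 by (auto simp: abs_le_iff field_simps)
  then have "norm (complex_of_real (1 + (- \<sigma> / 2) / real n)) <= 1"
   by (simp only: norm_of_real)
  then have "norm (\<psi> n ^ n - (complex_of_real (1 + (- \<sigma> / 2) / real n)) ^ n) <= real n * norm (\<psi> n - complex_of_real (1 + (- \<sigma> / 2) / real n))"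
   by (intro norm_power_diff \<psi>1)
  also have "... <= real n * (r n / (6 * real n))" by (intro mult_left_mono ap') simp
  also have "... = r n / 6" using n0 by simp
  finally show "norm (\<psi> n ^ n - (complex_of_real (1 + (- \<sigma> / 2) / real n)) ^ n) <= r n / 6" .
 qed
 have "r \<longlonglongrightarrow> (LINT x|M. 0)"
  unfolding r_def
 proof (rule integral_dominated_convergence[where w = "%x. 6 * (X x)^2"])
  show "AE x in M. (%n. min (6 * (X x)\<^sup>2) (\<bar>1 / sqrt (real n)\<bar> * \<bar>X x\<bar> ^ 3)) \<longlonglongrightarrow> 0"
  proof (rule AE_I2)
   fix x
   have "(%n. 1 / sqrt (real n)) \<longlonglongrightarrow> 0"
    by (intro tendsto_divide_0[OF tendsto_const] filterlim_at_top_imp_at_infinity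
     filterlim_compose[OF sqrt_at_top filterlim_real_sequentially])
   then have "(%n. min (6 * (X x)\<^sup>2) (\<bar>1 / sqrt (real n)\<bar> * \<bar>X x\<bar> ^ 3)) \<longlonglongrightarrow> min (6 * (X x)\<^sup>2) (\<bar>0\<bar> * \<bar>X x\<bar> ^ 3)"
    by (intro tendsto_intros)
   then show "(%n. min (6 * (X x)\<^sup>2) (\<bar>1 / sqrt (real n)\<bar> * \<bar>X x\<bar> ^ 3)) \<longlonglongrightarrow> 0" by simp
  qed
 qed (use sq in auto)
 then have "(%n. r n / 6) \<longlonglongrightarrow> 0" by (intro tendsto_divide_zero) simp
 then have "(%n. \<psi> n ^ n - (complex_of_real (1 + (- \<sigma> / 2) / real n)) ^ n) \<longlonglongrightarrow> 0"
  by (rule Lim_null_comparison[OF main])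
 moreover have "(%n. complex_of_real ((1 + (- \<sigma> / 2) / real n) ^ n)) \<longlonglongrightarrow> complex_of_real (exp (- \<sigma> / 2))"
  by (intro tendsto_of_real tendsto_exp_limit_sequentially)
 ultimately have "(%n. \<psi> n ^ n) \<longlonglongrightarrow> complex_of_real (exp (- \<sigma> / 2))"
  by (intro Lim_transform[where f="%n. \<psi> n ^ n"]) (simp_all add: of_real_power)
 then show ?thesis unfolding \<psi>_def \<sigma>_def by simp
qed

section \<open>Mean squares\<close>

text \<open>Mean squares are taken in the extended nonnegative reals, so that bounds can be chained before integrability is
known.\<close>

definition msq :: "'a measure => ('a => 'v::euclidean_space) => ennreal" where
 "msq M X = (\<integral>\<^sup>+om. ennreal ((norm (X om))\<^sup>2) \<partial>M)"

lemma norm_add_sq_le: "(norm (x + y))\<^sup>2 <= 2 * (norm x)\<^sup>2 + 2 * (norm (y::'v::real_normed_vector))\<^sup>2"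
proof -
 have "(norm (x + y))\<^sup>2 <= (norm x + norm y)\<^sup>2"
  by (intro power_mono norm_triangle_ineq) auto
 also have "... <= 2 * (norm x)\<^sup>2 + 2 * (norm y)\<^sup>2"
  using sum_squares_bound[of "norm x" "norm y"] by (simp add: power2_sum)
 finally show ?thesis .
qed

lemma norm_sum_sq_le:
 fixes x :: "'i => 'v::real_normed_vector"
 shows "(norm (\<Sum>i\<in>I. x i))\<^sup>2 <= real (card I) * (\<Sum>i\<in>I. (norm (x i))\<^sup>2)"
proof -
 have "(norm (\<Sum>i\<in>I. x i))\<^sup>2 <= (\<Sum>i\<in>I. norm (x i))\<^sup>2"
  by (intro power_mono norm_sum) auto
 also have "... = (\<Sum>i\<in>I. 1 * norm (x i))\<^sup>2" by simp
 also have "... <= (\<Sum>i\<in>I. 1\<^sup>2) * (\<Sum>i\<in>I. (norm (x i))\<^sup>2)"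
  by (rule Cauchy_Schwarz_ineq_sum)
 finally show ?thesis by simp
qed

lemma msq_add:
 assumes "X \<in> borel_measurable M" "Y \<in> borel_measurable M"
 shows "msq M (%om. X om + Y om) <= 2 * msq M X + 2 * msq M Y"
proof -
 have [measurable]: "X \<in> borel_measurable M" "Y \<in> borel_measurable M" by fact+
 have "msq M (%om. X om + Y om) <= (\<integral>\<^sup>+om. 2 * ennreal ((norm (X om))\<^sup>2) + 2 * ennreal ((norm (Y om))\<^sup>2) \<partial>M)"
  unfolding msq_def
 proof (rule nn_integral_mono)
  fix om
  have "ennreal ((norm (X om + Y om))\<^sup>2) <= ennreal (2 * (norm (X om))\<^sup>2 + 2 * (norm (Y om))\<^sup>2)"
   by (intro ennreal_leI norm_add_sq_le)
  then show "ennreal ((norm (X om + Y om))\<^sup>2) <= 2 * ennreal ((norm (X om))\<^sup>2) + 2 * ennreal ((norm (Y om))\<^sup>2)"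
   by (simp add: ennreal_mult)
 qed
 also have "... = 2 * msq M X + 2 * msq M Y"
  unfolding msq_def by (subst nn_integral_add) (auto simp: nn_integral_cmult)
 finally show ?thesis .
qed

lemma msq_uminus: "msq M (%om. - X om) = msq M X"
 unfolding msq_def by simp

lemma msq_diff:
 assumes "X \<in> borel_measurable M" "Y \<in> borel_measurable M"
 shows "msq M (%om. X om - Y om) <= 2 * msq M X + 2 * msq M Y"
 using msq_add[of X M "%om. - Y om"] assms by (simp add: msq_uminus)

lemma msq_sum:
 assumes [measurable]: "!!i. i \<in> I ==> X i \<in> borel_measurable M"
 shows "msq M (%om. \<Sum>i\<in>I. X i om) <= of_nat (card I) * (\<Sum>i\<in>I. msq M (X i))"
proof -
 have "msq M (%om. \<Sum>i\<in>I. X i om) <= (\<integral>\<^sup>+om. of_nat (card I) * (\<Sum>i\<in>I. ennreal ((norm (X i om))\<^sup>2)) \<partial>M)"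
  unfolding msq_def
 proof (rule nn_integral_mono)
  fix om
  have "ennreal ((norm (\<Sum>i\<in>I. X i om))\<^sup>2) <= ennreal (real (card I) * (\<Sum>i\<in>I. (norm (X i om))\<^sup>2))"
   by (intro ennreal_leI norm_sum_sq_le)
  then show "ennreal ((norm (\<Sum>i\<in>I. X i om))\<^sup>2) <= of_nat (card I) * (\<Sum>i\<in>I. ennreal ((norm (X i om))\<^sup>2))"
   by (simp add: ennreal_mult sum_nonneg ennreal_of_nat_eq_real_of_nat)
 qed
 also have "... = of_nat (card I) * (\<Sum>i\<in>I. msq M (X i))"
  unfolding msq_def by (subst nn_integral_cmult, measurable) (subst nn_integral_sum, auto)
 finally show ?thesis .
qed

lemma msq_mono_AE:
 assumes "AE om in M. norm (X om) <= norm (Y om)"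
 shows "msq M X <= msq M Y"
 unfolding msq_def
 by (rule nn_integral_mono_AE) (use assms in \<open>auto elim!: eventually_mono intro!: ennreal_leI power_mono\<close>)

lemma msq_bound:
 assumes "prob_space M" "AE om in M. norm (X om) <= C"
 shows "msq M X <= ennreal (C\<^sup>2)"
proof -
 interpret prob_space M by fact
 have "msq M X <= (\<integral>\<^sup>+om. ennreal (C\<^sup>2) \<partial>M)"
  unfolding msq_def
  by (rule nn_integral_mono_AE) (use assms in \<open>auto elim!: eventually_mono intro!: ennreal_leI power_mono\<close>)
 then show ?thesis by (simp add: emeasure_space_1)
qed

lemma msq_cong_AE: "AE om in M. X om = Y om ==> msq M X = msq M Y"
 unfolding msq_def by (rule nn_integral_cong_AE) auto

lemma msq_scaleR:
 assumes "X \<in> borel_measurable M" shows "msq M (%om. c *\<^sub>R X om) = ennreal (c\<^sup>2) * msq M X"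
 unfolding msq_def using assms by (subst nn_integral_cmult[symmetric]) (auto simp: power_mult_distrib ennreal_mult)

lemma msq_finite_integrable:
 assumes M: "prob_space M" and X[measurable]: "X \<in> borel_measurable M" and fin: "msq M X < \<infinity>"
 shows "integrable M (%om. (norm (X om))\<^sup>2)" "integrable M X"
  "msq M X = ennreal (LINT om|M. (norm (X om))\<^sup>2)"
  "(norm (LINT om|M. X om))\<^sup>2 <= (LINT om|M. (norm (X om))\<^sup>2)"
proof -
 interpret prob_space M by fact
 show i2: "integrable M (%om. (norm (X om))\<^sup>2)"
  using fin unfolding msq_def by (intro integrableI_nonneg) auto
 have i1: "integrable M (%om. norm (X om))"
  by (rule square_integrable_imp_integrable) (use i2 in auto)
 then show "integrable M X" by (simp add: integrable_norm_iff)
 show "msq M X = ennreal (LINT om|M. (norm (X om))\<^sup>2)"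
  unfolding msq_def using i2 by (subst nn_integral_eq_integral) auto
 have "0 <= variance (%om. norm (X om))" by simp
 also have "... = (LINT om|M. (norm (X om))\<^sup>2) - (LINT om|M. norm (X om))\<^sup>2"
  by (rule variance_eq[OF i1 i2])
 finally have "(LINT om|M. norm (X om))\<^sup>2 <= (LINT om|M. (norm (X om))\<^sup>2)" by simp
 moreover have "(norm (LINT om|M. X om))\<^sup>2 <= (LINT om|M. norm (X om))\<^sup>2"
  by (intro power_mono integral_norm_bound) auto
 ultimately show "(norm (LINT om|M. X om))\<^sup>2 <= (LINT om|M. (norm (X om))\<^sup>2)" by (rule order_trans[rotated])
qed

lemma msq_integral:
 assumes "integrable M (%om. (norm (X om))\<^sup>2)"
 shows "msq M X = ennreal (LINT om|M. (norm (X om))\<^sup>2)"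
 unfolding msq_def using assms by (subst nn_integral_eq_integral) auto

lemma borel_measurable_vec_component[measurable (raw)]:
 fixes f :: "'a => real^'n"
 shows "f \<in> borel_measurable M ==> (%x. f x $ k) \<in> borel_measurable M"
 by (rule measurable_compose[of f M borel "%x. x $ k"]) simp_all

lemma bounded_mult_integrable:
 fixes q Y :: "'a => real"
 assumes "integrable M Y" "q \<in> borel_measurable M" "AE om in M. norm (q om) <= K"
 shows "integrable M (%om. q om * Y om)"
proof (rule Bochner_Integration.integrable_bound[of M "%om. K * Y om"])
 show "AE om in M. norm (q om * Y om) <= norm (K * Y om)"
  using assms(3)
 proof (rule eventually_mono)
  fix om assume "norm (q om) <= K"
  then have "\<bar>q om\<bar> <= \<bar>K\<bar>" by simp
  then show "norm (q om * Y om) <= norm (K * Y om)"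
   unfolding real_norm_def abs_mult by (rule mult_right_mono) simp
 qed
qed (use assms in auto)

section \<open>Increments of a Wiener process\<close>

text \<open>The filtration is the augmented one of the driving process, with respect to which solutions are adapted.\<close>

locale brownian = prob_space M for M :: "'a measure" +
 fixes T :: real and W :: "real => 'a => real^'r"
 assumes wiener: "wiener_process M T W"
begin

abbreviation F :: "real => 'a measure" where "F \<equiv> aug_filtration M W"

definition dW :: "'r => real => real => 'a => real" where
 "dW k a b om = W b om $ k - W a om $ k"

lemma W_measurable: "t \<in> {0..T} ==> W t \<in> borel_measurable M"
 using wiener unfolding wiener_process_def by blast

lemma dW_measurable[measurable]: "a \<in> {0..T} ==> b \<in> {0..T} ==> dW k a b \<in> borel_measurable M"
 unfolding dW_def[abs_def] using W_measurable by measurable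

definition gens :: "real => 'a set set" where
 "gens t = {W s -` B \<inter> space M | s B. 0 <= s \<and> s <= t \<and> B \<in> sets borel} \<union> null_sets M"

lemma gens_Pow: "gens t \<subseteq> Pow (space M)"
 unfolding gens_def by (auto dest: null_setsD2 sets.sets_into_space)

lemma space_F[simp]: "space (F t) = space M"
 unfolding aug_filtration_def by (rule space_measure_of) (use gens_Pow[of t] in \<open>simp add: gens_def\<close>)

lemma sets_F: "sets (F t) = sigma_sets (space M) (gens t)"
 unfolding aug_filtration_def gens_def by (rule sets_measure_of) (use gens_Pow[of t] in \<open>simp add: gens_def\<close>)

lemma F_sub: assumes "t <= T" shows "sets (F t) \<subseteq> sets M"
 unfolding sets_F
proof (rule sets.sigma_sets_subset)
 show "gens t \<subseteq> events"
  unfolding gens_def using assms by (auto intro!: measurable_sets[OF W_measurable])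
qed

lemma F_mono: "s <= t ==> sets (F s) \<subseteq> sets (F t)"
 unfolding sets_F gens_def by (rule sigma_sets_mono') (fastforce intro: order_trans)

lemma measurable_F_M: "t <= T ==> X \<in> measurable (F t) N ==> X \<in> measurable M N"
 using F_sub[of t] unfolding measurable_def by auto

lemma measurable_F_mono: "s <= t ==> X \<in> measurable (F s) N ==> X \<in> measurable (F t) N"
 using F_mono[of s t] unfolding measurable_def by auto

lemma W_F: "0 <= s ==> s <= t ==> W s \<in> borel_measurable (F t)"
proof (rule measurableI)
 fix B :: "(real^'r) set" assume "0 <= s" "s <= t" "B \<in> sets borel"
 then show "W s -` B \<inter> space (F t) \<in> sets (F t)"
  unfolding sets_F space_F by (intro sigma_sets.Basic) (auto simp: gens_def)
qed simp

lemma dW_F: "0 <= a ==> a <= t ==> 0 <= b ==> b <= t ==> dW k a b \<in> borel_measurable (F t)"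
 unfolding dW_def[abs_def] using W_F[of a t] W_F[of b t] by measurable

text \<open>Null sets are independent of everything, so the independence of future increments from the past survives the
augmentation; it suffices to check it on the intersection-stable family of past events modified by null sets.\<close>

lemma indep_increment_sets:
 assumes "0 <= s" "s < t" "t <= T"
 shows "indep_set (sets (F s)) (sigma_sets (space M) {(%om. W t om - W s om) -` B \<inter> space M | B. B \<in> sets borel})"
proof -
 define \<A> where "\<A> = sigma_sets (space M) {W u -` B \<inter> space M | u B. 0 <= u \<and> u <= s \<and> B \<in> sets borel}"
 define \<B> where "\<B> = sigma_sets (space M) {(%om. W t om - W s om) -` B \<inter> space M | B. B \<in> sets borel}"
 have AB: "indep_set \<A> \<B>"
  using wiener assms unfolding wiener_process_def \<A>_def \<B>_def by blast
 then have AB': "\<A> \<subseteq> events" "\<B> \<subseteq> events" "!!a b. a \<in> \<A> ==> b \<in> \<B> ==> prob (a \<inter> b) = prob a * prob b"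
  unfolding indep_sets2_eq by auto
 interpret A: sigma_algebra "space M" \<A>
  unfolding \<A>_def by (rule sigma_algebra_sigma_sets) auto
 interpret B: sigma_algebra "space M" \<B>
  unfolding \<B>_def by (rule sigma_algebra_sigma_sets) auto
 have "indep_set (\<A> \<union> null_sets M) \<B>"
  unfolding indep_sets2_eq
 proof (intro conjI ballI)
  show "\<A> \<union> null_sets M \<subseteq> events" using AB'(1) by auto
  show "\<B> \<subseteq> events" by fact
  fix a b assume a: "a \<in> \<A> \<union> null_sets M" and b: "b \<in> \<B>"
  show "prob (a \<inter> b) = prob a * prob b"
  proof (cases "a \<in> \<A>")
   case False
   then have "a \<in> null_sets M" using a by auto
   moreover from this have "a \<inter> b \<in> null_sets M" using b AB'(2) by (intro null_set_Int2) auto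
   ultimately show ?thesis by (simp add: measure_def null_setsD1)
  qed (use AB'(3) b in auto)
 qed
 moreover have "Int_stable (\<A> \<union> null_sets M)"
  using AB'(1) by (auto simp: Int_stable_def intro: null_set_Int1 null_set_Int2)
 moreover have "Int_stable \<B>" by (auto simp: Int_stable_def)
 ultimately have *: "indep_set (sigma_sets (space M) (\<A> \<union> null_sets M)) (sigma_sets (space M) \<B>)"
  by (rule indep_set_sigma_sets)
 have "gens s \<subseteq> \<A> \<union> null_sets M" unfolding gens_def \<A>_def by auto
 then have "sets (F s) \<subseteq> sigma_sets (space M) (\<A> \<union> null_sets M)"
  unfolding sets_F by (rule sigma_sets_mono')
 moreover have "\<B> \<subseteq> sigma_sets (space M) \<B>" by (auto intro: sigma_sets.Basic)
 ultimately have "indep_set (sets (F s)) \<B>"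
  using * unfolding indep_sets2_eq by blast
 then show ?thesis unfolding \<B>_def .
qed

lemma indep_increment:
 assumes st: "0 <= s" "s < t" "t <= T" and Y: "Y \<in> measurable (F s) N" and \<phi>: "\<phi> \<in> measurable borel N'"
 shows "indep_var N Y N' (%om. \<phi> (W t om - W s om))"
 unfolding indep_var_eq
proof (intro conjI)
 show "Y \<in> measurable M N" using measurable_F_M[OF _ Y] st by auto
 have "(%om. W t om - W s om) \<in> borel_measurable M" using W_measurable st by auto
 then show "(%om. \<phi> (W t om - W s om)) \<in> measurable M N'" by (rule measurable_compose[OF _ \<phi>])
 have "sigma_sets (space M) {Y -` A \<inter> space M |A. A \<in> sets N} \<subseteq> sets (F s)"
  using measurable_sets[OF Y] sets.sigma_sets_subset[of "{Y -` A \<inter> space M |A. A \<in> sets N}" "F s"] by auto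
 moreover have "sigma_sets (space M) {(%om. \<phi> (W t om - W s om)) -` A \<inter> space M |A. A \<in> sets N'}
  \<subseteq> sigma_sets (space M) {(%om. W t om - W s om) -` A \<inter> space M |A. A \<in> sets borel}"
 proof (rule sigma_sets_mono', safe)
  fix A assume "A \<in> sets N'"
  then show "\<exists>B. (%om. \<phi> (W t om - W s om)) -` A \<inter> space M = (%om. W t om - W s om) -` B \<inter> space M \<and> B \<in> sets borel"
   using measurable_sets[OF \<phi>, of A] by (intro exI[of _ "\<phi> -` A"]) auto
 qed
 ultimately show "indep_set (sigma_sets (space M) {Y -` A \<inter> space M |A. A \<in> sets N})
  (sigma_sets (space M) {(%om. \<phi> (W t om - W s om)) -` A \<inter> space M |A. A \<in> sets N'})"
  using indep_increment_sets[OF st] unfolding indep_sets2_eq by blast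
qed

lemma increment_moments:
 assumes st: "0 <= s" "s <= t" "t <= T"
 shows "integrable M (dW k s t)" "expectation (dW k s t) = 0"
  "integrable M (%om. (dW k s t om)\<^sup>2)" "expectation (%om. (dW k s t om)\<^sup>2) = t - s"
proof -
 have "integrable M (dW k s t) \<and> expectation (dW k s t) = 0 \<and> integrable M (%om. (dW k s t om)\<^sup>2) \<and> expectation (%om. (dW k s t om)\<^sup>2) = t - s"
 proof (cases "s = t")
  case True
  then show ?thesis by (simp add: dW_def[abs_def])
 next
  case False
  then have lt: "s < t" using st by simp
  then have r: "0 < sqrt (t - s)" by simp
  have d: "distributed M lborel (%om. W t om - W s om) (%x. ennreal (gauss_density (sqrt (t - s)) x))"
   using wiener st lt unfolding wiener_process_def gauss_density_def by blast
  have m: "(%x. x $ k) \<in> borel_measurable (lborel :: (real^'r) measure)" "(%x. (x $ k)\<^sup>2) \<in> borel_measurable (lborel :: (real^'r) measure)"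
   by measurable
  note I = distributed_integrable[OF d m(1) gauss_density_nonneg] distributed_integral[OF d m(1) gauss_density_nonneg]
   distributed_integrable[OF d m(2) gauss_density_nonneg] distributed_integral[OF d m(2) gauss_density_nonneg]
  show ?thesis using gauss_density_moment[OF r, of k] I lt by (simp add: dW_def[abs_def])
 qed
 then show "integrable M (dW k s t)" "expectation (dW k s t) = 0"
  "integrable M (%om. (dW k s t om)\<^sup>2)" "expectation (%om. (dW k s t om)\<^sup>2) = t - s" by auto
qed

text \<open>A factor that is measurable at the left end point is independent of the increment, so expectations factorize.\<close>

lemma mult_increment:
 assumes st: "0 <= s" "s <= t" "t <= T" and Y: "Y \<in> borel_measurable (F s)" "integrable M (Y :: 'a => real)"
 shows "integrable M (%om. Y om * dW k s t om)" "expectation (%om. Y om * dW k s t om) = 0"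
  "integrable M (%om. Y om * (dW k s t om)\<^sup>2)" "expectation (%om. Y om * (dW k s t om)\<^sup>2) = (t - s) * expectation Y"
proof -
 note mo = increment_moments[OF st, of k]
 have "integrable M (%om. Y om * dW k s t om) \<and> expectation (%om. Y om * dW k s t om) = 0 \<and>
  integrable M (%om. Y om * (dW k s t om)\<^sup>2) \<and> expectation (%om. Y om * (dW k s t om)\<^sup>2) = (t - s) * expectation Y"
 proof (cases "s = t")
  case True
  then show ?thesis by (simp add: dW_def)
 next
  case False
  then have lt: "s < t" using st by simp
  note ind = indep_increment[OF st(1) lt st(3) Y(1)]
  have i1: "indep_var borel Y borel (dW k s t)"
   using ind[of "%x. x $ k" borel] by (simp add: dW_def[abs_def])
  have i2: "indep_var borel Y borel (%om. (dW k s t om)\<^sup>2)"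
   using ind[of "%x. (x $ k)\<^sup>2" borel] by (simp add: dW_def[abs_def])
  show ?thesis
   using indep_var_integrable[OF i1 Y(2) mo(1)] indep_var_lebesgue_integral[OF i1 Y(2) mo(1)]
   indep_var_integrable[OF i2 Y(2) mo(3)] indep_var_lebesgue_integral[OF i2 Y(2) mo(3)] mo by simp
 qed
 then show "integrable M (%om. Y om * dW k s t om)" "expectation (%om. Y om * dW k s t om) = 0"
  "integrable M (%om. Y om * (dW k s t om)\<^sup>2)" "expectation (%om. Y om * (dW k s t om)\<^sup>2) = (t - s) * expectation Y"
  by auto
qed

text \<open>The length of the intersection of two intervals.\<close>

definition overlap :: "real => real => real => real => real" where
 "overlap a b c d = max 0 (min b d - max a c)"

text \<open>The isometry for two elementary integrands whose intervals may overlap in any way. After ordering the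
left end points, the intervals are cut at the end points of one another; products over disjoint intervals
have mean zero, and the common part contributes its length.\<close>

lemma elementary_covariance:
 fixes \<xi> \<xi>' :: "'a => 'v::euclidean_space"
 assumes ab: "0 <= a" "a <= b" "b <= T" and cd: "0 <= c" "c <= d" "d <= T"
  and m: "\<xi> \<in> borel_measurable (F a)" "\<xi>' \<in> borel_measurable (F c)"
  and bd: "!!om. om \<in> space M ==> norm (\<xi> om) <= C" "!!om. om \<in> space M ==> norm (\<xi>' om) <= C'"
 shows "integrable M (%om. (dW k a b om *\<^sub>R \<xi> om) \<bullet> (dW k c d om *\<^sub>R \<xi>' om)) \<and>
  expectation (%om. (dW k a b om *\<^sub>R \<xi> om) \<bullet> (dW k c d om *\<^sub>R \<xi>' om)) = overlap a b c d * expectation (%om. \<xi> om \<bullet> \<xi>' om)"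
  (is "?P a b \<xi> c d \<xi>'")
proof -
 have wlog: "?P a b \<xi> c d \<xi>'" if ac: "a <= c" and ab: "0 <= a" "a <= b" "b <= T" and cd: "0 <= c" "c <= d" "d <= T"
  and m: "\<xi> \<in> borel_measurable (F a)" "\<xi>' \<in> borel_measurable (F c)"
  and bd: "!!om. om \<in> space M ==> norm (\<xi> om) <= C" "!!om. om \<in> space M ==> norm (\<xi>' om) <= C'"
  for a b c d C C' and \<xi> \<xi>' :: "'a => 'v"
 proof -
  define q where "q om = \<xi> om \<bullet> \<xi>' om" for om
  have qm: "q \<in> borel_measurable (F c)"
   unfolding q_def using measurable_F_mono[OF ac m(1)] m(2) by measurable
  have "AE om in M. norm (q om) <= C * C'"
  proof (rule AE_I2)
   fix om assume "om \<in> space M"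
   then show "norm (q om) <= C * C'"
    unfolding q_def real_norm_def
    by (intro order_trans[OF Cauchy_Schwarz_ineq2] mult_mono bd order_trans[OF norm_ge_zero bd(1)]) auto
  qed
  moreover have "q \<in> borel_measurable M" using measurable_F_M[OF _ qm] cd by auto
  ultimately have qi: "integrable M q" by (rule integrable_const_bound)
  have eq: "(dW k a b om *\<^sub>R \<xi> om) \<bullet> (dW k c d om *\<^sub>R \<xi>' om) = dW k a b om * dW k c d om * q om" for om
   unfolding q_def by simp
  show ?thesis
  proof (cases "b <= c")
   case True
   then have ov: "overlap a b c d = 0" unfolding overlap_def by auto
   have Y: "(%om. dW k a b om * q om) \<in> borel_measurable (F c)"
    by (rule borel_measurable_times[OF dW_F qm]) (use True ab in auto)
   have "integrable M (%om. q om * dW k a b om)"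
   proof -
    \<comment> \<open>product of a bounded and a square integrable variable\<close>
    have [measurable]: "q \<in> borel_measurable M" by fact
    have [measurable]: "dW k a b \<in> borel_measurable M" using ab by (intro dW_measurable) auto
    have "AE om in M. norm (q om) <= C * C'" by fact
    then show ?thesis using increment_moments(1)[OF ab, of k] by (intro bounded_mult_integrable) auto
   qed
   then have "integrable M (%om. dW k a b om * q om)" by (simp add: mult.commute)
   from mult_increment(1,2)[OF cd Y this, of k] show ?thesis
    unfolding ov eq by (simp add: ac_simps)
  next
   case False
   define e where "e = min b d"
   have e: "c <= e" "e <= b" "e <= d" "0 <= e" "e <= T" using False cd ab unfolding e_def by auto
   have ov: "overlap a b c d = e - c" using False ac e unfolding overlap_def e_def by auto
   have Fm: "q \<in> borel_measurable (F e)" using measurable_F_mono[OF e(1) qm] .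
   have 0: "integrable M (%om. q om * dW k a c om)"
   proof -
    have [measurable]: "q \<in> borel_measurable M" by fact
    have [measurable]: "dW k a c \<in> borel_measurable M" using ab cd by (intro dW_measurable) auto
    have "AE om in M. norm (q om) <= C * C'" by fact
    then show ?thesis using increment_moments(1)[of a c k] ab cd ac by (intro bounded_mult_integrable) auto
   qed
   have m1: "(%om. q om * dW k a c om) \<in> borel_measurable (F c)"
    by (rule borel_measurable_times[OF qm dW_F]) (use ab cd ac in auto)
   note A1 = mult_increment[OF cd(1) e(1,5) m1 0, of k]
   note A2 = mult_increment[OF e(4,3) cd(3) measurable_F_mono[OF e(1) m1] 0, of k]
   note A3 = mult_increment[OF cd(1) e(1,5) qm qi, of k]
   have m2: "(%om. q om * dW k c e om) \<in> borel_measurable (F e)"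
    by (rule borel_measurable_times[OF Fm dW_F]) (use e cd in auto)
   note A4 = mult_increment[OF e(4,3) cd(3) m2 A3(1), of k]
   note A5 = mult_increment[OF e(4,2) ab(3) m2 A3(1), of k]
   have z: "dW k e b om * dW k e d om = 0" for om
    unfolding e_def by (auto simp: min_def dW_def)
   have "dW k a b om * dW k c d om * q om = q om * dW k a c om * dW k c e om + q om * dW k a c om * dW k e d om
    + q om * (dW k c e om)\<^sup>2 + q om * dW k c e om * dW k e d om + q om * dW k c e om * dW k e b om" for om
   proof -
    have "dW k a b om = dW k a c om + dW k c e om + dW k e b om" "dW k c d om = dW k c e om + dW k e d om"
     unfolding dW_def by auto
    then have "dW k a b om * dW k c d om * q om = q om * dW k a c om * dW k c e om + q om * dW k a c om * dW k e d om
    + q om * (dW k c e om)\<^sup>2 + q om * dW k c e om * dW k e d om + q om * dW k c e om * dW k e b om + q om * (dW k e b om * dW k e d om)"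
     by (simp add: algebra_simps power2_eq_square)
    then show ?thesis by (simp add: z)
   qed
   note eq' = this
   show ?thesis
    unfolding eq eq' ov using A1(1,2) A2(1,2) A3(3,4) A4(1,2) A5(1,2) by (simp add: q_def[symmetric])
  qed
 qed
 show ?thesis
 proof (cases "a <= c")
  case True
  then show ?thesis by (rule wlog[OF _ ab cd m bd])
 next
  case False
  have "overlap a b c d = overlap c d a b" unfolding overlap_def by (simp add: min.commute max.commute)
  moreover have "?P c d \<xi>' a b \<xi>" using False by (intro wlog[OF _ cd ab m(2,1) bd(2,1)]) auto
  ultimately show ?thesis by (simp only: inner_commute)
 qed
qed

end

section \<open>Ito integrals and step integrands\<close>

lemma has_bochner_integral_Ioc: "has_bochner_integral lborel (indicat_real {l<..u}) (max 0 (u - l))"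
proof (cases "l <= u")
 case True
 then have "has_bochner_integral lborel (indicat_real {l<..u}) (measure lborel {l<..u})"
  by (intro has_bochner_integral_real_indicator) auto
 then show ?thesis using True by simp
qed (auto simp: indicator_def[abs_def] has_bochner_integral_zero)

context brownian begin

text \<open>A step integrand as a finite family of terms, each with its own interval. Intervals may overlap, so that the difference
of two step integrands over different partitions is again such a family.\<close>

definition elem_family :: "real => 'i set => ('i => real) => ('i => real) => ('i => 'a => 'v::euclidean_space) => bool" where
 "elem_family t I a b \<xi> \<longleftrightarrow> finite I \<and> (\<forall>i\<in>I. 0 <= a i \<and> a i <= b i \<and> b i <= t \<and> \<xi> i \<in> borel_measurable (F (a i))
  \<and> (\<exists>C. \<forall>om\<in>space M. norm (\<xi> i om) <= C))"

definition fam_val :: "'i set => ('i => real) => ('i => real) => ('i => 'a => 'v::euclidean_space) => real => 'a => 'v" where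
 "fam_val I a b \<xi> s om = (\<Sum>i\<in>I. indicator {a i<..b i} s *\<^sub>R \<xi> i om)"

definition fam_int :: "'r => 'i set => ('i => real) => ('i => real) => ('i => 'a => 'v::euclidean_space) => 'a => 'v" where
 "fam_int k I a b \<xi> om = (\<Sum>i\<in>I. dW k (a i) (b i) om *\<^sub>R \<xi> i om)"

lemma elem_familyD:
 assumes "elem_family t I a b \<xi>" "i \<in> I"
 shows "0 <= a i" "a i <= b i" "b i <= t" "\<xi> i \<in> borel_measurable (F (a i))" "\<exists>C. \<forall>om\<in>space M. norm (\<xi> i om) <= C" "finite I"
 using assms unfolding elem_family_def by blast+

lemma elem_family_M:
 assumes "elem_family t I a b \<xi>" "t <= T" "i \<in> I"
 shows "\<xi> i \<in> borel_measurable M" "dW k (a i) (b i) \<in> borel_measurable M"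
 using elem_familyD[OF assms(1,3)] assms(2) by (auto intro!: measurable_F_M[of "a i"] dW_measurable)

lemma elem_family_mono: "elem_family s I a b \<xi> ==> s <= t ==> elem_family t I a b \<xi>"
 unfolding elem_family_def by force

lemma fam_int_measurable:
 assumes "elem_family t I a b \<xi>" "t <= T" shows "fam_int k I a b \<xi> \<in> borel_measurable M"
 unfolding fam_int_def[abs_def] using elem_family_M[OF assms] by measurable

text \<open>Expanding the squared norm into pairs reduces the isometry to \<open>elementary_covariance\<close>; the same expansion of the
integrand produces the same overlaps.\<close>

lemma family_isometry:
 fixes \<xi> :: "'i => 'a => 'v::euclidean_space"
 assumes fam: "elem_family T I a b \<xi>"
 shows "integrable M (%om. (norm (fam_int k I a b \<xi> om))\<^sup>2)"
  "msq M (fam_int k I a b \<xi>) = (\<integral>\<^sup>+om. \<integral>\<^sup>+s. ennreal ((norm (fam_val I a b \<xi> s om))\<^sup>2) \<partial>lborel \<partial>M)"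
proof -
 have fin: "finite I" using fam unfolding elem_family_def by blast
 define ov where "ov i j = overlap (a i) (b i) (a j) (b j)" for i j
 have cov: "integrable M (%om. (dW k (a i) (b i) om *\<^sub>R \<xi> i om) \<bullet> (dW k (a j) (b j) om *\<^sub>R \<xi> j om)) \<and>
  expectation (%om. (dW k (a i) (b i) om *\<^sub>R \<xi> i om) \<bullet> (dW k (a j) (b j) om *\<^sub>R \<xi> j om)) = ov i j * expectation (%om. \<xi> i om \<bullet> \<xi> j om)"
  if ij: "i \<in> I" "j \<in> I" for i j
 proof -
  note i = elem_familyD[OF fam ij(1)] and j = elem_familyD[OF fam ij(2)]
  obtain C C' where "!!om. om \<in> space M ==> norm (\<xi> i om) <= C" "!!om. om \<in> space M ==> norm (\<xi> j om) <= C'"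
   using i(5) j(5) by blast
  then show ?thesis unfolding ov_def by (intro elementary_covariance i j)
 qed
 have qi: "integrable M (%om. \<xi> i om \<bullet> \<xi> j om)" if ij: "i \<in> I" "j \<in> I" for i j
 proof -
  note i = elem_familyD[OF fam ij(1)] and j = elem_familyD[OF fam ij(2)]
  obtain C C' where C: "!!om. om \<in> space M ==> norm (\<xi> i om) <= C" "!!om. om \<in> space M ==> norm (\<xi> j om) <= C'"
   using i(5) j(5) by blast
  show ?thesis
  proof (rule integrable_const_bound)
   show "AE om in M. norm (\<xi> i om \<bullet> \<xi> j om) <= C * C'"
    by (intro AE_I2) (auto intro!: order_trans[OF Cauchy_Schwarz_ineq2] mult_mono C order_trans[OF norm_ge_zero C(1)])
  qed (use elem_family_M[OF fam] ij in measurable)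
 qed
 have sq: "(norm (fam_int k I a b \<xi> om))\<^sup>2 = (\<Sum>i\<in>I. \<Sum>j\<in>I. (dW k (a i) (b i) om *\<^sub>R \<xi> i om) \<bullet> (dW k (a j) (b j) om *\<^sub>R \<xi> j om))" for om
  unfolding fam_int_def power2_norm_eq_inner by (subst inner_sum_left) (simp only: inner_sum_right)
 show i: "integrable M (%om. (norm (fam_int k I a b \<xi> om))\<^sup>2)"
  unfolding sq using cov by (intro Bochner_Integration.integrable_sum) blast
 have e: "expectation (%om. (norm (fam_int k I a b \<xi> om))\<^sup>2) = (\<Sum>i\<in>I. \<Sum>j\<in>I. ov i j * expectation (%om. \<xi> i om \<bullet> \<xi> j om))"
  unfolding sq using cov
  by (subst Bochner_Integration.integral_sum, fastforce intro!: Bochner_Integration.integrable_sum)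
   (intro sum.cong refl, subst Bochner_Integration.integral_sum, auto)
 have ind: "has_bochner_integral lborel (%s. indicator {a i<..b i} s * indicator {a j<..b j} s * c) (ov i j * c)" for i j and c :: real
 proof -
  have "{a i<..b i} \<inter> {a j<..b j} = {max (a i) (a j)<..min (b i) (b j)}" by auto
  moreover have "has_bochner_integral lborel (indicat_real {max (a i) (a j)<..min (b i) (b j)}) (ov i j)"
   unfolding ov_def overlap_def by (rule has_bochner_integral_Ioc)
  ultimately have "has_bochner_integral lborel (%s. indicator {a i<..b i} s * indicator {a j<..b j} s) (ov i j)"
   by (simp add: indicator_inter_arith[symmetric])
  then show ?thesis by (rule has_bochner_integral_mult_left[rotated])
 qed
 have vsq: "(norm (fam_val I a b \<xi> s om))\<^sup>2 = (\<Sum>i\<in>I. \<Sum>j\<in>I. indicator {a i<..b i} s * indicator {a j<..b j} s * (\<xi> i om \<bullet> \<xi> j om))" for s om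
  unfolding fam_val_def power2_norm_eq_inner by (subst inner_sum_left) (simp add: inner_sum_right mult.assoc mult.left_commute)
 have hb: "has_bochner_integral lborel (%s. (norm (fam_val I a b \<xi> s om))\<^sup>2) (\<Sum>i\<in>I. \<Sum>j\<in>I. ov i j * (\<xi> i om \<bullet> \<xi> j om))" for om
  unfolding vsq by (intro has_bochner_integral_sum ind)
 have inner: "(\<integral>\<^sup>+s. ennreal ((norm (fam_val I a b \<xi> s om))\<^sup>2) \<partial>lborel) = ennreal (\<Sum>i\<in>I. \<Sum>j\<in>I. ov i j * (\<xi> i om \<bullet> \<xi> j om))" for om
  using hb[of om] by (subst nn_integral_eq_integral) (auto simp: has_bochner_integral_iff)
 have nn: "0 <= (\<Sum>i\<in>I. \<Sum>j\<in>I. ov i j * (\<xi> i om \<bullet> \<xi> j om))" for om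
  unfolding has_bochner_integral_integral_eq[OF hb[of om], symmetric] by (rule Bochner_Integration.integral_nonneg) simp
 have "msq M (fam_int k I a b \<xi>) = ennreal (\<Sum>i\<in>I. \<Sum>j\<in>I. ov i j * expectation (%om. \<xi> i om \<bullet> \<xi> j om))"
  unfolding msq_integral[OF i] e ..
 also have "... = ennreal (expectation (%om. \<Sum>i\<in>I. \<Sum>j\<in>I. ov i j * (\<xi> i om \<bullet> \<xi> j om)))"
  using qi by (subst Bochner_Integration.integral_sum, fastforce intro!: Bochner_Integration.integrable_sum)
   (intro arg_cong[where f=ennreal] sum.cong refl, subst Bochner_Integration.integral_sum, auto)
 also have "... = (\<integral>\<^sup>+om. ennreal (\<Sum>i\<in>I. \<Sum>j\<in>I. ov i j * (\<xi> i om \<bullet> \<xi> j om)) \<partial>M)"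
  using qi nn by (intro nn_integral_eq_integral[symmetric]) (auto intro!: Bochner_Integration.integrable_sum)
 finally show "msq M (fam_int k I a b \<xi>) = (\<integral>\<^sup>+om. \<integral>\<^sup>+s. ennreal ((norm (fam_val I a b \<xi> s om))\<^sup>2) \<partial>lborel \<partial>M)"
  unfolding inner .
qed

lemma fam_int_mean:
 fixes \<xi> :: "'i => 'a => 'v::euclidean_space"
 assumes fam: "elem_family T I a b \<xi>"
 shows "expectation (fam_int k I a b \<xi>) = 0"
proof -
 have "has_bochner_integral M (%om. dW k (a i) (b i) om *\<^sub>R \<xi> i om) 0" if "i \<in> I" for i
 proof -
  note i = elem_familyD[OF fam that]
  obtain C where C: "!!om. om \<in> space M ==> norm (\<xi> i om) <= C" using i(5) by blast
  have meas[measurable]: "\<xi> i \<in> borel_measurable M" "dW k (a i) (b i) \<in> borel_measurable M" using elem_family_M[OF fam _ that] by auto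
  have c: "has_bochner_integral M (%om. (dW k (a i) (b i) om *\<^sub>R \<xi> i om) \<bullet> u) 0" if "u \<in> Basis" for u
  proof -
   have q: "integrable M (%om. \<xi> i om \<bullet> u)"
    by (rule integrable_const_bound[of _ C]) (use C that in \<open>auto intro!: AE_I2 order_trans[OF Basis_le_norm]\<close>)
   have "(%om. \<xi> i om \<bullet> u) \<in> borel_measurable (F (a i))" using i(4) by measurable
   from mult_increment(1,2)[OF i(1-3) this q, of k] show ?thesis
    by (simp add: has_bochner_integral_iff mult.commute)
  qed
  have "has_bochner_integral M (%om. \<Sum>u\<in>Basis. ((dW k (a i) (b i) om *\<^sub>R \<xi> i om) \<bullet> u) *\<^sub>R u) (\<Sum>u\<in>(Basis :: 'v set). 0 *\<^sub>R u)"
   by (intro has_bochner_integral_sum has_bochner_integral_scaleR_left c)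
  then show ?thesis by (simp only: euclidean_representation) simp
 qed
 then have "has_bochner_integral M (fam_int k I a b \<xi>) (\<Sum>i\<in>I. 0)"
  unfolding fam_int_def[abs_def] by (intro has_bochner_integral_sum)
 then show ?thesis by (simp add: has_bochner_integral_iff)
qed

lemma simple_process_family:
 assumes "simple_process M F t m \<tau> \<xi>"
 shows "elem_family t {..<m} \<tau> (%j. \<tau> (Suc j)) \<xi>"
  "simple_process_val m \<tau> \<xi> = fam_val {..<m} \<tau> (%j. \<tau> (Suc j)) \<xi>"
  "simple_process_integral m \<tau> \<xi> (%s om. W s om $ k) = fam_int k {..<m} \<tau> (%j. \<tau> (Suc j)) \<xi>"
proof -
 note sp = assms[unfolded simple_process_def]
 have st: "\<tau> i <= \<tau> j" if "i <= j" "j <= m" for i j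
  using that by (induction j rule: dec_induct) (use sp in \<open>auto intro: order_trans\<close>)
 show "elem_family t {..<m} \<tau> (%j. \<tau> (Suc j)) \<xi>"
  unfolding elem_family_def
 proof (intro conjI ballI)
  fix i assume i: "i \<in> {..<m}"
  show "0 <= \<tau> i" using st[of 0 i] i sp by auto
  show "\<tau> (Suc i) <= t" using st[of "Suc i" m] i sp by auto
 qed (use sp in auto)
 show "simple_process_val m \<tau> \<xi> = fam_val {..<m} \<tau> (%j. \<tau> (Suc j)) \<xi>"
  by (simp add: fun_eq_iff simple_process_val_def fam_val_def)
 show "simple_process_integral m \<tau> \<xi> (%s om. W s om $ k) = fam_int k {..<m} \<tau> (%j. \<tau> (Suc j)) \<xi>"
  by (simp add: fun_eq_iff simple_process_integral_def fam_int_def dW_def)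
qed

lemma progressive_measurable:
 fixes f :: "real => 'a => 'v::euclidean_space"
 assumes f: "(%(s, om). f s om) \<in> borel_measurable (restrict_space borel {0..t} \<Otimes>\<^sub>M F t)" and t: "t <= T"
 shows "(%(s, om). f s om) \<in> borel_measurable (restrict_space lborel {0..t} \<Otimes>\<^sub>M M)"
proof -
 have "(%x. x) \<in> restrict_space lborel {0..t} \<Otimes>\<^sub>M M \<rightarrow>\<^sub>M restrict_space borel {0..t} \<Otimes>\<^sub>M F t"
 proof (rule measurable_pair)
  have "sets (restrict_space lborel {0..t}) = sets (restrict_space borel {0..t})"
   by (rule sets_restrict_space_cong) simp
  then have "fst \<in> restrict_space lborel {0..t} \<Otimes>\<^sub>M M \<rightarrow>\<^sub>M restrict_space borel {0..t}"
   by (subst measurable_cong_sets[OF refl, symmetric]) auto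
  then show "fst \<circ> (%x. x) \<in> restrict_space lborel {0..t} \<Otimes>\<^sub>M M \<rightarrow>\<^sub>M restrict_space borel {0..t}"
   by (simp add: comp_def)
  have "(%x. x) \<in> M \<rightarrow>\<^sub>M F t" using F_sub[OF t] by (auto simp: measurable_def)
  from measurable_compose[OF measurable_snd this]
  show "snd \<circ> (%x. x) \<in> restrict_space lborel {0..t} \<Otimes>\<^sub>M M \<rightarrow>\<^sub>M F t" by (simp add: comp_def)
 qed
 from measurable_compose[OF this f] show ?thesis .
qed

lemma fam_val_measurable:
 assumes "elem_family t I a b \<xi>" "t <= T"
 shows "(%(s, om). fam_val I a b \<xi> s om) \<in> borel_measurable (restrict_space lborel {0..u} \<Otimes>\<^sub>M M)"
proof -
 have [measurable]: "indicat_real {c<..d} \<in> borel_measurable (restrict_space lborel {0..u})" for c d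
  by (rule measurable_restrict_space1) simp
 have "\<xi> i \<in> borel_measurable M" if "i \<in> I" for i using elem_family_M[OF assms that] by simp
 then show ?thesis unfolding fam_val_def case_prod_beta by measurable
qed

text \<open>The squared distance of integrands with respect to the product of time and probability; the Ito isometry equates it
to the mean square of the integral.\<close>

definition dsq :: "real => (real => 'a => 'v::euclidean_space) => ennreal" where
 "dsq t f = (\<integral>\<^sup>+om. (\<integral>\<^sup>+s\<in>{0..t}. ennreal ((norm (f s om))\<^sup>2) \<partial>lborel) \<partial>M)"

lemma dsq_restrict: "dsq t f = (\<integral>\<^sup>+om. (\<integral>\<^sup>+s. ennreal ((norm (f s om))\<^sup>2) \<partial>restrict_space lborel {0..t}) \<partial>M)"
 unfolding dsq_def by (subst nn_integral_restrict_space) auto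

lemma sigma_finite_interval: "sigma_finite_measure (restrict_space lborel {0..t::real})"
 by (intro sigma_finite_measure_restrict_space sigma_finite_lborel) auto

text \<open>Tonelli, so that a bound at each fixed time bounds the distance.\<close>

lemma dsq_swap:
 fixes f :: "real => 'a => 'v::euclidean_space"
 assumes f: "(%(s, om). f s om) \<in> borel_measurable (restrict_space lborel {0..t} \<Otimes>\<^sub>M M)"
 shows "dsq t f = (\<integral>\<^sup>+s\<in>{0..t}. msq M (f s) \<partial>lborel)"
proof -
 interpret R: sigma_finite_measure "restrict_space lborel {0..t}" by (rule sigma_finite_interval)
 interpret P: pair_sigma_finite "restrict_space lborel {0..t}" M ..
 have "dsq t f = (\<integral>\<^sup>+s. msq M (f s) \<partial>restrict_space lborel {0..t})"
  unfolding dsq_restrict msq_def using f by (intro P.Fubini') (simp add: case_prod_beta)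
 also have "... = (\<integral>\<^sup>+s\<in>{0..t}. msq M (f s) \<partial>lborel)" by (subst nn_integral_restrict_space) auto
 finally show ?thesis .
qed

lemma dsq_diff:
 fixes f g :: "real => 'a => 'v::euclidean_space"
 assumes f: "(%(s, om). f s om) \<in> borel_measurable (restrict_space lborel {0..t} \<Otimes>\<^sub>M M)"
  and g: "(%(s, om). g s om) \<in> borel_measurable (restrict_space lborel {0..t} \<Otimes>\<^sub>M M)"
 shows "dsq t (%s om. f s om - g s om) <= 2 * dsq t f + 2 * dsq t g"
proof -
 interpret R: sigma_finite_measure "restrict_space lborel {0..t}" by (rule sigma_finite_interval)
 have m: "(%om. \<integral>\<^sup>+s. ennreal ((norm (f s om))\<^sup>2) \<partial>restrict_space lborel {0..t}) \<in> borel_measurable M"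
  if f: "(%(s, om). f s om) \<in> borel_measurable (restrict_space lborel {0..t} \<Otimes>\<^sub>M M)" for f :: "real => 'a => 'v"
  using measurable_pair_swap[OF f] by (intro R.borel_measurable_nn_integral) (simp add: case_prod_beta)
 have m2: "(%s. ennreal ((norm (f s om))\<^sup>2)) \<in> borel_measurable (restrict_space lborel {0..t})"
  if f: "(%(s, om). f s om) \<in> borel_measurable (restrict_space lborel {0..t} \<Otimes>\<^sub>M M)" and "om \<in> space M" for f :: "real => 'a => 'v" and om
  using measurable_compose[OF measurable_Pair2'[OF that(2)] f] by simp
 have le: "ennreal ((norm (x - y))\<^sup>2) <= 2 * ennreal ((norm x)\<^sup>2) + 2 * ennreal ((norm y)\<^sup>2)" for x y :: 'v
 proof -
  have "ennreal ((norm (x - y))\<^sup>2) <= ennreal (2 * (norm x)\<^sup>2 + 2 * (norm y)\<^sup>2)"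
   using norm_add_sq_le[of x "- y"] by (intro ennreal_leI) simp
  then show ?thesis by (simp add: ennreal_mult)
 qed
 have "dsq t (%s om. f s om - g s om) <= (\<integral>\<^sup>+om. (\<integral>\<^sup>+s. 2 * ennreal ((norm (f s om))\<^sup>2) + 2 * ennreal ((norm (g s om))\<^sup>2) \<partial>restrict_space lborel {0..t}) \<partial>M)"
  unfolding dsq_restrict by (intro nn_integral_mono le)
 also have "... = (\<integral>\<^sup>+om. 2 * (\<integral>\<^sup>+s. ennreal ((norm (f s om))\<^sup>2) \<partial>restrict_space lborel {0..t}) + 2 * (\<integral>\<^sup>+s. ennreal ((norm (g s om))\<^sup>2) \<partial>restrict_space lborel {0..t}) \<partial>M)"
  using m2[OF f] m2[OF g] by (intro nn_integral_cong) (simp add: nn_integral_add nn_integral_cmult)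
 also have "... = 2 * dsq t f + 2 * dsq t g"
  unfolding dsq_restrict using m[OF f] m[OF g] by (simp add: nn_integral_add nn_integral_cmult)
 finally show ?thesis .
qed

lemma has_ito_integralE:
 assumes ito: "has_ito_integral M F (%s om. W s om $ k) f t J" and t: "0 <= t" "t <= T"
 obtains m \<tau> \<xi> where "(%(s, om). f s om) \<in> borel_measurable (restrict_space lborel {0..t} \<Otimes>\<^sub>M M)"
  "J \<in> borel_measurable M"
  "!!n::nat. elem_family t {..<m n} (\<tau> n) (%j::nat. \<tau> n (Suc j)) (\<xi> n)"
  "(%n. dsq t (%s om. f s om - fam_val {..<m n} (\<tau> n) (%j. \<tau> n (Suc j)) (\<xi> n) s om)) \<longlonglongrightarrow> 0"
  "(%n. msq M (%om. J om - fam_int k {..<m n} (\<tau> n) (%j. \<tau> n (Suc j)) (\<xi> n) om)) \<longlonglongrightarrow> 0"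
proof -
 from ito obtain m \<tau> \<xi> where sp: "!!n::nat. simple_process M F t (m n) (\<tau> n) (\<xi> n)"
  and l1: "(%n. \<integral>\<^sup>+om. (\<integral>\<^sup>+s\<in>{0..t}. ennreal ((norm (f s om - simple_process_val (m n) (\<tau> n) (\<xi> n) s om))\<^sup>2) \<partial>lborel) \<partial>M) \<longlonglongrightarrow> 0"
  and l2: "(%n. \<integral>\<^sup>+om. ennreal ((norm (J om - simple_process_integral (m n) (\<tau> n) (\<xi> n) (%s om. W s om $ k) om))\<^sup>2) \<partial>M) \<longlonglongrightarrow> 0"
  and J: "J \<in> borel_measurable M"
  and pm: "\<forall>u\<in>{0..t}. (%(s, om). f s om) \<in> borel_measurable (restrict_space borel {0..u} \<Otimes>\<^sub>M F u)"
  unfolding has_ito_integral_def by blast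
 show thesis
 proof (rule that)
  show "(%(s, om). f s om) \<in> borel_measurable (restrict_space lborel {0..t} \<Otimes>\<^sub>M M)"
   using pm t by (intro progressive_measurable) auto
  show "J \<in> borel_measurable M" by fact
  show "elem_family t {..<m n} (\<tau> n) (%j::nat. \<tau> n (Suc j)) (\<xi> n)" for n
   by (rule simple_process_family(1)[OF sp])
  show "(%n. dsq t (%s om. f s om - fam_val {..<m n} (\<tau> n) (%j. \<tau> n (Suc j)) (\<xi> n) s om)) \<longlonglongrightarrow> 0"
   using l1 unfolding simple_process_family(2)[OF sp] dsq_def .
  show "(%n. msq M (%om. J om - fam_int k {..<m n} (\<tau> n) (%j. \<tau> n (Suc j)) (\<xi> n) om)) \<longlonglongrightarrow> 0"
   using l2 unfolding simple_process_family(3)[OF sp] msq_def .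
 qed
qed

text \<open>The isometry for the step families of an approximating sequence transfers to the limit. The constant \<open>4\<close>, instead
of \<open>1\<close>, is the price of using only $|x+y|^2 \le 2|x|^2 + 2|y|^2$ in the passage to the limit.\<close>

lemma ito_family_distance:
 fixes \<xi> :: "'i => 'a => 'v::euclidean_space"
 assumes ito: "has_ito_integral M F (%s om. W s om $ k) f t J" and t: "0 <= t" "t <= T"
  and fam: "elem_family t I a b \<xi>"
 shows "msq M (%om. J om - fam_int k I a b \<xi> om) <= 4 * dsq t (%s om. f s om - fam_val I a b \<xi> s om)"
proof -
 obtain m \<tau> \<zeta> where f: "(%(s, om). f s om) \<in> borel_measurable (restrict_space lborel {0..t} \<Otimes>\<^sub>M M)"
  and J: "J \<in> borel_measurable M"
  and sp: "!!n::nat. elem_family t {..<m n} (\<tau> n) (%j::nat. \<tau> n (Suc j)) (\<zeta> n)"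
  and l1: "(%n. dsq t (%s om. f s om - fam_val {..<m n} (\<tau> n) (%j. \<tau> n (Suc j)) (\<zeta> n) s om)) \<longlonglongrightarrow> 0"
  and l2: "(%n. msq M (%om. J om - fam_int k {..<m n} (\<tau> n) (%j. \<tau> n (Suc j)) (\<zeta> n) om)) \<longlonglongrightarrow> 0"
  by (rule has_ito_integralE[OF ito t]) (rule that, assumption+)
 define V where "V n = fam_val {..<m n} (\<tau> n) (%j. \<tau> n (Suc j)) (\<zeta> n)" for n
 define K where "K n = fam_int k {..<m n} (\<tau> n) (%j. \<tau> n (Suc j)) (\<zeta> n)" for n
 have Vm: "(%(s, om). V n s om) \<in> borel_measurable (restrict_space lborel {0..t} \<Otimes>\<^sub>M M)" for n
  unfolding V_def by (rule fam_val_measurable[OF sp t(2)])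
 have Fm: "(%(s, om). fam_val I a b \<xi> s om) \<in> borel_measurable (restrict_space lborel {0..t} \<Otimes>\<^sub>M M)"
  by (rule fam_val_measurable[OF fam t(2)])
 have bound: "msq M (%om. J om - fam_int k I a b \<xi> om) \<le>
  2 * msq M (%om. J om - K n om) + 2 * (2 * dsq t (%s om. f s om - fam_val I a b \<xi> s om) + 2 * dsq t (%s om. f s om - V n s om))" for n
 proof -
  define I' where "I' = {..<m n} <+> I"
  define a' where "a' = case_sum (\<tau> n) a"
  define b' where "b' = case_sum (%j. \<tau> n (Suc j)) b"
  define \<xi>' where "\<xi>' = case_sum (\<zeta> n) (%i om. - \<xi> i om)"
  have fam': "elem_family t I' a' b' \<xi>'"
   using fam sp[of n] unfolding elem_family_def I'_def a'_def b'_def \<xi>'_def by auto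
  have fin: "finite I" using fam unfolding elem_family_def by blast
  have v: "fam_val I' a' b' \<xi>' s om = V n s om - fam_val I a b \<xi> s om" for s om
   unfolding fam_val_def V_def I'_def a'_def b'_def \<xi>'_def sum.Plus[OF finite_lessThan fin]
   by (simp only: comp_def sum.case scaleR_minus_right sum_negf diff_conv_add_uminus)
  have i: "fam_int k I' a' b' \<xi>' om = K n om - fam_int k I a b \<xi> om" for om
   unfolding fam_int_def K_def I'_def a'_def b'_def \<xi>'_def using fin by (simp add: sum.Plus comp_def sum_negf)
  have m1: "K n \<in> borel_measurable M" unfolding K_def by (rule fam_int_measurable[OF sp t(2)])
  have m2: "fam_int k I a b \<xi> \<in> borel_measurable M" by (rule fam_int_measurable[OF fam t(2)])
  have zero: "fam_val I' a' b' \<xi>' s om = 0" if "s \<notin> {0..t}" for s om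
   unfolding fam_val_def using elem_familyD(1-3)[OF fam'] that by (intro sum.neutral ballI) (fastforce simp: indicator_def)
  have "msq M (%om. J om - fam_int k I a b \<xi> om) = msq M (%om. (J om - K n om) + fam_int k I' a' b' \<xi>' om)"
   unfolding i by simp
  also have "... <= 2 * msq M (%om. J om - K n om) + 2 * msq M (fam_int k I' a' b' \<xi>')"
   using J m1 fam_int_measurable[OF fam' t(2)] by (intro msq_add) auto
  finally have e1: "msq M (%om. J om - fam_int k I a b \<xi> om) <= 2 * msq M (%om. J om - K n om) + 2 * msq M (fam_int k I' a' b' \<xi>')" .
  have "msq M (fam_int k I' a' b' \<xi>') = (\<integral>\<^sup>+om. \<integral>\<^sup>+s. ennreal ((norm (fam_val I' a' b' \<xi>' s om))\<^sup>2) \<partial>lborel \<partial>M)"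
   by (rule family_isometry(2)[OF elem_family_mono[OF fam' t(2)]])
  also have "... = dsq t (%s om. fam_val I' a' b' \<xi>' s om)"
   unfolding dsq_def using zero by (intro nn_integral_cong) (auto simp: indicator_def)
  also have "... = dsq t (%s om. (f s om - fam_val I a b \<xi> s om) - (f s om - V n s om))"
   unfolding v by simp
  also have "... <= 2 * dsq t (%s om. f s om - fam_val I a b \<xi> s om) + 2 * dsq t (%s om. f s om - V n s om)"
   using f Vm[of n] Fm by (intro dsq_diff) (simp_all add: case_prod_beta)
  finally show ?thesis by (intro order_trans[OF e1] add_left_mono mult_left_mono) simp_all
 qed
 have "(%n. 2 * msq M (%om. J om - K n om) + 2 * (2 * dsq t (%s om. f s om - fam_val I a b \<xi> s om) + 2 * dsq t (%s om. f s om - V n s om)))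
  \<longlonglongrightarrow> 2 * 0 + 2 * (2 * dsq t (%s om. f s om - fam_val I a b \<xi> s om) + 2 * 0)"
  using l1[folded V_def] l2[folded K_def]
  by (intro tendsto_add ennreal_tendsto_cmult tendsto_const) auto
 then have "msq M (%om. J om - fam_int k I a b \<xi> om) <= 2 * 0 + 2 * (2 * dsq t (%s om. f s om - fam_val I a b \<xi> s om) + 2 * 0)"
  by (rule LIMSEQ_le_const) (use bound in auto)
 then show ?thesis by (simp add: mult.assoc[symmetric])
qed

text \<open>Each approximating step integral has mean zero and convergence in mean square carries over the mean.\<close>

lemma ito_mean_zero:
 assumes ito: "has_ito_integral M F (%s om. W s om $ k) f t J" and t: "0 <= t" "t <= T"
 shows "integrable M J" "expectation J = 0" "msq M J < \<infinity>"
proof -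
 obtain m \<tau> \<zeta> where J: "J \<in> borel_measurable M"
  and sp: "!!n::nat. elem_family t {..<m n} (\<tau> n) (%j::nat. \<tau> n (Suc j)) (\<zeta> n)"
  and l2: "(%n. msq M (%om. J om - fam_int k {..<m n} (\<tau> n) (%j. \<tau> n (Suc j)) (\<zeta> n) om)) \<longlonglongrightarrow> 0"
  by (rule has_ito_integralE[OF ito t]) (rule that, assumption+)
 define K where "K n = fam_int k {..<m n} (\<tau> n) (%j. \<tau> n (Suc j)) (\<zeta> n)" for n
 have Km: "K n \<in> borel_measurable M" for n unfolding K_def by (rule fam_int_measurable[OF sp t(2)])
 have K2: "msq M (K n) < \<infinity>" for n
  unfolding K_def msq_integral[OF family_isometry(1)[OF elem_family_mono[OF sp t(2)]]] by simp
 have ev: "\<forall>\<^sub>F n in sequentially. msq M (%om. J om - K n om) < e" if "0 < e" for e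
  using l2 that unfolding K_def by (rule order_tendstoD(2))
 obtain n where n: "msq M (%om. J om - K n om) < 1" using ev[of 1] by (auto simp: eventually_sequentially)
 have "msq M J = msq M (%om. (J om - K n om) + K n om)" by simp
 also have "... <= 2 * msq M (%om. J om - K n om) + 2 * msq M (K n)" using J Km by (intro msq_add) auto
 also have "... < \<infinity>"
 proof -
  have "msq M (%om. J om - K n om) < top" using n by (rule less_trans) simp
  then show ?thesis using K2[of n] by (simp add: ennreal_mult_less_top)
 qed
 finally show fin: "msq M J < \<infinity>" .
 show iJ: "integrable M J" by (rule msq_finite_integrable(2)[OF prob_space_axioms J fin])
 have iK: "integrable M (K n)" for n by (rule msq_finite_integrable(2)[OF prob_space_axioms Km K2])
 have EK: "expectation (K n) = 0" for n unfolding K_def by (rule fam_int_mean[OF elem_family_mono[OF sp t(2)]])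
 have "(norm (expectation J))\<^sup>2 <= e" if e: "0 < e" for e
 proof -
  obtain n where n: "msq M (%om. J om - K n om) < ennreal e" using ev[of "ennreal e"] e by (auto simp: eventually_sequentially)
  have m: "(%om. J om - K n om) \<in> borel_measurable M" using J Km[of n] by measurable
  have fin: "msq M (%om. J om - K n om) < \<infinity>" using n by (rule less_trans) simp
  note B = msq_finite_integrable[OF prob_space_axioms m fin]
  have "expectation J = expectation (%om. J om - K n om)" using iJ iK EK by simp
  then have "(norm (expectation J))\<^sup>2 <= expectation (%om. (norm (J om - K n om))\<^sup>2)" using B(4) by simp
  also have "... < e" using n e unfolding B(3) by (simp add: ennreal_less_iff)
  finally show ?thesis by simp
 qed
 then have "(norm (expectation J))\<^sup>2 <= 0" by (rule field_le_epsilon[of _ 0, simplified])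
 then show "expectation J = 0" by simp
qed

text \<open>Versions of the integral up to two different times are chosen independently of each other. Both are compared with the step
integrals that approximate the one over the shorter interval; extended by zero, their integrands differ from \<open>f\<close> on
the remaining interval by at most \<open>K\<close>.\<close>

lemma ito_increment_bound:
 assumes ito: "has_ito_integral M F (%s om. W s om $ k) f t J" "has_ito_integral M F (%s om. W s om $ k) f s J'"
  and st: "0 <= s" "s <= t" "t <= T"
  and K: "AE om in M. \<forall>u\<in>{0..T}. norm (f u om) <= K"
 shows "msq M (%om. J om - J' om) <= ennreal (8 * K\<^sup>2 * (t - s))"
proof -
 have t: "0 <= t" "t <= T" and s: "0 <= s" "s <= T" using st by auto
 obtain m \<tau> \<zeta> where f: "(%(u, om). f u om) \<in> borel_measurable (restrict_space lborel {0..s} \<Otimes>\<^sub>M M)"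
  and J': "J' \<in> borel_measurable M"
  and sp: "!!n::nat. elem_family s {..<m n} (\<tau> n) (%j::nat. \<tau> n (Suc j)) (\<zeta> n)"
  and l1: "(%n. dsq s (%u om. f u om - fam_val {..<m n} (\<tau> n) (%j. \<tau> n (Suc j)) (\<zeta> n) u om)) \<longlonglongrightarrow> 0"
  and l2: "(%n. msq M (%om. J' om - fam_int k {..<m n} (\<tau> n) (%j. \<tau> n (Suc j)) (\<zeta> n) om)) \<longlonglongrightarrow> 0"
  by (rule has_ito_integralE[OF ito(2) s]) (rule that, assumption+)
 have J: "J \<in> borel_measurable M" using ito(1) unfolding has_ito_integral_def by blast
 define V where "V n = fam_val {..<m n} (\<tau> n) (%j. \<tau> n (Suc j)) (\<zeta> n)" for n
 define G where "G n = fam_int k {..<m n} (\<tau> n) (%j. \<tau> n (Suc j)) (\<zeta> n)" for n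
 have Gm: "G n \<in> borel_measurable M" for n unfolding G_def by (rule fam_int_measurable[OF sp s(2)])
 have dt: "dsq t (%u om. f u om - V n u om) <= dsq s (%u om. f u om - V n u om) + ennreal (K\<^sup>2 * (t - s))" for n
 proof -
  interpret R: sigma_finite_measure "restrict_space lborel {0..s}" by (rule sigma_finite_interval)
  have g: "(%(u, om). f u om - V n u om) \<in> borel_measurable (restrict_space lborel {0..s} \<Otimes>\<^sub>M M)"
   using f fam_val_measurable[OF sp[of n] s(2), folded V_def, of s] by (simp add: case_prod_beta)
  have m1: "(%om. \<integral>\<^sup>+u\<in>{0..s}. ennreal ((norm (f u om - V n u om))\<^sup>2) \<partial>lborel) \<in> borel_measurable M"
   using measurable_pair_swap[OF g] R.borel_measurable_nn_integral[of "%om u. ennreal ((norm (f u om - V n u om))\<^sup>2)" M]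
   by (subst nn_integral_restrict_space[symmetric]) (auto simp: case_prod_beta)
  have "dsq t (%u om. f u om - V n u om) <= (\<integral>\<^sup>+om. (\<integral>\<^sup>+u\<in>{0..s}. ennreal ((norm (f u om - V n u om))\<^sup>2) \<partial>lborel) + ennreal (K\<^sup>2 * (t - s)) \<partial>M)"
   unfolding dsq_def
  proof (rule nn_integral_mono_AE, use K AE_space in eventually_elim)
   case (elim om)
   have m2: "(%u. ennreal ((norm (f u om - V n u om))\<^sup>2) * indicator {0..s} u) \<in> borel_measurable lborel"
   proof -
    have "(%u. f u om - V n u om) \<in> borel_measurable (restrict_space lborel {0..s})"
     using measurable_compose[OF measurable_Pair2'[OF elim(2)] g] by simp
    then have "(%u. ennreal ((norm (f u om - V n u om))\<^sup>2)) \<in> borel_measurable (restrict_space lborel {0..s})" by measurable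
    then show ?thesis by (subst (asm) borel_measurable_restrict_space_iff_ennreal) auto
   qed
   have "(\<integral>\<^sup>+u\<in>{0..t}. ennreal ((norm (f u om - V n u om))\<^sup>2) \<partial>lborel) \<le>
    (\<integral>\<^sup>+u. ennreal ((norm (f u om - V n u om))\<^sup>2) * indicator {0..s} u + ennreal (K\<^sup>2) * indicator {s<..t} u \<partial>lborel)"
   proof (rule nn_integral_mono)
    fix u
    have "V n u om = 0" if "s < u"
     unfolding V_def fam_val_def using elem_familyD(1-3)[OF sp[of n]] that by (intro sum.neutral ballI) (fastforce simp: indicator_def)
    moreover have "(norm (f u om))\<^sup>2 <= K\<^sup>2" if "u \<in> {0..t}" using elim(1) that t by (intro power_mono) auto
    ultimately show "ennreal ((norm (f u om - V n u om))\<^sup>2) * indicator {0..t} u <= ennreal ((norm (f u om - V n u om))\<^sup>2) * indicator {0..s} u + ennreal (K\<^sup>2) * indicator {s<..t} u"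
     using st by (cases "u <= s") (auto simp: indicator_def intro!: ennreal_leI)
   qed
   also have "... = (\<integral>\<^sup>+u\<in>{0..s}. ennreal ((norm (f u om - V n u om))\<^sup>2) \<partial>lborel) + ennreal (K\<^sup>2) * ennreal (t - s)"
    using m2 st by (subst nn_integral_add) (auto simp: nn_integral_cmult_indicator)
   finally show ?case using st by (simp add: ennreal_mult)
  qed
  also have "... = dsq s (%u om. f u om - V n u om) + ennreal (K\<^sup>2 * (t - s))"
   using m1 unfolding dsq_def by (subst nn_integral_add) (auto simp: emeasure_space_1)
  finally show ?thesis .
 qed
 have bound: "msq M (%om. J om - J' om) <= 2 * (4 * (dsq s (%u om. f u om - V n u om) + ennreal (K\<^sup>2 * (t - s)))) + 2 * msq M (%om. J' om - G n om)" for n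
 proof -
  have "msq M (%om. J om - J' om) = msq M (%om. (J om - G n om) - (J' om - G n om))" by simp
  also have "... <= 2 * msq M (%om. J om - G n om) + 2 * msq M (%om. J' om - G n om)"
   using J J' Gm[of n] by (intro msq_diff) auto
  finally have e1: "msq M (%om. J om - J' om) <= 2 * msq M (%om. J om - G n om) + 2 * msq M (%om. J' om - G n om)" .
  have e2: "msq M (%om. J om - G n om) <= 4 * dsq t (%u om. f u om - V n u om)"
   unfolding G_def V_def by (rule ito_family_distance[OF ito(1) t elem_family_mono[OF sp st(2)]])
  show ?thesis
   by (intro order_trans[OF e1] add_right_mono mult_left_mono order_trans[OF e2] dt) simp_all
 qed
 have "(%n. 2 * (4 * (dsq s (%u om. f u om - V n u om) + ennreal (K\<^sup>2 * (t - s)))) + 2 * msq M (%om. J' om - G n om))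
  \<longlonglongrightarrow> 2 * (4 * (0 + ennreal (K\<^sup>2 * (t - s)))) + 2 * 0"
  using l1[folded V_def] l2[folded G_def]
  by (intro tendsto_add ennreal_tendsto_cmult tendsto_const) auto
 then have "msq M (%om. J om - J' om) <= 2 * (4 * (0 + ennreal (K\<^sup>2 * (t - s)))) + 2 * 0"
  by (rule LIMSEQ_le_const) (use bound in auto)
 also have "... = ennreal (8 * K\<^sup>2 * (t - s))"
  using st by (simp add: ennreal_mult mult.assoc[symmetric])
 finally show ?thesis .
qed

end

section \<open>Independence of the augmented filtrations\<close>

text \<open>Independence of the whole paths gives independence of the generated sigma algebras; adding null sets does not
change it.\<close>

lemma indep_augmented:
 fixes W :: "nat => real => 'a => real^'r"
 assumes M: "prob_space M" and wiener: "!!i. wiener_process M T (W i)"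
  and indep: "prob_space.indep_vars M (%i. PiM {0..T} (%_. borel)) (%i om. \<lambda>t\<in>{0..T}. W i t om) UNIV"
 shows "prob_space.indep_sets M (%i. sets (aug_filtration M (W i) T)) UNIV"
proof -
 interpret prob_space M by fact
 have B: "brownian M T (W i)" for i
  using M wiener unfolding brownian_def brownian_axioms_def by blast
 define X where "X i om = (\<lambda>t\<in>{0..T}. W i t om)" for i om
 define \<A> where "\<A> i = sigma_sets (space M) {X i -` A \<inter> space M | A. A \<in> sets (PiM {0..T} (%_. borel))}" for i
 have ind: "indep_sets \<A> UNIV" using indep unfolding indep_vars_def \<A>_def X_def by blast
 interpret A: sigma_algebra "space M" "\<A> i" for i
  unfolding \<A>_def by (rule sigma_algebra_sigma_sets) auto
 have sub: "\<A> i \<subseteq> events" for i using ind unfolding indep_sets_def by blast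
 have "indep_sets (%i. \<A> i \<union> null_sets M) UNIV"
 proof (rule indep_setsI)
  show "\<A> i \<union> null_sets M \<subseteq> events" for i using sub by auto
  fix J and A :: "nat => 'a set"
  assume J: "J ~= {}" "J \<subseteq> UNIV" "finite J" and A: "\<forall>j\<in>J. A j \<in> \<A> j \<union> null_sets M"
  show "prob (\<Inter>j\<in>J. A j) = (\<Prod>j\<in>J. prob (A j))"
  proof (cases "\<exists>j\<in>J. A j \<in> null_sets M")
   case True
   then obtain j where j: "j \<in> J" "A j \<in> null_sets M" by blast
   have "A i \<in> events" if "i \<in> J" for i using A that sub[of i] by auto
   then have ev: "(\<Inter>i\<in>J. A i) \<in> events" using J by (intro sets.finite_INT) auto
   have "(\<Inter>i\<in>J. A i) \<in> null_sets M"
    by (rule null_sets_subset[OF j(2) ev]) (use j in auto)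
   then have "prob (\<Inter>j\<in>J. A j) = 0" "prob (A j) = 0" using j by (auto simp: measure_def null_setsD1)
   then show ?thesis using j J(3) by (metis prod_zero)
  next
   case False
   then show ?thesis using A J by (intro indep_setsD[OF ind]) auto
  qed
 qed
 moreover have "Int_stable (\<A> i \<union> null_sets M)" for i
  using sub[of i] by (auto simp: Int_stable_def intro: null_set_Int1 null_set_Int2)
 ultimately have "indep_sets (%i. sigma_sets (space M) (\<A> i \<union> null_sets M)) UNIV"
  by (rule indep_sets_sigma)
 moreover have "sets (aug_filtration M (W i) T) \<subseteq> sigma_sets (space M) (\<A> i \<union> null_sets M)" for i
  unfolding brownian.sets_F[OF B]
 proof (rule sigma_sets_mono')
  show "brownian.gens M (W i) T \<subseteq> \<A> i \<union> null_sets M"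
   unfolding brownian.gens_def[OF B]
  proof (safe, goal_cases)
   case (1 x s C)
   have "W i s -` C \<inter> space M = X i -` ((%w. w s) -` C \<inter> space (PiM {0..T} (%_. borel))) \<inter> space M"
    using 1 by (auto simp: X_def space_PiM)
   moreover have "(%w. w s) -` C \<inter> space (PiM {0..T} (%_. borel)) \<in> sets (PiM {0..T} (%_. borel))"
    using 1 by (intro measurable_sets[OF measurable_component_singleton]) auto
   ultimately show ?case unfolding \<A>_def by (intro sigma_sets.Basic) blast
  qed
 qed
 ultimately show ?thesis
  by (rule indep_sets_mono_sets)
qed

section \<open>The coefficients of the filtering equation\<close>

lemma bounded_bilinear_matrix_mult:
 "bounded_bilinear ((**) :: complex^'d^'d => complex^'d^'d => complex^'d^'d)"
proof -
 have "bilinear ((**) :: complex^'d^'d => complex^'d^'d => complex^'d^'d)"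
  unfolding bilinear_def
  by (auto intro!: linearI simp: vec_eq_iff matrix_matrix_mult_def algebra_simps sum.distrib scaleR_sum_right)
 then show ?thesis by (simp add: bilinear_conv_bounded_bilinear)
qed

lemma bounded_linear_ctranspose: "bounded_linear (ctranspose :: complex^'d^'d => complex^'d^'d)"
 by (intro linear_conv_bounded_linear[THEN iffD1] linearI) (auto simp: vec_eq_iff ctranspose_def)

lemma bounded_linear_trace_Re: "bounded_linear (%A :: complex^'d^'d. Re (trace A))"
 by (intro linear_conv_bounded_linear[THEN iffD1] linearI) (auto simp: trace_def sum.distrib scaleR_sum_right sum_distrib_left)

lemmas bl_mult_left = bounded_bilinear.bounded_linear_left[OF bounded_bilinear_matrix_mult]
lemmas bl_mult_right = bounded_bilinear.bounded_linear_right[OF bounded_bilinear_matrix_mult]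

lemma bounded_bilinear_bform: "bounded_bilinear (bform :: complex^'d^'d => complex^'d^'d => real)"
proof -
 note ct = bounded_linear.linear[OF bounded_linear_ctranspose]
 note tr = bounded_linear.linear[OF bounded_linear_trace_Re]
 have "bilinear (bform :: complex^'d^'d => complex^'d^'d => real)"
  unfolding bilinear_def bform_def
  by (auto intro!: linearI simp: linear_add[OF ct] linear_scale[OF ct] linear_add[OF tr] linear_scale[OF tr] distrib_left
    bounded_bilinear.add_left[OF bounded_bilinear_matrix_mult] bounded_bilinear.add_right[OF bounded_bilinear_matrix_mult]
    bounded_bilinear.scaleR_left[OF bounded_bilinear_matrix_mult] bounded_bilinear.scaleR_right[OF bounded_bilinear_matrix_mult])
 then show ?thesis by (simp add: bilinear_conv_bounded_bilinear)
qed

lemma bounded_linear_bvec: "bounded_linear (bvec Ls :: complex^'d^'d => real^'r::finite)"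
proof -
 have "bounded_linear (bform (Ls k))" for k
  by (rule bounded_bilinear.bounded_linear_right[OF bounded_bilinear_bform])
 then have "linear (bform (Ls k))" for k by (rule bounded_linear.linear)
 then show ?thesis
  by (intro linear_conv_bounded_linear[THEN iffD1] linearI)
   (auto simp: vec_eq_iff bvec_def linear_add linear_cmul)
qed

lemma bounded_linear_lindblad: "bounded_linear (lindblad H (Ls :: 'r::finite => complex^'d^'d))"
proof -
 have l: "bounded_linear (%A. B ** A ** C)" for B C :: "complex^'d^'d"
  by (rule bounded_linear_compose[OF bl_mult_left bl_mult_right])
 show ?thesis
  unfolding lindblad_def[abs_def] commutator_def anticommutator_def
  by (intro bounded_linear_add bounded_linear_sum bounded_linear_sub l
    bounded_linear_compose[OF bl_mult_right] bounded_linear_compose[OF bounded_linear_scaleR_right] bl_mult_left bl_mult_right)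
qed

lemma norm_vec_le_sum: "norm (x :: 'b::real_normed_vector^'n) <= (\<Sum>i\<in>UNIV. norm (x $ i))"
 unfolding norm_vec_def by (rule L2_set_le_sum) simp

text \<open>The diagonal entries are nonnegative with sum one, and positivity on vectors with two nonzero coordinates bounds the
off-diagonal entries.\<close>

lemma density_matrix_entry:
 assumes A: "density_matrix (A :: complex^'d^'d)"
 shows "norm (A $ i $ j) <= 1"
proof -
 have sa: "cnj (A $ j $ i) = A $ i $ j" for i j
 proof -
  have "ctranspose A $ i $ j = A $ i $ j" using A unfolding density_matrix_def self_adjoint_def by simp
  then show ?thesis by (simp add: ctranspose_def)
 qed
 have pos: "0 <= Re (\<Sum>i\<in>UNIV. cnj (v $ i) * (A *v v) $ i)" for v
  using A unfolding density_matrix_def by blast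
 have tr: "(\<Sum>i\<in>UNIV. Re (A $ i $ i)) = 1"
 proof -
  have "trace A = 1" using A unfolding density_matrix_def by blast
  from arg_cong[OF this, of Re] show ?thesis by (simp add: trace_def)
 qed
 have cancel: "(\<Sum>l\<in>UNIV. g l * (if l = i then a else 0)) = g i * a"
  "(\<Sum>l\<in>UNIV. (if l = i then a else 0) * g l) = a * g i" for g :: "'d => complex" and i a
  by (simp_all add: if_distrib if_distribR cong: if_cong)
 have q2: "0 <= Re (cnj a * a * A $ i $ i + cnj b * b * A $ j $ j + cnj a * b * A $ i $ j + cnj b * a * A $ j $ i)" for i j a b
 proof -
  define v :: "complex^'d" where "v = (\<chi> l. (if l = i then a else 0) + (if l = j then b else 0))"
  have Av: "(A *v v) $ k = A $ k $ i * a + A $ k $ j * b" for k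
   unfolding v_def matrix_vector_mult_def by (simp add: distrib_left sum.distrib cancel)
  have cv: "cnj (v $ k) = (if k = i then cnj a else 0) + (if k = j then cnj b else 0)" for k
   unfolding v_def by simp
  have "(\<Sum>k\<in>UNIV. cnj (v $ k) * (A *v v) $ k) = cnj a * (A $ i $ i * a + A $ i $ j * b) + cnj b * (A $ j $ i * a + A $ j $ j * b)"
   unfolding Av cv by (simp only: distrib_right sum.distrib cancel)
  then show ?thesis using pos[of v] by (simp add: algebra_simps)
 qed
 have diag: "0 <= Re (A $ i $ i)" for i
  using q2[of 1 i 0 i] by simp
 have diag1: "Re (A $ i $ i) <= 1" for i
  unfolding tr[symmetric] by (rule member_le_sum) (auto simp: diag)
 show ?thesis
 proof (cases "A $ i $ j = 0")
  case False
  define b where "b = - cnj (sgn (A $ i $ j))"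
  have "norm b = 1" using False by (simp add: b_def norm_sgn)
  then have b1: "cnj b * b = 1" using complex_norm_square[of b] by (simp add: mult.commute)
  have "b * A $ i $ j = - (A $ i $ j * cnj (A $ i $ j)) / of_real (norm (A $ i $ j))"
   by (simp add: b_def sgn_div_norm scaleR_conv_of_real divide_inverse)
  then have b2: "b * A $ i $ j = - of_real (norm (A $ i $ j))"
   using False unfolding complex_norm_square[symmetric] by (simp add: power2_eq_square)
  then have b3: "cnj b * A $ j $ i = - of_real (norm (A $ i $ j))"
  proof -
   have "cnj (b * A $ i $ j) = - of_real (norm (A $ i $ j))" unfolding b2 by simp
   then show ?thesis unfolding complex_cnj_mult sa .
  qed
  have "0 <= Re (A $ i $ i + A $ j $ j + b * A $ i $ j + cnj b * A $ j $ i)"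
   using q2[of 1 i b j] b1 by simp
  then have "2 * norm (A $ i $ j) <= Re (A $ i $ i) + Re (A $ j $ j)"
   unfolding b2 b3 by simp
  then show ?thesis using diag1[of i] diag1[of j] by simp
 qed simp
qed

text \<open>The a priori bound that makes all coefficients bounded along the solution.\<close>

lemma density_matrix_norm:
 assumes A: "density_matrix (A :: complex^'d^'d)"
 shows "norm A <= (real CARD('d))\<^sup>2"
proof -
 have "norm A <= (\<Sum>i\<in>UNIV. norm (A $ i))" by (rule norm_vec_le_sum)
 also have "... <= (\<Sum>i\<in>(UNIV::'d set). \<Sum>j\<in>(UNIV::'d set). 1)"
  by (intro sum_mono order_trans[OF norm_vec_le_sum] density_matrix_entry A)
 finally show ?thesis by (simp add: power2_eq_square)
qed

text \<open>Projection onto the closed ball. Composing a coefficient with it changes nothing along a bounded solution and makes a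
quadratic coefficient bounded and globally Lipschitz, as the Euler scheme needs.\<close>

definition truncate :: "real => 'v::euclidean_space => 'v" where
 "truncate R = closest_point (cball 0 R)"

lemma truncate:
 assumes "0 <= R"
 shows "norm (truncate R x) <= R" "norm x <= R ==> truncate R x = x"
  "norm (truncate R x - truncate R y) <= norm (x - y)"
proof -
 show "norm (truncate R x) <= R"
  using closest_point_in_set[of "cball 0 R" x] assms unfolding truncate_def by simp
 show "norm x <= R ==> truncate R x = x"
  unfolding truncate_def by (rule closest_point_self) simp
 show "norm (truncate R x - truncate R y) <= norm (x - y)"
  using closest_point_lipschitz[of "cball 0 R" x y] assms unfolding truncate_def by (simp add: dist_norm)
qed

lemma quadratic_truncate_lipschitz:
 fixes l :: "'v::euclidean_space => 'v" and \<phi> :: "'v => real"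
 assumes l: "bounded_linear l" and \<phi>: "bounded_linear \<phi>" and R: "0 <= R"
 defines "q \<equiv> %x. l x - \<phi> x *\<^sub>R x"
 shows "\<exists>K. \<forall>x y. norm (q (truncate R x) - q (truncate R y)) <= K * norm (x - y) \<and> norm (q (truncate R x)) <= K"
proof -
 obtain K1 where K1: "0 <= K1" "!!x. norm (l x) <= norm x * K1" using bounded_linear.nonneg_bounded[OF l] by blast
 obtain K2 where K2: "0 <= K2" "!!x. norm (\<phi> x) <= norm x * K2" using bounded_linear.nonneg_bounded[OF \<phi>] by blast
 define K where "K = (K1 + 2 * K2 * R) + (R * K1 + R * K2 * R)"
 have "norm (q (truncate R x) - q (truncate R y)) <= K * norm (x - y) \<and> norm (q (truncate R x)) <= K" for x y
 proof
  let ?x = "truncate R x" and ?y = "truncate R y"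
  note tr = truncate[OF R]
  have "q ?x - q ?y = l (?x - ?y) - \<phi> (?x - ?y) *\<^sub>R ?x - \<phi> ?y *\<^sub>R (?x - ?y)"
   unfolding q_def using bounded_linear.linear[OF l] bounded_linear.linear[OF \<phi>] by (simp add: linear_diff algebra_simps)
  also have "norm ... <= norm (l (?x - ?y)) + norm (\<phi> (?x - ?y) *\<^sub>R ?x) + norm (\<phi> ?y *\<^sub>R (?x - ?y))"
   by (intro order_trans[OF norm_triangle_ineq4] add_mono order_refl)
  also have "... <= norm (?x - ?y) * K1 + (norm (?x - ?y) * K2) * R + (R * K2) * norm (?x - ?y)"
  proof (intro add_mono)
   show "norm (\<phi> (?x - ?y) *\<^sub>R ?x) <= (norm (?x - ?y) * K2) * R"
    unfolding norm_scaleR real_norm_def[symmetric] using K2 tr(1)[of x] by (intro mult_mono) auto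
   have "norm (\<phi> ?y) <= R * K2" using K2 tr(1)[of y] by (intro order_trans[OF K2(2)] mult_right_mono)
   then show "norm (\<phi> ?y *\<^sub>R (?x - ?y)) <= (R * K2) * norm (?x - ?y)"
    unfolding norm_scaleR real_norm_def[symmetric] by (rule mult_right_mono) simp
  qed (rule K1(2))
  also have "... = (K1 + 2 * K2 * R) * norm (?x - ?y)" by (simp add: algebra_simps)
  also have "... <= K * norm (x - y)"
   using tr(3)[of x y] K1(1) K2(1) R unfolding K_def by (intro mult_mono) auto
  finally show "norm (q ?x - q ?y) <= K * norm (x - y)" .
  have "norm (q ?x) <= norm (l ?x) + norm (\<phi> ?x) * norm ?x"
   unfolding q_def using norm_triangle_ineq4[of "l ?x" "\<phi> ?x *\<^sub>R ?x"] by simp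
  also have "... <= R * K1 + (R * K2) * R"
   using K1 K2 tr(1)[of x] R
   by (intro add_mono mult_mono order_trans[OF K1(2)] order_trans[OF K2(2)] mult_right_mono) auto
  also have "... <= K" unfolding K_def using K1(1) K2(1) R by simp
  finally show "norm (q ?x) <= K" .
 qed
 then show ?thesis by blast
qed

lemma diffusion_coeff_truncate_lipschitz:
 fixes B :: "complex^'d^'d"
 assumes R: "0 <= R"
 shows "\<exists>K. \<forall>x y. norm (diffusion_coeff B (truncate R x) - diffusion_coeff B (truncate R y)) <= K * norm (x - y)
  \<and> norm (diffusion_coeff B (truncate R x)) <= K"
proof -
 have "bounded_linear (%A. B ** A + A ** ctranspose B)"
  by (intro bounded_linear_add bl_mult_left bl_mult_right)
 from quadratic_truncate_lipschitz[OF this bounded_bilinear.bounded_linear_right[OF bounded_bilinear_bform] R, of B]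
 show ?thesis unfolding diffusion_coeff_def .
qed

lemma linear_truncate_lipschitz:
 fixes l :: "'v::euclidean_space => 'w::real_normed_vector"
 assumes l: "bounded_linear l" and R: "0 <= R"
 shows "\<exists>K. \<forall>x y. norm (l (truncate R x) - l (truncate R y)) <= K * norm (x - y) \<and> norm (l (truncate R x)) <= K"
proof -
 obtain K1 where K1: "0 <= K1" "!!x. norm (l x) <= norm x * K1" using bounded_linear.nonneg_bounded[OF l] by blast
 have "norm (l (truncate R x) - l (truncate R y)) <= (K1 + R * K1) * norm (x - y) \<and> norm (l (truncate R x)) <= K1 + R * K1" for x y
 proof
  have "norm (l (truncate R x) - l (truncate R y)) <= norm (truncate R x - truncate R y) * K1"
   using K1(2)[of "truncate R x - truncate R y"] bounded_linear.linear[OF l] by (simp add: linear_diff)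
  also have "... <= norm (x - y) * (K1 + R * K1)"
   using truncate(3)[OF R] K1(1) R by (intro mult_mono) auto
  finally show "norm (l (truncate R x) - l (truncate R y)) <= (K1 + R * K1) * norm (x - y)" by (simp add: mult.commute)
  have "norm (l (truncate R x)) <= R * K1"
   using truncate(1)[OF R, of x] K1(1) by (intro order_trans[OF K1(2)] mult_right_mono)
  then show "norm (l (truncate R x)) <= K1 + R * K1" using K1(1) by simp
 qed
 then show ?thesis by blast
qed

lemma norm_integral_sq_le:
 fixes g :: "'b => 'v::euclidean_space"
 assumes N: "finite_measure N" and g: "integrable N g" "integrable N (%x. (norm (g x))\<^sup>2)"
 shows "(norm (LINT x|N. g x))\<^sup>2 <= measure N (space N) * (LINT x|N. (norm (g x))\<^sup>2)"
proof -
 interpret finite_measure N by fact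
 define L where "L = measure N (space N)"
 define S where "S = (LINT x|N. norm (g x))"
 have ng: "integrable N (%x. norm (g x))" using g by simp
 have "S\<^sup>2 <= L * (LINT x|N. (norm (g x))\<^sup>2)"
 proof (cases "L = 0")
  case True
  then have "emeasure N (space N) = 0" unfolding L_def by (simp add: emeasure_eq_measure)
  then have "AE x in N. norm (g x) = 0" by (intro AE_I[of _ _ "space N"]) auto
  then have "S = (LINT x|N. 0)" unfolding S_def using ng by (intro integral_cong_AE) auto
  then show ?thesis using True by simp
 next
  case False
  then have L: "0 < L" unfolding L_def by (simp add: zero_less_measure_iff)
  have "0 <= (LINT x|N. (norm (g x) - S / L)\<^sup>2)" by simp
  also have "... = (LINT x|N. (norm (g x))\<^sup>2 - 2 * (S / L) * norm (g x) + (S / L)\<^sup>2)"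
   by (intro Bochner_Integration.integral_cong) (auto simp: power2_diff algebra_simps)
  also have "... = (LINT x|N. (norm (g x))\<^sup>2) - 2 * (S / L) * S + (S / L)\<^sup>2 * L"
   using g ng by (simp add: L_def S_def)
  also have "... = (LINT x|N. (norm (g x))\<^sup>2) - S\<^sup>2 / L"
   using L by (simp add: power2_eq_square)
  finally show ?thesis using L by (simp add: field_simps)
 qed
 moreover have "(norm (LINT x|N. g x))\<^sup>2 <= S\<^sup>2"
  unfolding S_def by (intro power_mono integral_norm_bound) auto
 ultimately show ?thesis unfolding L_def by simp
qed

section \<open>Time integrals of random processes\<close>

abbreviation leb :: "real => real measure" where "leb u \<equiv> restrict_space lborel {0..u}"

lemma space_leb[simp]: "space (leb u) = {0..u}"
 by (simp add: space_restrict_space)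

lemma set_integral_leb: "(LINT s:{0..u}|lborel. f s) = (LINT s|leb u. (f s :: 'v::euclidean_space))"
 unfolding set_lebesgue_integral_def by (subst integral_restrict_space) auto

lemma finite_leb: "finite_measure (leb u)"
 by (rule finite_measureI) (simp add: emeasure_restrict_space, cases "0 <= u", simp_all)

lemma measure_leb: "0 <= u ==> measure (leb u) {0..u} = u"
 by (simp add: measure_restrict_space)

lemma leb_integrable_bounded:
 fixes g :: "real => 'v::euclidean_space"
 assumes "g \<in> borel_measurable (leb u)" "!!s. s \<in> {0..u} ==> norm (g s) <= K"
 shows "integrable (leb u) g"
 by (rule finite_measure.integrable_const_bound[OF finite_leb, of _ K]) (use assms in \<open>auto intro!: AE_I2\<close>)

lemma leb_continuous_measurable:
 fixes g :: "real => 'v::euclidean_space"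
 assumes "continuous_on {0..u} g"
 shows "g \<in> borel_measurable (leb u)"
 using borel_measurable_continuous_on_restrict[OF assms]
 by (subst measurable_cong_sets[OF sets_restrict_space_cong refl, of lborel borel]) simp_all

lemma continuous_bounded_interval:
 fixes g :: "real => 'v::euclidean_space"
 assumes "continuous_on {0..u} g"
 obtains K where "!!s. s \<in> {0..u} ==> norm (g s) <= K"
 using compact_imp_bounded[OF compact_continuous_image[OF assms compact_Icc]] unfolding bounded_iff by blast

lemma leb_continuous_integrable:
 fixes f :: "real => 'v::euclidean_space"
 assumes f: "continuous_on {0..u} f" shows "integrable (leb u) f"
proof -
 obtain K where "!!s. s \<in> {0..u} ==> norm (f s) <= K" using continuous_bounded_interval[OF f] by blast
 then show ?thesis by (rule leb_integrable_bounded[OF leb_continuous_measurable[OF f]])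
qed

lemma set_integral_point: "(LINT s:{a..a}|lborel. f s) = (0::'v::euclidean_space)" for a :: real
 unfolding set_lebesgue_integral_def
 by (rule integral_eq_zero_AE) (use AE_lborel_singleton[of a] in \<open>eventually_elim, auto simp: indicator_def\<close>)

text \<open>The integral over the cell from \<open>s\<close> to \<open>t\<close> is expressed as a difference of two integrals from \<open>0\<close>, the form in which records and
their drifts appear.\<close>

lemma set_integral_increment:
 fixes g :: "real => 'v::euclidean_space"
 assumes g: "continuous_on {0..t} g" and st: "0 <= s" "s <= t" and K: "!!u. s <= u ==> u <= t ==> norm (g u - c) <= K"
 shows "norm ((LINT u:{0..t}|lborel. g u) - (LINT u:{0..s}|lborel. g u) - (t - s) *\<^sub>R c) <= K * (t - s)"
proof -
 have i: "set_integrable lborel {0..t} g" by (rule borel_integrable_atLeastAtMost'[OF g])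
 have i1: "set_integrable lborel {0..s} g" "set_integrable lborel {s<..t} g"
  using st by (auto intro!: set_integrable_subset[OF i])
 have "{0..t} = {0..s} \<union> {s<..t}" "{0..s} \<inter> {s<..t} = {}" using st by auto
 then have split: "(LINT u:{0..t}|lborel. g u) = (LINT u:{0..s}|lborel. g u) + (LINT u:{s<..t}|lborel. g u)"
  using set_integral_Un[OF _ i1] by simp
 have ig: "integrable lborel (%u. indicator {s<..t} u *\<^sub>R g u)" using i1(2) unfolding set_integrable_def .
 have hi: "has_bochner_integral lborel (indicat_real {s<..t}) (t - s)" using has_bochner_integral_Ioc[of s t] st by simp
 then have ic: "has_bochner_integral lborel (%u. indicator {s<..t} u *\<^sub>R c) ((t - s) *\<^sub>R c)"
  by (rule has_bochner_integral_scaleR_left[rotated])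
 have "(LINT u:{0..t}|lborel. g u) - (LINT u:{0..s}|lborel. g u) - (t - s) *\<^sub>R c = (LINT u|lborel. indicator {s<..t} u *\<^sub>R g u - indicator {s<..t} u *\<^sub>R c)"
  unfolding split using ig ic by (simp add: set_lebesgue_integral_def has_bochner_integral_iff)
 also have "norm ... <= (LINT u|lborel. indicator {s<..t} u * K)"
 proof (rule integral_norm_le)
  show "integrable lborel (%u. indicator {s<..t} u *\<^sub>R g u - indicator {s<..t} u *\<^sub>R c)" using ig ic by (auto simp: has_bochner_integral_iff)
  show "integrable lborel (%u. indicator {s<..t} u * K)" using hi by (auto simp: has_bochner_integral_iff)
  show "norm (indicator {s<..t} u *\<^sub>R g u - indicator {s<..t} u *\<^sub>R c) <= indicator {s<..t} u * K" for u
   using K[of u] st by (auto simp: indicator_def)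
 qed
 also have "... = K * (t - s)" using hi by (simp add: has_bochner_integral_iff)
 finally show ?thesis .
qed

text \<open>Iterating the integral equation \<open>n\<close> times gives the Taylor polynomial of the exponential series, with a remainder of
order $(Kt)^n/n!$.\<close>

lemma linear_ode_series:
 fixes a :: "'v::euclidean_space => 'v" and m :: "real => 'v"
 assumes a: "bounded_linear a" and m: "m \<in> borel_measurable (leb T)"
  and R: "!!t. t \<in> {0..T} ==> norm (m t) <= R"
  and eq: "!!t. t \<in> {0..T} ==> m t = x0 + (LINT s:{0..t}|lborel. a (m s))"
  and t: "t \<in> {0..T}"
 shows "(%n. (t ^ n / fact n) *\<^sub>R (a ^^ n) x0) sums m t"
proof -
 obtain K where K: "0 <= K" "!!x. norm (a x) <= norm x * K" using bounded_linear.nonneg_bounded[OF a] by blast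
 note lin = bounded_linear.linear[OF a]
 define S where "S n s = (\<Sum>k<n. (s ^ k / fact k) *\<^sub>R (a ^^ k) x0)" for n s
 have Sc: "continuous_on A (S n)" for A n unfolding S_def by (auto intro!: continuous_intros)
 have ac: "continuous_on UNIV a" by (rule linear_continuous_on[OF a])
 have am[measurable]: "a \<in> borel_measurable borel" by (rule borel_measurable_continuous_onI[OF ac])
 have mt: "m \<in> borel_measurable (leb t)" if "t \<in> {0..T}" for t
  using m that by (intro measurable_restrict_mono[OF m]) auto
 have R0: "0 <= R" using R[OF t] norm_ge_zero order_trans by blast
 have rem: "norm (m t - S n t) <= R * (K * t) ^ n / fact n" if "t \<in> {0..T}" for n t
  using that
 proof (induction n arbitrary: t)
  case 0 then show ?case using R by (simp add: S_def)
 next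
  case (Suc n)
  have i1: "integrable (leb t) (%s. a (m s))"
  proof (rule leb_integrable_bounded[where K="R * K"])
   show "(%s. a (m s)) \<in> borel_measurable (leb t)" using mt[OF Suc.prems] by measurable
   show "norm (a (m s)) <= R * K" if "s \<in> {0..t}" for s
    using K(1) R[of s] that Suc.prems by (intro order_trans[OF K(2)] mult_right_mono) auto
  qed
  obtain K' where K': "!!s. s \<in> {0..t} ==> norm (a (S n s)) <= K'"
   using continuous_bounded_interval[of t "%s. a (S n s)"] continuous_on_compose2[OF ac Sc] by auto
  have i2: "integrable (leb t) (%s. a (S n s))"
   by (rule leb_integrable_bounded[OF leb_continuous_measurable K'])
    (auto intro: continuous_on_compose2[OF ac Sc])
  have pw: "has_bochner_integral (leb t) (%s. s ^ k) (t ^ Suc k / real (Suc k))" for k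
  proof -
   have "(LINT s|leb t. s ^ k) = t ^ Suc k / real (Suc k)"
    using integral_power[of 0 t k] Suc.prems by (subst integral_restrict_space) (auto simp: mult.commute)
   moreover have "integrable (leb t) (%s. s ^ k)"
    by (rule leb_integrable_bounded[OF leb_continuous_measurable, where K="\<bar>t\<bar> ^ k"]) (auto intro!: continuous_intros power_mono simp: power_abs)
   ultimately show ?thesis by (simp add: has_bochner_integral_iff)
  qed
  have "has_bochner_integral (leb t) (%s. \<Sum>k<n. s ^ k *\<^sub>R ((1 / fact k) *\<^sub>R (a ^^ Suc k) x0)) (\<Sum>k<n. (t ^ Suc k / real (Suc k)) *\<^sub>R ((1 / fact k) *\<^sub>R (a ^^ Suc k) x0))"
   by (intro has_bochner_integral_sum has_bochner_integral_scaleR_left pw)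
  moreover have "(\<Sum>k<n. s ^ k *\<^sub>R ((1 / fact k) *\<^sub>R (a ^^ Suc k) x0)) = a (S n s)" for s
   unfolding S_def by (simp add: linear_sum[OF lin] linear_cmul[OF lin])
  moreover have "(\<Sum>k<n. (t ^ Suc k / real (Suc k)) *\<^sub>R ((1 / fact k) *\<^sub>R (a ^^ Suc k) x0)) = S (Suc n) t - x0"
   unfolding S_def sum.lessThan_Suc_shift by (simp add: mult.commute)
  ultimately have Sint: "(LINT s|leb t. a (S n s)) = S (Suc n) t - x0"
   by (simp add: has_bochner_integral_iff)
  have "m t - S (Suc n) t = (LINT s|leb t. a (m s)) - (LINT s|leb t. a (S n s))"
   unfolding Sint using eq[OF Suc.prems] by (simp add: set_integral_leb)
  also have "... = (LINT s|leb t. a (m s - S n s))"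
   using i1 i2 by (simp add: linear_diff[OF lin])
  also have "norm ... <= (LINT s|leb t. s ^ n * (R * K ^ Suc n / fact n))"
  proof (rule integral_norm_le)
   show "integrable (leb t) (%s. a (m s - S n s))" using i1 i2 by (simp add: linear_diff[OF lin])
   show "integrable (leb t) (%s. s ^ n * (R * K ^ Suc n / fact n))" using pw[of n] by (simp add: has_bochner_integral_iff)
   fix s assume "s \<in> space (leb t)"
   then have s: "s \<in> {0..T}" using Suc.prems by auto
   have "norm (a (m s - S n s)) <= norm (m s - S n s) * K" by (rule K(2))
   also have "... <= (R * (K * s) ^ n / fact n) * K" by (intro mult_right_mono Suc.IH s K(1))
   finally show "norm (a (m s - S n s)) <= s ^ n * (R * K ^ Suc n / fact n)"
    by (simp add: power_mult_distrib mult_ac)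
  qed
  also have "... = t ^ Suc n / real (Suc n) * (R * K ^ Suc n / fact n)"
   using pw[of n] by (simp add: has_bochner_integral_iff del: power_Suc of_nat_Suc)
  also have "... = R * (K * t) ^ Suc n / fact (Suc n)"
   by (simp add: power_mult_distrib field_simps)
  finally show ?case .
 qed
 have "(%n. R * (inverse (fact n) * (K * t) ^ n)) \<longlonglongrightarrow> R * 0"
  by (intro tendsto_mult tendsto_const summable_LIMSEQ_zero summable_exp)
 then have "(%n. R * (K * t) ^ n / fact n) \<longlonglongrightarrow> 0"
  by (simp add: divide_inverse mult_ac)
 moreover have "\<forall>\<^sub>F n in sequentially. norm (S n t - m t) <= R * (K * t) ^ n / fact n"
  using rem[OF t] by (simp add: norm_minus_commute)
 ultimately have "(%n. S n t - m t) \<longlonglongrightarrow> 0" by (rule Lim_null_comparison[rotated])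
 then have "(%n. S n t) \<longlonglongrightarrow> m t" by (rule LIM_zero_cancel)
 then show ?thesis unfolding sums_def S_def .
qed

lemma sigma_finite_leb: "sigma_finite_measure (leb u)"
 by (intro sigma_finite_measure_restrict_space sigma_finite_lborel) auto

text \<open>Approximations that are frozen at the left end points of equidistant cells are jointly measurable and converge by
continuity of the paths.\<close>

lemma continuous_process_measurable:
 fixes X :: "real => 'a => 'v::euclidean_space" and M :: "'a measure"
 assumes X: "!!t. t \<in> {0..u} ==> X t \<in> borel_measurable M"
  and c: "!!om. om \<in> space M ==> continuous_on {0..u} (%t. X t om)" and u: "0 <= u"
 shows "(%(s, om). X s om) \<in> borel_measurable (leb u \<Otimes>\<^sub>M M)"
proof (rule borel_measurable_LIMSEQ_metric)
 define g where "g n j = real j * u / real (Suc n)" for n j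
 define Z where "Z n = (%(s, om). (\<Sum>j<Suc n. indicator {g n j..<g n (Suc j)} s *\<^sub>R X (g n j) om) + indicator {u} s *\<^sub>R X u om)" for n
 have gu: "g n j \<in> {0..u}" if "j < Suc n" for n j
 proof -
  have "real j * u <= real (Suc n) * u" using that u by (intro mult_right_mono) auto
  then show ?thesis using u unfolding g_def by (auto simp: field_simps)
 qed
 show "Z n \<in> borel_measurable (leb u \<Otimes>\<^sub>M M)" for n
 proof -
  have [measurable]: "indicat_real A \<in> borel_measurable (leb u)" if "A \<in> sets borel" for A
   using that by (intro measurable_restrict_space1) simp
  have [measurable]: "X u \<in> borel_measurable M" using X u by simp
  have [measurable]: "j \<in> {..<Suc n} ==> X (g n j) \<in> borel_measurable M" for j using X gu[of j n] by simp
  show ?thesis unfolding Z_def case_prod_beta by measurable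
 qed
 fix x assume "x \<in> space (leb u \<Otimes>\<^sub>M M)"
 then obtain s om where x: "x = (s, om)" "s \<in> {0..u}" "om \<in> space M" by (auto simp: space_pair_measure)
 show "(%n. Z n x) \<longlonglongrightarrow> (%(s, om). X s om) x"
 proof (cases "s = u")
  case True
  have "Z n x = X u om" for n
  proof -
   have "indicator {g n j..<g n (Suc j)} u = (0::real)" if "j < Suc n" for j
   proof -
    have "real (Suc j) * u <= real (Suc n) * u" using that u by (intro mult_right_mono) auto
    then have "g n (Suc j) <= u" unfolding g_def by (simp add: field_simps)
    then show ?thesis by simp
   qed
   then have "(\<Sum>j<Suc n. indicator {g n j..<g n (Suc j)} u *\<^sub>R X (g n j) om) = 0"
    by (intro sum.neutral) auto
   then show ?thesis unfolding Z_def x True by simp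
  qed
  then show ?thesis by (simp add: x True)
 next
  case False
  then have su: "0 <= s" "s < u" using x by auto
  define j where "j n = nat \<lfloor>real (Suc n) * s / u\<rfloor>" for n
  have j1: "real (j n) <= real (Suc n) * s / u" "real (Suc n) * s / u < real (j n) + 1" for n
   unfolding j_def using su by (auto simp: of_nat_nat)
  have jn: "g n (j n) <= s" "s < g n (Suc (j n))" for n
   using j1[of n] su unfolding g_def by (auto simp: field_simps)
  have jl: "j n < Suc n" for n
  proof -
   have "real (Suc n) * s < real (Suc n) * u" using su by (intro mult_strict_left_mono) auto
   then have "real (Suc n) * s / u < real (Suc n)" using su by (simp add: pos_divide_less_eq)
   then have "real (j n) < real (Suc n)" using j1(1)[of n] by linarith
   then show ?thesis by simp
  qed
  have mono: "g n i <= g n k" if "i <= k" for n i k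
   unfolding g_def using that u by (intro divide_right_mono mult_right_mono) auto
  have Zx: "Z n x = X (g n (j n)) om" for n
  proof -
   have "indicator {g n i..<g n (Suc i)} s = (if i = j n then 1 else (0::real))" for i
   proof (cases "i = j n")
    case True then show ?thesis using jn[of n] by simp
   next
    case F: False
    show ?thesis
    proof (cases "i < j n")
     case True
     then have "g n (Suc i) <= g n (j n)" by (intro mono) simp
     then show ?thesis using jn(1)[of n] F by simp
    next
     case False
     then have "g n (Suc (j n)) <= g n i" using F by (intro mono) simp
     then show ?thesis using jn(2)[of n] F by simp
    qed
   qed
   then have "(\<Sum>i<Suc n. indicator {g n i..<g n (Suc i)} s *\<^sub>R X (g n i) om) = (\<Sum>i<Suc n. if i = j n then X (g n i) om else 0)"
    by (intro sum.cong) auto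
   also have "... = X (g n (j n)) om" using jl[of n] by simp
   finally show ?thesis unfolding Z_def x using su by simp
  qed
  have "(%n. g n (j n)) \<longlonglongrightarrow> s"
  proof (rule tendsto_sandwich)
   show "\<forall>\<^sub>F n in sequentially. s - u / real (Suc n) <= g n (j n)"
   proof (intro always_eventually allI)
    fix n
    have "g n (Suc (j n)) = g n (j n) + u / real (Suc n)"
     unfolding g_def by (simp only: of_nat_Suc[of "j n"] distrib_right add_divide_distrib mult_1 add.commute)
    then show "s - u / real (Suc n) <= g n (j n)" using jn(2)[of n] by linarith
   qed
   show "\<forall>\<^sub>F n in sequentially. g n (j n) <= s" using jn(1) by simp
   have "(%n. s - u * (1 / real (Suc n))) \<longlonglongrightarrow> s - u * 0"
    using LIMSEQ_inverse_real_of_nat by (intro tendsto_intros) (simp add: inverse_eq_divide)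
   then show "(%n. s - u / real (Suc n)) \<longlonglongrightarrow> s" by simp
  qed simp
  then have "(%n. X (g n (j n)) om) \<longlonglongrightarrow> X s om"
   using x gu[OF jl] by (intro continuous_on_tendsto_compose[OF c[OF x(3)]]) auto
  then show ?thesis unfolding Zx by (simp add: x)
 qed
qed

lemma section_measurable:
 assumes "(%(s, om). g s om) \<in> borel_measurable (leb u \<Otimes>\<^sub>M M)" "om \<in> space M"
 shows "(%s. g s om) \<in> borel_measurable (leb u)"
 using measurable_compose[OF measurable_Pair2'[OF assms(2)] assms(1)] by simp

lemma time_integral_measurable:
 fixes g :: "real => 'a => 'v::euclidean_space"
 assumes g: "(%(s, om). g s om) \<in> borel_measurable (leb u \<Otimes>\<^sub>M M)"
 shows "(%om. LINT s:{0..u}|lborel. g s om) \<in> borel_measurable M"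
proof -
 interpret R: sigma_finite_measure "leb u" by (rule sigma_finite_leb)
 show ?thesis
  unfolding set_integral_leb using measurable_pair_swap[OF g]
  by (intro R.borel_measurable_lebesgue_integral) (simp add: case_prod_beta)
qed

context brownian begin

lemma time_section_measurable:
 assumes "(%(s, om). g s om) \<in> borel_measurable (leb u \<Otimes>\<^sub>M M)" "s \<in> {0..u}"
 shows "g s \<in> borel_measurable M"
 using measurable_compose[OF measurable_Pair1' assms(1), of s] assms(2) by simp

text \<open>Cauchy-Schwarz in time for each path, followed by Tonelli.\<close>

lemma msq_time_integral:
 fixes g :: "real => 'a => 'v::euclidean_space"
 assumes g: "(%(s, om). g s om) \<in> borel_measurable (leb u \<Otimes>\<^sub>M M)" and u: "0 <= u"
  and K: "AE om in M. \<forall>s\<in>{0..u}. norm (g s om) <= K"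
 shows "msq M (%om. LINT s:{0..u}|lborel. g s om) <= ennreal u * dsq u g"
proof -
 interpret R: sigma_finite_measure "leb u" by (rule sigma_finite_interval)
 have m: "(%om. \<integral>\<^sup>+s. ennreal ((norm (g s om))\<^sup>2) \<partial>leb u) \<in> borel_measurable M"
  using measurable_pair_swap[OF g] by (intro R.borel_measurable_nn_integral) (simp add: case_prod_beta)
 have "msq M (%om. LINT s:{0..u}|lborel. g s om) <= (\<integral>\<^sup>+om. ennreal u * (\<integral>\<^sup>+s. ennreal ((norm (g s om))\<^sup>2) \<partial>leb u) \<partial>M)"
  unfolding msq_def
 proof (rule nn_integral_mono_AE, use K AE_space in eventually_elim)
  case (elim om)
  have gm: "(%s. g s om) \<in> borel_measurable (leb u)" by (rule section_measurable[OF g elim(2)])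
  have i: "integrable (leb u) (%s. g s om)" by (rule leb_integrable_bounded[OF gm, of K]) (use elim in auto)
  have i2: "integrable (leb u) (%s. (norm (g s om))\<^sup>2)"
   by (rule leb_integrable_bounded[of _ _ "K\<^sup>2"]) (use elim gm in \<open>auto intro!: power_mono\<close>)
  have "(norm (LINT s|leb u. g s om))\<^sup>2 <= u * (LINT s|leb u. (norm (g s om))\<^sup>2)"
   using norm_integral_sq_le[OF finite_leb i i2] u by (simp add: measure_leb)
  then have "ennreal ((norm (LINT s|leb u. g s om))\<^sup>2) <= ennreal (u * (LINT s|leb u. (norm (g s om))\<^sup>2))"
   by (rule ennreal_leI)
  also have "... = ennreal u * (\<integral>\<^sup>+s. ennreal ((norm (g s om))\<^sup>2) \<partial>leb u)"
   using i2 u by (simp add: ennreal_mult nn_integral_eq_integral)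
  finally show ?case by (simp add: set_integral_leb)
 qed
 also have "... = ennreal u * dsq u g"
  unfolding dsq_restrict using m by (rule nn_integral_cmult)
 finally show ?thesis .
qed

lemma expectation_time_integral:
 fixes g :: "real => 'a => 'v::euclidean_space"
 assumes g: "(%(s, om). g s om) \<in> borel_measurable (leb u \<Otimes>\<^sub>M M)"
  and K: "AE om in M. \<forall>s\<in>{0..u}. norm (g s om) <= K"
 shows "integrable M (%om. LINT s:{0..u}|lborel. g s om)"
  "expectation (%om. LINT s:{0..u}|lborel. g s om) = (LINT s:{0..u}|lborel. expectation (g s))"
  "(%s. expectation (g s)) \<in> borel_measurable (leb u)"
proof -
 interpret R: sigma_finite_measure "leb u" by (rule sigma_finite_interval)
 interpret P: pair_sigma_finite "leb u" M ..
 have Ks: "AE om in M. norm (g s om) <= K" if "s \<in> {0..u}" for s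
  using K that by (auto elim!: eventually_mono)
 have i: "integrable M (g s)" if "s \<in> {0..u}" for s
  by (rule integrable_const_bound[OF Ks[OF that] time_section_measurable[OF g that]])
 have int: "integrable (leb u \<Otimes>\<^sub>M M) (%(s, om). g s om)"
 proof (rule P.Fubini_integrable[OF g])
  have "(%s. LINT om|M. norm (g s om)) \<in> borel_measurable (leb u)"
   using g by (intro borel_measurable_lebesgue_integral) (simp add: case_prod_beta)
  then show "integrable (leb u) (%s. LINT om|M. norm (case (s, om) of (s, om) => g s om))"
   unfolding prod.case
  proof (rule leb_integrable_bounded[of _ _ K])
   fix s assume s: "s \<in> {0..u}"
   have "(LINT om|M. norm (g s om)) <= (LINT om|M. K)"
    using i[OF s] Ks[OF s] by (intro integral_mono_AE) auto
   then show "norm (LINT om|M. norm (g s om)) <= K" by (simp add: prob_space)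
  qed
  show "AE s in leb u. integrable M (%om. case (s, om) of (s, om) => g s om)" using i by (intro AE_I2) simp
 qed
 show "integrable M (%om. LINT s:{0..u}|lborel. g s om)"
  unfolding set_integral_leb using P.integrable_snd[OF int] by simp
 show "expectation (%om. LINT s:{0..u}|lborel. g s om) = (LINT s:{0..u}|lborel. expectation (g s))"
  unfolding set_integral_leb using P.Fubini_integral[OF int] by simp
 show "(%s. expectation (g s)) \<in> borel_measurable (leb u)"
  using g by (intro borel_measurable_lebesgue_integral) (simp add: case_prod_beta)
qed

section \<open>Stochastic differential equations\<close>

definition sde_solution :: "('v => 'v) => ('r => 'v => 'v) => 'v => (real => 'a => 'v::euclidean_space) => bool" where
 "sde_solution a c x0 X \<longleftrightarrow>
  (\<forall>t\<in>{0..T}. X t \<in> borel_measurable (F t)) \<and>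
  (\<forall>om\<in>space M. continuous_on {0..T} (%t. X t om)) \<and>
  (\<forall>t\<in>{0..T}. \<exists>J. (\<forall>k. has_ito_integral M F (%s om. W s om $ k) (%s om. c k (X s om)) t (J k)) \<and>
    (AE om in M. X t om = x0 + (LINT s:{0..t}|lborel. a (X s om)) + (\<Sum>k\<in>UNIV. J k om)))"

lemma sde_process:
 fixes X :: "real => 'a => 'v::euclidean_space" and q :: "'v => 'w::euclidean_space"
 assumes X: "sde_solution a c x0 X" and q: "continuous_on UNIV q" and u: "0 <= u" "u <= T"
 shows "(%(s, om). q (X s om)) \<in> borel_measurable (leb u \<Otimes>\<^sub>M M)"
  "!!s. s \<in> {0..u} ==> (%om. q (X s om)) \<in> borel_measurable M"
  "!!om. om \<in> space M ==> continuous_on {0..u} (%s. q (X s om))"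
proof -
 have [measurable]: "q \<in> borel_measurable borel" by (rule borel_measurable_continuous_onI[OF q])
 have c: "continuous_on {0..T} (%t. X t om)" if "om \<in> space M" for om using X that unfolding sde_solution_def by blast
 show c': "continuous_on {0..u} (%s. q (X s om))" if "om \<in> space M" for om
  using c[OF that] u by (intro continuous_on_compose2[OF q]) (auto intro: continuous_on_subset)
 have "X t \<in> borel_measurable M" if "t \<in> {0..T}" for t
  using X that measurable_F_M[of t "X t"] unfolding sde_solution_def by auto
 then show mm: "(%om. q (X s om)) \<in> borel_measurable M" if "s \<in> {0..u}" for s
  using that u by auto
 show "(%(s, om). q (X s om)) \<in> borel_measurable (leb u \<Otimes>\<^sub>M M)"
  by (rule continuous_process_measurable[OF mm c' u(1)])
qed

text \<open>Taking expectations removes the Ito integrals, and a linear drift commutes with the expectation. The resulting integral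
equation has the exponential series as its solution.\<close>

lemma sde_mean:
 fixes X :: "real => 'a => 'v::euclidean_space"
 assumes X: "sde_solution a c x0 X" and a: "bounded_linear a"
  and R: "AE om in M. \<forall>t\<in>{0..T}. norm (X t om) <= R" and t: "t \<in> {0..T}"
 shows "(%n. (t ^ n / fact n) *\<^sub>R (a ^^ n) x0) sums expectation (X t)"
proof (rule linear_ode_series[OF a, where m="%t. expectation (X t)" and R=R and T=T])
 have T0: "0 <= T" using t by auto
 note ac = linear_continuous_on[OF a, of UNIV]
 note id = sde_process[OF X continuous_on_id T0 order_refl]
 show "(%t. expectation (X t)) \<in> borel_measurable (leb T)"
  by (rule expectation_time_integral(3)[OF id(1) R])
 have Rt: "AE om in M. norm (X s om) <= R" if "s \<in> {0..T}" for s using R that by (auto elim!: eventually_mono)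
 have i: "integrable M (X s)" if "s \<in> {0..T}" for s
  by (rule integrable_const_bound[OF Rt[OF that] id(2)[OF that]])
 show "norm (expectation (X t)) <= R" if "t \<in> {0..T}" for t
 proof -
  have "norm (expectation (X t)) <= expectation (%om. norm (X t om))" by (rule integral_norm_bound)
  also have "... <= expectation (%om. R)" using i[OF that] Rt[OF that] by (intro integral_mono_AE) auto
  finally show ?thesis by (simp add: prob_space)
 qed
 obtain K where K: "0 <= K" "!!x. norm (a x) <= norm x * K" using bounded_linear.nonneg_bounded[OF a] by blast
 show "expectation (X t) = x0 + (LINT s:{0..t}|lborel. a (expectation (X s)))" if t: "t \<in> {0..T}" for t
 proof -
  have t0: "0 <= t" "t <= T" using t by auto
  obtain J where J: "!!k. has_ito_integral M F (%s om. W s om $ k) (%s om. c k (X s om)) t (J k)"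
   and e: "AE om in M. X t om = x0 + (LINT s:{0..t}|lborel. a (X s om)) + (\<Sum>k\<in>UNIV. J k om)"
   using X t unfolding sde_solution_def by blast
  note pa = sde_process[OF X ac t0]
  have ba: "AE om in M. \<forall>s\<in>{0..t}. norm (a (X s om)) <= R * K"
   using R by eventually_elim (use t in \<open>auto intro!: order_trans[OF K(2)] mult_right_mono K(1)\<close>)
  note ti = expectation_time_integral[OF pa(1) ba]
  note iJ = ito_mean_zero[OF J t0]
  have "expectation (X t) = expectation (%om. x0 + (LINT s:{0..t}|lborel. a (X s om)) + (\<Sum>k\<in>UNIV. J k om))"
   using e id(2)[OF t] time_integral_measurable[OF pa(1)] borel_measurable_integrable[OF iJ(1)]
   by (intro integral_cong_AE) auto
  also have "... = x0 + (LINT s:{0..t}|lborel. expectation (%om. a (X s om)))"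
   using ti iJ by (simp add: prob_space)
  also have "(LINT s:{0..t}|lborel. expectation (%om. a (X s om))) = (LINT s:{0..t}|lborel. a (expectation (X s)))"
   unfolding set_integral_leb using t
   by (intro Bochner_Integration.integral_cong refl integral_bounded_linear[OF a] i) auto
  finally show ?thesis .
 qed
qed (rule t)

text \<open>The diffusion part dominates: its mean square is proportional to the length of the time interval.\<close>

lemma sde_increment:
 fixes X :: "real => 'a => 'v::euclidean_space"
 assumes X: "sde_solution a c x0 X" and ac: "continuous_on UNIV a"
  and K: "AE om in M. \<forall>t\<in>{0..T}. norm (a (X t om)) <= K" "!!k. AE om in M. \<forall>t\<in>{0..T}. norm (c k (X t om)) <= K"
  and st: "0 <= s" "s <= t" "t <= T"
 shows "msq M (%om. X t om - X s om) <= ennreal ((2 * K\<^sup>2 * T + 16 * (real CARD('r))\<^sup>2 * K\<^sup>2) * (t - s))"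
proof -
 have tT: "t \<in> {0..T}" and sT: "s \<in> {0..T}" and T0: "0 <= T" using st by auto
 obtain J where J: "!!k. has_ito_integral M F (%s om. W s om $ k) (%s om. c k (X s om)) t (J k)"
   and e: "AE om in M. X t om = x0 + (LINT s:{0..t}|lborel. a (X s om)) + (\<Sum>k\<in>UNIV. J k om)"
  using X tT unfolding sde_solution_def by blast
 obtain J' where J': "!!k. has_ito_integral M F (%s om. W s om $ k) (%s om. c k (X s om)) s (J' k)"
   and e': "AE om in M. X s om = x0 + (LINT s:{0..s}|lborel. a (X s om)) + (\<Sum>k\<in>UNIV. J' k om)"
  using X sT unfolding sde_solution_def by blast
 have Jm: "J k \<in> borel_measurable M" "J' k \<in> borel_measurable M" for k
  using J J' unfolding has_ito_integral_def by blast+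
 define D where "D om = (LINT u:{0..t}|lborel. a (X u om)) - (LINT u:{0..s}|lborel. a (X u om))" for om
 note pt = sde_process[OF X ac _ st(3)] and ps = sde_process[OF X ac st(1)]
 have Dm: "D \<in> borel_measurable M"
  unfolding D_def using time_integral_measurable[OF pt(1)] time_integral_measurable[OF ps(1)] st by auto
 have "msq M (%om. X t om - X s om) = msq M (%om. D om + (\<Sum>k\<in>UNIV. J k om - J' k om))"
  by (rule msq_cong_AE) (use e e' in \<open>eventually_elim, simp add: D_def sum_subtractf\<close>)
 also have "... <= 2 * msq M D + 2 * msq M (%om. \<Sum>k\<in>UNIV. J k om - J' k om)"
  using Dm Jm by (intro msq_add) auto
 also have "... <= 2 * ennreal ((K * (t - s))\<^sup>2) + 2 * (of_nat CARD('r) * (\<Sum>k\<in>(UNIV::'r set). ennreal (8 * K\<^sup>2 * (t - s))))"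
 proof (intro add_mono mult_left_mono)
  show "msq M D <= ennreal ((K * (t - s))\<^sup>2)"
  proof (rule msq_bound[OF prob_space_axioms], use K(1) AE_space in eventually_elim)
   case (elim om)
   show ?case unfolding D_def
    using elim st pt(3)[OF _ elim(2)] by (intro set_integral_increment[where c=0, simplified]) auto
  qed
  have "msq M (%om. \<Sum>k\<in>UNIV. J k om - J' k om) <= of_nat CARD('r) * (\<Sum>k\<in>UNIV. msq M (%om. J k om - J' k om))"
   using Jm by (intro msq_sum) auto
  also have "... <= of_nat CARD('r) * (\<Sum>k\<in>(UNIV::'r set). ennreal (8 * K\<^sup>2 * (t - s)))"
   by (intro mult_left_mono sum_mono ito_increment_bound[OF J J' st K(2)]) simp
  finally show "msq M (%om. \<Sum>k\<in>UNIV. J k om - J' k om) <= of_nat CARD('r) * (\<Sum>k\<in>(UNIV::'r set). ennreal (8 * K\<^sup>2 * (t - s)))" .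
 qed auto
 also have "... = ennreal (2 * (K * (t - s))\<^sup>2 + 2 * (real CARD('r) * (real CARD('r) * (8 * K\<^sup>2 * (t - s)))))"
 proof -
  have e2: "2 * ennreal x = ennreal (2 * x)" for x by (simp add: ennreal_mult')
  have en: "of_nat n * ennreal x = ennreal (real n * x)" for n x
   by (simp add: ennreal_mult' ennreal_of_nat_eq_real_of_nat)
  have es: "(\<Sum>k\<in>(UNIV::'r set). ennreal x) = ennreal (real CARD('r) * x)" for x
   by (simp add: en[symmetric])
  show ?thesis unfolding e2 es en using st by (intro ennreal_plus[symmetric]) auto
 qed
 also have "... <= ennreal ((2 * K\<^sup>2 * T + 16 * (real CARD('r))\<^sup>2 * K\<^sup>2) * (t - s))"
 proof (rule ennreal_leI)
  have "2 * K\<^sup>2 * ((t - s) * (t - s)) <= 2 * K\<^sup>2 * (T * (t - s))" using st by (intro mult_left_mono mult_right_mono) auto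
  then show "2 * (K * (t - s))\<^sup>2 + 2 * (real CARD('r) * (real CARD('r) * (8 * K\<^sup>2 * (t - s)))) <= (2 * K\<^sup>2 * T + 16 * (real CARD('r))\<^sup>2 * K\<^sup>2) * (t - s)"
   by (simp add: power2_eq_square algebra_simps)
 qed
 finally show ?thesis .
qed

end

lemma has_bochner_integral_leb:
 fixes f :: "real => 'v::euclidean_space"
 shows "has_bochner_integral (leb u) f x \<longleftrightarrow> has_bochner_integral lborel (%s. indicator {0..u} s *\<^sub>R f s) x"
 by (simp add: has_bochner_integral_iff integral_restrict_space integrable_restrict_space)

section \<open>Euler approximation of strong solutions\<close>

text \<open>The cells of the grid are taken as left-open intervals, matching the convention for simple processes; the time \<open>0\<close>
belongs to no cell and has to be treated as a null set.\<close>

definition gridt :: "real => nat => nat => real" where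
 "gridt T n j = real j * (T / real n)"

lemma gridt_simps: "gridt T n 0 = 0" "0 < n ==> gridt T n n = T" "gridt T n (Suc j) = gridt T n j + T / real n"
 unfolding gridt_def by (auto simp: algebra_simps add_divide_distrib)

lemma gridt_mono: "0 <= T ==> i <= j ==> gridt T n i <= gridt T n j"
 unfolding gridt_def by (intro mult_right_mono) auto

lemma gridt_range: "0 <= T ==> j <= n ==> gridt T n j \<in> {0..T}"
proof (cases "n = 0")
 case False
 then show "0 <= T ==> j <= n ==> gridt T n j \<in> {0..T}"
  using gridt_mono[of T 0 j n] gridt_mono[of T j n n] by (auto simp: gridt_simps)
qed (simp add: gridt_def)

lemma gridt_cell:
 assumes T: "0 < T" and n: "0 < n" and s: "0 < s" "s <= gridt T n j"
 obtains i where "i < j" "s \<in> {gridt T n i<..gridt T n (Suc i)}"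
proof -
 define i where "i = (LEAST k. s <= gridt T n k)"
 have i1: "s <= gridt T n i" unfolding i_def by (rule LeastI[of _ j]) (rule s)
 have ij: "i <= j" unfolding i_def by (rule Least_le) (rule s)
 have "i ~= 0" using i1 s by (auto simp: gridt_simps intro: ccontr)
 then obtain k where k: "i = Suc k" using not0_implies_Suc by blast
 have "\<not> s <= gridt T n k" using not_less_Least[of k "%k. s <= gridt T n k"] k unfolding i_def by simp
 then show thesis using i1 ij k by (intro that[of k]) auto
qed

lemma gridt_cell_unique:
 assumes T: "0 <= T" and "s \<in> {gridt T n i<..gridt T n (Suc i)}" "s \<in> {gridt T n k<..gridt T n (Suc k)}"
 shows "i = k"
proof (rule ccontr)
 assume "i ~= k"
 then consider "Suc i <= k" | "Suc k <= i" by linarith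
 then show False
  using assms gridt_mono[OF T, of "Suc i" k n] gridt_mono[OF T, of "Suc k" i n] by cases auto
qed

lemma sum_grid_indicator:
 fixes x :: "nat => 'v::real_vector"
 assumes T: "0 <= T" and i: "i < j" "s \<in> {gridt T n i<..gridt T n (Suc i)}"
 shows "(\<Sum>k<j. indicator {gridt T n k<..gridt T n (Suc k)} s *\<^sub>R x k) = x i"
proof -
 have "(\<Sum>k<j. indicator {gridt T n k<..gridt T n (Suc k)} s *\<^sub>R x k) = (\<Sum>k<j. if k = i then x k else 0)"
 proof (rule sum.cong[OF refl])
  fix k
  have "s \<notin> {gridt T n k<..gridt T n (Suc k)}" if "k ~= i"
   using gridt_cell_unique[OF T i(2), of k] that by blast
  then show "indicator {gridt T n k<..gridt T n (Suc k)} s *\<^sub>R x k = (if k = i then x k else 0)"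
   using i(2) by (cases "k = i") simp_all
 qed
 then show ?thesis using i by simp
qed

primrec euler :: "real => (real => 'a => real^'r) => ('v::euclidean_space => 'v) => ('r::finite => 'v => 'v) => 'v => nat => nat => 'a => 'v" where
 "euler T W a c x0 n 0 = (%om. x0)"
| "euler T W a c x0 n (Suc j) = (%om. euler T W a c x0 n j om + (T / real n) *\<^sub>R a (euler T W a c x0 n j om)
  + (\<Sum>k\<in>UNIV. (W (gridt T n (Suc j)) om $ k - W (gridt T n j) om $ k) *\<^sub>R c k (euler T W a c x0 n j om)))"

text \<open>The discrete Gronwall inequality. In the extended nonnegative reals no finiteness has to be established
beforehand, so the recursion can be used before the error is known to be finite.\<close>

lemma gronwall_ennreal:
 fixes e :: "nat => ennreal"
 assumes e: "!!j. j <= n ==> e j <= b * (\<Sum>i<j. e i + \<eta>)"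
 shows "j <= n ==> e j + \<eta> <= \<eta> * (1 + b) ^ j"
proof (induction j rule: less_induct)
 case (less j)
 have sum: "b * (\<Sum>i<j. \<eta> * (1 + b) ^ i) + \<eta> = \<eta> * (1 + b) ^ j" for j
  by (induction j) (simp_all add: algebra_simps)
 have "e j + \<eta> <= b * (\<Sum>i<j. e i + \<eta>) + \<eta>" using e[OF less.prems] by (intro add_right_mono)
 also have "... <= b * (\<Sum>i<j. \<eta> * (1 + b) ^ i) + \<eta>"
  using less by (intro add_right_mono mult_left_mono sum_mono) auto
 also note sum
 finally show ?case .
qed

text \<open>A solution with coefficients \<open>a\<close>, \<open>c\<close> that stays in the ball of radius \<open>R\<close>. The Euler scheme uses the truncated
coefficients \<open>a'\<close>, \<open>c'\<close>, which agree with the original ones on the ball.\<close>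

locale euler_approximation = brownian M T W
 for M :: "'a measure" and T :: real and W :: "real => 'a => real^'r" +
 fixes a a' :: "'v::euclidean_space => 'v" and c c' :: "'r => 'v => 'v" and x0 :: 'v and X :: "real => 'a => 'v" and R K :: real
 assumes T: "0 < T" and sol: "sde_solution a c x0 X" and R: "AE om in M. \<forall>t\<in>{0..T}. norm (X t om) <= R"
  and cont: "continuous_on UNIV a" "!!k. continuous_on UNIV (c k)"
  and agree: "!!x. norm x <= R ==> a x = a' x" "!!k x. norm x <= R ==> c k x = c' k x"
  and lip: "!!x y. norm (a' x - a' y) <= K * norm (x - y)" "!!k x y. norm (c' k x - c' k y) <= K * norm (x - y)"
  and bdd: "!!x. norm (a' x) <= K" "!!k x. norm (c' k x) <= K"
begin

abbreviation "eul \<equiv> euler T W a' c' x0"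
abbreviation "\<tau> \<equiv> gridt T"
abbreviation "step n j q \<equiv> fam_val {..<j::nat} (\<tau> n) (%i. \<tau> n (Suc i)) (%i om. q (eul n i om))"

lemma K0: "0 <= K" using bdd(1) norm_ge_zero order_trans by blast

lemma lipschitz_measurable:
 fixes q :: "'v => 'w::euclidean_space"
 assumes "!!x y. norm (q x - q y) <= K * norm (x - y)"
 shows "q \<in> borel_measurable borel"
proof (rule borel_measurable_continuous_onI)
 show "continuous_on UNIV q"
  by (rule lipschitz_on_continuous_on[where L=K]) (use assms K0 in \<open>auto intro!: lipschitz_onI simp: dist_norm\<close>)
qed

lemma eul_measurable: "j <= n ==> eul n j \<in> borel_measurable (F (\<tau> n j))"
proof (induction j)
 case (Suc j)
 have t: "\<tau> n j <= \<tau> n (Suc j)" "0 <= \<tau> n j" "0 <= \<tau> n (Suc j)"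
  using gridt_mono[of T j "Suc j" n] gridt_range[of T j n] gridt_range[of T "Suc j" n] Suc.prems T by auto
 have e[measurable]: "eul n j \<in> borel_measurable (F (\<tau> n (Suc j)))"
  using measurable_F_mono[OF t(1) Suc.IH] Suc.prems by auto
 have [measurable]: "a' \<in> borel_measurable borel" "c' k \<in> borel_measurable borel" for k
  using lip by (auto intro: lipschitz_measurable)
 have [measurable]: "W (\<tau> n j) \<in> borel_measurable (F (\<tau> n (Suc j)))" "W (\<tau> n (Suc j)) \<in> borel_measurable (F (\<tau> n (Suc j)))"
  using W_F t by auto
 show ?case by simp
qed simp

lemma eul_M: assumes "j <= n" shows "eul n j \<in> borel_measurable M"
 by (rule measurable_F_M[OF _ eul_measurable[OF assms]]) (use gridt_range[of T j n] T assms in auto)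

lemma eul_family:
 fixes q :: "'v => 'w::euclidean_space"
 assumes q: "!!x y. norm (q x - q y) <= K * norm (x - y)" "!!x. norm (q x) <= K" and j: "j <= n"
 shows "elem_family (\<tau> n j) {..<j} (\<tau> n) (%i. \<tau> n (Suc i)) (%i om. q (eul n i om))"
 unfolding elem_family_def
proof (intro conjI ballI)
 fix i assume i: "i \<in> {..<j}"
 show "0 <= \<tau> n i" using gridt_range[of T i n] i j T by auto
 show "\<tau> n i <= \<tau> n (Suc i)" "\<tau> n (Suc i) <= \<tau> n j" using gridt_mono[of T] i T by auto
 show "(%om. q (eul n i om)) \<in> borel_measurable (F (\<tau> n i))"
  using measurable_compose[OF eul_measurable lipschitz_measurable[OF q(1)], of i n] i j by simp
 show "\<exists>C. \<forall>om\<in>space M. norm (q (eul n i om)) <= C" using q(2) by blast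
qed simp

text \<open>The scheme has the same structure as the equation, with integrands frozen on each cell; hence the isometry applies to the
difference of the two.\<close>

lemma eul_sum:
 "eul n j om = x0 + (\<Sum>i<j. (T / real n) *\<^sub>R a' (eul n i om))
  + (\<Sum>k\<in>UNIV. fam_int k {..<j} (\<tau> n) (%i. \<tau> n (Suc i)) (%i om. c' k (eul n i om)) om)"
 by (induction j) (simp_all add: fam_int_def dW_def sum.distrib)

lemma step_integral:
 fixes q :: "'v => 'w::euclidean_space"
 assumes n: "0 < n" and j: "j <= n"
 shows "integrable (leb (\<tau> n j)) (%s. step n j q s om)" "(LINT s|leb (\<tau> n j). step n j q s om) = (\<Sum>i<j. (T / real n) *\<^sub>R q (eul n i om))"
proof -
 have "has_bochner_integral (leb (\<tau> n j)) (%s. indicator {\<tau> n i<..\<tau> n (Suc i)} s *\<^sub>R q (eul n i om)) ((T / real n) *\<^sub>R q (eul n i om))" if "i < j" for i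
 proof (rule has_bochner_integral_scaleR_left)
  have m: "\<tau> n i <= \<tau> n (Suc i)" "\<tau> n (Suc i) <= \<tau> n j" "0 <= \<tau> n i" using gridt_mono[of T] gridt_range[of T i n] that j T by auto
  have "has_bochner_integral lborel (indicat_real {\<tau> n i<..\<tau> n (Suc i)}) (T / real n)"
   using has_bochner_integral_Ioc[of "\<tau> n i" "\<tau> n (Suc i)"] m by (simp add: gridt_simps)
  moreover have "indicat_real {0..\<tau> n j} s *\<^sub>R indicat_real {\<tau> n i<..\<tau> n (Suc i)} s = indicat_real {\<tau> n i<..\<tau> n (Suc i)} s" for s
   using m by (auto simp: indicator_def)
  ultimately show "has_bochner_integral (leb (\<tau> n j)) (indicat_real {\<tau> n i<..\<tau> n (Suc i)}) (T / real n)"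
   by (simp only: has_bochner_integral_leb)
 qed
 then have "has_bochner_integral (leb (\<tau> n j)) (%s. step n j q s om) (\<Sum>i<j. (T / real n) *\<^sub>R q (eul n i om))"
  unfolding fam_val_def by (intro has_bochner_integral_sum) auto
 then show "integrable (leb (\<tau> n j)) (%s. step n j q s om)" "(LINT s|leb (\<tau> n j). step n j q s om) = (\<Sum>i<j. (T / real n) *\<^sub>R q (eul n i om))"
  by (auto simp: has_bochner_integral_iff)
qed

definition incr_const :: real where "incr_const = 2 * K\<^sup>2 * T + 16 * (real CARD('r))\<^sup>2 * K\<^sup>2"

definition err :: "nat => nat => ennreal" where "err n j = msq M (%om. X (\<tau> n j) om - eul n j om)"

lemma incr_const_nonneg: "0 <= incr_const" unfolding incr_const_def using T by simp

lemma X_M: "t \<in> {0..T} ==> X t \<in> borel_measurable M"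
 using sde_process(2)[OF sol continuous_on_id, of T t] T by auto

lemma X_increment: "0 <= s ==> s <= t ==> t <= T ==> msq M (%om. X t om - X s om) <= ennreal (incr_const * (t - s))"
 unfolding incr_const_def
proof (rule sde_increment[OF sol cont(1)])
 show "AE om in M. \<forall>t\<in>{0..T}. norm (a (X t om)) <= K" using R by eventually_elim (use agree bdd in auto)
 show "AE om in M. \<forall>t\<in>{0..T}. norm (c k (X t om)) <= K" for k using R by eventually_elim (use agree bdd in auto)
qed

lemma msq_lipschitz:
 fixes q :: "'v => 'w::euclidean_space"
 assumes q: "!!x y. norm (q x - q y) <= K * norm (x - y)" and "Y \<in> borel_measurable M" "Z \<in> borel_measurable M"
 shows "msq M (%om. q (Y om) - q (Z om)) <= ennreal (K\<^sup>2) * msq M (%om. Y om - Z om)"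
proof -
 have "msq M (%om. q (Y om) - q (Z om)) <= msq M (%om. K *\<^sub>R (Y om - Z om))"
  by (rule msq_mono_AE) (use q K0 in auto)
 also have "... = ennreal (K\<^sup>2) * msq M (%om. Y om - Z om)"
  using assms by (intro msq_scaleR) auto
 finally show ?thesis .
qed

text \<open>On a cell, the distance splits into the increment of the solution since the left end point, of order the mesh, and
the error of the scheme at that point.\<close>

lemma step_distance:
 fixes q q' :: "'v => 'w::euclidean_space"
 assumes q: "continuous_on UNIV q" "!!x. norm x <= R ==> q x = q' x"
  and q': "!!x y. norm (q' x - q' y) <= K * norm (x - y)" "!!x. norm (q' x) <= K"
  and n: "0 < n" and j: "j <= n"
 shows "dsq (\<tau> n j) (%s om. q (X s om) - step n j q' s om) <= ennreal (T / real n * (2 * K\<^sup>2)) * (\<Sum>i<j. err n i + ennreal (incr_const * (T / real n)))"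
proof -
 have jT: "0 <= \<tau> n j" "\<tau> n j <= T" using gridt_range[of T j n] j T by auto
 have m: "(%(s, om). q (X s om) - step n j q' s om) \<in> borel_measurable (leb (\<tau> n j) \<Otimes>\<^sub>M M)"
  using sde_process(1)[OF sol q(1) jT] fam_val_measurable[OF eul_family[OF q' j] jT(2), of "\<tau> n j"] by (simp add: case_prod_beta)
 define bd where "bd i = ennreal (2 * K\<^sup>2) * (err n i + ennreal (incr_const * (T / real n)))" for i
 have main: "msq M (%om. q (X s om) - step n j q' s om) <= bd i"
  if i: "i < j" and s: "s \<in> {\<tau> n i<..\<tau> n (Suc i)}" for i s
 proof -
  have ti: "\<tau> n i \<in> {0..T}" "s \<in> {0..T}"
   using gridt_range[of T i n] gridt_range[of T "Suc i" n] s i j T by auto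
  have "\<tau> n (Suc i) = \<tau> n i + T / real n" by (simp add: gridt_simps)
  then have si: "s - \<tau> n i <= T / real n" "\<tau> n i <= s" using s by auto
  have ei: "eul n i \<in> borel_measurable M" using i j by (intro eul_M) auto
  have st: "step n j q' s om = q' (eul n i om)" for om
   unfolding fam_val_def using sum_grid_indicator[OF less_imp_le[OF T] i s] by simp
  have "msq M (%om. q (X s om) - step n j q' s om) = msq M (%om. q' (X s om) - q' (eul n i om))"
   unfolding st by (rule msq_cong_AE) (use R in \<open>eventually_elim, use q(2) ti in auto\<close>)
  also have "... <= ennreal (K\<^sup>2) * msq M (%om. X s om - eul n i om)"
   by (rule msq_lipschitz[OF q'(1) X_M[OF ti(2)] ei])
  also have "... <= ennreal (K\<^sup>2) * (2 * ennreal (incr_const * (T / real n)) + 2 * err n i)"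
  proof (rule mult_left_mono)
   have "msq M (%om. X s om - eul n i om) = msq M (%om. (X s om - X (\<tau> n i) om) + (X (\<tau> n i) om - eul n i om))" by simp
   also have "... <= 2 * msq M (%om. X s om - X (\<tau> n i) om) + 2 * err n i"
    unfolding err_def using X_M[OF ti(1)] X_M[OF ti(2)] ei by (intro msq_add) auto
   also have "... <= 2 * ennreal (incr_const * (T / real n)) + 2 * err n i"
   proof -
    have "msq M (%om. X s om - X (\<tau> n i) om) <= ennreal (incr_const * (s - \<tau> n i))"
     using ti si by (intro X_increment) auto
    also have "... <= ennreal (incr_const * (T / real n))"
     using si incr_const_nonneg by (intro ennreal_leI mult_left_mono)
    finally show ?thesis by (intro add_right_mono mult_left_mono) auto
   qed
   finally show "msq M (%om. X s om - eul n i om) <= 2 * ennreal (incr_const * (T / real n)) + 2 * err n i" .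
  qed simp
  also have "... = bd i"
  proof -
   have "ennreal (2 * K\<^sup>2) = 2 * ennreal (K\<^sup>2)" by (simp add: ennreal_mult')
   then show ?thesis unfolding bd_def by (simp only: distrib_left mult.assoc mult.left_commute add.commute)
  qed
  finally show ?thesis .
 qed
 have "dsq (\<tau> n j) (%s om. q (X s om) - step n j q' s om) = (\<integral>\<^sup>+s\<in>{0..\<tau> n j}. msq M (%om. q (X s om) - step n j q' s om) \<partial>lborel)"
  by (rule dsq_swap[OF m])
 also have "... <= (\<integral>\<^sup>+s. (\<Sum>i<j. bd i * indicator {\<tau> n i<..\<tau> n (Suc i)} s) \<partial>lborel)"
 proof (rule nn_integral_mono_AE, use AE_lborel_singleton[of 0] in eventually_elim)
  case (elim s)
  show ?case
  proof (cases "s \<in> {0..\<tau> n j}")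
   case True
   then have "0 < s" using elim by auto
   then obtain i where i: "i < j" "s \<in> {\<tau> n i<..\<tau> n (Suc i)}" using gridt_cell[OF T n, of s j] True by auto
   have "msq M (%om. q (X s om) - step n j q' s om) * indicator {0..\<tau> n j} s <= bd i * indicator {\<tau> n i<..\<tau> n (Suc i)} s"
    using main[OF i] i True by simp
   also have "... <= (\<Sum>i<j. bd i * indicator {\<tau> n i<..\<tau> n (Suc i)} s)"
    by (rule member_le_sum) (use i in auto)
   finally show ?thesis .
  qed simp
 qed
 also have "... = (\<Sum>i<j. bd i * ennreal (T / real n))"
 proof (subst nn_integral_sum)
  have "(\<integral>\<^sup>+s. bd i * indicator {\<tau> n i<..\<tau> n (Suc i)} s \<partial>lborel) = bd i * ennreal (T / real n)" for i
   using gridt_mono[of T i "Suc i" n] T by (simp add: nn_integral_cmult_indicator gridt_simps)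
  then show "(\<Sum>i<j. \<integral>\<^sup>+s. bd i * indicator {\<tau> n i<..\<tau> n (Suc i)} s \<partial>lborel) = (\<Sum>i<j. bd i * ennreal (T / real n))" by simp
 qed simp
 also have "... = ennreal (T / real n * (2 * K\<^sup>2)) * (\<Sum>i<j. err n i + ennreal (incr_const * (T / real n)))"
 proof -
  have "ennreal (T / real n * (2 * K\<^sup>2)) = ennreal (T / real n) * ennreal (2 * K\<^sup>2)"
   using T by (intro ennreal_mult) auto
  then show ?thesis unfolding bd_def sum_distrib_left by (simp only: mult_ac)
 qed
 finally show ?thesis .
qed

definition growth_const :: real where "growth_const = (2 * T + 8 * (real CARD('r))\<^sup>2) * (2 * K\<^sup>2)"

text \<open>Besides the drift of the equation this covers any Lipschitz observable \<open>q\<close> of the state, such as the signal.\<close>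

lemma drift_distance:
 fixes q q' :: "'v => 'w::euclidean_space"
 assumes q: "continuous_on UNIV q" "!!x. norm x <= R ==> q x = q' x"
  and q': "!!x y. norm (q' x - q' y) <= K * norm (x - y)" "!!x. norm (q' x) <= K"
  and n: "0 < n" and j: "j <= n"
 defines "E \<equiv> %om. (LINT s:{0..\<tau> n j}|lborel. q (X s om)) - (\<Sum>i<j. (T / real n) *\<^sub>R q' (eul n i om))"
 shows "E \<in> borel_measurable M"
  "msq M E <= ennreal T * (ennreal (T / real n * (2 * K\<^sup>2)) * (\<Sum>i<j. err n i + ennreal (incr_const * (T / real n))))"
proof -
 have jT: "0 <= \<tau> n j" "\<tau> n j <= T" using gridt_range[of T j n] j T by auto
 note pa = sde_process[OF sol q(1) jT(1,2)]
 have mE: "(%(s, om). q (X s om) - step n j q' s om) \<in> borel_measurable (leb (\<tau> n j) \<Otimes>\<^sub>M M)"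
  using pa(1) fam_val_measurable[OF eul_family[OF q' j] jT(2), of "\<tau> n j"] by (simp add: case_prod_beta)
 have sb: "norm (step n j q' s om) <= K" if sj: "s \<in> {0..\<tau> n j}" for s om
 proof (cases "s = 0")
  case True
  then have "step n j q' s om = 0"
   unfolding fam_val_def
  proof (intro sum.neutral ballI)
   fix i
   have "0 <= \<tau> n i" unfolding gridt_def using T by simp
   then show "indicat_real {\<tau> n i<..\<tau> n (Suc i)} s *\<^sub>R q' (eul n i om) = 0" by (simp add: True)
  qed
  then show ?thesis using K0 by simp
 next
  case False
  then have "0 < s" "s <= \<tau> n j" using sj by auto
  then obtain i where i: "i < j" "s \<in> {\<tau> n i<..\<tau> n (Suc i)}" by (rule gridt_cell[OF T n])
  show ?thesis unfolding fam_val_def sum_grid_indicator[OF less_imp_le[OF T] i] by (rule q')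
 qed
 have eq: "(LINT s:{0..\<tau> n j}|lborel. q (X s om) - step n j q' s om) = E om" if w: "om \<in> space M" for om
 proof -
  have "integrable (leb (\<tau> n j)) (%s. q (X s om))" by (rule leb_continuous_integrable[OF pa(3)[OF w]])
  then show ?thesis
   unfolding E_def set_integral_leb using step_integral[OF n j, of q' om] by simp
 qed
 show Em: "E \<in> borel_measurable M"
  using time_integral_measurable[OF mE] by (subst measurable_cong[OF eq[symmetric]])
 have "msq M E = msq M (%om. LINT s:{0..\<tau> n j}|lborel. q (X s om) - step n j q' s om)"
  using eq by (intro msq_cong_AE AE_I2) simp
 also have "... <= ennreal (\<tau> n j) * dsq (\<tau> n j) (%s om. q (X s om) - step n j q' s om)"
 proof (rule msq_time_integral[OF mE jT(1)], use R in eventually_elim)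
  case (elim om)
  show "\<forall>s\<in>{0..\<tau> n j}. norm (q (X s om) - step n j q' s om) <= K + K"
  proof
   fix s assume s: "s \<in> {0..\<tau> n j}"
   then have "norm (q (X s om)) <= K" using elim jT q(2) q'(2) by auto
   then show "norm (q (X s om) - step n j q' s om) <= K + K"
    using sb[OF s, of om] by (intro order_trans[OF norm_triangle_ineq4] add_mono)
  qed
 qed
 also have "... <= ennreal T * (ennreal (T / real n * (2 * K\<^sup>2)) * (\<Sum>i<j. err n i + ennreal (incr_const * (T / real n))))"
  by (intro mult_mono ennreal_leI jT step_distance[OF q q' n j]) auto
 finally show "msq M E <= ennreal T * (ennreal (T / real n * (2 * K\<^sup>2)) * (\<Sum>i<j. err n i + ennreal (incr_const * (T / real n))))" .
qed

text \<open>The drift difference is controlled by \<open>drift_distance\<close> and each Ito integral difference by \<open>ito_family_distance\<close>.\<close>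

lemma err_recursion:
 assumes n: "0 < n" and j: "j <= n"
 shows "err n j <= ennreal (growth_const * (T / real n)) * (\<Sum>i<j. err n i + ennreal (incr_const * (T / real n)))"
proof -
 have jT: "0 <= \<tau> n j" "\<tau> n j <= T" "\<tau> n j \<in> {0..T}" using gridt_range[of T j n] j T by auto
 define D where "D = ennreal (T / real n * (2 * K\<^sup>2)) * (\<Sum>i<j. err n i + ennreal (incr_const * (T / real n)))"
 obtain J where J: "!!k. has_ito_integral M F (%s om. W s om $ k) (%s om. c k (X s om)) (\<tau> n j) (J k)"
   and e: "AE om in M. X (\<tau> n j) om = x0 + (LINT s:{0..\<tau> n j}|lborel. a (X s om)) + (\<Sum>k\<in>UNIV. J k om)"
  using sol jT(3) unfolding sde_solution_def by blast
 have Jm: "J k \<in> borel_measurable M" for k using J unfolding has_ito_integral_def by blast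
 define I where "I k = fam_int k {..<j} (\<tau> n) (%i. \<tau> n (Suc i)) (%i om. c' k (eul n i om))" for k
 have Im: "I k \<in> borel_measurable M" for k unfolding I_def by (rule fam_int_measurable[OF eul_family[OF lip(2) bdd(2) j] jT(2)])
 define E where "E om = (LINT s:{0..\<tau> n j}|lborel. a (X s om)) - (\<Sum>i<j. (T / real n) *\<^sub>R a' (eul n i om))" for om
 have Em: "E \<in> borel_measurable M" unfolding E_def[abs_def] by (rule drift_distance(1)[OF cont(1) agree(1) lip(1) bdd(1) n j])
 have eq: "AE om in M. X (\<tau> n j) om - eul n j om = E om + (\<Sum>k\<in>UNIV. J k om - I k om)"
  using e by eventually_elim (simp add: eul_sum[of n j] E_def I_def sum_subtractf)
 have "err n j = msq M (%om. E om + (\<Sum>k\<in>UNIV. J k om - I k om))"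
  unfolding err_def by (rule msq_cong_AE[OF eq])
 also have "... <= 2 * msq M E + 2 * msq M (%om. \<Sum>k\<in>UNIV. J k om - I k om)"
  using Em Jm Im by (intro msq_add) auto
 also have "... <= 2 * (ennreal T * D) + 2 * (of_nat CARD('r) * (\<Sum>k\<in>(UNIV::'r set). 4 * D))"
 proof (intro add_mono mult_left_mono)
  show "msq M E <= ennreal T * D" unfolding E_def[abs_def] D_def by (rule drift_distance(2)[OF cont(1) agree(1) lip(1) bdd(1) n j])
  have "msq M (%om. \<Sum>k\<in>UNIV. J k om - I k om) <= of_nat CARD('r) * (\<Sum>k\<in>UNIV. msq M (%om. J k om - I k om))"
   using Jm Im by (intro msq_sum) auto
  also have "... <= of_nat CARD('r) * (\<Sum>k\<in>(UNIV::'r set). 4 * D)"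
  proof (intro mult_left_mono sum_mono)
   fix k
   have "msq M (%om. J k om - I k om) <= 4 * dsq (\<tau> n j) (%s om. c k (X s om) - step n j (c' k) s om)"
    unfolding I_def by (rule ito_family_distance[OF J jT(1,2) eul_family[OF lip(2) bdd(2) j]])
   also have "... <= 4 * D"
    unfolding D_def by (intro mult_left_mono step_distance[OF cont(2) agree(2) lip(2) bdd(2) n j]) auto
   finally show "msq M (%om. J k om - I k om) <= 4 * D" .
  qed simp
  finally show "msq M (%om. \<Sum>k\<in>UNIV. J k om - I k om) <= of_nat CARD('r) * (\<Sum>k\<in>(UNIV::'r set). 4 * D)" .
 qed auto
 also have "... = ennreal (2 * T + 8 * (real CARD('r))\<^sup>2) * D"
 proof -
  have r: "ennreal (8 * (real CARD('r))\<^sup>2) = 2 * (of_nat CARD('r) * (of_nat CARD('r) * 4))"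
   using ennreal_of_nat_eq_real_of_nat[of "8 * CARD('r) * CARD('r)"] by (simp add: power2_eq_square mult_ac)
  have "ennreal (2 * T + 8 * (real CARD('r))\<^sup>2) = ennreal (2 * T) + ennreal (8 * (real CARD('r))\<^sup>2)"
   using T by (intro ennreal_plus) auto
  also have "... = 2 * ennreal T + 2 * (of_nat CARD('r) * (of_nat CARD('r) * 4))"
   unfolding r using T by (simp add: ennreal_mult')
  finally show ?thesis by (simp add: distrib_right mult.assoc)
 qed
 also have "... = ennreal (growth_const * (T / real n)) * (\<Sum>i<j. err n i + ennreal (incr_const * (T / real n)))"
 proof -
  have "growth_const * (T / real n) = (2 * T + 8 * (real CARD('r))\<^sup>2) * (T / real n * (2 * K\<^sup>2))"
   unfolding growth_const_def by (simp add: mult_ac)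
  then have "ennreal (growth_const * (T / real n)) = ennreal (2 * T + 8 * (real CARD('r))\<^sup>2) * ennreal (T / real n * (2 * K\<^sup>2))"
   using T by (simp only: ) (rule ennreal_mult, auto)
  then show ?thesis unfolding D_def by (simp only: mult.assoc)
 qed
 finally show ?thesis .
qed

definition euler_const :: real where "euler_const = incr_const * exp (growth_const * T)"

lemma err_bound:
 assumes n: "0 < n" and j: "j <= n"
 shows "err n j + ennreal (incr_const * (T / real n)) <= ennreal (euler_const * (T / real n))"
proof -
 have g0: "0 <= growth_const" unfolding growth_const_def using T by simp
 define b where "b = growth_const * (T / real n)"
 have b0: "0 <= b" unfolding b_def using g0 T by simp
 have "err n j + ennreal (incr_const * (T / real n)) <= ennreal (incr_const * (T / real n)) * (1 + ennreal b) ^ j"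
  by (rule gronwall_ennreal[OF _ j]) (use err_recursion[OF n] in \<open>simp add: b_def\<close>)
 also have "(1 + ennreal b) ^ j = ennreal ((1 + b) ^ j)"
  using b0 by (simp add: ennreal_power[symmetric] flip: ennreal_plus ennreal_1)
 also have "ennreal (incr_const * (T / real n)) * ennreal ((1 + b) ^ j) = ennreal (incr_const * (T / real n) * (1 + b) ^ j)"
  using b0 incr_const_nonneg T by (intro ennreal_mult[symmetric]) auto
 also have "... <= ennreal (euler_const * (T / real n))"
 proof (rule ennreal_leI)
  have "(1 + b) ^ j <= exp b ^ j" using b0 exp_ge_add_one_self[of b] by (intro power_mono) auto
  also have "... = exp (growth_const * \<tau> n j)" by (simp add: exp_of_nat_mult[symmetric] b_def gridt_def mult_ac)
  also have "... <= exp (growth_const * T)" using g0 gridt_range[of T j n] j T by (simp add: mult_left_mono)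
  finally show "incr_const * (T / real n) * (1 + b) ^ j <= euler_const * (T / real n)"
   unfolding euler_const_def using incr_const_nonneg T
   by (simp add: mult_left_mono divide_right_mono mult_ac)
 qed
 finally show ?thesis .
qed

lemma drift_error:
 fixes q q' :: "'v => 'w::euclidean_space"
 assumes q: "continuous_on UNIV q" "!!x. norm x <= R ==> q x = q' x"
  and q': "!!x y. norm (q' x - q' y) <= K * norm (x - y)" "!!x. norm (q' x) <= K"
  and n: "0 < n" and j: "j <= n"
 shows "msq M (%om. (LINT s:{0..\<tau> n j}|lborel. q (X s om)) - (\<Sum>i<j. (T / real n) *\<^sub>R q' (eul n i om)))
  <= ennreal (2 * K\<^sup>2 * T\<^sup>2 * euler_const * (T / real n))"
proof -
 have ec: "0 <= euler_const" unfolding euler_const_def using incr_const_nonneg by simp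
 note drift_distance(2)[OF q q' n j]
 also have "ennreal T * (ennreal (T / real n * (2 * K\<^sup>2)) * (\<Sum>i<j. err n i + ennreal (incr_const * (T / real n))))
  <= ennreal T * (ennreal (T / real n * (2 * K\<^sup>2)) * (\<Sum>i<n. ennreal (euler_const * (T / real n))))"
  using err_bound[OF n] j by (intro mult_left_mono order_trans[OF sum_mono sum_mono2]) auto
 also have "... = ennreal (T * (T / real n * (2 * K\<^sup>2) * (real n * (euler_const * (T / real n)))))"
  unfolding sum_constant card_lessThan ennreal_of_nat_eq_real_of_nat
  using T by (subst ennreal_mult'[symmetric], simp)+ simp
 also have "T * (T / real n * (2 * K\<^sup>2) * (real n * (euler_const * (T / real n)))) = 2 * K\<^sup>2 * T\<^sup>2 * euler_const * (T / real n)"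
  using n by (simp add: power2_eq_square)
 finally show ?thesis .
qed

end

section \<open>Functions of the increments along a grid\<close>

text \<open>A Markov chain driven by the increments of the Wiener process along the grid; it generalizes the Euler scheme so that
additive functionals of the scheme can be carried along in the state.\<close>

primrec chain :: "real => nat => (nat => 's => real^'r => 's) => 's => (real => 'a => real^'r) => nat => 'a => 's" where
 "chain T n \<Phi> s0 W 0 = (%om. s0)"
| "chain T n \<Phi> s0 W (Suc j) = (%om. \<Phi> j (chain T n \<Phi> s0 W j om) (W (gridt T n (Suc j)) om - W (gridt T n j) om))"

context brownian begin

lemma chain_measurable:
 fixes s0 :: "'s::euclidean_space"
 assumes T: "0 <= T" and \<Phi>: "!!j. (%(x, w). \<Phi> j x w) \<in> borel_measurable (borel \<Otimes>\<^sub>M borel)"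
 shows "j <= n ==> chain T n \<Phi> s0 W j \<in> borel_measurable (F (gridt T n j))"
proof (induction j)
 case (Suc j)
 have t: "gridt T n j <= gridt T n (Suc j)" "0 <= gridt T n j" "0 <= gridt T n (Suc j)"
  using gridt_mono[of T j "Suc j" n] gridt_range[of T j n] gridt_range[of T "Suc j" n] Suc.prems T by auto
 have [measurable]: "chain T n \<Phi> s0 W j \<in> borel_measurable (F (gridt T n (Suc j)))"
  using measurable_F_mono[OF t(1) Suc.IH] Suc.prems by auto
 have [measurable]: "W (gridt T n j) \<in> borel_measurable (F (gridt T n (Suc j)))" "W (gridt T n (Suc j)) \<in> borel_measurable (F (gridt T n (Suc j)))"
  using W_F t by auto
 have "(%om. (chain T n \<Phi> s0 W j om, W (gridt T n (Suc j)) om - W (gridt T n j) om)) \<in> F (gridt T n (Suc j)) \<rightarrow>\<^sub>M borel \<Otimes>\<^sub>M borel"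
  by measurable
 from measurable_compose[OF this \<Phi>[of j]] show ?case by simp
qed simp

text \<open>The increment is independent of the past and Gaussian, so the joint law is a product with a factor that does not depend
on the process.\<close>

lemma pair_increment_distr:
 fixes Y :: "'a => 's::euclidean_space"
 assumes st: "0 <= s" "s < t" "t <= T" and Y: "Y \<in> borel_measurable (F s)"
 shows "distr M (borel \<Otimes>\<^sub>M borel) (%om. (Y om, W t om - W s om))
  = distr M borel Y \<Otimes>\<^sub>M density lborel (%x. ennreal (gauss_density (sqrt (t - s)) x))"
proof -
 have d: "distributed M lborel (%om. W t om - W s om) (%x. ennreal (gauss_density (sqrt (t - s)) x))"
  using wiener st unfolding wiener_process_def gauss_density_def by blast
 have Ym[measurable]: "Y \<in> borel_measurable M" using measurable_F_M[OF _ Y] st by auto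
 have Wm[measurable]: "(%om. W t om - W s om) \<in> borel_measurable M" using W_measurable st by auto
 have dd: "density lborel (%x. ennreal (gauss_density (sqrt (t - s)) x)) = distr M borel (%om. W t om - W s om)"
  using distributed_distr_eq_density[OF d] by (simp add: distr_cong[OF refl sets_lborel refl])
 interpret A: prob_space "distr M borel Y" by (rule prob_space_distr) simp
 interpret B: prob_space "distr M borel (%om. W t om - W s om)" by (rule prob_space_distr) simp
 show ?thesis
  unfolding dd
 proof (rule pair_measure_eqI[symmetric])
  show "sigma_finite_measure (distr M borel Y)" "sigma_finite_measure (distr M borel (%om. W t om - W s om))" by unfold_locales
  fix A B assume AB: "A \<in> sets (distr M borel Y)" "B \<in> sets (distr M borel (%om. W t om - W s om))"
  have "prob ((Y -` A \<inter> space M) \<inter> ((%om. W t om - W s om) -` B \<inter> space M)) = prob (Y -` A \<inter> space M) * prob ((%om. W t om - W s om) -` B \<inter> space M)"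
  proof (rule indep_setD[OF indep_increment_sets[OF st]])
   show "Y -` A \<inter> space M \<in> sets (F s)" using measurable_sets[OF Y, of A] AB by simp
  qed (use AB in \<open>auto intro: sigma_sets.Basic\<close>)
  moreover have "(%om. (Y om, W t om - W s om)) -` (A \<times> B) \<inter> space M = (Y -` A \<inter> space M) \<inter> ((%om. W t om - W s om) -` B \<inter> space M)" by auto
  ultimately show "emeasure (distr M borel Y) A * emeasure (distr M borel (%om. W t om - W s om)) B
   = emeasure (distr M (borel \<Otimes>\<^sub>M borel) (%om. (Y om, W t om - W s om))) (A \<times> B)"
   using AB by (simp add: emeasure_distr emeasure_eq_measure ennreal_mult[symmetric])
 qed simp
qed

end

text \<open>Each step maps the joint law of state and increment, which is a product with a fixed Gaussian factor. By induction
the law depends on the update maps only.\<close>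

lemma chain_law:
 fixes s0 :: "'s::euclidean_space"
 assumes W: "brownian M T W" "brownian M T W'" and T: "0 < T" and n: "0 < n"
  and \<Phi>: "!!j. (%(x, w). \<Phi> j x w) \<in> borel_measurable (borel \<Otimes>\<^sub>M borel)"
 shows "j <= n ==> distr M borel (chain T n \<Phi> s0 W j) = distr M borel (chain T n \<Phi> s0 W' j)"
proof (induction j)
 case (Suc j)
 have st: "0 <= gridt T n j" "gridt T n j < gridt T n (Suc j)" "gridt T n (Suc j) <= T"
  using gridt_range[of T j n] gridt_range[of T "Suc j" n] Suc.prems T n by (auto simp: gridt_simps)
 have *: "distr M borel (chain T n \<Phi> s0 W (Suc j)) = distr (distr M borel (chain T n \<Phi> s0 W j)
   \<Otimes>\<^sub>M density lborel (%x. ennreal (gauss_density (sqrt (gridt T n (Suc j) - gridt T n j)) x))) borel (%(x, w). \<Phi> j x w)"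
  if "brownian M T W" for W
 proof -
  interpret brownian M T W by fact
  have c: "chain T n \<Phi> s0 W j \<in> borel_measurable (F (gridt T n j))"
   using Suc.prems T by (intro chain_measurable \<Phi>) auto
  have [measurable]: "chain T n \<Phi> s0 W j \<in> borel_measurable M" using measurable_F_M[OF _ c] st by auto
  have [measurable]: "W (gridt T n j) \<in> borel_measurable M" "W (gridt T n (Suc j)) \<in> borel_measurable M"
   using W_measurable st by auto
  show ?thesis
   unfolding pair_increment_distr[OF st c, symmetric]
   by (subst distr_distr[OF \<Phi>]) (auto simp: comp_def)
 qed
 show ?case unfolding *[OF W(1)] *[OF W(2)] using Suc by simp
qed simp

section \<open>Continuously differentiable maps up to the boundary\<close>

text \<open>Differentiability is required on the open set only, whereas the function and its partial derivatives extend
continuously to the closure.\<close>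

definition C1_on :: "(real^'p) set => (real^'p => 'v::real_normed_vector) => ('p => real^'p => 'v) => bool" where
 "C1_on U f D \<longleftrightarrow> continuous_on (closure U) f \<and> (\<forall>i. continuous_on (closure U) (D i)) \<and>
  (\<forall>x\<in>U. (f has_derivative (%v. \<Sum>i\<in>UNIV. v $ i *\<^sub>R D i x)) (at x))"

lemma C1_onI_cont_diff:
 assumes "cont_diff_closure (Suc l) U f"
 obtains D where "C1_on U f D"
proof -
 have c: "continuous_on (closure U) g" if "cont_diff_closure l U g" for l and g :: "real^'a => 'b"
  using that by (cases l) auto
 show thesis using assms that c unfolding C1_on_def cont_diff_closure.simps by blast
qed

lemma C1_on_const: "C1_on U (%_. k) (%_ _. 0)"
 unfolding C1_on_def by auto

lemma C1_on_add: "C1_on U f D ==> C1_on U g E ==> C1_on U (%x. f x + g x) (%i x. D i x + E i x)"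
 unfolding C1_on_def
 by (auto intro!: continuous_on_add derivative_eq_intros simp: scaleR_right_distrib sum.distrib)

lemma C1_on_linear:
 assumes l: "bounded_linear l" and f: "C1_on U f D"
 shows "C1_on U (%x. l (f x)) (%i x. l (D i x))"
 unfolding C1_on_def
proof (intro conjI allI ballI)
 note lin = bounded_linear.linear[OF l]
 show "continuous_on (closure U) (%x. l (f x))" "continuous_on (closure U) (%x. l (D i x))" for i
  using f unfolding C1_on_def by (auto intro: bounded_linear.continuous_on[OF l])
 fix x assume "x \<in> U"
 then have "(f has_derivative (%v. \<Sum>i\<in>UNIV. v $ i *\<^sub>R D i x)) (at x)" using f unfolding C1_on_def by blast
 from bounded_linear.has_derivative[OF l this]
 show "((%x. l (f x)) has_derivative (%v. \<Sum>i\<in>UNIV. v $ i *\<^sub>R l (D i x))) (at x)"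
  by (simp add: linear_sum[OF lin] linear_cmul[OF lin])
qed

lemma C1_on_diff:
 assumes "C1_on U f D" "C1_on U g E" shows "C1_on U (%x. f x - g x) (%i x. D i x - E i x)"
 using C1_on_add[OF assms(1) C1_on_linear[OF bounded_linear_minus[OF bounded_linear_ident] assms(2)]] by simp

lemma C1_on_sum:
 assumes "finite S" "!!k. k \<in> S ==> C1_on U (f k) (D k)"
 shows "C1_on U (%x. \<Sum>k\<in>S. f k x) (%i x. \<Sum>k\<in>S. D k i x)"
 using assms by (induction S rule: finite_induct) (auto intro: C1_on_const C1_on_add)

lemma C1_on_bilinear:
 assumes b: "bounded_bilinear pr" and f: "C1_on U f D" and g: "C1_on U g E"
 shows "C1_on U (%x. pr (f x) (g x)) (%i x. pr (f x) (E i x) + pr (D i x) (g x))"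
 unfolding C1_on_def
proof (intro conjI allI ballI)
 interpret bounded_bilinear pr by fact
 show "continuous_on (closure U) (%x. pr (f x) (g x))" "continuous_on (closure U) (%x. pr (f x) (E i x) + pr (D i x) (g x))" for i
  using f g unfolding C1_on_def by (auto intro!: continuous_on continuous_on_add)
 fix x assume "x \<in> U"
 then have "(f has_derivative (%v. \<Sum>i\<in>UNIV. v $ i *\<^sub>R D i x)) (at x)" "(g has_derivative (%v. \<Sum>i\<in>UNIV. v $ i *\<^sub>R E i x)) (at x)"
  using f g unfolding C1_on_def by blast+
 from FDERIV[OF this]
 show "((%x. pr (f x) (g x)) has_derivative (%v. \<Sum>i\<in>UNIV. v $ i *\<^sub>R (pr (f x) (E i x) + pr (D i x) (g x)))) (at x)"
  by (simp add: sum_left sum_right scaleR_left scaleR_right sum.distrib scaleR_right_distrib)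
qed

lemma C1_on_bounded:
 assumes f: "C1_on U f D" and U: "bounded U"
 shows "\<exists>K. \<forall>x\<in>closure U. norm (f x) <= K \<and> (\<forall>i. norm (D i x) <= K)"
proof -
 have cl: "compact (closure U)" using U by simp
 have bdd: "\<exists>K. \<forall>x\<in>closure U. norm (g x) <= K" if "continuous_on (closure U) g" for g :: "real^'a => 'b"
  using compact_imp_bounded[OF compact_continuous_image[OF that cl]] unfolding bounded_iff by auto
 obtain K0 where K0: "\<forall>x\<in>closure U. norm (f x) <= K0" using bdd f unfolding C1_on_def by blast
 have "\<forall>i. \<exists>K. \<forall>x\<in>closure U. norm (D i x) <= K" using bdd f unfolding C1_on_def by blast
 then obtain K1 where K1: "!!i x. x \<in> closure U ==> norm (D i x) <= K1 i" by metis
 have "norm (f x) <= max K0 (Max (range K1)) \<and> (\<forall>i. norm (D i x) <= max K0 (Max (range K1)))" if "x \<in> closure U" for x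
 proof (intro conjI allI)
  show "norm (f x) <= max K0 (Max (range K1))" using K0 that by fastforce
  fix i
  have "norm (D i x) <= K1 i" using K1 that by blast
  also have "K1 i <= Max (range K1)" by (rule Max_ge) auto
  finally show "norm (D i x) <= max K0 (Max (range K1))" by simp
 qed
 then show ?thesis by blast
qed

section \<open>Exponential series depending on a parameter\<close>

text \<open>The generator as an element of the Banach space of bounded operators, where its dependence on the parameter can be
differentiated.\<close>

definition superop :: "complex^'d^'d => ('r::finite => complex^'d^'d) => (complex^'d^'d) \<Rightarrow>\<^sub>L (complex^'d^'d)" where
 "superop H Ls = Blinfun (lindblad H Ls)"

lemma superop_apply: "blinfun_apply (superop H Ls) A = lindblad H Ls A"
 unfolding superop_def by (simp add: bounded_linear_Blinfun_apply[OF bounded_linear_lindblad])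

definition lmul :: "complex^'d^'d => (complex^'d^'d) \<Rightarrow>\<^sub>L (complex^'d^'d)" where "lmul A = Blinfun (%X. A ** X)"
definition rmul :: "complex^'d^'d => (complex^'d^'d) \<Rightarrow>\<^sub>L (complex^'d^'d)" where "rmul A = Blinfun (%X. X ** A)"

lemma lmul_apply: "blinfun_apply (lmul A) X = A ** X" and rmul_apply: "blinfun_apply (rmul A) X = X ** A"
 unfolding lmul_def rmul_def by (simp_all add: bounded_linear_Blinfun_apply bl_mult_left bl_mult_right)

lemma bounded_linear_lmul: "bounded_linear (lmul :: complex^'d^'d => _)"
 using bounded_bilinear.bounded_linear_prod_right[OF bounded_bilinear_matrix_mult]
 by (rule back_subst[of bounded_linear]) (auto intro!: ext blinfun_eqI simp: lmul_apply bounded_bilinear.prod_right.rep_eq[OF bounded_bilinear_matrix_mult])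

lemma bounded_linear_rmul: "bounded_linear (rmul :: complex^'d^'d => _)"
 using bounded_bilinear.bounded_linear_prod_left[OF bounded_bilinear_matrix_mult]
 by (rule back_subst[of bounded_linear]) (auto intro!: ext blinfun_eqI simp: rmul_apply bounded_bilinear.prod_left.rep_eq[OF bounded_bilinear_matrix_mult])

text \<open>Left and right multiplications depend linearly on the matrix, so this form reduces differentiability of the generator
to the rules for linear and bilinear maps.\<close>

lemma superop_decompose:
 "superop H Ls = (lmul (mat (- \<i>)) o\<^sub>L (lmul H - rmul H)) +
  (\<Sum>k\<in>UNIV. (rmul (ctranspose (Ls k)) o\<^sub>L lmul (Ls k)) - (1/2) *\<^sub>R (lmul (ctranspose (Ls k) ** Ls k) + rmul (ctranspose (Ls k) ** Ls k)))"
 by (rule blinfun_eqI)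
  (simp add: superop_apply lindblad_def commutator_def anticommutator_def lmul_apply rmul_apply
   blinfun.add_left blinfun.diff_left blinfun.sum_left blinfun.scaleR_left)

lemma superop_C1:
 fixes H :: "real^'p => complex^'d^'d" and L :: "real^'p => 'r::finite => complex^'d^'d"
 assumes H: "C1_on U H DH" and L: "!!k. C1_on U (%\<theta>. L \<theta> k) (DL k)"
 obtains D where "C1_on U (%\<theta>. superop (H \<theta>) (L \<theta>)) D"
proof -
 note bb = bounded_bilinear_blinfun_compose
 note LL = C1_on_bilinear[OF bounded_bilinear_matrix_mult C1_on_linear[OF bounded_linear_ctranspose L] L]
 show thesis
  apply (rule that)
  apply (unfold superop_decompose)
  apply (rule C1_on_add[OF C1_on_bilinear[OF bb C1_on_const C1_on_diff[OF C1_on_linear[OF bounded_linear_lmul H] C1_on_linear[OF bounded_linear_rmul H]]]])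
  apply (rule C1_on_sum[OF finite])
  apply (rule C1_on_diff)
  apply (rule C1_on_bilinear[OF bb C1_on_linear[OF bounded_linear_rmul C1_on_linear[OF bounded_linear_ctranspose L]] C1_on_linear[OF bounded_linear_lmul L]])
  apply (rule C1_on_linear[OF bounded_linear_scaleR_right C1_on_add[OF C1_on_linear[OF bounded_linear_lmul LL] C1_on_linear[OF bounded_linear_rmul LL]]])
  done
qed

primrec iter_state :: "(real^'p => 'v::euclidean_space \<Rightarrow>\<^sub>L 'v) => 'v => nat => real^'p => 'v" where
 "iter_state B x0 0 = (%\<theta>. x0)"
| "iter_state B x0 (Suc n) = (%\<theta>. blinfun_apply (B \<theta>) (iter_state B x0 n \<theta>))"

text \<open>The formal derivative of the iterates given by the product rule.\<close>

primrec iter_deriv :: "(real^'p => 'v::euclidean_space \<Rightarrow>\<^sub>L 'v) => ('p => real^'p => 'v \<Rightarrow>\<^sub>L 'v) => 'v => nat => 'p => real^'p => 'v" where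
 "iter_deriv B D x0 0 = (%i \<theta>. 0)"
| "iter_deriv B D x0 (Suc n) = (%i \<theta>. blinfun_apply (B \<theta>) (iter_deriv B D x0 n i \<theta>) + blinfun_apply (D i \<theta>) (iter_state B x0 n \<theta>))"

lemma iter_state_C1:
 assumes "C1_on U B D"
 shows "C1_on U (iter_state B x0 n) (iter_deriv B D x0 n)"
 by (induction n) (use C1_on_bilinear[OF bounded_bilinear_blinfun_apply assms] in \<open>simp_all add: C1_on_const\<close>)

lemma iter_state_bound:
 assumes K: "norm (B \<theta>) <= K" "!!i. norm (D i \<theta>) <= K" "1 <= K"
 shows "norm (iter_state B x0 n \<theta>) <= norm x0 * K ^ n" "norm (iter_deriv B D x0 n i \<theta>) <= norm x0 * (2 * K) ^ n"
proof -
 have 1: "norm (iter_state B x0 n \<theta>) <= norm x0 * K ^ n" for n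
 proof (induction n)
  case (Suc n)
  have "norm (iter_state B x0 (Suc n) \<theta>) <= norm (B \<theta>) * norm (iter_state B x0 n \<theta>)" by (simp add: norm_blinfun)
  also have "... <= K * (norm x0 * K ^ n)" using K Suc by (intro mult_mono) auto
  finally show ?case by (simp add: mult_ac)
 qed simp
 then show "norm (iter_state B x0 n \<theta>) <= norm x0 * K ^ n" .
 show "norm (iter_deriv B D x0 n i \<theta>) <= norm x0 * (2 * K) ^ n"
 proof (induction n)
  case (Suc n)
  have "norm (iter_deriv B D x0 (Suc n) i \<theta>) <= norm (B \<theta>) * norm (iter_deriv B D x0 n i \<theta>) + norm (D i \<theta>) * norm (iter_state B x0 n \<theta>)"
   by (simp, rule order_trans[OF norm_triangle_ineq]) (intro add_mono norm_blinfun)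
  also have "... <= K * (norm x0 * (2 * K) ^ n) + K * (norm x0 * (2 * K) ^ n)"
  proof (intro add_mono mult_mono K Suc)
   have "K ^ n <= (2 * K) ^ n" using K(3) by (intro power_mono) auto
   then show "norm (iter_state B x0 n \<theta>) <= norm x0 * (2 * K) ^ n" using 1[of n] by (meson mult_left_mono norm_ge_zero order_trans)
  qed (use K in auto)
  finally show ?case by (simp add: mult_ac)
 qed simp
qed

lemma abs_power_diff_le:
 assumes "\<bar>s\<bar> <= B" "\<bar>t\<bar> <= B" "1 <= (B::real)"
 shows "\<bar>t ^ n - s ^ n\<bar> <= real n * B ^ n * \<bar>t - s\<bar>"
proof (induction n)
 case (Suc n)
 have "t ^ Suc n - s ^ Suc n = t * (t ^ n - s ^ n) + (t - s) * s ^ n" by (simp add: algebra_simps)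
 also have "\<bar>...\<bar> <= \<bar>t\<bar> * \<bar>t ^ n - s ^ n\<bar> + \<bar>t - s\<bar> * \<bar>s\<bar> ^ n"
  by (rule order_trans[OF abs_triangle_ineq]) (simp add: abs_mult power_abs)
 also have "... <= B * (real n * B ^ n * \<bar>t - s\<bar>) + \<bar>t - s\<bar> * B ^ Suc n"
 proof (intro add_mono mult_mono Suc assms mult_left_mono)
  have "\<bar>s\<bar> ^ n <= B ^ n" using assms by (intro power_mono) auto
  also have "... <= B ^ Suc n" using assms by (intro power_increasing) auto
  finally show "\<bar>s\<bar> ^ n <= B ^ Suc n" .
 qed (use assms in auto)
 finally show ?case by (simp add: algebra_simps)
qed simp

text \<open>A common summable weight for the time coefficients $t^n/n!$ and for their increments in time.\<close>

definition wt :: "real => nat => real" where "wt T n = (2 * (1 + T)) ^ n / fact n"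

lemma wt_nonneg: "0 <= T ==> 0 <= wt T n"
 unfolding wt_def by simp

lemma wt_summable: "summable (%n. wt T n * (C * K ^ n))"
proof -
 have "summable (%n. C * (inverse (fact n) * (2 * (1 + T) * K) ^ n))"
  by (intro summable_mult summable_exp)
 then show ?thesis by (simp add: wt_def power_mult_distrib divide_inverse mult_ac)
qed

text \<open>The coefficients and their Lipschitz constants in time grow like $T^n/n!$; the cruder weight \<open>wt\<close> dominates both
and is still summable against any geometric sequence.\<close>

lemma coeff_bounds:
 assumes "t \<in> {0..T}" "s \<in> {0..T}"
 shows "\<bar>t ^ n / fact n\<bar> <= wt T n" "\<bar>t ^ n / fact n - s ^ n / fact n\<bar> <= wt T n * \<bar>t - s\<bar>"
proof -
 have n2: "real n <= 2 ^ n" using of_nat_less_two_power[of n, where 'a=real] by simp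
 have "\<bar>t\<bar> ^ n <= (2 * (1 + T)) ^ n" using assms by (intro power_mono) auto
 then show "\<bar>t ^ n / fact n\<bar> <= wt T n" unfolding wt_def by (simp add: divide_right_mono power_abs)
 have "\<bar>t ^ n - s ^ n\<bar> <= real n * (1 + T) ^ n * \<bar>t - s\<bar>" by (rule abs_power_diff_le) (use assms in auto)
 also have "... <= 2 ^ n * (1 + T) ^ n * \<bar>t - s\<bar>" using n2 assms by (intro mult_right_mono) auto
 finally have "\<bar>t ^ n - s ^ n\<bar> <= (2 * (1 + T)) ^ n * \<bar>t - s\<bar>" by (simp only: power_mult_distrib)
 then have "\<bar>t ^ n - s ^ n\<bar> / fact n <= (2 * (1 + T)) ^ n * \<bar>t - s\<bar> / fact n" by (rule divide_right_mono) simp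
 then show "\<bar>t ^ n / fact n - s ^ n / fact n\<bar> <= wt T n * \<bar>t - s\<bar>"
  unfolding wt_def by (simp add: diff_divide_distrib[symmetric] abs_divide)
qed

text \<open>A power series in time with coefficients depending on a parameter, such as the exponential series of a generator.\<close>

definition pser :: "(nat => 'x => 'v::banach) => real => 'x => 'v" where
 "pser y t x = (\<Sum>n. (t ^ n / fact n) *\<^sub>R y n x)"

lemma pser_summable:
 fixes y :: "nat => 'x => 'v::banach"
 assumes b: "!!n. norm (y n x) <= C * K ^ n" and t: "t \<in> {0..T}"
 shows "summable (%n. (t ^ n / fact n) *\<^sub>R y n x)" "summable (%n. wt T n * norm (y n x))"
  "norm (pser y t x) <= (\<Sum>n. wt T n * norm (y n x))"
  "s \<in> {0..T} ==> norm (pser y t x - pser y s x) <= (\<Sum>n. wt T n * norm (y n x)) * \<bar>t - s\<bar>"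
proof -
 have T: "0 <= T" using t by auto
 show w: "summable (%n. wt T n * norm (y n x))"
  by (rule summable_comparison_test'[OF wt_summable[of T C K]]) (use b wt_nonneg[OF T] in \<open>auto simp: abs_mult intro!: mult_left_mono\<close>)
 have le: "norm ((t ^ n / fact n) *\<^sub>R y n x) <= wt T n * norm (y n x)" if "t \<in> {0..T}" for t n
  unfolding norm_scaleR using coeff_bounds(1)[OF that that] by (intro mult_right_mono) auto
 have s1: "summable (%n. (t ^ n / fact n) *\<^sub>R y n x)" if "t \<in> {0..T}" for t
  by (rule summable_comparison_test'[OF w]) (use le[OF that] in auto)
 then show "summable (%n. (t ^ n / fact n) *\<^sub>R y n x)" using t by blast
 have gen: "norm (suminf f) <= (\<Sum>n. wt T n * norm (y n x)) * c" if "!!n. norm (f n) <= wt T n * norm (y n x) * c" "summable f" for f :: "nat => 'v" and c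
 proof -
  have sc: "summable (%n. wt T n * norm (y n x) * c)" using w by (rule summable_mult2)
  have sn: "summable (%n. norm (f n))" by (rule summable_comparison_test'[OF sc]) (use that in auto)
  have "norm (suminf f) <= (\<Sum>n. norm (f n))" by (rule summable_norm[OF sn])
  also have "... <= (\<Sum>n. wt T n * norm (y n x) * c)" by (rule suminf_le[OF that(1) sn sc])
  also have "... = (\<Sum>n. wt T n * norm (y n x)) * c" using w by (rule suminf_mult2[symmetric])
  finally show ?thesis .
 qed
 show "norm (pser y t x) <= (\<Sum>n. wt T n * norm (y n x))"
  unfolding pser_def using gen[of "%n. (t ^ n / fact n) *\<^sub>R y n x" 1] le[OF t] s1[OF t] by simp
 assume s: "s \<in> {0..T}"
 have "pser y t x - pser y s x = (\<Sum>n. (t ^ n / fact n - s ^ n / fact n) *\<^sub>R y n x)"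
  unfolding pser_def using suminf_diff[OF s1[OF t] s1[OF s]] by (simp add: scaleR_left_diff_distrib)
 also have "norm ... <= (\<Sum>n. wt T n * norm (y n x)) * \<bar>t - s\<bar>"
 proof (rule gen)
  show "summable (%n. (t ^ n / fact n - s ^ n / fact n) *\<^sub>R y n x)"
   using summable_diff[OF s1[OF t] s1[OF s]] by (simp add: scaleR_left_diff_distrib)
  fix n
  have "norm ((t ^ n / fact n - s ^ n / fact n) *\<^sub>R y n x) <= (wt T n * \<bar>t - s\<bar>) * norm (y n x)"
   unfolding norm_scaleR using coeff_bounds(2)[OF t s] by (intro mult_right_mono) auto
  then show "norm ((t ^ n / fact n - s ^ n / fact n) *\<^sub>R y n x) <= wt T n * norm (y n x) * \<bar>t - s\<bar>" by (simp add: mult_ac)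
 qed
 finally show "norm (pser y t x - pser y s x) <= (\<Sum>n. wt T n * norm (y n x)) * \<bar>t - s\<bar>" .
qed

lemma pser_diff:
 fixes y :: "nat => 'x => 'v::banach"
 assumes "!!n. norm (y n x) <= C * K ^ n" "!!n. norm (y n z) <= C * K ^ n" "t \<in> {0..T}"
 shows "pser y t x - pser y t z = pser (%n _. y n x - y n z) t ()"
 unfolding pser_def
 using suminf_diff[OF pser_summable(1)[where y=y and x=x, OF assms(1,3)] pser_summable(1)[where y=y and x=z, OF assms(2,3)]]
 by (simp add: scaleR_right_diff_distrib)

lemma pser_continuous:
 fixes y :: "nat => 'x::topological_space => 'v::banach"
 assumes b: "!!n x. x \<in> S ==> norm (y n x) <= C * K ^ n" and c: "!!n. continuous_on S (y n)" and t: "t \<in> {0..T}"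
 shows "continuous_on S (pser y t)"
proof (rule uniform_limit_theorem[OF _ _ trivial_limit_sequentially])
 have T: "0 <= T" using t by auto
 show "uniform_limit S (%n x. \<Sum>i<n. (t ^ i / fact i) *\<^sub>R y i x) (pser y t) sequentially"
  unfolding pser_def[abs_def]
 proof (rule Weierstrass_m_test[OF _ wt_summable[of T C K]])
  show "norm ((t ^ n / fact n) *\<^sub>R y n x) <= wt T n * (C * K ^ n)" if "x \<in> S" for n x
   unfolding norm_scaleR using coeff_bounds(1)[OF t t] b[OF that] wt_nonneg[OF T] by (intro mult_mono) auto
 qed
 show "\<forall>\<^sub>F n in sequentially. continuous_on S (%x. \<Sum>i<n. (t ^ i / fact i) *\<^sub>R y i x)"
  using c by (intro always_eventually allI continuous_intros)
qed

text \<open>Summing the bounds for the coefficients yields a modulus in the parameter that is uniform in time and still vanishes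
continuously at the base point.\<close>

lemma pser_modulus_continuous:
 fixes y :: "nat => 'x::topological_space => 'v::banach"
 assumes b: "!!n x. x \<in> S ==> norm (y n x) <= C * K ^ n" and c: "!!n. continuous_on S (y n)" and z: "z \<in> S" and T: "0 <= T"
 shows "continuous_on S (%x. \<Sum>n. wt T n * norm (y n x - y n z))"
proof (rule uniform_limit_theorem[OF _ _ trivial_limit_sequentially])
 show "uniform_limit S (%n x. \<Sum>i<n. wt T i * norm (y i x - y i z)) (%x. \<Sum>n. wt T n * norm (y n x - y n z)) sequentially"
 proof (rule Weierstrass_m_test[OF _ wt_summable[of T "2 * C" K]])
  show "norm (wt T n * norm (y n x - y n z)) <= wt T n * (2 * C * K ^ n)" if "x \<in> S" for n x
  proof -
   have "norm (y n x - y n z) <= 2 * C * K ^ n"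
    using norm_triangle_ineq4[of "y n x" "y n z"] b[OF that, of n] b[OF z, of n] by simp
   then show ?thesis using wt_nonneg[OF T, of n] by (simp add: abs_mult mult_left_mono)
  qed
 qed
 show "\<forall>\<^sub>F n in sequentially. continuous_on S (%x. \<Sum>i<n. wt T i * norm (y i x - y i z))"
  using c by (intro always_eventually allI continuous_intros)
qed

text \<open>Termwise differentiation: the series of derivatives converges uniformly on the set by the Weierstrass test.\<close>

lemma pser_has_derivative:
 fixes y :: "nat => real^'p => 'v::banach"
 assumes U: "open U" "convex U" and y: "!!n. C1_on U (y n) (Dy n)"
  and b: "!!n x. x \<in> U ==> norm (y n x) <= C * K ^ n" "!!n i x. x \<in> U ==> norm (Dy n i x) <= C * K ^ n"
  and t: "t \<in> {0..T}" and x: "x \<in> U"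
 shows "(pser y t has_derivative (%v. \<Sum>i\<in>UNIV. v $ i *\<^sub>R pser (%n. Dy n i) t x)) (at x)"
proof -
 have T: "0 <= T" using t by auto
 define f' where "f' n x v = (t ^ n / fact n) *\<^sub>R (\<Sum>i\<in>UNIV. v $ i *\<^sub>R Dy n i x)" for n x v
 define g' where "g' x v = (\<Sum>i\<in>UNIV. v $ i *\<^sub>R pser (%n. Dy n i) t x)" for x v
 have d: "((%x. (t ^ n / fact n) *\<^sub>R y n x) has_derivative f' n x) (at x within U)" if "x \<in> U" for n x
  using y[of n] that unfolding C1_on_def f'_def by (auto intro!: has_derivative_scaleR_right intro: has_derivative_at_withinI)
 have unif: "uniform_limit U (%n x. \<Sum>m<n. (t ^ m / fact m) *\<^sub>R Dy m i x) (pser (%n. Dy n i) t) sequentially" for i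
  unfolding pser_def[abs_def]
 proof (rule Weierstrass_m_test[OF _ wt_summable[of T C K]])
  show "norm ((t ^ n / fact n) *\<^sub>R Dy n i x) <= wt T n * (C * K ^ n)" if "x \<in> U" for n x
   unfolding norm_scaleR using coeff_bounds(1)[OF t t] b(2)[OF that] wt_nonneg[OF T] by (intro mult_mono) auto
 qed
 have "\<exists>g. \<forall>x\<in>U. (%n. (t ^ n / fact n) *\<^sub>R y n x) sums (g x) \<and> (g has_derivative g' x) (at x within U)"
 proof (rule has_derivative_series[OF U(2) d _ x summable_sums])
  show "summable (%n. (t ^ n / fact n) *\<^sub>R y n x)" by (rule pser_summable(1)[where y=y and x=x, OF b(1)[OF x] t])
  fix e :: real assume e: "0 < e"
  define e' where "e' = e / real CARD('p)"
  have e': "0 < e'" unfolding e'_def using e by simp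
  have "\<forall>\<^sub>F n in sequentially. \<forall>i\<in>UNIV. \<forall>x\<in>U. dist (\<Sum>m<n. (t ^ m / fact m) *\<^sub>R Dy m i x) (pser (%n. Dy n i) t x) < e'"
   using uniform_limitD[OF unif e'] by (subst eventually_ball_finite_distrib) auto
  then show "\<forall>\<^sub>F n in sequentially. \<forall>x\<in>U. \<forall>v. norm ((\<Sum>m<n. f' m x v) - g' x v) <= e * norm v"
  proof eventually_elim
   case (elim n)
   show ?case
   proof (intro ballI allI)
    fix x v assume x: "x \<in> U"
    have "(\<Sum>m<n. f' m x v) - g' x v = (\<Sum>i\<in>UNIV. v $ i *\<^sub>R ((\<Sum>m<n. (t ^ m / fact m) *\<^sub>R Dy m i x) - pser (%n. Dy n i) t x))"
    proof -
     have "(\<Sum>m<n. f' m x v) = (\<Sum>i\<in>UNIV. \<Sum>m<n. v $ i *\<^sub>R ((t ^ m / fact m) *\<^sub>R Dy m i x))"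
      unfolding f'_def scaleR_sum_right by (subst sum.swap) (simp add: mult.commute)
     then show ?thesis unfolding g'_def by (simp add: scaleR_diff_right scaleR_sum_right sum_subtractf)
    qed
    also have "norm ... <= (\<Sum>i\<in>(UNIV::'p set). norm v * e')"
    proof (intro sum_norm_le)
     fix i
     show "norm (v $ i *\<^sub>R ((\<Sum>m<n. (t ^ m / fact m) *\<^sub>R Dy m i x) - pser (%n. Dy n i) t x)) <= norm v * e'"
      unfolding norm_scaleR using elim[rule_format, of i x] x component_le_norm_cart[of v i] e'
      by (intro mult_mono) (auto simp: dist_norm)
    qed
    also have "... = e * norm v" unfolding e'_def by simp
    finally show "norm ((\<Sum>m<n. f' m x v) - g' x v) <= e * norm v" .
   qed
  qed
 qed
 then obtain g where g: "!!x. x \<in> U ==> (%n. (t ^ n / fact n) *\<^sub>R y n x) sums (g x)" "!!x. x \<in> U ==> (g has_derivative g' x) (at x within U)"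
  by blast
 have eq: "g x = pser y t x" if "x \<in> U" for x unfolding pser_def using g(1)[OF that] by (rule sums_unique)
 have "(g has_derivative g' x) (at x)" using g(2)[OF x] at_within_open[OF x U(1)] by simp
 then have "(pser y t has_derivative g' x) (at x)"
  by (rule has_derivative_transform_within_open[OF _ U(1) x]) (rule eq)
 then show ?thesis unfolding g'_def .
qed

section \<open>Riemann sums and summation by parts\<close>

lemma lipschitz_continuous:
 fixes f :: "real => 'v::real_normed_vector"
 assumes "!!s t. s \<in> S ==> t \<in> S ==> norm (f t - f s) <= A * \<bar>t - s\<bar>"
 shows "continuous_on S f"
proof (rule lipschitz_on_continuous_on[where L="\<bar>A\<bar>"], rule lipschitz_onI)
 fix s t assume "s \<in> S" "t \<in> S"
 then have "norm (f s - f t) <= A * \<bar>s - t\<bar>" using assms by blast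
 also have "... <= \<bar>A\<bar> * \<bar>s - t\<bar>" by (intro mult_right_mono) auto
 finally show "dist (f s) (f t) <= \<bar>A\<bar> * dist s t" by (simp add: dist_norm)
qed simp

lemma cell_error:
 fixes f :: "real => 'v::euclidean_space"
 assumes T: "0 < T" and f: "!!s t. s \<in> {0..T} ==> t \<in> {0..T} ==> norm (f t - f s) <= A * \<bar>t - s\<bar>" and A: "0 <= A"
  and n: "0 < n" and j: "j < n"
 shows "norm ((LINT u:{0..gridt T n (Suc j)}|lborel. f u) - (LINT u:{0..gridt T n j}|lborel. f u) - (T / real n) *\<^sub>R f (gridt T n j)) <= A * (T / real n)\<^sup>2"
proof -
 have r: "gridt T n j \<in> {0..T}" "gridt T n (Suc j) \<in> {0..T}" "gridt T n (Suc j) - gridt T n j = T / real n"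
  using gridt_range[of T j n] gridt_range[of T "Suc j" n] j T by (auto simp: gridt_simps)
 have le: "gridt T n j <= gridt T n (Suc j)" using r(3) T by (metis diff_ge_0_iff_ge divide_nonneg_nonneg less_imp_le of_nat_0_le_iff)
 have "continuous_on {0..gridt T n (Suc j)} f" using r by (intro lipschitz_continuous[where A=A] f) auto
 moreover have "norm (f u - f (gridt T n j)) <= A * (T / real n)" if "gridt T n j <= u" "u <= gridt T n (Suc j)" for u
 proof -
  have "norm (f u - f (gridt T n j)) <= A * \<bar>u - gridt T n j\<bar>" using that r by (intro f) auto
  also have "... <= A * (T / real n)" using that r(3) A by (intro mult_left_mono) auto
  finally show ?thesis .
 qed
 ultimately have "norm ((LINT u:{0..gridt T n (Suc j)}|lborel. f u) - (LINT u:{0..gridt T n j}|lborel. f u) - (gridt T n (Suc j) - gridt T n j) *\<^sub>R f (gridt T n j))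
  <= A * (T / real n) * (gridt T n (Suc j) - gridt T n j)"
  using r le by (intro set_integral_increment) auto
 then show ?thesis unfolding r(3) by (simp add: power2_eq_square mult.assoc)
qed

lemma riemann_error:
 fixes f :: "real => 'v::euclidean_space"
 assumes T: "0 < T" and f: "!!s t. s \<in> {0..T} ==> t \<in> {0..T} ==> norm (f t - f s) <= A * \<bar>t - s\<bar>" and A: "0 <= A"
  and n: "0 < n"
 shows "norm ((LINT u:{0..T}|lborel. f u) - (\<Sum>j<n. (T / real n) *\<^sub>R f (gridt T n j))) <= A * T * (T / real n)"
proof -
 define P where "P j = (LINT u:{0..gridt T n j}|lborel. f u)" for j
 have "P 0 = 0" unfolding P_def gridt_simps by (rule set_integral_point)
 then have "(LINT u:{0..T}|lborel. f u) = (\<Sum>j<n. P (Suc j) - P j)"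
  unfolding sum_lessThan_telescope by (simp add: P_def gridt_simps n)
 then have "norm ((LINT u:{0..T}|lborel. f u) - (\<Sum>j<n. (T / real n) *\<^sub>R f (gridt T n j))) = norm (\<Sum>j<n. P (Suc j) - P j - (T / real n) *\<^sub>R f (gridt T n j))"
  by (simp add: sum_subtractf)
 also have "... <= (\<Sum>j<n. A * (T / real n)\<^sup>2)"
  unfolding P_def by (intro sum_norm_le cell_error T f A n) auto
 also have "... = A * T * (T / real n)" using n by (simp add: power2_eq_square)
 finally show ?thesis .
qed

lemma summation_by_parts:
 fixes q z :: "nat => 'v::real_inner"
 shows "(\<Sum>j<n. q j \<bullet> (z (Suc j) - z j)) = q n \<bullet> z n - q 0 \<bullet> z 0 - (\<Sum>j<n. (q (Suc j) - q j) \<bullet> z (Suc j))"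
 by (induction n) (simp_all add: inner_diff_left inner_diff_right)

text \<open>The size of a path as it enters after summation by parts: its end value plus its average over the grid. It replaces the
supremum of the path, and its expectation is bounded by second moments at fixed times.\<close>

definition fluct :: "nat => (nat => 'v::real_normed_vector) => real" where
 "fluct n z = norm (z n) + (1 / real n) * (\<Sum>j<n. norm (z (Suc j)))"

lemma fluct_nonneg: "0 <= fluct n z"
 unfolding fluct_def by (simp add: sum_nonneg)

text \<open>Summation by parts moves the differences from the rough path to the Lipschitz coefficients; each of the \<open>n\<close>
differences is of order $T/n$.\<close>

lemma grid_sum_bound:
 fixes q z :: "nat => 'v::real_inner"
 assumes z0: "z 0 = 0" and A: "norm (q n) <= A" "!!j. j < n ==> norm (q (Suc j) - q j) <= A * (T / real n)" and T: "0 < T" and n: "0 < n"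
 shows "\<bar>\<Sum>j<n. q j \<bullet> (z (Suc j) - z j)\<bar> <= A * (1 + T) * fluct n z"
proof -
 have A0: "0 <= A" using A(1) norm_ge_zero order_trans by blast
 define Sg where "Sg = (1 / real n) * (\<Sum>j<n. norm (z (Suc j)))"
 have Sg0: "0 <= Sg" unfolding Sg_def by (simp add: sum_nonneg)
 have "\<bar>\<Sum>j<n. q j \<bullet> (z (Suc j) - z j)\<bar> <= \<bar>q n \<bullet> z n\<bar> + \<bar>\<Sum>j<n. (q (Suc j) - q j) \<bullet> z (Suc j)\<bar>"
  unfolding summation_by_parts z0 by simp
 also have "... <= A * norm (z n) + (\<Sum>j<n. A * (T / real n) * norm (z (Suc j)))"
  by (intro add_mono order_trans[OF Cauchy_Schwarz_ineq2] mult_right_mono A order_trans[OF sum_abs] sum_mono) (auto intro: A)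
 also have "... = A * norm (z n) + A * T * Sg" unfolding Sg_def by (simp add: sum_distrib_left mult_ac)
 also have "... <= A * (1 + T) * (norm (z n) + Sg)"
  using A0 T Sg0 by (simp add: algebra_simps)
 finally show ?thesis unfolding fluct_def Sg_def .
qed

text \<open>The identity behind the contrast: \<open>a\<close> and \<open>b\<close> are the signals under the candidate and the true parameter, \<open>d\<close> is the mesh,
and the observed increment is the sum of a fluctuation \<open>z\<close>, a discretization error \<open>r\<close> and the signal.\<close>

lemma complete_the_square:
 fixes a b :: "'v::real_inner"
 shows "a \<bullet> (z + r + d *\<^sub>R b) - 1/2 * (d * (norm a)\<^sup>2) - (b \<bullet> (z + r + d *\<^sub>R b) - 1/2 * (d * (norm b)\<^sup>2))
  = (a - b) \<bullet> z + (a - b) \<bullet> r - 1/2 * (d * (norm (a - b))\<^sup>2)"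
proof -
 have n: "(norm (a - b))\<^sup>2 = (norm a)\<^sup>2 - 2 * (a \<bullet> b) + (norm b)\<^sup>2"
  unfolding power2_norm_eq_inner by (simp add: inner_diff_left inner_diff_right inner_commute)
 have l: "a \<bullet> (z + r + d *\<^sub>R b) = a \<bullet> z + a \<bullet> r + d * (a \<bullet> b)" "b \<bullet> (z + r + d *\<^sub>R b) = b \<bullet> z + b \<bullet> r + d * (norm b)\<^sup>2"
  by (simp_all add: inner_add_right power2_norm_eq_inner)
 show ?thesis unfolding n l inner_diff_left by (simp add: field_simps)
qed

section \<open>Consistency of the contrast maximizer\<close>

text \<open>A deterministic signal with time-Lipschitz parameter gradients \<open>g\<close>. The last bound on the modulus \<open>om\<close> says that the
gradient at a parameter differs from that at \<open>\<theta>0\<close> by a function of time that is small in Lipschitz norm; this is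
what lets summation by parts absorb the nonlinearity of the score.\<close>

locale regular_signal =
 fixes T :: real and U :: "(real^'p) set" and \<theta>0 :: "real^'p" and h :: "real => real^'p => real^'r"
  and g :: "'p => real => real^'p => real^'r" and C :: real and om :: "real^'p => real"
 assumes T: "0 < T" and U: "open U" "bounded U" and \<theta>0: "\<theta>0 \<in> U"
  and h_lip: "!!\<theta> s t. \<theta> \<in> closure U ==> s \<in> {0..T} ==> t \<in> {0..T} ==> norm (h t \<theta> - h s \<theta>) <= C * \<bar>t - s\<bar>"
  and h_bdd: "!!\<theta> t. \<theta> \<in> closure U ==> t \<in> {0..T} ==> norm (h t \<theta>) <= C"
  and h_cont: "!!t. t \<in> {0..T} ==> continuous_on (closure U) (h t)"
  and g_lip: "!!i \<theta> s t. \<theta> \<in> closure U ==> s \<in> {0..T} ==> t \<in> {0..T} ==> norm (g i t \<theta> - g i s \<theta>) <= C * \<bar>t - s\<bar>"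
  and g_bdd: "!!i \<theta> t. \<theta> \<in> closure U ==> t \<in> {0..T} ==> norm (g i t \<theta>) <= C"
  and g_mod: "!!i \<theta> t. \<theta> \<in> closure U ==> t \<in> {0..T} ==> norm (g i t \<theta> - g i t \<theta>0) <= om \<theta>"
   "!!i \<theta> s t. \<theta> \<in> closure U ==> s \<in> {0..T} ==> t \<in> {0..T} ==>
    norm ((g i t \<theta> - g i t \<theta>0) - (g i s \<theta> - g i s \<theta>0)) <= om \<theta> * \<bar>t - s\<bar>"
  and om: "continuous_on (closure U) om" "om \<theta>0 = 0"
  and deriv: "!!\<theta> t. \<theta> \<in> U ==> t \<in> {0..T} ==> (h t has_derivative (%v. \<Sum>i\<in>UNIV. v $ i *\<^sub>R g i t \<theta>)) (at \<theta>)"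
  and ident: "!!\<theta>. \<theta> \<in> closure U ==> \<theta> ~= \<theta>0 ==> \<exists>t\<in>{0..T}. h t \<theta> ~= h t \<theta>0"
begin

abbreviation "\<tau> \<equiv> gridt T"

lemma \<theta>0_cl: "\<theta>0 \<in> closure U" using \<theta>0 closure_subset by blast

lemma C0: "0 <= C" using order_trans[OF norm_ge_zero h_bdd[OF \<theta>0_cl, of 0]] T by simp

lemma tau_in: "j <= n ==> \<tau> n j \<in> {0..T}" using gridt_range[of T j n] T by auto

text \<open>The fluctuation of a record around the integrated signal of the true parameter.\<close>

definition fl :: "(real => real^'r) => real => real^'r" where
 "fl y t = y t - (LINT s:{0..t}|lborel. h s \<theta>0)"

text \<open>The squared distance between the signals of a parameter and of the true one; identifiability means that it vanishes only
at the truth. The discrete version \<open>sepn\<close> is its Riemann sum.\<close>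

definition sep :: "real^'p => real" where
 "sep \<theta> = (LINT s:{0..T}|lborel. (norm (h s \<theta> - h s \<theta>0))\<^sup>2)"

definition sepn :: "nat => real^'p => real" where
 "sepn n \<theta> = (\<Sum>j<n. (T / real n) * (norm (h (\<tau> n j) \<theta> - h (\<tau> n j) \<theta>0))\<^sup>2)"

definition rem :: "nat => nat => real^'r" where
 "rem n j = (LINT s:{0..\<tau> n (Suc j)}|lborel. h s \<theta>0) - (LINT s:{0..\<tau> n j}|lborel. h s \<theta>0) - (T / real n) *\<^sub>R h (\<tau> n j) \<theta>0"

lemma rem_bound: "j < n ==> norm (rem n j) <= C * (T / real n)\<^sup>2"
 unfolding rem_def by (intro cell_error T h_lip[OF \<theta>0_cl] C0) auto

lemma increment_split: "y (\<tau> n (Suc j)) - y (\<tau> n j) = (fl y (\<tau> n (Suc j)) - fl y (\<tau> n j)) + rem n j + (T / real n) *\<^sub>R h (\<tau> n j) \<theta>0"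
 unfolding fl_def rem_def by simp

lemma contrast_eq: "contrast T h y n \<theta> = (\<Sum>j<n. h (\<tau> n j) \<theta> \<bullet> (y (\<tau> n (Suc j)) - y (\<tau> n j)) - (1/2) * ((T / real n) * (norm (h (\<tau> n j) \<theta>))\<^sup>2))"
proof -
 have r: "{1..n} = Suc ` {..<n}" by (auto simp: image_Suc_lessThan)
 show ?thesis
  unfolding contrast_def Let_def r sum.reindex[OF inj_on_subset[OF inj_Suc subset_UNIV]] comp_def gridt_def
  by (simp add: sum_subtractf sum_distrib_left mult_ac)
qed

lemma contrast_difference:
 "contrast T h y n \<theta> - contrast T h y n \<theta>0 =
  (\<Sum>j<n. (h (\<tau> n j) \<theta> - h (\<tau> n j) \<theta>0) \<bullet> (fl y (\<tau> n (Suc j)) - fl y (\<tau> n j)))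
  + (\<Sum>j<n. (h (\<tau> n j) \<theta> - h (\<tau> n j) \<theta>0) \<bullet> rem n j) - (1/2) * sepn n \<theta>"
 unfolding contrast_eq sepn_def sum_distrib_left sum_subtractf[symmetric] sum.distrib[symmetric]
 unfolding increment_split[of y] by (intro sum.cong refl complete_the_square)

text \<open>The contrast at a maximizer is at least that at \<open>\<theta>0\<close>, so the quadratic loss cannot exceed the stochastic
term, which \<open>grid_sum_bound\<close> controls.\<close>

lemma maximizer_separation:
 assumes n: "0 < n" and y0: "y 0 = 0" and \<theta>: "\<theta> \<in> closure U" and max: "contrast T h y n \<theta>0 <= contrast T h y n \<theta>"
 shows "sepn n \<theta> <= 4 * C * (1 + T) * fluct n (%j. fl y (\<tau> n j)) + 4 * C\<^sup>2 * T * (T / real n)"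
proof -
 let ?q = "%j. h (\<tau> n j) \<theta> - h (\<tau> n j) \<theta>0"
 have q: "norm (?q j) <= 2 * C" if "j <= n" for j
  using h_bdd[OF \<theta> tau_in[OF that]] h_bdd[OF \<theta>0_cl tau_in[OF that]] norm_triangle_ineq4[of "h (\<tau> n j) \<theta>" "h (\<tau> n j) \<theta>0"] by linarith
 have "\<bar>\<Sum>j<n. ?q j \<bullet> (fl y (\<tau> n (Suc j)) - fl y (\<tau> n j))\<bar> <= 2 * C * (1 + T) * fluct n (%j. fl y (\<tau> n j))"
 proof (rule grid_sum_bound[OF _ _ _ T n])
  show "fl y (\<tau> n 0) = 0"
  proof -
   have "(LINT s:{0..0}|lborel. h s \<theta>0) = 0" unfolding set_lebesgue_integral_def
    by (rule integral_eq_zero_AE) (use AE_lborel_singleton[of 0] in \<open>eventually_elim, auto simp: indicator_def\<close>)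
   then show ?thesis unfolding fl_def gridt_simps y0 by simp
  qed
  show "norm (?q n) <= 2 * C" using q by simp
  fix j assume j: "j < n"
  have d: "\<tau> n (Suc j) - \<tau> n j = T / real n" by (simp add: gridt_simps)
  have "norm (?q (Suc j) - ?q j) = norm ((h (\<tau> n (Suc j)) \<theta> - h (\<tau> n j) \<theta>) - (h (\<tau> n (Suc j)) \<theta>0 - h (\<tau> n j) \<theta>0))"
   by (simp add: algebra_simps)
  also have "... <= C * \<bar>\<tau> n (Suc j) - \<tau> n j\<bar> + C * \<bar>\<tau> n (Suc j) - \<tau> n j\<bar>"
   using j by (intro order_trans[OF norm_triangle_ineq4] add_mono h_lip \<theta> \<theta>0_cl tau_in) auto
  finally show "norm (?q (Suc j) - ?q j) <= 2 * C * (T / real n)" unfolding d using T by simp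
 qed
 moreover have "\<bar>\<Sum>j<n. ?q j \<bullet> rem n j\<bar> <= (\<Sum>j<n. 2 * C * (C * (T / real n)\<^sup>2))"
  using C0 by (intro order_trans[OF sum_abs] sum_mono order_trans[OF Cauchy_Schwarz_ineq2] mult_mono q rem_bound) auto
 moreover have "(\<Sum>j<n. 2 * C * (C * (T / real n)\<^sup>2)) = 2 * C\<^sup>2 * T * (T / real n)"
  using n by (simp add: power2_eq_square)
 ultimately show ?thesis
  using max contrast_difference[of y n \<theta>] by (simp add: abs_le_iff)
qed

lemma sep_lip:
 assumes \<theta>: "\<theta> \<in> closure U" and st: "s \<in> {0..T}" "t \<in> {0..T}"
 shows "\<bar>(norm (h t \<theta> - h t \<theta>0))\<^sup>2 - (norm (h s \<theta> - h s \<theta>0))\<^sup>2\<bar> <= 8 * C\<^sup>2 * \<bar>t - s\<bar>"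
proof -
 let ?a = "norm (h t \<theta> - h t \<theta>0)" and ?b = "norm (h s \<theta> - h s \<theta>0)"
 have b: "?a <= 2 * C" "?b <= 2 * C"
  using h_bdd[OF \<theta>] h_bdd[OF \<theta>0_cl] st norm_triangle_ineq4[of "h t \<theta>" "h t \<theta>0"] norm_triangle_ineq4[of "h s \<theta>" "h s \<theta>0"]
  by (smt (verit))+
 have "\<bar>?a - ?b\<bar> <= norm ((h t \<theta> - h s \<theta>) - (h t \<theta>0 - h s \<theta>0))"
  by (rule order_trans[OF norm_triangle_ineq3]) (simp add: algebra_simps)
 also have "... <= C * \<bar>t - s\<bar> + C * \<bar>t - s\<bar>"
  by (intro order_trans[OF norm_triangle_ineq4] add_mono h_lip \<theta> \<theta>0_cl st)
 finally have d: "\<bar>?a - ?b\<bar> <= 2 * C * \<bar>t - s\<bar>" by simp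
 have "\<bar>?a\<^sup>2 - ?b\<^sup>2\<bar> = \<bar>?a - ?b\<bar> * (?a + ?b)"
  by (simp add: power2_eq_square square_diff_square_factored abs_mult mult.commute)
 also have "... <= (2 * C * \<bar>t - s\<bar>) * (4 * C)" using d b C0 by (intro mult_mono) auto
 finally show ?thesis by (simp add: power2_eq_square mult_ac)
qed

lemma sep_approx:
 assumes \<theta>: "\<theta> \<in> closure U" and n: "0 < n"
 shows "\<bar>sep \<theta> - sepn n \<theta>\<bar> <= 8 * C\<^sup>2 * T * (T / real n)"
 unfolding sep_def sepn_def
 using riemann_error[OF T, of "%s. (norm (h s \<theta> - h s \<theta>0))\<^sup>2" "8 * C\<^sup>2" n] sep_lip[OF \<theta>] n by simp

text \<open>If the integral vanished, the continuous integrand would vanish almost everywhere on the interval, hence everywhere.\<close>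

lemma sep_pos:
 assumes \<theta>: "\<theta> \<in> closure U" "\<theta> ~= \<theta>0"
 shows "0 < sep \<theta>"
proof (rule ccontr)
 assume "\<not> 0 < sep \<theta>"
 moreover have "0 <= sep \<theta>" unfolding sep_def set_lebesgue_integral_def by (intro Bochner_Integration.integral_nonneg) simp
 ultimately have z: "sep \<theta> = 0" by simp
 let ?f = "%s. (norm (h s \<theta> - h s \<theta>0))\<^sup>2"
 have c: "continuous_on {0..T} ?f"
  by (rule lipschitz_continuous[where A="8 * C\<^sup>2"]) (use sep_lip[OF \<theta>(1)] in auto)
 have i: "set_integrable lborel {0..T} ?f" by (rule borel_integrable_atLeastAtMost'[OF c])
 have "sep \<theta> = integral {0..T} ?f" unfolding sep_def by (rule set_borel_integral_eq_integral(2)[OF i])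
 then have "(?f has_integral sep \<theta>) {0..T}"
  using integrable_integral[OF set_borel_integral_eq_integral(1)[OF i]] by simp
 then have "?f t = 0" if "t \<in> {0..T}" for t
  using has_integral_0_cbox_imp_0[of 0 T ?f t] c z that T by (simp add: box_real)
 then show False using ident[OF \<theta>] by auto
qed

lemma sep_continuous: "continuous_on (closure U) sep"
 unfolding continuous_on_sequentially
proof (intro allI ballI impI)
 fix x a assume a: "a \<in> closure U" and x: "(\<forall>n. x n \<in> closure U) \<and> x \<longlonglongrightarrow> a"
 let ?f = "%\<theta> s. (norm (h s \<theta> - h s \<theta>0))\<^sup>2"
 have m: "?f \<theta> \<in> borel_measurable (leb T)" if "\<theta> \<in> closure U" for \<theta>
  by (intro leb_continuous_measurable lipschitz_continuous[where A="8 * C\<^sup>2"]) (use sep_lip[OF that] in auto)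
 have "(%n. LINT s|leb T. ?f (x n) s) \<longlonglongrightarrow> (LINT s|leb T. ?f a s)"
 proof (rule integral_dominated_convergence[where w="%_. (2 * C)\<^sup>2"])
  show "integrable (leb T) (%_. (2 * C)\<^sup>2)" by (rule leb_integrable_bounded[of _ _ "(2 * C)\<^sup>2"]) auto
  show "AE s in leb T. (%n. ?f (x n) s) \<longlonglongrightarrow> ?f a s"
  proof (rule AE_I2)
   fix s assume "s \<in> space (leb T)"
   then have "continuous_on (closure U) (h s)" by (intro h_cont) simp
   then have "(%n. h s (x n)) \<longlonglongrightarrow> h s a" using a x by (auto intro: continuous_on_tendsto_compose)
   then show "(%n. ?f (x n) s) \<longlonglongrightarrow> ?f a s" by (intro tendsto_intros)
  qed
  show "AE s in leb T. norm (?f (x n) s) <= (2 * C)\<^sup>2" for n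
  proof (rule AE_I2)
   fix s assume "s \<in> space (leb T)"
   then have "norm (h s (x n)) <= C" "norm (h s \<theta>0) <= C" using x by (auto intro: h_bdd \<theta>0_cl)
   then have "norm (h s (x n) - h s \<theta>0) <= 2 * C" using norm_triangle_ineq4[of "h s (x n)" "h s \<theta>0"] by linarith
   then have "(norm (h s (x n) - h s \<theta>0))\<^sup>2 <= (2 * C)\<^sup>2" by (rule power_mono) simp
   then show "norm (?f (x n) s) <= (2 * C)\<^sup>2" by simp
  qed
 qed (use m a x in auto)
 then show "(sep \<circ> x) \<longlonglongrightarrow> sep a" unfolding sep_def set_integral_leb comp_def .
qed

text \<open>On the compact set outside a ball the continuous function \<open>sep\<close> has a positive minimum, which a small fluctuation and
a small mesh cannot compensate.\<close>

lemma consistency: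
 assumes e: "0 < \<epsilon>"
 shows "\<exists>\<delta>>0. \<exists>n0. \<forall>n\<ge>n0. 0 < n --> (\<forall>y \<theta>. y 0 = 0 --> \<theta> \<in> closure U --> contrast T h y n \<theta>0 <= contrast T h y n \<theta>
  --> fluct n (%j. fl y (\<tau> n j)) < \<delta> --> dist \<theta> \<theta>0 < \<epsilon>)"
proof -
 define A where "A = {\<theta> \<in> closure U. \<epsilon> <= dist \<theta> \<theta>0}"
 have cl: "compact (closure U)" using U by simp
 have A: "compact A"
 proof -
  have "A = closure U \<inter> {\<theta>. \<epsilon> <= dist \<theta> \<theta>0}" unfolding A_def by auto
  moreover have "closed {\<theta>. \<epsilon> <= dist \<theta> \<theta>0}" by (intro closed_Collect_le continuous_intros)
  ultimately show ?thesis using cl by (simp add: compact_Int_closed)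
 qed
 obtain m where m: "0 < m" "!!\<theta>. \<theta> \<in> A ==> m <= sep \<theta>"
 proof (cases "A = {}")
  case True then show thesis using that[of 1] by auto
 next
  case False
  obtain a where a: "a \<in> A" "\<forall>\<theta>\<in>A. sep a <= sep \<theta>"
   using continuous_attains_inf[OF A False continuous_on_subset[OF sep_continuous]] unfolding A_def by auto
  have "a ~= \<theta>0" "a \<in> closure U" using a(1) e unfolding A_def by auto
  then have "0 < sep a" by (intro sep_pos)
  then show thesis using that[of "sep a"] a by blast
 qed
 define B where "B = 4 * C * (1 + T)"
 define B' where "B' = 12 * C\<^sup>2 * T * T"
 have B: "0 <= B" "0 <= B'" unfolding B_def B'_def using C0 T by auto
 obtain n0 where n0: "2 * B' / m < real n0" using reals_Archimedean2 by blast
 define \<delta> where "\<delta> = m / (2 * (B + 1))"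
 have \<delta>: "0 < \<delta>" unfolding \<delta>_def using m B by simp
 have "dist \<theta> \<theta>0 < \<epsilon>" if n: "n0 <= n" "0 < n" and y0: "y 0 = 0" and \<theta>: "\<theta> \<in> closure U" "contrast T h y n \<theta>0 <= contrast T h y n \<theta>"
  and D: "fluct n (%j. fl y (\<tau> n j)) < \<delta>" for n y \<theta>
 proof (rule ccontr)
  assume "\<not> dist \<theta> \<theta>0 < \<epsilon>"
  then have "m <= sep \<theta>" using \<theta> m(2) unfolding A_def by auto
  also have "sep \<theta> <= sepn n \<theta> + 8 * C\<^sup>2 * T * (T / real n)"
   using sep_approx[OF \<theta>(1) n(2)] by (simp add: abs_le_iff)
  also have "... <= B * fluct n (%j. fl y (\<tau> n j)) + B' / real n"
  proof -
   have "B' / real n = 4 * C\<^sup>2 * T * (T / real n) + 8 * C\<^sup>2 * T * (T / real n)"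
    unfolding B'_def by (simp add: add_divide_distrib[symmetric])
   then show ?thesis using maximizer_separation[OF n(2) y0 \<theta>] unfolding B_def by linarith
  qed
  also have "B * fluct n (%j. fl y (\<tau> n j)) <= B * \<delta>" using D B by (intro mult_left_mono) auto
  also have "B * \<delta> <= m / 2" unfolding \<delta>_def using m B by (simp add: field_simps)
  also have "B' / real n < m / 2"
  proof -
   have "2 * B' / m < real n" using n0 n by linarith
   then have "2 * B' < real n * m" using m by (simp add: pos_divide_less_eq)
   then show ?thesis using n by (simp add: field_simps)
  qed
  finally show False by simp
 qed
 then show ?thesis using \<delta> by (intro exI[of _ \<delta>] conjI exI[of _ n0] allI impI) auto
qed

end

section \<open>Linear expansion of the maximizer\<close>

context regular_signal begin

definition I0 :: "real^'p^'p" where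
 "I0 = (\<chi> i l. LINT t:{0..T}|lborel. g i t \<theta>0 \<bullet> g l t \<theta>0)"

text \<open>The discrete score: the gradient of the contrast at the true parameter, up to the discretization error.\<close>

definition score :: "nat => (real => real^'r) => real^'p" where
 "score n z = (\<chi> i. \<Sum>j<n. g i (\<tau> n j) \<theta>0 \<bullet> (z (\<tau> n (Suc j)) - z (\<tau> n j)))"

lemma fl_0: "y 0 = 0 ==> fl y (\<tau> n 0) = 0"
 unfolding fl_def gridt_simps by (simp only: set_integral_point diff_0_right)

lemma score_bound:
 assumes n: "0 < n" and z0: "z (\<tau> n 0) = 0"
 shows "\<bar>score n z $ i\<bar> <= C * (1 + T) * fluct n (%j. z (\<tau> n j))"
 unfolding score_def vec_lambda_beta
proof (rule grid_sum_bound[where z="%j. z (\<tau> n j)", OF z0 _ _ T n])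
 show "norm (g i (\<tau> n n) \<theta>0) <= C" by (intro g_bdd \<theta>0_cl tau_in) simp
 fix j assume j: "j < n"
 have "norm (g i (\<tau> n (Suc j)) \<theta>0 - g i (\<tau> n j) \<theta>0) <= C * \<bar>\<tau> n (Suc j) - \<tau> n j\<bar>"
  using j by (intro g_lip \<theta>0_cl tau_in) auto
 then show "norm (g i (\<tau> n (Suc j)) \<theta>0 - g i (\<tau> n j) \<theta>0) <= C * (T / real n)" using T by (simp add: gridt_simps)
qed

text \<open>The estimator lies in the open set once it is close to the truth, so the gradient vanishes there.\<close>

lemma contrast_gradient:
 assumes \<theta>: "\<theta> \<in> U" and n: "0 < n" and max: "!!\<theta>'. \<theta>' \<in> U ==> contrast T h y n \<theta>' <= contrast T h y n \<theta>"
 shows "(\<Sum>j<n. g i (\<tau> n j) \<theta> \<bullet> (y (\<tau> n (Suc j)) - y (\<tau> n j) - (T / real n) *\<^sub>R h (\<tau> n j) \<theta>)) = 0"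
proof -
 define d where "d j v = (\<Sum>i\<in>UNIV. v $ i *\<^sub>R g i (\<tau> n j) \<theta>)" for j v
 have hd: "(h (\<tau> n j) has_derivative d j) (at \<theta>)" if "j < n" for j
  unfolding d_def using that by (intro deriv \<theta> tau_in) simp
 define D where "D v = (\<Sum>j<n. d j v \<bullet> (y (\<tau> n (Suc j)) - y (\<tau> n j)) - (T / real n) * (h (\<tau> n j) \<theta> \<bullet> d j v))" for v
 have "(contrast T h y n has_derivative D) (at \<theta>)"
  unfolding contrast_eq[abs_def] D_def power2_norm_eq_inner
 proof (rule has_derivative_sum)
  fix j assume "j \<in> {..<n}"
  then have hj: "(h (\<tau> n j) has_derivative d j) (at \<theta>)" using hd by simp
  show "((%\<theta>. h (\<tau> n j) \<theta> \<bullet> (y (\<tau> n (Suc j)) - y (\<tau> n j)) - 1 / 2 * (T / real n * (h (\<tau> n j) \<theta> \<bullet> h (\<tau> n j) \<theta>)))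
   has_derivative (%v. d j v \<bullet> (y (\<tau> n (Suc j)) - y (\<tau> n j)) - T / real n * (h (\<tau> n j) \<theta> \<bullet> d j v))) (at \<theta>)"
   by (rule has_derivative_eq_rhs)
    (rule has_derivative_diff has_derivative_inner_left hj has_derivative_mult_right has_derivative_inner | simp add: inner_commute fun_eq_iff)+
 qed
 then have "D = (%v. 0)"
  by (rule differential_zero_maxmin[OF \<theta> U(1)]) (use max in blast)
 then have "D (axis i 1) = 0" by simp
 moreover have "d j (axis i 1) = g i (\<tau> n j) \<theta>" for j
  unfolding d_def axis_def by (simp add: if_distribR if_distrib[where f="%x. x *\<^sub>R _"] cong: if_cong)
 ultimately show ?thesis
  unfolding D_def by (simp add: inner_diff_right inner_commute)
qed

text \<open>The mean value inequality on a ball; the modulus \<open>om\<close> of the gradient replaces second derivatives.\<close>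

lemma signal_linearization:
 assumes \<epsilon>: "ball \<theta>0 \<epsilon> \<subseteq> U" and w: "!!\<theta>'. \<theta>' \<in> ball \<theta>0 \<epsilon> ==> om \<theta>' <= w" and \<theta>: "\<theta> \<in> ball \<theta>0 \<epsilon>" and t: "t \<in> {0..T}"
 shows "norm (h t \<theta> - h t \<theta>0 - (\<Sum>l\<in>UNIV. (\<theta> - \<theta>0) $ l *\<^sub>R g l t \<theta>0)) <= real CARD('p) * w * norm (\<theta> - \<theta>0)"
proof -
 define f where "f \<theta> = h t \<theta> - (\<Sum>l\<in>UNIV. \<theta> $ l *\<^sub>R g l t \<theta>0)" for \<theta>
 have c0: "\<theta>0 \<in> ball \<theta>0 \<epsilon>" using \<theta> by (auto intro: le_less_trans[OF zero_le_dist])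
 have "norm (f \<theta> - f \<theta>0) <= real CARD('p) * w * norm (\<theta> - \<theta>0)"
 proof (rule differentiable_bound[of "ball \<theta>0 \<epsilon>" f "%x v. \<Sum>l\<in>UNIV. v $ l *\<^sub>R (g l t x - g l t \<theta>0)"])
  show "convex (ball \<theta>0 \<epsilon>)" by simp
  fix x assume x: "x \<in> ball \<theta>0 \<epsilon>"
  have "(f has_derivative (%v. (\<Sum>l\<in>UNIV. v $ l *\<^sub>R g l t x) - (\<Sum>l\<in>UNIV. v $ l *\<^sub>R g l t \<theta>0))) (at x)"
   unfolding f_def
  proof (rule has_derivative_diff)
   show "(h t has_derivative (%v. \<Sum>l\<in>UNIV. v $ l *\<^sub>R g l t x)) (at x)" using x \<epsilon> by (intro deriv t) auto
   show "((%\<theta>. \<Sum>l\<in>UNIV. \<theta> $ l *\<^sub>R g l t \<theta>0) has_derivative (%v. \<Sum>l\<in>UNIV. v $ l *\<^sub>R g l t \<theta>0)) (at x)"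
    by (intro bounded_linear_imp_has_derivative bounded_linear_sum bounded_linear_scaleR_const bounded_linear_vec_nth)
  qed
  then show "(f has_derivative (%v. \<Sum>l\<in>UNIV. v $ l *\<^sub>R (g l t x - g l t \<theta>0))) (at x within ball \<theta>0 \<epsilon>)"
   unfolding scaleR_diff_right sum_subtractf by (rule has_derivative_at_withinI)
  show "onorm (%v. \<Sum>l\<in>UNIV. v $ l *\<^sub>R (g l t x - g l t \<theta>0)) <= real CARD('p) * w"
  proof (rule onorm_le)
   fix v :: "real^'p"
   have xc: "x \<in> closure U" using x \<epsilon> closure_subset by blast
   have "norm (\<Sum>l\<in>UNIV. v $ l *\<^sub>R (g l t x - g l t \<theta>0)) <= (\<Sum>l\<in>(UNIV::'p set). norm v * w)"
   proof (rule sum_norm_le)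
    fix l
    have "norm (g l t x - g l t \<theta>0) <= w" using g_mod(1)[OF xc t, of l] w[OF x] by linarith
    then show "norm (v $ l *\<^sub>R (g l t x - g l t \<theta>0)) <= norm v * w"
     unfolding norm_scaleR using component_le_norm_cart[of v l] by (intro mult_mono) auto
   qed
   then show "norm (\<Sum>l\<in>UNIV. v $ l *\<^sub>R (g l t x - g l t \<theta>0)) <= real CARD('p) * w * norm v" by (simp add: mult_ac)
  qed
 qed (use \<theta> c0 in auto)
 moreover have "f \<theta> - f \<theta>0 = h t \<theta> - h t \<theta>0 - (\<Sum>l\<in>UNIV. (\<theta> - \<theta>0) $ l *\<^sub>R g l t \<theta>0)"
  unfolding f_def by (simp add: scaleR_left_diff_distrib sum_subtractf)
 ultimately show ?thesis by simp
qed

lemma information_riemann: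
 assumes n: "0 < n"
 shows "\<bar>I0 $ i $ l - (\<Sum>j<n. (T / real n) * (g i (\<tau> n j) \<theta>0 \<bullet> g l (\<tau> n j) \<theta>0))\<bar> <= 2 * C\<^sup>2 * T * (T / real n)"
proof -
 have "norm ((LINT t:{0..T}|lborel. g i t \<theta>0 \<bullet> g l t \<theta>0) - (\<Sum>j<n. (T / real n) *\<^sub>R (g i (\<tau> n j) \<theta>0 \<bullet> g l (\<tau> n j) \<theta>0))) <= 2 * C\<^sup>2 * T * (T / real n)"
 proof (rule riemann_error[OF T _ _ n])
  fix s t assume st: "s \<in> {0..T}" "t \<in> {0..T}"
  have "g i t \<theta>0 \<bullet> g l t \<theta>0 - g i s \<theta>0 \<bullet> g l s \<theta>0 = g i t \<theta>0 \<bullet> (g l t \<theta>0 - g l s \<theta>0) + (g i t \<theta>0 - g i s \<theta>0) \<bullet> g l s \<theta>0"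
   by (simp add: inner_diff_left inner_diff_right)
  also have "norm ... <= C * (C * \<bar>t - s\<bar>) + (C * \<bar>t - s\<bar>) * C"
   unfolding real_norm_def using C0
   by (intro order_trans[OF abs_triangle_ineq] add_mono order_trans[OF Cauchy_Schwarz_ineq2] mult_mono g_bdd g_lip \<theta>0_cl st) auto
  finally show "norm (g i t \<theta>0 \<bullet> g l t \<theta>0 - g i s \<theta>0 \<bullet> g l s \<theta>0) <= 2 * C\<^sup>2 * \<bar>t - s\<bar>"
   by (simp add: power2_eq_square)
 qed (use C0 in auto)
 then show ?thesis unfolding I0_def by simp
qed

text \<open>Collects the constants of the linearized first order condition; only its independence of the path and of \<open>n\<close> matters.\<close>

definition lin_const :: real where
 "lin_const = (1 + T) + C\<^sup>2 * T + 2 * real CARD('p) * C * T + real CARD('p) * (2 * C\<^sup>2 * T)"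

lemma lin_const_pos: "0 < lin_const"
 unfolding lin_const_def using T C0 by (intro add_pos_nonneg) auto

text \<open>In the first order condition the gradient is replaced by its value at \<open>\<theta>0\<close>, the signal by its linearization and the
Riemann sum by the information integral. The first replacement costs a small multiple of the fluctuation, the second
a small multiple of the estimation error, the third the mesh.\<close>

lemma score_linearization:
 assumes \<epsilon>: "ball \<theta>0 \<epsilon> \<subseteq> U" "\<epsilon> <= 1" and w: "!!\<theta>'. \<theta>' \<in> ball \<theta>0 \<epsilon> ==> om \<theta>' <= w" and \<theta>: "\<theta> \<in> ball \<theta>0 \<epsilon>"
  and n: "0 < n" and y0: "y 0 = 0" and max: "!!\<theta>'. \<theta>' \<in> U ==> contrast T h y n \<theta>' <= contrast T h y n \<theta>"
 shows "\<bar>score n (fl y) $ i - (I0 *v (\<theta> - \<theta>0)) $ i\<bar> <= lin_const * (w * fluct n (%j. fl y (\<tau> n j)) + T / real n + w * norm (\<theta> - \<theta>0))"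
proof -
 define \<Delta> where "\<Delta> = T / real n"
 have \<Delta>: "0 < \<Delta>" "real n * \<Delta> = T" unfolding \<Delta>_def using T n by auto
 define e where "e = \<theta> - \<theta>0"
 have e1: "norm e < 1" using \<theta> \<epsilon>(2) unfolding e_def by (simp add: dist_norm norm_minus_commute)
 have \<theta>U: "\<theta> \<in> U" using \<theta> \<epsilon> by blast
 then have \<theta>c: "\<theta> \<in> closure U" using closure_subset by blast
 define z where "z j = fl y (\<tau> n j)" for j
 define gi where "gi j = g i (\<tau> n j) \<theta>" for j
 define g0 where "g0 j = g i (\<tau> n j) \<theta>0" for j
 define L where "L j = (\<Sum>l\<in>UNIV. e $ l *\<^sub>R g l (\<tau> n j) \<theta>0)" for j
 define dh where "dh j = h (\<tau> n j) \<theta> - h (\<tau> n j) \<theta>0" for j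
 have tc: "\<tau> n j \<in> {0..T}" if "j <= n" for j using tau_in[OF that] .
 have w0: "0 <= w" using g_mod(1)[OF \<theta>c tc[of 0], of i] w[OF \<theta>] norm_ge_zero[of "g i (\<tau> n 0) \<theta> - g i (\<tau> n 0) \<theta>0"] by linarith
 \<comment> \<open>the likelihood equation\<close>
 have "(\<Sum>j<n. gi j \<bullet> (y (\<tau> n (Suc j)) - y (\<tau> n j) - \<Delta> *\<^sub>R h (\<tau> n j) \<theta>)) = 0"
  unfolding gi_def \<Delta>_def by (rule contrast_gradient[OF \<theta>U n max])
 then have "0 = (\<Sum>j<n. g0 j \<bullet> (z (Suc j) - z j) + (gi j - g0 j) \<bullet> (z (Suc j) - z j) + gi j \<bullet> rem n j
   - \<Delta> * (gi j \<bullet> dh j - g0 j \<bullet> L j) - \<Delta> * (g0 j \<bullet> L j))"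
  unfolding increment_split[of y] z_def[symmetric] \<Delta>_def[symmetric] dh_def
  by (simp add: inner_add_right inner_diff_left inner_diff_right algebra_simps)
 also have "... = (\<Sum>j<n. g0 j \<bullet> (z (Suc j) - z j)) + (\<Sum>j<n. (gi j - g0 j) \<bullet> (z (Suc j) - z j)) + (\<Sum>j<n. gi j \<bullet> rem n j)
   - (\<Sum>j<n. \<Delta> * (gi j \<bullet> dh j - g0 j \<bullet> L j)) - (\<Sum>j<n. \<Delta> * (g0 j \<bullet> L j))"
  by (simp add: sum.distrib sum_subtractf)
 finally have main: "(\<Sum>j<n. g0 j \<bullet> (z (Suc j) - z j)) - (\<Sum>j<n. \<Delta> * (g0 j \<bullet> L j)) =
  - (\<Sum>j<n. (gi j - g0 j) \<bullet> (z (Suc j) - z j)) - (\<Sum>j<n. gi j \<bullet> rem n j) + (\<Sum>j<n. \<Delta> * (gi j \<bullet> dh j - g0 j \<bullet> L j))"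
  by simp
 have b1: "\<bar>\<Sum>j<n. (gi j - g0 j) \<bullet> (z (Suc j) - z j)\<bar> <= w * (1 + T) * fluct n z"
 proof (rule grid_sum_bound[OF _ _ _ T n])
  show "z 0 = 0" unfolding z_def by (rule fl_0[of y, OF y0])
  show "norm (gi n - g0 n) <= w" unfolding gi_def g0_def using g_mod(1)[OF \<theta>c tc[of n], of i] w[OF \<theta>] by simp
  fix j assume j: "j < n"
  have "norm ((gi (Suc j) - g0 (Suc j)) - (gi j - g0 j)) <= om \<theta> * \<bar>\<tau> n (Suc j) - \<tau> n j\<bar>"
   unfolding gi_def g0_def using j by (intro g_mod(2) \<theta>c tc) auto
  also have "... <= w * (T / real n)" using w[OF \<theta>] T by (simp add: gridt_simps mult_right_mono divide_right_mono)
  finally show "norm ((gi (Suc j) - g0 (Suc j)) - (gi j - g0 j)) <= w * (T / real n)" .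
 qed
 have gb: "norm (gi j) <= C" if "j < n" for j unfolding gi_def using that by (intro g_bdd \<theta>c tc) auto
 have b2: "\<bar>\<Sum>j<n. gi j \<bullet> rem n j\<bar> <= C\<^sup>2 * T * \<Delta>"
 proof -
  have "\<bar>\<Sum>j<n. gi j \<bullet> rem n j\<bar> <= (\<Sum>j<n. C * (C * (T / real n)\<^sup>2))"
   using C0 by (intro order_trans[OF sum_abs] sum_mono order_trans[OF Cauchy_Schwarz_ineq2] mult_mono gb rem_bound) auto
  also have "... = C\<^sup>2 * T * \<Delta>" unfolding \<Delta>_def using n by (simp add: power2_eq_square)
  finally show ?thesis .
 qed
 have Lb: "norm (L j) <= real CARD('p) * C * norm e" if "j < n" for j
 proof -
  have "norm (L j) <= (\<Sum>l\<in>(UNIV::'p set). norm e * C)"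
   unfolding L_def
  proof (rule sum_norm_le)
   fix l show "norm (e $ l *\<^sub>R g l (\<tau> n j) \<theta>0) <= norm e * C"
    unfolding norm_scaleR using component_le_norm_cart[of e l] C0 that by (intro mult_mono g_bdd \<theta>0_cl tc) auto
  qed
  then show ?thesis by (simp add: mult_ac)
 qed
 have b3: "\<bar>\<Sum>j<n. \<Delta> * (gi j \<bullet> dh j - g0 j \<bullet> L j)\<bar> <= 2 * real CARD('p) * C * T * (w * norm e)"
 proof -
  have t: "\<bar>gi j \<bullet> dh j - g0 j \<bullet> L j\<bar> <= 2 * real CARD('p) * C * (w * norm e)" if j: "j < n" for j
  proof -
   have "gi j \<bullet> dh j - g0 j \<bullet> L j = gi j \<bullet> (dh j - L j) + (gi j - g0 j) \<bullet> L j" by (simp add: inner_diff_left inner_diff_right)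
   also have "\<bar>...\<bar> <= C * (real CARD('p) * w * norm e) + w * (real CARD('p) * C * norm e)"
   proof (intro order_trans[OF abs_triangle_ineq] add_mono order_trans[OF Cauchy_Schwarz_ineq2] mult_mono gb Lb j)
    show "norm (dh j - L j) <= real CARD('p) * w * norm e"
     unfolding dh_def L_def e_def using j by (intro signal_linearization[OF \<epsilon>(1) w \<theta>] tc) auto
    show "norm (gi j - g0 j) <= w" unfolding gi_def g0_def using g_mod(1)[OF \<theta>c tc[of j], of i] w[OF \<theta>] j by simp
   qed (use C0 w0 in auto)
   finally show ?thesis by (simp add: mult_ac)
  qed
  have "\<bar>\<Sum>j<n. \<Delta> * (gi j \<bullet> dh j - g0 j \<bullet> L j)\<bar> <= (\<Sum>j<n. \<Delta> * (2 * real CARD('p) * C * (w * norm e)))"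
  proof (intro order_trans[OF sum_abs] sum_mono)
   fix j assume "j \<in> {..<n}"
   then have "\<Delta> * \<bar>gi j \<bullet> dh j - g0 j \<bullet> L j\<bar> <= \<Delta> * (2 * real CARD('p) * C * (w * norm e))"
    using \<Delta>(1) by (intro mult_left_mono t) auto
   then show "\<bar>\<Delta> * (gi j \<bullet> dh j - g0 j \<bullet> L j)\<bar> <= \<Delta> * (2 * real CARD('p) * C * (w * norm e))"
    using \<Delta>(1) by (simp add: abs_mult)
  qed
  also have "... = (real n * \<Delta>) * (2 * real CARD('p) * C * (w * norm e))" by (simp add: mult.assoc)
  finally show ?thesis unfolding \<Delta>(2) by (simp add: mult_ac)
 qed
 have b4: "\<bar>(\<Sum>j<n. \<Delta> * (g0 j \<bullet> L j)) - (I0 *v e) $ i\<bar> <= real CARD('p) * (2 * C\<^sup>2 * T) * \<Delta>"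
 proof -
  have "(\<Sum>j<n. \<Delta> * (g0 j \<bullet> L j)) = (\<Sum>l\<in>UNIV. e $ l * (\<Sum>j<n. \<Delta> * (g0 j \<bullet> g l (\<tau> n j) \<theta>0)))"
   unfolding L_def inner_sum_right sum_distrib_left by (subst sum.swap) (simp add: mult_ac)
  moreover have "(I0 *v e) $ i = (\<Sum>l\<in>UNIV. e $ l * I0 $ i $ l)"
   by (simp add: matrix_vector_mult_def mult.commute)
  ultimately have "\<bar>(\<Sum>j<n. \<Delta> * (g0 j \<bullet> L j)) - (I0 *v e) $ i\<bar> = \<bar>\<Sum>l\<in>UNIV. e $ l * ((\<Sum>j<n. \<Delta> * (g0 j \<bullet> g l (\<tau> n j) \<theta>0)) - I0 $ i $ l)\<bar>"
   by (simp add: right_diff_distrib sum_subtractf)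
  also have "... <= (\<Sum>l\<in>(UNIV::'p set). 1 * (2 * C\<^sup>2 * T * \<Delta>))"
  proof (intro order_trans[OF sum_abs] sum_mono)
   fix l
   have "\<bar>e $ l\<bar> <= 1" using component_le_norm_cart[of e l] e1 by linarith
   moreover have "\<bar>(\<Sum>j<n. \<Delta> * (g0 j \<bullet> g l (\<tau> n j) \<theta>0)) - I0 $ i $ l\<bar> <= 2 * C\<^sup>2 * T * \<Delta>"
    using information_riemann[OF n, of i l] unfolding \<Delta>_def g0_def by (simp add: abs_minus_commute)
   ultimately show "\<bar>e $ l * ((\<Sum>j<n. \<Delta> * (g0 j \<bullet> g l (\<tau> n j) \<theta>0)) - I0 $ i $ l)\<bar> <= 1 * (2 * C\<^sup>2 * T * \<Delta>)"
    unfolding abs_mult by (intro mult_mono) auto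
  qed
  finally show ?thesis by simp
 qed
 have sc: "score n (fl y) $ i = (\<Sum>j<n. g0 j \<bullet> (z (Suc j) - z j))" unfolding score_def g0_def z_def by simp
 have "\<bar>score n (fl y) $ i - (I0 *v e) $ i\<bar> <= w * (1 + T) * fluct n z + C\<^sup>2 * T * \<Delta> + 2 * real CARD('p) * C * T * (w * norm e) + real CARD('p) * (2 * C\<^sup>2 * T) * \<Delta>"
  using main b1 b2 b3 b4 unfolding sc by linarith
 also have "... <= lin_const * (w * fluct n z) + lin_const * \<Delta> + lin_const * (w * norm e)"
 proof -
  have f0: "0 <= w * fluct n z" "0 <= w * norm e" using w0 fluct_nonneg[of n z] by auto
  have c: "0 <= C\<^sup>2 * T" "0 <= 2 * real CARD('p) * C * T" "0 <= real CARD('p) * (2 * C\<^sup>2 * T)" "0 <= 1 + T" using C0 T by auto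
  have lc: "1 + T <= lin_const" "C\<^sup>2 * T + real CARD('p) * (2 * C\<^sup>2 * T) <= lin_const" "2 * real CARD('p) * C * T <= lin_const"
   unfolding lin_const_def using c by linarith+
  have "(1 + T) * (w * fluct n z) <= lin_const * (w * fluct n z)" by (rule mult_right_mono[OF lc(1) f0(1)])
  moreover have "(C\<^sup>2 * T + real CARD('p) * (2 * C\<^sup>2 * T)) * \<Delta> <= lin_const * \<Delta>" using \<Delta>(1) by (intro mult_right_mono lc(2)) simp
  moreover have "(2 * real CARD('p) * C * T) * (w * norm e) <= lin_const * (w * norm e)" by (rule mult_right_mono[OF lc(3) f0(2)])
  moreover have "w * (1 + T) * fluct n z + C\<^sup>2 * T * \<Delta> + 2 * real CARD('p) * C * T * (w * norm e) + real CARD('p) * (2 * C\<^sup>2 * T) * \<Delta>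
   = (1 + T) * (w * fluct n z) + (C\<^sup>2 * T + real CARD('p) * (2 * C\<^sup>2 * T)) * \<Delta> + (2 * real CARD('p) * C * T) * (w * norm e)"
   by (simp add: algebra_simps)
  ultimately show ?thesis by linarith
 qed
 finally show ?thesis unfolding \<Delta>_def e_def z_def by (simp add: distrib_left)
qed

text \<open>Positive definiteness makes the kernel trivial, hence the matrix invertible, and the inverse inherits the symmetry.\<close>

lemma pos_def_inverse:
 assumes "pos_def_matrix (A :: real^'p^'p)"
 shows "invertible A" "matrix_inv A ** A = mat 1" "A ** matrix_inv A = mat 1" "transpose (matrix_inv A) = matrix_inv A"
proof -
 have inj: "A *v x = 0 ==> x = 0" for x
  using assms unfolding pos_def_matrix_def by (metis inner_zero_right less_irrefl)
 show inv: "invertible A"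
  by (simp add: invertible_left_inverse matrix_left_invertible_ker inj)
 then show l: "matrix_inv A ** A = mat 1" and r: "A ** matrix_inv A = mat 1"
  using someI_ex[of "%B. A ** B = mat 1 \<and> B ** A = mat 1"] inv unfolding invertible_def matrix_inv_def by blast+
 have tA: "transpose A = A" using assms unfolding pos_def_matrix_def by blast
 have "transpose (matrix_inv A) ** A = mat 1"
  using arg_cong[OF r, of transpose] unfolding matrix_transpose_mul tA by (simp add: transpose_mat)
 then have "transpose (matrix_inv A) ** A ** matrix_inv A = matrix_inv A" by simp
 then show "transpose (matrix_inv A) = matrix_inv A" by (simp add: matrix_mul_assoc[symmetric] r)
qed

text \<open>Solving the linearized first order condition for the estimation error first bounds it by a multiple of the fluctuation plus the
mesh, and inserting that bound into the remainder makes the remainder small relative to the fluctuation. Here \<open>w\<close> measures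
this smallness and can be prescribed; closeness to \<open>\<theta>0\<close> is supplied by \<open>consistency\<close>.\<close>

lemma estimator_expansion:
 assumes pd: "pos_def_matrix I0"
 shows "\<exists>B. \<forall>w>0. \<exists>\<delta>>0. \<exists>n0. \<forall>n\<ge>n0. 0 < n --> (\<forall>y \<theta>. y 0 = 0 --> \<theta> \<in> closure U
  --> (\<forall>\<theta>'\<in>closure U. contrast T h y n \<theta>' <= contrast T h y n \<theta>) --> fluct n (%j. fl y (\<tau> n j)) < \<delta>
  --> norm (\<theta> - \<theta>0 - matrix_inv I0 *v score n (fl y)) <= B * (w * fluct n (%j. fl y (\<tau> n j)) + T / real n))"
proof -
 note inv = pos_def_inverse[OF pd]
 define p where "p = real CARD('p)"
 obtain c where c: "0 < c" "!!x. norm (matrix_inv I0 *v x) <= norm x * c"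
  using bounded_linear.pos_bounded[OF matrix_vector_mul_bounded_linear[of "matrix_inv I0"]] by blast
 define A where "A = c * (p * lin_const)"
 have A: "0 < A" unfolding A_def p_def using c lin_const_pos by simp
 define E where "E = 2 * (c * (p * (C * (1 + T))) + A)"
 have E0: "0 <= E" unfolding E_def p_def using A c C0 T by simp
 define B where "B = A * (1 + E)"
 have "\<exists>\<delta>>0. \<exists>n0. \<forall>n\<ge>n0. 0 < n --> (\<forall>y \<theta>. y 0 = 0 --> \<theta> \<in> closure U
  --> (\<forall>\<theta>'\<in>closure U. contrast T h y n \<theta>' <= contrast T h y n \<theta>) --> fluct n (%j. fl y (\<tau> n j)) < \<delta>
  --> norm (\<theta> - \<theta>0 - matrix_inv I0 *v score n (fl y)) <= B * (w0 * fluct n (%j. fl y (\<tau> n j)) + T / real n))" if w0: "0 < w0" for w0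
 proof -
  define w where "w = min (min w0 1) (1 / (2 * A))"
  have w: "0 < w" "w <= w0" "w <= 1" "A * w <= 1 / 2"
  proof -
   show "0 < w" "w <= w0" "w <= 1" unfolding w_def using w0 A by auto
   have "A * w <= A * (1 / (2 * A))" unfolding w_def using A by (intro mult_left_mono) auto
   then show "A * w <= 1 / 2" using A by simp
  qed
  obtain \<epsilon>1 where e1: "0 < \<epsilon>1" "ball \<theta>0 \<epsilon>1 \<subseteq> U" using U(1) \<theta>0 openE by blast
  obtain \<epsilon>2 where e2: "0 < \<epsilon>2" "!!\<theta>. \<theta> \<in> closure U ==> dist \<theta> \<theta>0 < \<epsilon>2 ==> dist (om \<theta>) (om \<theta>0) < w"
   using om(1) \<theta>0_cl w(1) unfolding continuous_on_iff by blast
  define \<epsilon> where "\<epsilon> = min (min \<epsilon>1 \<epsilon>2) 1"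
  have \<epsilon>: "0 < \<epsilon>" "ball \<theta>0 \<epsilon> \<subseteq> U" "\<epsilon> <= 1" unfolding \<epsilon>_def using e1 e2 by auto
  have wb: "om \<theta>' <= w" if "\<theta>' \<in> ball \<theta>0 \<epsilon>" for \<theta>'
  proof -
   have "\<theta>' \<in> closure U" using that \<epsilon> closure_subset by blast
   moreover have "dist \<theta>' \<theta>0 < \<epsilon>2" using that unfolding \<epsilon>_def by (auto simp: dist_commute)
   ultimately show ?thesis using e2(2)[of \<theta>'] om(2) by (simp add: dist_real_def)
  qed
  obtain \<delta> n0 where \<delta>: "0 < \<delta>" and cons: "!!n y \<theta>. n \<ge> n0 ==> 0 < n ==> y 0 = 0 ==> \<theta> \<in> closure U ==> contrast T h y n \<theta>0 <= contrast T h y n \<theta>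
   ==> fluct n (%j. fl y (\<tau> n j)) < \<delta> ==> dist \<theta> \<theta>0 < \<epsilon>"
   using consistency[OF \<epsilon>(1)] by blast
  have "norm (\<theta> - \<theta>0 - matrix_inv I0 *v score n (fl y)) <= B * (w0 * fluct n (%j. fl y (\<tau> n j)) + T / real n)"
   if n: "n \<ge> n0" "0 < n" and y0: "y 0 = 0" and \<theta>: "\<theta> \<in> closure U" and max: "\<forall>\<theta>'\<in>closure U. contrast T h y n \<theta>' <= contrast T h y n \<theta>"
   and D: "fluct n (%j. fl y (\<tau> n j)) < \<delta>" for n y \<theta>
  proof -
   define F where "F = fluct n (%j. fl y (\<tau> n j))"
   define \<Delta> where "\<Delta> = T / real n"
   have F0: "0 <= F" "0 <= \<Delta>" unfolding F_def \<Delta>_def using fluct_nonneg T by auto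
   define e where "e = \<theta> - \<theta>0"
   define S where "S = score n (fl y)"
   have "dist \<theta> \<theta>0 < \<epsilon>" using cons[OF n y0 \<theta> _ D] max \<theta>0_cl by blast
   then have \<theta>b: "\<theta> \<in> ball \<theta>0 \<epsilon>" by (simp add: dist_commute)
   have mU: "contrast T h y n \<theta>' <= contrast T h y n \<theta>" if "\<theta>' \<in> U" for \<theta>' using max that closure_subset by blast
   have comp: "\<bar>S $ i - (I0 *v e) $ i\<bar> <= lin_const * (w * F + \<Delta> + w * norm e)" for i
    unfolding S_def e_def F_def \<Delta>_def by (rule score_linearization[OF \<epsilon>(2,3) wb \<theta>b n(2) y0 mU])
   have "norm (S - I0 *v e) <= (\<Sum>i\<in>UNIV. norm ((S - I0 *v e) $ i))" by (rule norm_vec_le_sum)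
   also have "... <= (\<Sum>i\<in>(UNIV::'p set). lin_const * (w * F + \<Delta> + w * norm e))"
    by (intro sum_mono) (use comp in simp)
   finally have d: "norm (S - I0 *v e) <= p * lin_const * (w * F + \<Delta> + w * norm e)" unfolding p_def by simp
   have ee: "matrix_inv I0 *v (I0 *v e) = e" by (simp add: matrix_vector_mul_assoc inv)
   have "norm (e - matrix_inv I0 *v S) = norm (matrix_inv I0 *v (S - I0 *v e))"
    by (simp add: matrix_vector_mult_diff_distrib ee norm_minus_commute)
   also have "... <= norm (S - I0 *v e) * c" by (rule c(2))
   also have "... <= (p * lin_const * (w * F + \<Delta> + w * norm e)) * c" using d c(1) by (intro mult_right_mono) auto
   also have "... = A * (w * F + \<Delta> + w * norm e)" unfolding A_def by (simp add: mult_ac)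
   finally have fin: "norm (e - matrix_inv I0 *v S) <= A * (w * F + \<Delta> + w * norm e)" .
   have Sb: "norm S <= p * (C * (1 + T)) * F"
   proof -
    have "norm S <= (\<Sum>i\<in>UNIV. norm (S $ i))" by (rule norm_vec_le_sum)
    also have "... <= (\<Sum>i\<in>(UNIV::'p set). C * (1 + T) * F)"
     unfolding S_def F_def by (intro sum_mono) (use score_bound[OF n(2), of "fl y"] fl_0[of y, OF y0] in simp)
    finally show ?thesis unfolding p_def by simp
   qed
   have "norm e <= norm (matrix_inv I0 *v S) + norm (e - matrix_inv I0 *v S)"
    using norm_triangle_ineq[of "matrix_inv I0 *v S" "e - matrix_inv I0 *v S"] by simp
   also have "... <= (p * (C * (1 + T)) * F) * c + A * (w * F + \<Delta> + w * norm e)"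
    using Sb c by (intro add_mono order_trans[OF c(2)] mult_right_mono fin) auto
   also have "A * (w * F + \<Delta> + w * norm e) = (A * w) * F + A * \<Delta> + (A * w) * norm e" by (simp add: algebra_simps)
   also have "(p * (C * (1 + T)) * F) * c + ((A * w) * F + A * \<Delta> + (A * w) * norm e) <= (p * (C * (1 + T)) * F) * c + (A * F + A * \<Delta> + 1/2 * norm e)"
    using w A F0 by (intro add_mono mult_right_mono order_refl) (auto simp: mult_le_cancel_left2)
   finally have "norm e <= 2 * (p * (C * (1 + T)) * F * c + (A * F + A * \<Delta>))" by simp
   also have "... <= E * (F + \<Delta>)"
   proof -
    have "0 <= c * (p * (C * (1 + T))) * \<Delta>" using c C0 T F0 unfolding p_def by simp
    then show ?thesis unfolding E_def by (simp add: algebra_simps)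
   qed
   finally have eb: "norm e <= E * (F + \<Delta>)" .
   have "w * F + \<Delta> + w * norm e <= w * F + \<Delta> + w * (E * (F + \<Delta>))" using eb w by (intro add_left_mono mult_left_mono) auto
   also have "... <= (1 + E) * (w * F + \<Delta>)"
   proof -
    have "w * (E * \<Delta>) <= 1 * (E * \<Delta>)" using w E0 F0 by (intro mult_right_mono) auto
    then show ?thesis by (simp add: algebra_simps)
   qed
   also have "... <= (1 + E) * (w0 * F + \<Delta>)" using w E0 F0 by (intro mult_left_mono add_right_mono mult_right_mono) auto
   finally have "A * (w * F + \<Delta> + w * norm e) <= A * ((1 + E) * (w0 * F + \<Delta>))" using A by (intro mult_left_mono) auto
   then show ?thesis using fin unfolding e_def S_def F_def \<Delta>_def B_def by (simp add: mult.assoc)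
  qed
  then show ?thesis using \<delta> by (intro exI[of _ \<delta>] conjI exI[of _ n0] allI impI) auto
 qed
 then show ?thesis by blast
qed

end

section \<open>Regularity of the mean signal\<close>

text \<open>The assumptions on the family of models in the form used below, with identifiability expressed through the mean signal.\<close>

locale observed_model = prob_space M
 for M :: "'a measure" +
 fixes T :: real and U :: "(real^'p) set" and \<theta>0 :: "real^'p"
  and H :: "real^'p => complex^'d^'d" and L :: "real^'p => 'r::finite => complex^'d^'d"
  and W :: "nat => real => 'a => real^'r" and \<rho>0 :: "complex^'d^'d"
  and \<rho> :: "real^'p => nat => real => 'a => complex^'d^'d"
 assumes T: "0 < T" and U: "open U" "convex U" "bounded U" and \<theta>0: "\<theta>0 \<in> U"
  and wiener: "!!i. wiener_process M T (W i)"
  and indep: "indep_vars (%i. PiM {0..T} (%_. borel)) (%i om. \<lambda>t\<in>{0..T}. W i t om) UNIV"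
  and solution: "!!\<theta> i. \<theta> \<in> closure U ==> belavkin_solution M T (H \<theta>) (L \<theta>) \<rho>0 (W i) (\<rho> \<theta> i)"
  and smooth_H: "\<exists>D. C1_on U H D"
  and smooth_L: "!!k. \<exists>D. C1_on U (%\<theta>. L \<theta> k) D"
  and identifiable: "!!\<theta>. \<theta> \<in> closure U ==> \<theta> ~= \<theta>0 ==>
    \<exists>t\<in>{0..T}. mean_signal M L \<rho> t \<theta> ~= mean_signal M L \<rho> t \<theta>0"
begin

abbreviation "h \<equiv> mean_signal M L \<rho>"

text \<open>A bound for the norm of density matrices: each of the entries has modulus at most one.\<close>

definition radius :: real where "radius = (real CARD('d))\<^sup>2"

lemma radius_nonneg: "0 <= radius" unfolding radius_def by simp

lemma brownian: "brownian M T (W i)"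
 using wiener prob_space_axioms unfolding brownian_def brownian_axioms_def by blast

lemma \<theta>0_cl: "\<theta>0 \<in> closure U" using \<theta>0 closure_subset by blast

lemma state_bound:
 assumes "\<theta> \<in> closure U"
 shows "AE om in M. \<forall>t\<in>{0..T}. norm (\<rho> \<theta> i t om) <= radius"
proof -
 have "AE om in M. \<forall>t\<in>{0..T}. density_matrix (\<rho> \<theta> i t om)"
  using solution[OF assms, of i] unfolding belavkin_solution_def by blast
 then show ?thesis unfolding radius_def by eventually_elim (use density_matrix_norm in blast)
qed

lemma state_sde:
 assumes "\<theta> \<in> closure U"
 shows "brownian.sde_solution M T (W i) (lindblad (H \<theta>) (L \<theta>)) (%k. diffusion_coeff (L \<theta> k)) \<rho>0 (\<rho> \<theta> i)"
 using solution[OF assms, of i] unfolding brownian.sde_solution_def[OF brownian] belavkin_solution_def by blast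

abbreviation "B \<equiv> (%\<theta>. superop (H \<theta>) (L \<theta>))"

lemma funpow_lindblad: "(lindblad (H \<theta>) (L \<theta>) ^^ n) x = iter_state B x n \<theta>"
 by (induction n) (simp_all add: superop_apply)

lemma mean_series:
 assumes "\<theta> \<in> closure U" "t \<in> {0..T}"
 shows "(%n. (t ^ n / fact n) *\<^sub>R iter_state B \<rho>0 n \<theta>) sums expectation (\<rho> \<theta> i t)"
 using brownian.sde_mean[OF brownian state_sde[OF assms(1)] bounded_linear_lindblad state_bound[OF assms(1)] assms(2)]
 unfolding funpow_lindblad .

text \<open>Every copy has the same exponential series as its mean.\<close>

lemma mean_copy:
 assumes "\<theta> \<in> closure U" "t \<in> {0..T}"
 shows "expectation (\<rho> \<theta> i t) = mean_state M \<rho> \<theta> t"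
 unfolding mean_state_def using sums_unique2[OF mean_series[OF assms, of i] mean_series[OF assms, of 0]] .

text \<open>The mean signal as a power series in time whose coefficients are products of the differentiable observable and
iterates of the differentiable generator.\<close>

definition sig_coeff :: "nat => real^'p => real^'r" where
 "sig_coeff n \<theta> = (\<Sum>k\<in>UNIV. bform (L \<theta> k) (iter_state B \<rho>0 n \<theta>) *\<^sub>R axis k 1)"

lemma bvec_sum: "bvec Ls A = (\<Sum>k\<in>UNIV. bform (Ls k) A *\<^sub>R axis k 1)"
 by (simp add: vec_eq_iff bvec_def axis_def if_distrib[where f="%x. _ * x"] cong: if_cong)

lemma signal_series:
 assumes "\<theta> \<in> closure U" "t \<in> {0..T}"
 shows "h t \<theta> = pser sig_coeff t \<theta>"
proof -
 note bl = bounded_linear_bvec[of "L \<theta>"]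
 have "(%n. bvec (L \<theta>) ((t ^ n / fact n) *\<^sub>R iter_state B \<rho>0 n \<theta>)) sums h t \<theta>"
  unfolding mean_signal_def mean_state_def by (rule bounded_linear.sums[OF bl mean_series[OF assms]])
 then have "(%n. (t ^ n / fact n) *\<^sub>R sig_coeff n \<theta>) sums h t \<theta>"
  by (simp only: linear_cmul[OF bounded_linear.linear[OF bl]] sig_coeff_def bvec_sum[symmetric])
 then show ?thesis unfolding pser_def by (rule sums_unique)
qed

text \<open>The product rule together with geometric bounds on the iterates, uniform over the compact parameter set.\<close>

lemma sig_coeff_regular:
 "\<exists>Dy C K. (\<forall>n. C1_on U (sig_coeff n) (Dy n)) \<and> (\<forall>n. \<forall>\<theta>\<in>closure U. norm (sig_coeff n \<theta>) <= C * K ^ n \<and> (\<forall>i. norm (Dy n i \<theta>) <= C * K ^ n))"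
proof -
 obtain DH where DH: "C1_on U H DH" using smooth_H by blast
 have "\<forall>k. \<exists>D. C1_on U (%\<theta>. L \<theta> k) D" using smooth_L by blast
 from choice[OF this] obtain DL where DL: "!!k. C1_on U (%\<theta>. L \<theta> k) (DL k)" by blast
 obtain DB where DB: "C1_on U B DB"
  by (rule superop_C1[where H=H and L=L and DL=DL, OF DH DL]) (rule that)
 define dx where "dx = iter_deriv B DB \<rho>0"
 define Dy where "Dy n i \<theta> = (\<Sum>k\<in>UNIV. (bform (L \<theta> k) (dx n i \<theta>) + bform (DL k i \<theta>) (iter_state B \<rho>0 n \<theta>)) *\<^sub>R axis k (1::real))" for n i \<theta>
 have C1: "C1_on U (sig_coeff n) (Dy n)" for n
  unfolding sig_coeff_def[abs_def] Dy_def[abs_def] dx_def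
  by (intro C1_on_sum finite C1_on_linear[OF bounded_linear_scaleR_left] C1_on_bilinear[OF bounded_bilinear_bform] DL iter_state_C1 DB)
 obtain K0 where K0: "\<forall>\<theta>\<in>closure U. norm (B \<theta>) <= K0 \<and> (\<forall>i. norm (DB i \<theta>) <= K0)" using C1_on_bounded[OF DB U(3)] by blast
 define K where "K = max 1 K0"
 have K: "norm (B \<theta>) <= K" "norm (DB i \<theta>) <= K" "1 <= K" if "\<theta> \<in> closure U" for \<theta> i
  using K0 that unfolding K_def by (auto simp: le_max_iff_disj)
 have "\<forall>k. \<exists>K2. \<forall>\<theta>\<in>closure U. norm (L \<theta> k) <= K2 \<and> (\<forall>i. norm (DL k i \<theta>) <= K2)" using C1_on_bounded[OF DL U(3)] by blast
 from choice[OF this] obtain K2 where K2: "!!k \<theta>. \<theta> \<in> closure U ==> norm (L \<theta> k) <= K2 k \<and> (\<forall>i. norm (DL k i \<theta>) <= K2 k)" by blast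
 obtain Kb where Kb: "0 <= Kb" "!!A B :: complex^'d^'d. norm (bform A B) <= norm A * norm B * Kb"
  using bounded_bilinear.nonneg_bounded[OF bounded_bilinear_bform] by blast
 define C where "C = 2 * (\<Sum>k\<in>UNIV. K2 k * norm \<rho>0 * Kb)"
 have "norm (sig_coeff n \<theta>) <= C * (2 * K) ^ n \<and> (\<forall>i. norm (Dy n i \<theta>) <= C * (2 * K) ^ n)" if \<theta>: "\<theta> \<in> closure U" for n \<theta>
 proof (intro conjI allI)
  note it = iter_state_bound[where B=B and D=DB and \<theta>=\<theta> and K=K and ?x0.0=\<rho>0, OF K(1,2,3)[OF \<theta>]]
  have K20: "0 <= K2 k" for k using K2[OF \<theta>, of k] norm_ge_zero order_trans by blast
  have P0: "0 <= (2 * K) ^ n" using K(3)[OF \<theta>] by simp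
  have x: "norm (iter_state B \<rho>0 n \<theta>) <= norm \<rho>0 * (2 * K) ^ n"
  proof -
   have "K ^ n <= (2 * K) ^ n" using K(3)[OF \<theta>] by (intro power_mono) auto
   then show ?thesis using it(1)[of n] by (meson mult_left_mono norm_ge_zero order_trans)
  qed
  have bf: "\<bar>bform A x\<bar> <= K2 k * norm \<rho>0 * Kb * (2 * K) ^ n" if "norm A <= K2 k" "norm x <= norm \<rho>0 * (2 * K) ^ n" for A x :: "complex^'d^'d" and k
  proof -
   have "\<bar>bform A x\<bar> <= norm A * norm x * Kb" using Kb(2)[of A x] by simp
   also have "... <= K2 k * (norm \<rho>0 * (2 * K) ^ n) * Kb" using that Kb(1) K20 by (intro mult_right_mono mult_mono) auto
   finally show ?thesis by (simp add: mult_ac)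
  qed
  have "norm (sig_coeff n \<theta>) <= (\<Sum>k\<in>UNIV. K2 k * norm \<rho>0 * Kb * (2 * K) ^ n)"
   unfolding sig_coeff_def using bf K2[OF \<theta>] x by (intro sum_norm_le) (simp add: norm_axis_1)
  also have "... = (\<Sum>k\<in>UNIV. K2 k * norm \<rho>0 * Kb) * (2 * K) ^ n" by (simp add: sum_distrib_right)
  also have "... <= C * (2 * K) ^ n"
   unfolding C_def using P0 K20 Kb by (intro mult_right_mono) (auto intro!: sum_nonneg)
  finally show "norm (sig_coeff n \<theta>) <= C * (2 * K) ^ n" .
  fix i
  have "norm (Dy n i \<theta>) <= (\<Sum>k\<in>UNIV. 2 * (K2 k * norm \<rho>0 * Kb * (2 * K) ^ n))"
   unfolding Dy_def
  proof (rule sum_norm_le)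
   fix k
   have "\<bar>bform (L \<theta> k) (dx n i \<theta>)\<bar> <= K2 k * norm \<rho>0 * Kb * (2 * K) ^ n" "\<bar>bform (DL k i \<theta>) (iter_state B \<rho>0 n \<theta>)\<bar> <= K2 k * norm \<rho>0 * Kb * (2 * K) ^ n"
    using bf K2[OF \<theta>] x it(2)[of n i] unfolding dx_def by auto
   then show "norm ((bform (L \<theta> k) (dx n i \<theta>) + bform (DL k i \<theta>) (iter_state B \<rho>0 n \<theta>)) *\<^sub>R axis k (1::real)) <= 2 * (K2 k * norm \<rho>0 * Kb * (2 * K) ^ n)"
    by (simp add: norm_axis_1)
  qed
  also have "... = C * (2 * K) ^ n" unfolding C_def by (simp add: sum_distrib_right sum_distrib_left mult_ac)
  finally show "norm (Dy n i \<theta>) <= C * (2 * K) ^ n" .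
 qed
 with C1 show ?thesis by blast
qed

text \<open>All bounds required of a regular signal are obtained by summing those of the coefficients against the time weights.\<close>

lemma regular: "\<exists>g C om. regular_signal T U \<theta>0 h g C om"
proof -
 obtain Dy C K where C1: "!!n. C1_on U (sig_coeff n) (Dy n)"
  and b: "!!n \<theta>. \<theta> \<in> closure U ==> norm (sig_coeff n \<theta>) <= C * K ^ n" "!!n i \<theta>. \<theta> \<in> closure U ==> norm (Dy n i \<theta>) <= C * K ^ n"
  using sig_coeff_regular by blast
 define g where "g i t \<theta> = pser (%n. Dy n i) t \<theta>" for i t \<theta>
 define C' where "C' = (\<Sum>n. wt T n * (C * K ^ n))"
 define \<mu> where "\<mu> i \<theta> = (\<Sum>n. wt T n * norm (Dy n i \<theta> - Dy n i \<theta>0))" for i \<theta>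
 define om where "om \<theta> = (\<Sum>i\<in>UNIV. \<mu> i \<theta>)" for \<theta>
 have T0: "0 <= T" using T by simp
 have le: "(\<Sum>n. wt T n * norm (y n \<theta>)) <= C'" if "!!n. norm (y n \<theta>) <= C * K ^ n" for y :: "nat => real^'p => real^'r" and \<theta>
  unfolding C'_def using that wt_nonneg[OF T0] pser_summable(2)[where y=y and x=\<theta> and t=0 and T=T, OF that] T
  by (intro suminf_le mult_left_mono wt_summable) auto
 have lip: "norm (pser y t \<theta> - pser y s \<theta>) <= C' * \<bar>t - s\<bar>" "norm (pser y t \<theta>) <= C'"
  if y: "!!n. norm (y n \<theta>) <= C * K ^ n" and st: "s \<in> {0..T}" "t \<in> {0..T}" for y :: "nat => real^'p => real^'r" and \<theta> s t
  using pser_summable(4)[where y=y and x=\<theta>, OF y st(2) st(1)] pser_summable(3)[where y=y and x=\<theta>, OF y st(2)] le[of y \<theta>, OF y]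
   mult_right_mono[OF le[of y \<theta>, OF y], of "\<bar>t - s\<bar>"]
  by linarith+
 have d: "norm (Dy n i \<theta> - Dy n i \<theta>0) <= (2 * C) * K ^ n" if "\<theta> \<in> closure U" for n i \<theta>
  using norm_triangle_ineq4[of "Dy n i \<theta>" "Dy n i \<theta>0"] b(2)[OF that, of n i] b(2)[OF \<theta>0_cl, of n i] by simp
 have gd: "g i t \<theta> - g i t \<theta>0 = pser (%n _. Dy n i \<theta> - Dy n i \<theta>0) t ()" if "\<theta> \<in> closure U" "t \<in> {0..T}" for i t \<theta>
  unfolding g_def using pser_diff[where y="%n. Dy n i" and x=\<theta> and z=\<theta>0, OF b(2)[OF that(1)] b(2)[OF \<theta>0_cl] that(2)] .
 have \<mu>om: "\<mu> i \<theta> <= om \<theta>" if "\<theta> \<in> closure U" for i \<theta>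
 proof -
  have "0 <= \<mu> l \<theta>" for l
   unfolding \<mu>_def using pser_summable(2)[where y="%n _. Dy n l \<theta> - Dy n l \<theta>0" and x="()" and t=0 and T=T, OF d[OF that]] T wt_nonneg[OF T0]
   by (intro suminf_nonneg) auto
  then show ?thesis unfolding om_def by (intro member_le_sum) auto
 qed
 have "regular_signal T U \<theta>0 h g C' om"
 proof
  show "0 < T" "open U" "bounded U" "\<theta>0 \<in> U" by (fact T U \<theta>0)+
  fix \<theta> s t assume \<theta>: "\<theta> \<in> closure U" and st: "s \<in> {0..T}" "t \<in> {0..T}"
  show "norm (h t \<theta> - h s \<theta>) <= C' * \<bar>t - s\<bar>"
   unfolding signal_series[OF \<theta> st(1)] signal_series[OF \<theta> st(2)] by (rule lip(1)[of sig_coeff \<theta> s t, OF b(1)[OF \<theta>] st])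
  show "norm (h t \<theta>) <= C'"
   unfolding signal_series[OF \<theta> st(2)] by (rule lip(2)[of sig_coeff \<theta> s t, OF b(1)[OF \<theta>] st])
  show "norm (g i t \<theta> - g i s \<theta>) <= C' * \<bar>t - s\<bar>" "norm (g i t \<theta>) <= C'" for i
   unfolding g_def by (rule lip(1)[of "%n. Dy n i" \<theta> s t, OF b(2)[OF \<theta>] st], rule lip(2)[of "%n. Dy n i" \<theta> s t, OF b(2)[OF \<theta>] st])
  show "norm (g i t \<theta> - g i t \<theta>0) <= om \<theta>" for i
   unfolding gd[OF \<theta> st(2)] using pser_summable(3)[where y="%n _. Dy n i \<theta> - Dy n i \<theta>0" and x="()", OF d[OF \<theta>] st(2)] \<mu>om[OF \<theta>, of i]
   unfolding \<mu>_def by linarith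
  show "norm ((g i t \<theta> - g i t \<theta>0) - (g i s \<theta> - g i s \<theta>0)) <= om \<theta> * \<bar>t - s\<bar>" for i
   unfolding gd[OF \<theta> st(2)] gd[OF \<theta> st(1)]
   using pser_summable(4)[where y="%n _. Dy n i \<theta> - Dy n i \<theta>0" and x="()", OF d[OF \<theta>] st(2) st(1)] mult_right_mono[OF \<mu>om[OF \<theta>, of i], of "\<bar>t - s\<bar>"]
   unfolding \<mu>_def by linarith
 next
  fix t assume t: "t \<in> {0..T}"
  have "continuous_on (closure U) (pser sig_coeff t)"
   by (rule pser_continuous[OF b(1) _ t]) (use C1 in \<open>auto simp: C1_on_def\<close>)
  then show "continuous_on (closure U) (h t)"
   by (rule continuous_on_eq) (use signal_series t in simp)
 next
  show "continuous_on (closure U) om"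
   unfolding om_def[abs_def] \<mu>_def
   by (intro continuous_on_sum pser_modulus_continuous[where y="%n. Dy n i" for i, OF b(2) _ \<theta>0_cl T0]) (use C1 in \<open>auto simp: C1_on_def\<close>)
  show "om \<theta>0 = 0" unfolding om_def \<mu>_def by simp
 next
  fix \<theta> t assume \<theta>: "\<theta> \<in> U" and t: "t \<in> {0..T}"
  have "(pser sig_coeff t has_derivative (%v. \<Sum>i\<in>UNIV. v $ i *\<^sub>R pser (%n. Dy n i) t \<theta>)) (at \<theta>)"
   by (rule pser_has_derivative[OF U(1,2) C1 b(1) b(2) t \<theta>]) (use closure_subset in blast)+
  then show "(h t has_derivative (%v. \<Sum>i\<in>UNIV. v $ i *\<^sub>R g i t \<theta>)) (at \<theta>)"
   unfolding g_def
   by (rule has_derivative_transform_within_open[OF _ U(1) \<theta>]) (use signal_series t closure_subset in fastforce)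
 next
  show "\<exists>t\<in>{0..T}. h t \<theta> ~= h t \<theta>0" if "\<theta> \<in> closure U" "\<theta> ~= \<theta>0" for \<theta> using identifiable[OF that] .
 qed
 then show ?thesis by blast
qed

end

section \<open>Fluctuations of the averaged record\<close>

locale observed_regular = observed_model M T U \<theta>0 H L W \<rho>0 \<rho> + regular_signal T U \<theta>0 "mean_signal M L \<rho>" g C md
 for M :: "'a measure" and T :: real and U :: "(real^'p) set" and \<theta>0 :: "real^'p"
  and H :: "real^'p => complex^'d^'d" and L :: "real^'p => 'r::finite => complex^'d^'d"
  and W :: "nat => real => 'a => real^'r" and \<rho>0 :: "complex^'d^'d"
  and \<rho> :: "real^'p => nat => real => 'a => complex^'d^'d"
  and g :: "'p => real => real^'p => real^'r" and C :: real and md :: "real^'p => real"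
begin

abbreviation "FT i \<equiv> aug_filtration M (W i) T"

text \<open>The signal of copy \<open>i\<close> under the true parameter, whose mean is \<open>h s \<theta>0\<close>.\<close>

definition sig :: "nat => real => 'a => real^'r" where "sig i s om = bvec (L \<theta>0) (\<rho> \<theta>0 i s om)"

text \<open>The fluctuation of the record of a single copy: a centred process measurable with respect to that copy.\<close>

definition Z :: "nat => real => 'a => real^'r" where
 "Z i t om = fl (%t. obs_record L \<rho> W \<theta>0 i t om) t"

lemma T_nonneg: "0 <= T" using T by simp

lemma Z_eq: "Z i t om = (LINT s:{0..t}|lborel. sig i s om) - (LINT s:{0..t}|lborel. h s \<theta>0) + W i t om"
 unfolding Z_def fl_def obs_record_def sig_def by simp

lemma space_FT[simp]: "space (FT i) = space M" by (rule brownian.space_F[OF brownian])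

lemma FT_M: "V \<in> borel_measurable (FT i) ==> V \<in> borel_measurable M"
 by (rule brownian.measurable_F_M[OF brownian order_refl])

lemma sig_process:
 shows "s \<in> {0..T} ==> sig i s \<in> borel_measurable (FT i)" "om \<in> space M ==> continuous_on {0..T} (%s. sig i s om)"
proof -
 note sol = solution[OF observed_model.\<theta>0_cl[OF observed_model_axioms], of i, unfolded belavkin_solution_def]
 note bc = linear_continuous_on[OF bounded_linear_bvec[of "L \<theta>0"], of UNIV]
 have [measurable]: "bvec (L \<theta>0) \<in> borel_measurable borel" by (rule borel_measurable_continuous_onI[OF bc])
 show "sig i s \<in> borel_measurable (FT i)" if "s \<in> {0..T}"
 proof -
  have "\<rho> \<theta>0 i s \<in> borel_measurable (aug_filtration M (W i) s)" using sol that by blast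
  from brownian.measurable_F_mono[OF brownian _ this, of T] have "\<rho> \<theta>0 i s \<in> borel_measurable (FT i)" using that by simp
  then show ?thesis unfolding sig_def[abs_def] by measurable
 qed
 show "continuous_on {0..T} (%s. sig i s om)" if "om \<in> space M"
  unfolding sig_def using sol that by (intro continuous_on_compose2[OF bc]) auto
qed

text \<open>An almost sure bound for the signal: an operator bound of the observable times the radius of the state space.\<close>

definition sig_bd :: real where "sig_bd = (SOME K. 0 <= K \<and> (\<forall>x. norm (bvec (L \<theta>0) x) <= norm x * K)) * radius"

lemma sig_bound: "AE om in M. \<forall>s\<in>{0..T}. norm (sig i s om) <= sig_bd" and sig_bd_nonneg: "0 <= sig_bd"
proof -
 define K where "K = (SOME K. 0 <= K \<and> (\<forall>x. norm (bvec (L \<theta>0) x) <= norm x * K))"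
 have K: "0 <= K \<and> (\<forall>x. norm (bvec (L \<theta>0) x) <= norm x * K)"
  unfolding K_def by (rule someI_ex) (use bounded_linear.nonneg_bounded[OF bounded_linear_bvec[of "L \<theta>0"]] in blast)
 show "0 <= sig_bd" unfolding sig_bd_def K_def[symmetric] using K radius_nonneg by simp
 show "AE om in M. \<forall>s\<in>{0..T}. norm (sig i s om) <= sig_bd"
  using state_bound[OF observed_model.\<theta>0_cl[OF observed_model_axioms], of i]
 proof eventually_elim
  case (elim om)
  show ?case
  proof
   fix s assume "s \<in> {0..T}"
   then have "norm (\<rho> \<theta>0 i s om) * K <= radius * K" using elim K by (intro mult_right_mono) auto
   then show "norm (sig i s om) <= sig_bd" unfolding sig_def sig_bd_def K_def[symmetric] using K by (metis mult.commute order_trans)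
  qed
 qed
qed

lemma h0_continuous: "t <= T ==> continuous_on {0..t} (%s. h s \<theta>0)"
 by (rule lipschitz_continuous[where A=C]) (use h_lip \<theta>0_cl in auto)

lemma sig_jointly_measurable:
 assumes "t \<in> {0..T}"
 shows "(%(s, om). sig i s om) \<in> borel_measurable (leb t \<Otimes>\<^sub>M FT i)" "(%(s, om). sig i s om) \<in> borel_measurable (leb t \<Otimes>\<^sub>M M)"
proof -
 have c: "continuous_on {0..t} (%s. sig i s om)" if "om \<in> space M" for om
  using continuous_on_subset[OF sig_process(2)[OF that, of i], of "{0..t}"] assms by auto
 show "(%(s, om). sig i s om) \<in> borel_measurable (leb t \<Otimes>\<^sub>M FT i)"
  by (rule continuous_process_measurable) (use sig_process(1)[of _ i] c assms in auto)
 show "(%(s, om). sig i s om) \<in> borel_measurable (leb t \<Otimes>\<^sub>M M)"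
  by (rule continuous_process_measurable) (use FT_M[OF sig_process(1)] c assms in auto)
qed

lemma Z_FT: "t \<in> {0..T} ==> Z i t \<in> borel_measurable (FT i)"
proof -
 assume t: "t \<in> {0..T}"
 have "W i t \<in> borel_measurable (FT i)" using t by (intro brownian.W_F[OF brownian]) auto
 then show ?thesis unfolding Z_eq[abs_def] using time_integral_measurable[OF sig_jointly_measurable(1)[OF t]] by measurable
qed

text \<open>Since \<open>W i 0\<close> vanishes almost surely, the value at \<open>t\<close> is an increment from \<open>0\<close>.\<close>

lemma W_moments:
 assumes t: "t \<in> {0..T}"
 shows "integrable M (W i t)" "expectation (W i t) = 0" "msq M (W i t) <= ennreal (real CARD('r) * T)"
proof -
 interpret b: brownian M T "W i" by (rule brownian)
 have m: "W i t \<in> borel_measurable M" by (rule b.W_measurable[OF t])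
 have ae: "AE om in M. \<forall>k. W i t om $ k = b.dW k 0 t om"
  using wiener[of i] unfolding wiener_process_def by (auto simp: b.dW_def elim!: eventually_mono)
 note mo = b.increment_moments[of 0 t]
 have k: "integrable M (%om. W i t om $ k)" "expectation (%om. W i t om $ k) = 0"
  "integrable M (%om. (W i t om $ k)\<^sup>2)" "expectation (%om. (W i t om $ k)\<^sup>2) = t" for k
 proof -
  have a: "AE om in M. W i t om $ k = b.dW k 0 t om" using ae by (auto elim!: eventually_mono)
  have mk: "(%om. W i t om $ k) \<in> borel_measurable M" using m by measurable
  have md: "b.dW k 0 t \<in> borel_measurable M" using t by (intro b.dW_measurable) auto
  show "integrable M (%om. W i t om $ k)" using mo(1)[of k] integrable_cong_AE[OF mk md a] t by simp
  show "expectation (%om. W i t om $ k) = 0" using mo(2)[of k] integral_cong_AE[OF mk md a] t by simp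
  have a2: "AE om in M. (W i t om $ k)\<^sup>2 = (b.dW k 0 t om)\<^sup>2" using a by (auto elim!: eventually_mono)
  show "integrable M (%om. (W i t om $ k)\<^sup>2)" using mo(3)[of k] integrable_cong_AE[OF _ _ a2] mk md t by simp
  show "expectation (%om. (W i t om $ k)\<^sup>2) = t" using mo(4)[of k] integral_cong_AE[OF _ _ a2] mk md t by simp
 qed
 have rep: "W i t om = (\<Sum>k\<in>UNIV. (W i t om $ k) *\<^sub>R axis k 1)" for om
  by (simp add: vec_eq_iff axis_def if_distrib[where f="%x. _ * x"] cong: if_cong)
 have "has_bochner_integral M (%om. \<Sum>k\<in>UNIV. (W i t om $ k) *\<^sub>R axis k (1::real)) (\<Sum>k\<in>UNIV. 0 *\<^sub>R axis k (1::real))"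
  by (intro has_bochner_integral_sum has_bochner_integral_scaleR_left) (use k in \<open>auto simp: has_bochner_integral_iff\<close>)
 then have "has_bochner_integral M (W i t) 0" unfolding rep[symmetric] by simp
 then show "integrable M (W i t)" "expectation (W i t) = 0" by (auto simp: has_bochner_integral_iff)
 have n: "(norm (W i t om))\<^sup>2 = (\<Sum>k\<in>UNIV. (W i t om $ k)\<^sup>2)" for om
  unfolding power2_norm_eq_inner inner_vec_def by (simp add: power2_eq_square)
 have "msq M (W i t) = ennreal (\<Sum>k\<in>(UNIV::'r set). t)"
  using k(3) by (subst msq_integral) (simp_all add: n k(4))
 also have "... <= ennreal (real CARD('r) * T)" using t by (intro ennreal_leI) simp
 finally show "msq M (W i t) <= ennreal (real CARD('r) * T)" .
qed

lemma signal_mean_integral: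
 assumes t: "t \<in> {0..T}"
 shows "integrable M (%om. LINT s:{0..t}|lborel. sig i s om)"
  "expectation (%om. LINT s:{0..t}|lborel. sig i s om) = (LINT s:{0..t}|lborel. h s \<theta>0)"
  "!!s. s \<in> {0..T} ==> integrable M (sig i s) \<and> expectation (sig i s) = h s \<theta>0"
proof -
 interpret b: brownian M T "W i" by (rule brownian)
 have K: "AE om in M. \<forall>s\<in>{0..t}. norm (sig i s om) <= sig_bd" using sig_bound[of i] by eventually_elim (use t in auto)
 note ti = b.expectation_time_integral[OF sig_jointly_measurable(2)[OF t] K]
 show "integrable M (%om. LINT s:{0..t}|lborel. sig i s om)" by (rule ti(1))
 show es: "integrable M (sig i s) \<and> expectation (sig i s) = h s \<theta>0" if s: "s \<in> {0..T}" for s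
 proof -
  note cl = observed_model.\<theta>0_cl[OF observed_model_axioms]
  have m: "\<rho> \<theta>0 i s \<in> borel_measurable M"
   using b.sde_process(2)[OF state_sde[OF cl] continuous_on_id T_nonneg order_refl s] by simp
  have "AE om in M. norm (\<rho> \<theta>0 i s om) <= radius" using state_bound[OF cl, of i] by eventually_elim (use s in auto)
  then have i: "integrable M (\<rho> \<theta>0 i s)" using m by (rule integrable_const_bound)
  have "expectation (sig i s) = bvec (L \<theta>0) (expectation (\<rho> \<theta>0 i s))"
   unfolding sig_def[abs_def] by (rule integral_bounded_linear[OF bounded_linear_bvec i])
  then show ?thesis
   using integrable_bounded_linear[OF bounded_linear_bvec i] unfolding mean_copy[OF cl s] mean_signal_def sig_def[abs_def] by simp
 qed
 have "(LINT s:{0..t}|lborel. expectation (sig i s)) = (LINT s:{0..t}|lborel. h s \<theta>0)"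
  unfolding set_integral_leb using es t by (intro Bochner_Integration.integral_cong) auto
 then show "expectation (%om. LINT s:{0..t}|lborel. sig i s om) = (LINT s:{0..t}|lborel. h s \<theta>0)" using ti(2) by simp
qed

lemma Z_mean:
 assumes t: "t \<in> {0..T}"
 shows "integrable M (Z i t)" "expectation (Z i t) = 0"
proof -
 note m = signal_mean_integral[OF t, of i] and w = W_moments[OF t, of i]
 show "integrable M (Z i t)" unfolding Z_eq[abs_def] using m w by simp
 have "expectation (Z i t) = expectation (%om. LINT s:{0..t}|lborel. sig i s om) - (LINT s:{0..t}|lborel. h s \<theta>0) + expectation (W i t)"
  unfolding Z_eq[abs_def] using m(1) w(1) by (simp add: prob_space)
 then show "expectation (Z i t) = 0" using m(2) w(2) by simp
qed

definition Z_bd :: real where "Z_bd = 2 * ((sig_bd + C) * T)\<^sup>2 + 2 * (real CARD('r) * T)"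

lemma Z_bd_nonneg: "0 <= Z_bd" unfolding Z_bd_def using T by simp

lemma interval_integral_bound:
 fixes f :: "real => 'v::euclidean_space"
 assumes c: "continuous_on {0..T} f" and b: "!!s. s \<in> {0..T} ==> norm (f s) <= K" and t: "t \<in> {0..T}"
 shows "norm (LINT s:{0..t}|lborel. f s) <= K * T"
proof -
 have "norm (LINT s:{0..t}|lborel. f s) <= (LINT s|leb t. K)"
  unfolding set_integral_leb
 proof (rule integral_norm_le)
  show "integrable (leb t) f"
   by (rule leb_integrable_bounded[OF leb_continuous_measurable, of _ _ K]) (use c b t in \<open>auto intro: continuous_on_subset\<close>)
  show "integrable (leb t) (%s. K)" by (rule leb_integrable_bounded[of _ _ "\<bar>K\<bar>"]) auto
  show "norm (f s) <= K" if "s \<in> space (leb t)" for s using that b t by auto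
 qed
 also have "... = K * t" using t by (simp add: measure_leb)
 also have "... <= K * T" using t order_trans[OF norm_ge_zero b[OF t]] by (intro mult_left_mono) auto
 finally show ?thesis .
qed

lemma Z_msq:
 assumes t: "t \<in> {0..T}"
 shows "msq M (Z i t) <= ennreal Z_bd"
proof -
 define D where "D om = (LINT s:{0..t}|lborel. sig i s om) - (LINT s:{0..t}|lborel. h s \<theta>0)" for om
 have Dm: "D \<in> borel_measurable M" unfolding D_def[abs_def] using signal_mean_integral(1)[OF t, of i] by simp
 have Wm: "W i t \<in> borel_measurable M" using W_moments(1)[OF t, of i] by simp
 have "msq M (Z i t) <= 2 * msq M D + 2 * msq M (W i t)"
  using msq_add[OF Dm Wm] unfolding D_def Z_eq[abs_def] by simp
 also have "... <= 2 * ennreal (((sig_bd + C) * T)\<^sup>2) + 2 * ennreal (real CARD('r) * T)"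
 proof (intro add_mono mult_left_mono W_moments(3)[OF t])
  show "msq M D <= ennreal (((sig_bd + C) * T)\<^sup>2)"
  proof (rule msq_bound[OF prob_space_axioms], use sig_bound[of i] AE_space in eventually_elim)
   case (elim om)
   have "norm (D om) <= sig_bd * T + C * T"
    unfolding D_def using elim t sig_process(2)[OF elim(2)] h0_continuous[of T] h_bdd[OF \<theta>0_cl]
    by (intro order_trans[OF norm_triangle_ineq4] add_mono interval_integral_bound) auto
   then show ?case by (simp add: distrib_right)
  qed
 qed auto
 also have "... = ennreal Z_bd" unfolding Z_bd_def using T by (simp add: ennreal_mult')
 finally show ?thesis .
qed

text \<open>Variables that are functionals of different copies are independent, since each is measurable with respect to the
augmented filtration of its own Wiener process.\<close>

lemma indep_copies:
 fixes V :: "nat => 'a => 'v::topological_space"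
 assumes V: "!!i. V i \<in> borel_measurable (FT i)"
 shows "indep_vars (%_. borel) V UNIV"
 unfolding indep_vars_def2
proof (intro conjI ballI)
 show "V i \<in> borel_measurable M" for i using brownian.measurable_F_M[OF brownian order_refl V] .
 show "indep_sets (%i. {V i -` A \<inter> space M |A. A \<in> sets borel}) UNIV"
 proof (rule indep_sets_mono_sets[OF indep_augmented[OF prob_space_axioms wiener indep]])
  show "{V i -` A \<inter> space M |A. A \<in> sets borel} \<subseteq> sets (FT i)" for i
   using measurable_sets[OF V[of i]] by auto
 qed
qed

text \<open>Cross terms vanish by independence, coordinate by coordinate.\<close>

lemma indep_mean_msq:
 fixes V :: "nat => 'a => 'v::euclidean_space"
 assumes V: "!!i. V i \<in> borel_measurable (FT i)" and m: "!!i. expectation (V i) = 0" and K: "!!i. msq M (V i) <= ennreal K" and K0: "0 <= K"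
  and N: "0 < N"
 shows "msq M (%om. (1 / real N) *\<^sub>R (\<Sum>i<N. V i om)) <= ennreal (K / real N)"
proof -
 have Vm[measurable]: "V i \<in> borel_measurable M" for i by (rule FT_M[OF V])
 have fin: "msq M (V i) < \<infinity>" for i using K[of i] by (rule order_le_less_trans) simp
 note sq = msq_finite_integrable[OF prob_space_axioms Vm fin]
 have Ki: "expectation (%om. (norm (V i om))\<^sup>2) <= K" for i using K[of i] K0 unfolding sq(3) by simp
 have ip: "integrable M (%om. V i om \<bullet> V l om)" for i l
 proof (rule Bochner_Integration.integrable_bound[of M "%om. (norm (V i om))\<^sup>2 + (norm (V l om))\<^sup>2"])
  show "AE om in M. norm (V i om \<bullet> V l om) <= norm ((norm (V i om))\<^sup>2 + (norm (V l om))\<^sup>2)"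
  proof (rule AE_I2)
   fix om
   have "\<bar>V i om \<bullet> V l om\<bar> <= norm (V i om) * norm (V l om)" by (rule Cauchy_Schwarz_ineq2)
   also have "... <= (norm (V i om))\<^sup>2 + (norm (V l om))\<^sup>2"
    using sum_squares_bound[of "norm (V i om)" "norm (V l om)"] zero_le_power2[of "norm (V i om)"] zero_le_power2[of "norm (V l om)"] by linarith
   finally show "norm (V i om \<bullet> V l om) <= norm ((norm (V i om))\<^sup>2 + (norm (V l om))\<^sup>2)" by simp
  qed
 qed (use sq(1) in auto)
 have off: "expectation (%om. V i om \<bullet> V l om) = 0" if il: "i ~= l" for i l
 proof -
  have "expectation (%om. V i om \<bullet> V l om) = (\<Sum>b\<in>Basis. expectation (%om. (V i om \<bullet> b) * (V l om \<bullet> b))) \<and> (\<forall>b\<in>Basis. expectation (%om. (V i om \<bullet> b) * (V l om \<bullet> b)) = 0)"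
  proof -
   have c: "integrable M (%om. (V i om \<bullet> b) * (V l om \<bullet> b)) \<and> expectation (%om. (V i om \<bullet> b) * (V l om \<bullet> b)) = 0" for b
   proof -
    define Vb where "Vb j om = V j om \<bullet> b" for j om
    have "indep_vars (%_. borel) Vb UNIV"
     by (rule indep_copies) (unfold Vb_def[abs_def], use V in measurable)
    then have ind: "indep_vars (%_. borel) Vb {i, l}" by (rule indep_vars_subset) auto
    have int: "integrable M (Vb j)" for j unfolding Vb_def[abs_def] using sq(2) by simp
    have mean: "expectation (Vb j) = 0" for j unfolding Vb_def[abs_def] using sq(2) m[of j] by simp
    show ?thesis
     using indep_vars_lebesgue_integral[OF _ ind int] indep_vars_integrable[OF _ ind int] il by (simp add: mean) (simp add: Vb_def)
   qed
   have "expectation (%om. V i om \<bullet> V l om) = (\<Sum>b\<in>Basis. expectation (%om. (V i om \<bullet> b) * (V l om \<bullet> b)))"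
    using c by (subst euclidean_inner) (simp add: Bochner_Integration.integral_sum)
   then show ?thesis using c by simp
  qed
  then show ?thesis by simp
 qed
 have S2: "(norm (\<Sum>i<N. V i om))\<^sup>2 = (\<Sum>i<N. \<Sum>l<N. V i om \<bullet> V l om)" for om
  unfolding power2_norm_eq_inner by (subst inner_sum_left) (simp only: inner_sum_right)
 have "expectation (%om. (norm (\<Sum>i<N. V i om))\<^sup>2) = (\<Sum>i<N. \<Sum>l<N. expectation (%om. V i om \<bullet> V l om))"
  unfolding S2 using ip by (simp add: Bochner_Integration.integral_sum)
 also have "... = (\<Sum>i<N. \<Sum>l<N. if i = l then expectation (%om. (norm (V i om))\<^sup>2) else 0)"
  using off by (intro sum.cong refl) (simp add: power2_norm_eq_inner)
 also have "... <= (\<Sum>i<N. K)" using Ki by (intro sum_mono) simp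
 finally have e: "expectation (%om. (norm (\<Sum>i<N. V i om))\<^sup>2) <= real N * K" by simp
 have i2: "integrable M (%om. (norm (\<Sum>i<N. V i om))\<^sup>2)" unfolding S2 using ip by simp
 have "msq M (%om. (1 / real N) *\<^sub>R (\<Sum>i<N. V i om)) = ennreal ((1 / real N)\<^sup>2) * msq M (%om. \<Sum>i<N. V i om)"
  by (rule msq_scaleR) measurable
 also have "... <= ennreal ((1 / real N)\<^sup>2) * ennreal (real N * K)"
  unfolding msq_integral[OF i2] using e by (intro mult_left_mono ennreal_leI) auto
 also have "... = ennreal (K / real N)"
  using N K0 by (simp add: ennreal_mult[symmetric] power2_eq_square)
 finally show ?thesis .
qed

text \<open>The fluctuation of the averaged record.\<close>

definition ZN :: "nat => real => 'a => real^'r" where "ZN N t om = (1 / real N) *\<^sub>R (\<Sum>i<N. Z i t om)"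

lemma ZN_eq: "0 < N ==> fl (%t. mean_record (obs_record L \<rho> W \<theta>0) N t om) t = ZN N t om"
 unfolding ZN_def Z_def fl_def mean_record_def
 by (simp add: sum_subtractf scaleR_diff_right scaleR_sum_right[symmetric] sum_constant_scaleR del: sum_constant)

lemma ZN_measurable: "t \<in> {0..T} ==> ZN N t \<in> borel_measurable M"
 unfolding ZN_def[abs_def] using FT_M[OF Z_FT] by measurable

lemma ZN_abs:
 assumes "t \<in> {0..T}" "0 < N"
 shows "integrable M (%om. norm (ZN N t om))" "expectation (%om. norm (ZN N t om)) <= sqrt (Z_bd / real N)"
proof -
 have m: "msq M (ZN N t) <= ennreal (Z_bd / real N)"
  unfolding ZN_def[abs_def] by (rule indep_mean_msq[OF Z_FT[OF assms(1)] Z_mean(2)[OF assms(1)] Z_msq[OF assms(1)] Z_bd_nonneg assms(2)])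
 have fin: "msq M (ZN N t) < \<infinity>" using m by (rule order_le_less_trans) simp
 note sq = msq_finite_integrable[OF prob_space_axioms ZN_measurable[OF assms(1)] fin]
 show "integrable M (%om. norm (ZN N t om))" using sq(2) by simp
 have e: "expectation (%om. (norm (ZN N t om))\<^sup>2) <= Z_bd / real N" using m Z_bd_nonneg unfolding sq(3) by simp
 have mn: "(%om. norm (ZN N t om)) \<in> borel_measurable M" using ZN_measurable[OF assms(1)] by measurable
 have fn: "msq M (%om. norm (ZN N t om)) < \<infinity>" using fin unfolding msq_def by simp
 have "(norm (expectation (%om. norm (ZN N t om))))\<^sup>2 <= Z_bd / real N"
  using msq_finite_integrable(4)[OF prob_space_axioms mn fn] e by simp
 then show "expectation (%om. norm (ZN N t om)) <= sqrt (Z_bd / real N)"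
  by (intro real_le_rsqrt) simp
qed

text \<open>Every grid value of the averaged fluctuation has mean norm of order $N^{-1/2}$, and \<open>fluct\<close> averages over the grid instead of
taking a supremum, so that no maximal inequality is called for.\<close>

lemma fluct_ZN:
 assumes N: "0 < N" and n: "0 < n"
 shows "integrable M (%om. fluct n (%j. ZN N (\<tau> n j) om))" "expectation (%om. fluct n (%j. ZN N (\<tau> n j) om)) <= 2 * sqrt (Z_bd / real N)"
proof -
 have i: "integrable M (%om. norm (ZN N (\<tau> n j) om))" "expectation (%om. norm (ZN N (\<tau> n j) om)) <= sqrt (Z_bd / real N)" if "j <= n" for j
  using ZN_abs[OF tau_in[OF that] N] by auto
 have iS: "integrable M (%om. \<Sum>j<n. norm (ZN N (\<tau> n (Suc j)) om))"
  and eS: "expectation (%om. \<Sum>j<n. norm (ZN N (\<tau> n (Suc j)) om)) = (\<Sum>j<n. expectation (%om. norm (ZN N (\<tau> n (Suc j)) om)))"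
  using i(1) by (auto intro!: Bochner_Integration.integrable_sum Bochner_Integration.integral_sum simp: Suc_le_eq)
 show "integrable M (%om. fluct n (%j. ZN N (\<tau> n j) om))"
  unfolding fluct_def by (intro Bochner_Integration.integrable_add integrable_mult_right iS i(1) order_refl)
 have s: "(\<Sum>j<n. expectation (%om. norm (ZN N (\<tau> n (Suc j)) om))) <= (\<Sum>j<n. sqrt (Z_bd / real N))"
  using i(2) by (intro sum_mono) (simp add: Suc_le_eq)
 have "expectation (%om. fluct n (%j. ZN N (\<tau> n j) om)) = expectation (%om. norm (ZN N (\<tau> n n) om)) + (1 / real n) * (\<Sum>j<n. expectation (%om. norm (ZN N (\<tau> n (Suc j)) om)))"
  unfolding fluct_def
  by (subst Bochner_Integration.integral_add[OF i(1)[OF order_refl] integrable_mult_right[OF iS]]) (simp only: integral_mult_right_zero eS)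
 also have "... <= sqrt (Z_bd / real N) + (1 / real n) * (\<Sum>j<n. sqrt (Z_bd / real N))"
  using s i(2)[of n] by (intro add_mono mult_left_mono) auto
 also have "... = 2 * sqrt (Z_bd / real N)" using n by simp
 finally show "expectation (%om. fluct n (%j. ZN N (\<tau> n j) om)) <= 2 * sqrt (Z_bd / real N)" .
qed

end

section \<open>Comparison of characteristic functions\<close>

text \<open>The remainder after the linear term has a derivative of modulus at most $|x|$; this makes its increments
quadratic, with one factor \<open>x - y\<close>.\<close>

lemma iexp_remainder_diff: "cmod ((iexp x - 1 - \<i> * x) - (iexp y - 1 - \<i> * y)) <= 2 * (\<bar>x - y\<bar> * (\<bar>x\<bar> + \<bar>y\<bar>))"
proof -
 have e1: "cmod (iexp z - 1) <= \<bar>z\<bar>" for z using iexp_approx1[of z 0] by simp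
 have e2: "cmod (iexp z - 1 - \<i> * z) <= \<bar>z\<bar>\<^sup>2 / 2" for z
  using iexp_approx1[of z 1] by (simp add: numeral_2_eq_2 atMost_Suc algebra_simps)
 define d where "d = x - y"
 have "iexp x = iexp y * iexp d" unfolding d_def by (simp add: exp_add[symmetric] algebra_simps)
 then have eq: "(iexp x - 1 - \<i> * x) - (iexp y - 1 - \<i> * y) = iexp y * (iexp d - 1 - \<i> * d) + \<i> * d * (iexp y - 1)"
  unfolding d_def by (simp add: algebra_simps)
 have "cmod ((iexp x - 1 - \<i> * x) - (iexp y - 1 - \<i> * y)) <= cmod (iexp y * (iexp d - 1 - \<i> * d)) + cmod (\<i> * d * (iexp y - 1))"
  unfolding eq by (rule norm_triangle_ineq)
 also have "... <= \<bar>d\<bar>\<^sup>2 / 2 + \<bar>d\<bar> * \<bar>y\<bar>"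
  using e1[of y] e2[of d] by (intro add_mono) (auto simp: norm_mult mult_left_mono)
 also have "... <= 2 * (\<bar>d\<bar> * (\<bar>x\<bar> + \<bar>y\<bar>))"
 proof -
  have "\<bar>d\<bar> * \<bar>d\<bar> <= \<bar>d\<bar> * (\<bar>x\<bar> + \<bar>y\<bar>)" unfolding d_def by (intro mult_left_mono) auto
  moreover have "0 <= \<bar>d\<bar> * \<bar>x\<bar>" "0 <= \<bar>d\<bar> * \<bar>y\<bar>" by simp_all
  ultimately show ?thesis unfolding power2_eq_square distrib_left by linarith
 qed
 finally show ?thesis unfolding d_def .
qed

lemma young_inequality:
 assumes s: "0 < s" shows "2 * (d * a) <= (1 / s) * d\<^sup>2 + s * (a::real)\<^sup>2"
proof -
 have "(1 / s) * d\<^sup>2 + s * a\<^sup>2 - 2 * (d * a) = (d - s * a)\<^sup>2 / s"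
  using s by (simp add: field_simps power2_eq_square)
 also have "0 <= ..." using s by simp
 finally show ?thesis by simp
qed

text \<open>For variables of equal mean the linear terms cancel. Young's inequality with a free weight \<open>s\<close> separates the small
difference from the second moments; after scaling by $N^{-1/2}$ both terms are of order $1/N$, so \<open>N\<close>-th powers can be
compared.\<close>

lemma (in prob_space) char_compare:
 fixes X Y :: "'a => real"
 assumes [measurable]: "X \<in> borel_measurable M" "Y \<in> borel_measurable M"
  and sq: "integrable M (%om. (X om)\<^sup>2)" "integrable M (%om. (Y om)\<^sup>2)" and mean: "integrable M X" "integrable M Y" "expectation X = expectation Y" and s: "0 < s"
 shows "cmod (expectation (%om. iexp (X om)) - expectation (%om. iexp (Y om)))
  <= (1 / s) * expectation (%om. (X om - Y om)\<^sup>2) + 2 * s * (expectation (%om. (X om)\<^sup>2) + expectation (%om. (Y om)\<^sup>2))"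
proof -
 have i: "integrable M (%om. iexp (X om))" "integrable M (%om. iexp (Y om))"
  using iexp_integrable[OF prob_space_axioms, of X 1] iexp_integrable[OF prob_space_axioms, of Y 1] by simp_all
 have d: "integrable M (%om. (X om - Y om)\<^sup>2)"
 proof (rule Bochner_Integration.integrable_bound[of M "%om. 2 * (X om)\<^sup>2 + 2 * (Y om)\<^sup>2"])
  show "AE om in M. norm ((X om - Y om)\<^sup>2) <= norm (2 * (X om)\<^sup>2 + 2 * (Y om)\<^sup>2)"
   using norm_add_sq_le[of "X om" "- Y om" for om] by (intro AE_I2) simp
 qed (use sq in auto)
 let ?D = "%om. (iexp (X om) - 1 - \<i> * X om) - (iexp (Y om) - 1 - \<i> * Y om)"
 have "expectation ?D = expectation (%om. iexp (X om)) - expectation (%om. iexp (Y om))"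
  using i mean by (simp add: prob_space)
 then have "cmod (expectation (%om. iexp (X om)) - expectation (%om. iexp (Y om))) = cmod (expectation ?D)" by simp
 also have "... <= expectation (%om. (1 / s) * (X om - Y om)\<^sup>2 + 2 * s * ((X om)\<^sup>2 + (Y om)\<^sup>2))"
 proof (rule integral_norm_le)
  fix om
  let ?d = "\<bar>X om - Y om\<bar>" and ?a = "\<bar>X om\<bar> + \<bar>Y om\<bar>"
  have "cmod (?D om) <= 2 * (?d * ?a)" by (rule iexp_remainder_diff)
  also have "... <= (1 / s) * ?d\<^sup>2 + s * ?a\<^sup>2" by (rule young_inequality[OF s])
  also have "... <= (1 / s) * ?d\<^sup>2 + 2 * s * ((X om)\<^sup>2 + (Y om)\<^sup>2)"
   using s mult_left_mono[OF norm_add_sq_le[of "\<bar>X om\<bar>" "\<bar>Y om\<bar>"], of s] by (simp add: algebra_simps)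
  finally show "cmod (?D om) <= (1 / s) * (X om - Y om)\<^sup>2 + 2 * s * ((X om)\<^sup>2 + (Y om)\<^sup>2)" by simp
 qed (use i mean d sq in auto)
 also have "... = (1 / s) * expectation (%om. (X om - Y om)\<^sup>2) + 2 * s * (expectation (%om. (X om)\<^sup>2) + expectation (%om. (Y om)\<^sup>2))"
  using d sq by simp
 finally show ?thesis .
qed

lemma msq_fluct:
 fixes z :: "nat => 'a => 'v::euclidean_space"
 assumes n: "0 < n" and z: "!!j. j <= n ==> z j \<in> borel_measurable M" "!!j. j <= n ==> msq M (z j) <= ennreal K" and K: "0 <= K"
 shows "msq M (%om. fluct n (%j. z j om)) <= ennreal (4 * K)"
proof -
 let ?S = "%om. \<Sum>j<n. norm (z (Suc j) om)"
 have nm: "msq M (%om. norm (z j om)) = msq M (z j)" for j unfolding msq_def by simp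
 have m: "(%om. norm (z j om)) \<in> borel_measurable M" if "j <= n" for j using z(1)[OF that] by measurable
 have mS: "?S \<in> borel_measurable M" using m by (intro borel_measurable_sum) (simp add: Suc_le_eq)
 have "msq M ?S <= of_nat (card {..<n}) * (\<Sum>j<n. msq M (%om. norm (z (Suc j) om)))"
  using m by (intro msq_sum) (simp add: Suc_le_eq)
 also have "... <= of_nat n * (\<Sum>j<n. ennreal K)"
  unfolding nm using z(2) by (simp only: card_lessThan) (intro mult_left_mono sum_mono, auto simp: Suc_le_eq)
 also have "... = ennreal (real n * (real n * K))"
  using K by (simp add: ennreal_mult ennreal_of_nat_eq_real_of_nat)
 finally have S: "msq M ?S <= ennreal (real n * (real n * K))" .
 have "msq M (%om. (1 / real n) *\<^sub>R ?S om) = ennreal ((1 / real n)\<^sup>2) * msq M ?S" by (rule msq_scaleR[OF mS])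
 also have "... <= ennreal ((1 / real n)\<^sup>2) * ennreal (real n * (real n * K))" by (intro mult_left_mono S) simp
 also have "... = ennreal K" using n K by (subst ennreal_mult'[symmetric]) (auto simp: power2_eq_square)
 finally have S2: "msq M (%om. (1 / real n) *\<^sub>R ?S om) <= ennreal K" .
 have "msq M (%om. fluct n (%j. z j om)) <= 2 * msq M (%om. norm (z n om)) + 2 * msq M (%om. (1 / real n) *\<^sub>R ?S om)"
  unfolding fluct_def using msq_add[OF m[OF order_refl], of "%om. (1 / real n) *\<^sub>R ?S om"] mS by simp
 also have "... <= 2 * ennreal K + 2 * ennreal K"
  unfolding nm using z(2)[of n] S2 by (intro add_mono mult_left_mono) auto
 also have "... = ennreal (4 * K)" using K by (simp add: ennreal_mult' flip: distrib_right)
 finally show ?thesis .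
qed

section \<open>Scores of the single copies and their Euler copies\<close>

context observed_regular begin

text \<open>The discrete score of a single copy.\<close>

definition sc :: "nat => nat => 'a => real^'p" where "sc i n om = score n (%t. Z i t om)"

lemma vec_lambda_sum: "(\<chi> a. f a) = (\<Sum>a\<in>UNIV. f a *\<^sub>R axis a (1::real))"
 by (simp add: vec_eq_iff axis_def if_distrib[where f="%x. _ * x"] cong: if_cong)

lemma sc_FT: "sc i n \<in> borel_measurable (FT i)"
proof -
 have "(%om. g a (\<tau> n j) \<theta>0 \<bullet> (Z i (\<tau> n (Suc j)) om - Z i (\<tau> n j) om)) \<in> borel_measurable (FT i)" if "j < n" for a j
 proof -
  have [measurable]: "Z i (\<tau> n (Suc j)) \<in> borel_measurable (FT i)" "Z i (\<tau> n j) \<in> borel_measurable (FT i)"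
   using that by (intro Z_FT tau_in; simp)+
  show ?thesis by measurable
 qed
 then show ?thesis unfolding sc_def[abs_def] score_def vec_lambda_sum
  by (intro borel_measurable_sum borel_measurable_scaleR borel_measurable_const) auto
qed

lemma sc_mean: "integrable M (sc i n)" "expectation (sc i n) = 0"
proof -
 have z: "has_bochner_integral M (Z i (\<tau> n j)) 0" if "j <= n" for j
  using Z_mean[OF tau_in[OF that], of i] by (auto simp: has_bochner_integral_iff)
 have "has_bochner_integral M (%om. g a (\<tau> n j) \<theta>0 \<bullet> (Z i (\<tau> n (Suc j)) om - Z i (\<tau> n j) om)) (g a (\<tau> n j) \<theta>0 \<bullet> (0 - 0))" if "j < n" for a j
  using that by (intro has_bochner_integral_inner_right has_bochner_integral_diff z) auto
 then have "has_bochner_integral M (%om. \<Sum>a\<in>UNIV. (\<Sum>j<n. g a (\<tau> n j) \<theta>0 \<bullet> (Z i (\<tau> n (Suc j)) om - Z i (\<tau> n j) om)) *\<^sub>R axis a (1::real))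
   (\<Sum>a\<in>UNIV. (\<Sum>j<n. g a (\<tau> n j) \<theta>0 \<bullet> (0 - 0)) *\<^sub>R axis a (1::real))"
  by (intro has_bochner_integral_sum has_bochner_integral_scaleR_left) auto
 then have "has_bochner_integral M (sc i n) 0"
  unfolding sc_def[abs_def] score_def vec_lambda_sum by simp
 then show "integrable M (sc i n)" "expectation (sc i n) = 0" by (auto simp: has_bochner_integral_iff)
qed

abbreviation "lind' \<equiv> %x. lindblad (H \<theta>0) (L \<theta>0) (truncate radius x)"
abbreviation "diff' \<equiv> %k x. diffusion_coeff (L \<theta>0 k) (truncate radius x)"
abbreviation "bvec' \<equiv> %x. bvec (L \<theta>0) (truncate radius x)"

text \<open>One Lipschitz and bound constant serves all truncated coefficients and all copies.\<close>

lemma euler_setup: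
 obtains K where
  "!!i. euler_approximation M T (W i) (lindblad (H \<theta>0) (L \<theta>0)) lind' (%k. diffusion_coeff (L \<theta>0 k)) diff' \<rho>0 (\<rho> \<theta>0 i) radius K"
  "!!x y. norm (bvec' x - bvec' y) <= K * norm (x - y)" "!!x. norm (bvec' x) <= K"
proof -
 obtain Ka where Ka: "!!x y. norm (lind' x - lind' y) <= Ka * norm (x - y)" "!!x. norm (lind' x) <= Ka"
  using linear_truncate_lipschitz[OF bounded_linear_lindblad[of "H \<theta>0" "L \<theta>0"] radius_nonneg] by blast
 obtain Kb where Kb: "!!x y. norm (bvec' x - bvec' y) <= Kb * norm (x - y)" "!!x. norm (bvec' x) <= Kb"
  using linear_truncate_lipschitz[OF bounded_linear_bvec[of "L \<theta>0"] radius_nonneg] by blast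
 have "\<forall>k. \<exists>K. \<forall>x y. norm (diff' k x - diff' k y) <= K * norm (x - y) \<and> norm (diff' k x) <= K"
  using diffusion_coeff_truncate_lipschitz[OF radius_nonneg] by blast
 then obtain Kc where Kc: "!!k x y. norm (diff' k x - diff' k y) <= Kc k * norm (x - y)" "!!k x. norm (diff' k x) <= Kc k" by metis
 have n0: "0 <= Ka" "0 <= Kb" "!!k. 0 <= Kc k" using Ka(2) Kb(2) Kc(2) norm_ge_zero order_trans by blast+
 define K where "K = Ka + Kb + (\<Sum>k\<in>UNIV. Kc k)"
 have s0: "0 <= (\<Sum>k\<in>UNIV. Kc k)" by (intro sum_nonneg n0)
 have sk: "Kc k <= (\<Sum>k\<in>UNIV. Kc k)" for k by (intro member_le_sum) (use n0 in auto)
 have le: "Ka <= K" "Kb <= K" "Kc k <= K" for k unfolding K_def using n0 s0 sk[of k] by linarith+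
 have up: "a <= K * norm x" if "a <= k * norm x" "k <= K" for a k and x :: "complex^'d^'d"
  using that mult_right_mono[OF that(2) norm_ge_zero[of x]] by linarith
 have tr: "truncate radius x = x" if "norm x <= radius" for x :: "complex^'d^'d" by (rule truncate(2)[OF radius_nonneg that])
 have cd: "continuous_on UNIV (diffusion_coeff (L \<theta>0 k))" for k
 proof -
  have "bounded_linear (%A. L \<theta>0 k ** A + A ** ctranspose (L \<theta>0 k))"
   by (intro bounded_linear_add bl_mult_left bl_mult_right)
  then show ?thesis
   unfolding diffusion_coeff_def[abs_def]
   using bounded_bilinear.bounded_linear_right[OF bounded_bilinear_bform, of "L \<theta>0 k"]
   by (intro continuous_on_diff continuous_on_scaleR continuous_on_id linear_continuous_on) auto
 qed
 show thesis
 proof (rule that[of K])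
  show "euler_approximation M T (W i) (lindblad (H \<theta>0) (L \<theta>0)) lind' (%k. diffusion_coeff (L \<theta>0 k)) diff' \<rho>0 (\<rho> \<theta>0 i) radius K" for i
  proof (intro euler_approximation.intro euler_approximation_axioms.intro brownian)
   note cl = observed_model.\<theta>0_cl[OF observed_model_axioms]
   show "0 < T" by (rule T)
   show "brownian.sde_solution M T (W i) (lindblad (H \<theta>0) (L \<theta>0)) (%k. diffusion_coeff (L \<theta>0 k)) \<rho>0 (\<rho> \<theta>0 i)" by (rule state_sde[OF cl])
   show "AE om in M. \<forall>t\<in>{0..T}. norm (\<rho> \<theta>0 i t om) <= radius" by (rule state_bound[OF cl])
   show "continuous_on UNIV (lindblad (H \<theta>0) (L \<theta>0))" by (rule linear_continuous_on[OF bounded_linear_lindblad])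
   show "norm (lind' x - lind' y) <= K * norm (x - y)" for x y by (rule up[OF Ka(1) le(1)])
   show "norm (diff' k x - diff' k y) <= K * norm (x - y)" for k x y by (rule up[OF Kc(1) le(3)])
   show "norm (lind' x) <= K" for x by (rule order_trans[OF Ka(2) le(1)])
   show "norm (diff' k x) <= K" for k x by (rule order_trans[OF Kc(2) le(3)])
  qed (simp_all add: cd tr)
  show "norm (bvec' x - bvec' y) <= K * norm (x - y)" for x y by (rule up[OF Kb(1) le(2)])
  show "norm (bvec' x) <= K" for x by (rule order_trans[OF Kb(2) le(2)])
 qed
qed

text \<open>The scores of different copies are not known to have equal laws, because the solutions are merely given as
processes adapted to their own Wiener processes. The Euler scheme, with the discrete score carried along as
a second component of its state, is one chain driven by the increments; its law is the same for all copies, and its distance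
to the actual score is uniform in the copy.\<close>

lemma euler_copy:
 "\<exists>K\<ge>0. \<forall>n>0. \<exists>G :: nat => 'a => real^'p. (\<forall>i. G i \<in> borel_measurable (FT i)) \<and> (\<forall>i. distr M borel (G i) = distr M borel (G 0))
  \<and> (\<forall>i. msq M (%om. sc i n om - G i om) <= ennreal (K / real n))"
proof -
 obtain K where eul: "!!i. euler_approximation M T (W i) (lindblad (H \<theta>0) (L \<theta>0)) lind' (%k. diffusion_coeff (L \<theta>0 k)) diff' \<rho>0 (\<rho> \<theta>0 i) radius K"
  and q': "!!x y. norm (bvec' x - bvec' y) <= K * norm (x - y)" "!!x. norm (bvec' x) <= K"
  by (rule euler_setup) blast
 define ec where "ec = euler_approximation.euler_const TYPE('r) T K"
 have ec0: "0 <= ec" unfolding ec_def using euler_approximation.euler_const_def[OF eul] euler_approximation.incr_const_nonneg[OF eul] by simp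
 define K1 where "K1 = 2 * K\<^sup>2 * T\<^sup>2 * ec * T"
 have K1: "0 <= K1" unfolding K1_def using ec0 T by simp
 define c where "c = real CARD('p) * (C * (1 + T))"
 have c0: "0 <= c" unfolding c_def using C0 T by simp
 show ?thesis
 proof (intro exI[of _ "c\<^sup>2 * (4 * K1)"] conjI allI impI)
  show "0 <= c\<^sup>2 * (4 * K1)" using K1 by simp
  fix n :: nat assume n: "0 < n"
  \<comment> \<open>the exact mean increments are subtracted, so only the random drift has to be approximated\<close>
  define m where "m j = (LINT s:{0..\<tau> n (Suc j)}|lborel. h s \<theta>0) - (LINT s:{0..\<tau> n j}|lborel. h s \<theta>0)" for j
  define \<Phi> :: "nat => (complex^'d^'d) \<times> (real^'p) => real^'r => (complex^'d^'d) \<times> (real^'p)" where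
   "\<Phi> j p w = (fst p + (T / real n) *\<^sub>R lind' (fst p) + (\<Sum>k\<in>UNIV. (w $ k) *\<^sub>R diff' k (fst p)),
    snd p + (\<Sum>a\<in>UNIV. (g a (\<tau> n j) \<theta>0 \<bullet> (w + (T / real n) *\<^sub>R bvec' (fst p) - m j)) *\<^sub>R axis a 1))" for j p w
  note lm = euler_approximation.lipschitz_measurable[OF eul]
  have [measurable]: "lind' \<in> borel_measurable borel" "diff' k \<in> borel_measurable borel" "bvec' \<in> borel_measurable borel" for k
   using lm[OF euler_approximation.lip(1)[OF eul]] lm[OF euler_approximation.lip(2)[OF eul]] lm[OF q'(1)] by auto
  have [measurable]: "fst \<in> borel_measurable (borel :: ((complex^'d^'d) \<times> (real^'p)) measure)" "snd \<in> borel_measurable (borel :: ((complex^'d^'d) \<times> (real^'p)) measure)"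
   by (intro borel_measurable_continuous_onI continuous_intros)+
  have \<Phi>m: "(%(p, w). \<Phi> j p w) \<in> borel_measurable (borel \<Otimes>\<^sub>M borel)" for j
   unfolding \<Phi>_def split_beta by measurable
  define Ch where "Ch i j = chain T n \<Phi> (\<rho>0, 0) (W i) j" for i j
  let ?eul = "%i j om. euler T (W i) lind' diff' \<rho>0 n j om"
  have f: "fst (Ch i j om) = ?eul i j om" for i j om
   unfolding Ch_def by (induction j) (simp_all add: \<Phi>_def)
  have s: "snd (Ch i j om) $ a = (\<Sum>l<j. g a (\<tau> n l) \<theta>0 \<bullet> (W i (\<tau> n (Suc l)) om - W i (\<tau> n l) om + (T / real n) *\<^sub>R bvec' (?eul i l om) - m l))" for i j om a
  proof (induction j)
   case (Suc j)
   have "snd (Ch i (Suc j) om) = snd (Ch i j om) + (\<chi> a. g a (\<tau> n j) \<theta>0 \<bullet> (W i (\<tau> n (Suc j)) om - W i (\<tau> n j) om + (T / real n) *\<^sub>R bvec' (fst (Ch i j om)) - m j))"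
    unfolding vec_lambda_sum by (simp add: Ch_def \<Phi>_def)
   then show ?case using Suc unfolding f by simp
  qed (simp add: Ch_def)
  show "\<exists>G :: nat => 'a => real^'p. (\<forall>i. G i \<in> borel_measurable (FT i)) \<and> (\<forall>i. distr M borel (G i) = distr M borel (G 0))
  \<and> (\<forall>i. msq M (%om. sc i n om - G i om) <= ennreal (c\<^sup>2 * (4 * K1) / real n))"
  proof (intro exI[of _ "%i om. snd (Ch i n om)"] conjI allI)
   fix i
   have "Ch i n \<in> borel_measurable (aug_filtration M (W i) (gridt T n n))" for i
    unfolding Ch_def by (rule brownian.chain_measurable[OF brownian T_nonneg \<Phi>m order_refl])
   then have ChF: "Ch i n \<in> borel_measurable (FT i)" for i using n by (simp add: gridt_simps)
   then show GF: "(%om. snd (Ch i n om)) \<in> borel_measurable (FT i)" by measurable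
   have [measurable]: "Ch i n \<in> borel_measurable M" for i by (rule FT_M[OF ChF])
   have "distr M borel (%om. snd (Ch i n om)) = distr (distr M borel (Ch i n)) borel snd" for i
    by (subst distr_distr) (auto simp: comp_def)
   moreover have "distr M borel (Ch i n) = distr M borel (Ch 0 n)"
    unfolding Ch_def by (rule chain_law[OF brownian brownian T n \<Phi>m order_refl])
   ultimately show "distr M borel (%om. snd (Ch i n om)) = distr M borel (%om. snd (Ch 0 n om))" by simp
   \<comment> \<open>accumulated drift error; it is bounded through summation by parts like a record\<close>
   define z where "z j om = (LINT s:{0..\<tau> n j}|lborel. sig i s om) - (\<Sum>l<j. (T / real n) *\<^sub>R bvec' (?eul i l om))" for j om
   have q: "continuous_on UNIV (bvec (L \<theta>0) :: complex^'d^'d => real^'r)" by (rule linear_continuous_on[OF bounded_linear_bvec])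
   have qq: "bvec (L \<theta>0) x = bvec' x" if "norm x <= radius" for x :: "complex^'d^'d" using truncate(2)[OF radius_nonneg that] by simp
   have zm: "z j \<in> borel_measurable M" if "j <= n" for j
    using euler_approximation.drift_distance(1)[OF eul q qq q' n that] unfolding z_def[abs_def] sig_def .
   have zb: "msq M (z j) <= ennreal (K1 / real n)" if "j <= n" for j
    using euler_approximation.drift_error[OF eul q qq q' n that] unfolding z_def[abs_def] sig_def K1_def ec_def by simp
   have diff: "(sc i n om - snd (Ch i n om)) $ a = (\<Sum>j<n. g a (\<tau> n j) \<theta>0 \<bullet> (z (Suc j) om - z j om))" for a om
    unfolding vector_minus_component s sc_def score_def vec_lambda_beta sum_subtractf[symmetric] inner_diff_right[symmetric]
    by (intro sum.cong refl arg_cong[where f="inner _"]) (simp add: Z_eq z_def m_def)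
   have z0: "z 0 om = 0" for om unfolding z_def gridt_simps set_integral_point by simp
   have "norm (sc i n om - snd (Ch i n om)) <= c * fluct n (%j. z j om)" for om
   proof -
    have "norm (sc i n om - snd (Ch i n om)) <= (\<Sum>a\<in>UNIV. norm ((sc i n om - snd (Ch i n om)) $ a))" by (rule norm_vec_le_sum)
    also have "... <= (\<Sum>a\<in>(UNIV::'p set). C * (1 + T) * fluct n (%j. z j om))"
    proof (rule sum_mono)
     fix a
     show "norm ((sc i n om - snd (Ch i n om)) $ a) <= C * (1 + T) * fluct n (%j. z j om)"
      unfolding diff real_norm_def
     proof (rule grid_sum_bound[where z="%j. z j om", OF z0 _ _ T n])
      show "norm (g a (\<tau> n n) \<theta>0) <= C" by (intro g_bdd \<theta>0_cl tau_in) simp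
      fix j assume j: "j < n"
      have "norm (g a (\<tau> n (Suc j)) \<theta>0 - g a (\<tau> n j) \<theta>0) <= C * \<bar>\<tau> n (Suc j) - \<tau> n j\<bar>"
       using j by (intro g_lip \<theta>0_cl tau_in) auto
      then show "norm (g a (\<tau> n (Suc j)) \<theta>0 - g a (\<tau> n j) \<theta>0) <= C * (T / real n)" using T by (simp add: gridt_simps)
     qed
    qed
    finally show ?thesis unfolding c_def by simp
   qed
   then have "msq M (%om. sc i n om - snd (Ch i n om)) <= msq M (%om. c *\<^sub>R fluct n (%j. z j om))"
    by (intro msq_mono_AE AE_I2) (simp add: abs_mult c0 abs_of_nonneg[OF fluct_nonneg])
   also have "... = ennreal (c\<^sup>2) * msq M (%om. fluct n (%j. z j om))"
    unfolding fluct_def using zm n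
    by (intro msq_scaleR borel_measurable_add borel_measurable_times borel_measurable_const borel_measurable_sum borel_measurable_norm) (auto simp: Suc_le_eq)
   also have "... <= ennreal (c\<^sup>2) * ennreal (4 * (K1 / real n))"
    by (intro mult_left_mono msq_fluct[OF n zm zb]) (use K1 in auto)
   also have "... = ennreal (c\<^sup>2 * (4 * K1) / real n)" by (subst ennreal_mult'[symmetric]) auto
   finally show "msq M (%om. sc i n om - snd (Ch i n om)) <= ennreal (c\<^sup>2 * (4 * K1) / real n)" .
  qed
 qed
qed

section \<open>The discrete score and the Ito score\<close>

text \<open>The rows of the gradient matrix are the vectors \<open>g a t \<theta>0\<close>.\<close>

lemma grad_g:
 assumes t: "t \<in> {0..T}"
 shows "grad (h t) \<theta>0 $ a $ k = g a t \<theta>0 $ k"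
proof -
 have "frechet_derivative (h t) (at \<theta>0) = (%v. \<Sum>i\<in>UNIV. v $ i *\<^sub>R g i t \<theta>0)"
  by (rule frechet_derivative_at[symmetric, OF deriv[OF observed_model.\<theta>0[OF observed_model_axioms] t]])
 then show ?thesis
  unfolding grad_def jacobian_def transpose_def matrix_def
  by (simp add: axis_def if_distrib[where f="%x. x * _"] cong: if_cong)
qed

lemma g_continuous: "t <= T ==> continuous_on {0..t} (%s. g a s \<theta>0)"
 by (rule lipschitz_continuous[where A=C]) (use g_lip observed_model.\<theta>0_cl[OF observed_model_axioms] in auto)

text \<open>On a cell the gradient varies by at most \<open>C * (T / n)\<close> while the drift is bounded, so replacing the gradient by its
value at the left end point costs the mesh.\<close>

lemma score_drift_error:
 assumes w: "om \<in> space M" and sb: "\<forall>s\<in>{0..T}. norm (sig 0 s om) <= sig_bd" and n: "0 < n"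
 defines "D \<equiv> %j. (LINT s:{0..\<tau> n j}|lborel. sig 0 s om) - (LINT s:{0..\<tau> n j}|lborel. h s \<theta>0)"
 shows "\<bar>(LINT s:{0..T}|lborel. g a s \<theta>0 \<bullet> (sig 0 s om - h s \<theta>0)) - (\<Sum>j<n. g a (\<tau> n j) \<theta>0 \<bullet> (D (Suc j) - D j))\<bar> <= C * (sig_bd + C) * T * (T / real n)"
proof -
 note cl = observed_model.\<theta>0_cl[OF observed_model_axioms]
 define V where "V s = sig 0 s om - h s \<theta>0" for s
 define P where "P j = (LINT s:{0..\<tau> n j}|lborel. g a s \<theta>0 \<bullet> V s)" for j
 have sc: "continuous_on {0..t} (%s. sig 0 s om)" if "t <= T" for t
  using continuous_on_subset[OF sig_process(2)[OF w, of 0], of "{0..t}"] that by auto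
 have Vc: "continuous_on {0..t} V" if "t <= T" for t
  unfolding V_def[abs_def] using that by (intro continuous_on_diff sc h0_continuous)
 have Vb: "norm (V s) <= sig_bd + C" if "s \<in> {0..T}" for s
  unfolding V_def using sb h_bdd[OF cl that] that by (intro order_trans[OF norm_triangle_ineq4] add_mono) auto
 have cell: "\<bar>P (Suc j) - P j - g a (\<tau> n j) \<theta>0 \<bullet> (D (Suc j) - D j)\<bar> <= C * (T / real n) * (sig_bd + C) * (T / real n)" if j: "j < n" for j
 proof -
  let ?f = "%s. (g a s \<theta>0 - g a (\<tau> n j) \<theta>0) \<bullet> V s"
  have t: "\<tau> n j \<in> {0..T}" "\<tau> n (Suc j) \<in> {0..T}" using j by (intro tau_in; simp)+
  have st: "\<tau> n (Suc j) - \<tau> n j = T / real n" by (simp add: gridt_simps)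
  have le: "\<tau> n j <= \<tau> n (Suc j)" using gridt_mono[OF T_nonneg, of j "Suc j" n] by simp
  have I: "(LINT s:{0..\<tau> n l}|lborel. ?f s) = P l - g a (\<tau> n j) \<theta>0 \<bullet> D l" if "\<tau> n l \<in> {0..T}" for l
  proof -
   note c = leb_continuous_integrable[OF Vc] leb_continuous_integrable[OF sc] leb_continuous_integrable[OF h0_continuous]
   have l: "\<tau> n l <= T" using that by simp
   have i1: "integrable (leb (\<tau> n l)) (%s. g a s \<theta>0 \<bullet> V s)"
    by (intro leb_continuous_integrable continuous_on_inner g_continuous Vc l)
   have "(LINT s|leb (\<tau> n l). ?f s) = (LINT s|leb (\<tau> n l). g a s \<theta>0 \<bullet> V s) - (LINT s|leb (\<tau> n l). g a (\<tau> n j) \<theta>0 \<bullet> V s)"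
    unfolding inner_diff_left using i1 c(1)[OF l] by (intro Bochner_Integration.integral_diff) auto
   also have "(LINT s|leb (\<tau> n l). g a (\<tau> n j) \<theta>0 \<bullet> V s) = g a (\<tau> n j) \<theta>0 \<bullet> (LINT s|leb (\<tau> n l). V s)"
    using c(1)[OF l] by simp
   also have "(LINT s|leb (\<tau> n l). V s) = D l"
    unfolding V_def D_def set_integral_leb using c(2,3)[OF l] by (intro Bochner_Integration.integral_diff) auto
   finally show ?thesis unfolding P_def set_integral_leb .
  qed
  have "norm ((LINT s:{0..\<tau> n (Suc j)}|lborel. ?f s) - (LINT s:{0..\<tau> n j}|lborel. ?f s) - (\<tau> n (Suc j) - \<tau> n j) *\<^sub>R 0)
    <= C * (T / real n) * (sig_bd + C) * (\<tau> n (Suc j) - \<tau> n j)"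
  proof (rule set_integral_increment)
   show "continuous_on {0..\<tau> n (Suc j)} ?f"
    using t by (intro continuous_on_inner continuous_on_diff g_continuous Vc continuous_on_const) auto
   show "0 <= \<tau> n j" "\<tau> n j <= \<tau> n (Suc j)" using t le by auto
   fix u assume u: "\<tau> n j <= u" "u <= \<tau> n (Suc j)"
   have uT: "u \<in> {0..T}" using u t by auto
   have "norm (g a u \<theta>0 - g a (\<tau> n j) \<theta>0) <= C * \<bar>u - \<tau> n j\<bar>" by (rule g_lip[OF cl t(1) uT])
   also have "... <= C * (T / real n)" using u st C0 by (intro mult_left_mono) auto
   finally have gb: "norm (g a u \<theta>0 - g a (\<tau> n j) \<theta>0) <= C * (T / real n)" .
   have "\<bar>?f u\<bar> <= norm (g a u \<theta>0 - g a (\<tau> n j) \<theta>0) * norm (V u)" by (rule Cauchy_Schwarz_ineq2)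
   also have "... <= C * (T / real n) * (sig_bd + C)" using gb Vb[OF uT] C0 T by (intro mult_mono) auto
   finally show "norm (?f u - 0) <= C * (T / real n) * (sig_bd + C)" by simp
  qed
  then show ?thesis unfolding I[OF t(1)] I[OF t(2)] st by (simp add: inner_diff_right algebra_simps)
 qed
 have "P n - P 0 = (\<Sum>j<n. P (Suc j) - P j)" by (simp add: sum_lessThan_telescope)
 moreover have "P 0 = 0" unfolding P_def gridt_simps by (rule set_integral_point)
 ultimately have "P n = (\<Sum>j<n. P (Suc j) - P j)" by simp
 then have "(LINT s:{0..T}|lborel. g a s \<theta>0 \<bullet> (sig 0 s om - h s \<theta>0)) = (\<Sum>j<n. P (Suc j) - P j)"
  unfolding P_def[of n] V_def gridt_simps(2)[OF n] .
 then have "\<bar>(LINT s:{0..T}|lborel. g a s \<theta>0 \<bullet> (sig 0 s om - h s \<theta>0)) - (\<Sum>j<n. g a (\<tau> n j) \<theta>0 \<bullet> (D (Suc j) - D j))\<bar>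
  = \<bar>\<Sum>j<n. P (Suc j) - P j - g a (\<tau> n j) \<theta>0 \<bullet> (D (Suc j) - D j)\<bar>" by (simp add: sum_subtractf)
 also have "... <= (\<Sum>j<n. C * (T / real n) * (sig_bd + C) * (T / real n))"
  using cell by (intro order_trans[OF sum_abs] sum_mono) auto
 also have "... = C * (sig_bd + C) * T * (T / real n)" using n by simp
 finally show ?thesis .
qed

text \<open>The record has a drift part and a Wiener part. For the drift part, the frozen gradient is handled by
\<open>score_drift_error\<close>; for the Wiener part, the frozen gradient is a step family at uniform distance $O(1/n)$ from the integrand,
so \<open>ito_family_distance\<close> applies.\<close>

lemma eta_close:
 assumes score: "has_score M T L \<rho> W \<theta>0 \<theta>0 0 \<eta>"
 shows "\<exists>K\<ge>0. \<forall>n>0. msq M (%om. \<eta> om - sc 0 n om) <= ennreal (K / real n)"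
proof -
 interpret b: brownian M T "W 0" by (rule brownian)
 note cl = observed_model.\<theta>0_cl[OF observed_model_axioms]
 define cv where "cv k t = column k (grad (h t) \<theta>0)" for k t
 have cv: "cv k t $ a = g a t \<theta>0 $ k" if "t \<in> {0..T}" for k t a
  unfolding cv_def column_def by (simp add: grad_g[OF that])
 obtain J where Jp: "!!k. has_ito_process_integral M (aug_filtration M (W 0))
       (%t om. sig 0 t om $ k) (%t om. W 0 t om $ k) (%t om. cv k t) T (J k)"
  and \<eta>m: "\<eta> \<in> borel_measurable M"
  and \<eta>: "AE om in M. \<eta> om = (\<Sum>k\<in>UNIV. J k om) - (LINT t:{0..T}|lborel. grad (h t) \<theta>0 *v h t \<theta>0)"
  using score unfolding has_score_def cv_def sig_def bvec_def by auto
 have "\<forall>k. \<exists>J'. has_ito_integral M (aug_filtration M (W 0)) (%t om. W 0 t om $ k) (%t om. cv k t) T J'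
  \<and> (AE om in M. J k om = (LINT s:{0..T}|lborel. (sig 0 s om $ k) *\<^sub>R cv k s) + J' om)"
  using Jp unfolding has_ito_process_integral_def by auto
 from choice[OF this] obtain J' where *: "\<forall>k. has_ito_integral M (aug_filtration M (W 0)) (%t om. W 0 t om $ k) (%t om. cv k t) T (J' k)
  \<and> (AE om in M. J k om = (LINT s:{0..T}|lborel. (sig 0 s om $ k) *\<^sub>R cv k s) + J' k om)" by blast
 then have J': "!!k. has_ito_integral M (aug_filtration M (W 0)) (%t om. W 0 t om $ k) (%t om. cv k t) T (J' k)" by blast
 from * have J: "AE om in M. \<forall>k. J k om = (LINT s:{0..T}|lborel. (sig 0 s om $ k) *\<^sub>R cv k s) + J' k om" by (simp add: AE_all_countable)
 have J'm: "J' k \<in> borel_measurable M" for k using J' unfolding has_ito_integral_def by blast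
 define c r where "c = real CARD('p) * C" and "r = real CARD('r)"
 have c0: "0 <= c" unfolding c_def using C0 by simp
 define \<kappa> where "\<kappa> = T\<^sup>2 * (8 * r\<^sup>2 * T * c\<^sup>2 + 2 * (c * (sig_bd + C) * T)\<^sup>2)"
 show ?thesis
 proof (intro exI[of _ \<kappa>] conjI allI impI)
  show "0 <= \<kappa>" unfolding \<kappa>_def using T by simp
  fix n :: nat assume n: "0 < n"
  define fi where "fi k = b.fam_int k {..<n} (\<tau> n) (%j. \<tau> n (Suc j)) (%j om. cv k (\<tau> n j))" for k
  have fam: "b.elem_family T {..<n} (\<tau> n) (%j. \<tau> n (Suc j)) (%j om. cv k (\<tau> n j))" for k
   unfolding b.elem_family_def
  proof (intro conjI ballI)
   fix j assume "j \<in> {..<n}"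
   then have t: "\<tau> n j \<in> {0..T}" "\<tau> n (Suc j) \<in> {0..T}" by (intro tau_in; simp)+
   show "0 <= \<tau> n j" "\<tau> n (Suc j) <= T" using t by auto
   show "\<tau> n j <= \<tau> n (Suc j)" using gridt_mono[OF T_nonneg, of j "Suc j" n] by simp
   show "\<exists>C. \<forall>om\<in>space M. norm (cv k (\<tau> n j)) <= C" by blast
  qed auto
  have fim: "fi k \<in> borel_measurable M" for k unfolding fi_def by (rule b.fam_int_measurable[OF fam order_refl])
  have cell: "norm (cv k s - b.fam_val {..<n} (\<tau> n) (%j. \<tau> n (Suc j)) (%j om. cv k (\<tau> n j)) s om) <= c * (T / real n)"
   if s: "s \<in> {0..T}" "s ~= 0" for s k om
  proof -
   have "0 < s" "s <= gridt T n n" using s n by (auto simp: gridt_simps)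
   then obtain i where i: "i < n" "s \<in> {\<tau> n i<..\<tau> n (Suc i)}" by (rule gridt_cell[OF T n])
   have t: "\<tau> n i \<in> {0..T}" using i by (intro tau_in) simp
   have d: "\<bar>s - \<tau> n i\<bar> <= T / real n" using i(2) by (simp add: gridt_simps)
   have "norm (cv k s - cv k (\<tau> n i)) <= (\<Sum>a\<in>UNIV. norm ((cv k s - cv k (\<tau> n i)) $ a))" by (rule norm_vec_le_sum)
   also have "... <= (\<Sum>a\<in>(UNIV::'p set). C * (T / real n))"
   proof (rule sum_mono)
    fix a
    have "norm ((cv k s - cv k (\<tau> n i)) $ a) = norm ((g a s \<theta>0 - g a (\<tau> n i) \<theta>0) $ k)" using cv s(1) t by simp
    also have "... <= norm (g a s \<theta>0 - g a (\<tau> n i) \<theta>0)" by (rule Finite_Cartesian_Product.norm_nth_le)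
    also have "... <= C * \<bar>s - \<tau> n i\<bar>" by (rule g_lip[OF cl t s(1)])
    also have "... <= C * (T / real n)" by (rule mult_left_mono[OF d C0])
    finally show "norm ((cv k s - cv k (\<tau> n i)) $ a) <= C * (T / real n)" .
   qed
   finally show ?thesis
    unfolding b.fam_val_def sum_grid_indicator[OF T_nonneg i] c_def by simp
  qed
  have dist: "msq M (%om. J' k om - fi k om) <= ennreal (4 * (T * (c * (T / real n))\<^sup>2))" for k
  proof -
   let ?d = "%s om. cv k s - b.fam_val {..<n} (\<tau> n) (%j. \<tau> n (Suc j)) (%j om. cv k (\<tau> n j)) s om"
   have "msq M (%om. J' k om - fi k om) <= 4 * b.dsq T ?d"
    unfolding fi_def by (rule b.ito_family_distance[OF J' T_nonneg order_refl fam])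
   also have "b.dsq T ?d <= (\<integral>\<^sup>+om. ennreal ((c * (T / real n))\<^sup>2) * ennreal T \<partial>M)"
    unfolding b.dsq_def
   proof (rule nn_integral_mono)
    fix om
    have "(\<integral>\<^sup>+s\<in>{0..T}. ennreal ((norm (?d s om))\<^sup>2) \<partial>lborel) <= (\<integral>\<^sup>+s. ennreal ((c * (T / real n))\<^sup>2) * indicator {0..T} s \<partial>lborel)"
    proof (rule nn_integral_mono_AE, use AE_lborel_singleton[of 0] in eventually_elim)
     case (elim s)
     show ?case
     proof (cases "s \<in> {0..T}")
      case True
      have "(norm (?d s om))\<^sup>2 <= (c * (T / real n))\<^sup>2" using cell[OF True elim, of k om] by (intro power_mono) auto
      then show ?thesis using True by (simp add: ennreal_leI)
     qed simp
    qed
    also have "... = ennreal ((c * (T / real n))\<^sup>2) * ennreal T"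
     using T by (simp add: nn_integral_cmult_indicator)
    finally show "(\<integral>\<^sup>+s\<in>{0..T}. ennreal ((norm (?d s om))\<^sup>2) \<partial>lborel) <= ennreal ((c * (T / real n))\<^sup>2) * ennreal T" .
   qed
   also have "(\<integral>\<^sup>+om. ennreal ((c * (T / real n))\<^sup>2) * ennreal T \<partial>M) = ennreal (T * (c * (T / real n))\<^sup>2)"
    using T by (simp add: emeasure_space_1 ennreal_mult[symmetric] mult.commute)
   finally have "msq M (%om. J' k om - fi k om) <= 4 * ennreal (T * (c * (T / real n))\<^sup>2)" by (simp add: mult_left_mono)
   also have "... = ennreal (4 * (T * (c * (T / real n))\<^sup>2))" by (subst ennreal_mult') auto
   finally show ?thesis .
  qed
  define S where "S om = (\<Sum>k\<in>UNIV. J' k om - fi k om)" for om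
  define R where "R om = \<eta> om - sc 0 n om - S om" for om
  have Sm: "S \<in> borel_measurable M" unfolding S_def[abs_def] using J'm fim by measurable
  have Rm: "R \<in> borel_measurable M" unfolding R_def[abs_def] using \<eta>m FT_M[OF sc_FT] Sm by measurable
  have fis: "(\<Sum>k\<in>UNIV. fi k om) $ a = (\<Sum>j<n. g a (\<tau> n j) \<theta>0 \<bullet> (W 0 (\<tau> n (Suc j)) om - W 0 (\<tau> n j) om))" for om a
  proof -
   have "(\<Sum>k\<in>UNIV. fi k om) $ a = (\<Sum>k\<in>UNIV. \<Sum>j<n. (W 0 (\<tau> n (Suc j)) om - W 0 (\<tau> n j) om) $ k * g a (\<tau> n j) \<theta>0 $ k)"
    unfolding fi_def b.fam_int_def b.dW_def by (simp add: cv[OF tau_in])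
   also have "... = (\<Sum>j<n. \<Sum>k\<in>UNIV. (W 0 (\<tau> n (Suc j)) om - W 0 (\<tau> n j) om) $ k * g a (\<tau> n j) \<theta>0 $ k)" by (rule sum.swap)
   finally show ?thesis by (simp add: inner_vec_def mult.commute)
  qed
  have Rb: "AE om in M. norm (R om) <= c * (sig_bd + C) * T * (T / real n)"
   using J \<eta> sig_bound[of 0] AE_space
  proof eventually_elim
   case (elim om)
   have sc': "continuous_on {0..T} (%s. sig 0 s om)" by (rule sig_process(2)[OF elim(4)])
   define D where "D j = (LINT s:{0..\<tau> n j}|lborel. sig 0 s om) - (LINT s:{0..\<tau> n j}|lborel. h s \<theta>0)" for j
   have Ra: "R om $ a = (LINT s:{0..T}|lborel. g a s \<theta>0 \<bullet> (sig 0 s om - h s \<theta>0)) - (\<Sum>j<n. g a (\<tau> n j) \<theta>0 \<bullet> (D (Suc j) - D j))" for a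
   proof -
    have i1: "integrable (leb T) (%s. (sig 0 s om $ k) *\<^sub>R cv k s)" for k
    proof (rule leb_continuous_integrable)
     have "continuous_on {0..T} (%s. (sig 0 s om $ k) *\<^sub>R (\<chi> a. g a s \<theta>0 $ k))"
      by (intro continuous_intros sc' g_continuous order_refl)
     then show "continuous_on {0..T} (%s. (sig 0 s om $ k) *\<^sub>R cv k s)"
      by (rule continuous_on_cong[THEN iffD1, rotated 2]) (auto simp: vec_eq_iff cv)
    qed
    have gh: "(grad (h s) \<theta>0 *v h s \<theta>0) $ a = g a s \<theta>0 \<bullet> h s \<theta>0" if "s \<in> {0..T}" for s a
     unfolding matrix_vector_mult_def inner_vec_def using grad_g[OF that] by simp
    have i2: "integrable (leb T) (%s. grad (h s) \<theta>0 *v h s \<theta>0)"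
    proof (rule leb_continuous_integrable)
     have "continuous_on {0..T} (%s. \<chi> a. g a s \<theta>0 \<bullet> h s \<theta>0)"
      by (intro continuous_on_vec_lambda continuous_on_inner g_continuous h0_continuous order_refl)
     then show "continuous_on {0..T} (%s. grad (h s) \<theta>0 *v h s \<theta>0)"
      by (rule continuous_on_cong[THEN iffD1, rotated 2]) (auto simp: vec_eq_iff gh)
    qed
    have n1: "(LINT s|leb T. f s) $ a = (LINT s|leb T. f s $ a)" if "integrable (leb T) f" for f :: "real => real^'p"
     using integral_bounded_linear[OF bounded_linear_vec_nth that] by simp
    have i1a: "integrable (leb T) (%s. ((sig 0 s om $ k) *\<^sub>R cv k s) $ a)" "integrable (leb T) (%s. (grad (h s) \<theta>0 *v h s \<theta>0) $ a)" for k
     by (rule integrable_bounded_linear[OF bounded_linear_vec_nth i1] integrable_bounded_linear[OF bounded_linear_vec_nth i2])+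
    have "(\<Sum>k\<in>UNIV. (LINT s|leb T. (sig 0 s om $ k) *\<^sub>R cv k s)) $ a - (LINT s|leb T. grad (h s) \<theta>0 *v h s \<theta>0) $ a
     = (\<Sum>k\<in>UNIV. LINT s|leb T. ((sig 0 s om $ k) *\<^sub>R cv k s) $ a) - (LINT s|leb T. (grad (h s) \<theta>0 *v h s \<theta>0) $ a)"
     by (simp add: n1[OF i1] n1[OF i2] del: vector_scaleR_component)
    also have "... = (LINT s|leb T. (\<Sum>k\<in>UNIV. ((sig 0 s om $ k) *\<^sub>R cv k s) $ a) - (grad (h s) \<theta>0 *v h s \<theta>0) $ a)"
     using i1a by (simp add: Bochner_Integration.integral_sum del: vector_scaleR_component)
    also have "... = (LINT s|leb T. g a s \<theta>0 \<bullet> (sig 0 s om - h s \<theta>0))"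
     by (intro Bochner_Integration.integral_cong refl) (simp add: cv gh inner_diff_right, simp add: inner_vec_def mult.commute)
    finally have e: "(\<Sum>k\<in>UNIV. (LINT s|leb T. (sig 0 s om $ k) *\<^sub>R cv k s)) $ a - (LINT s|leb T. grad (h s) \<theta>0 *v h s \<theta>0) $ a
     = (LINT s:{0..T}|lborel. g a s \<theta>0 \<bullet> (sig 0 s om - h s \<theta>0))" unfolding set_integral_leb .
    have "sc 0 n om $ a = (\<Sum>k\<in>UNIV. fi k om) $ a + (\<Sum>j<n. g a (\<tau> n j) \<theta>0 \<bullet> (D (Suc j) - D j))"
     unfolding fis sum.distrib[symmetric] inner_add_right[symmetric] sc_def score_def vec_lambda_beta
     by (intro sum.cong refl arg_cong[where f="inner _"]) (simp add: Z_eq D_def)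
    moreover have "R om $ a = (\<Sum>k\<in>UNIV. (LINT s|leb T. (sig 0 s om $ k) *\<^sub>R cv k s)) $ a - (LINT s|leb T. grad (h s) \<theta>0 *v h s \<theta>0) $ a
      + (\<Sum>k\<in>UNIV. fi k om) $ a - sc 0 n om $ a"
     unfolding R_def S_def elim(2) using elim(1) by (simp add: set_integral_leb sum.distrib sum_subtractf del: sum_component)
    ultimately show ?thesis using e by simp
   qed
   have "norm (R om) <= (\<Sum>a\<in>UNIV. norm (R om $ a))" by (rule norm_vec_le_sum)
   also have "... <= (\<Sum>a\<in>(UNIV::'p set). C * (sig_bd + C) * T * (T / real n))"
    unfolding Ra D_def real_norm_def by (intro sum_mono score_drift_error[OF elim(4,3) n])
   finally show ?case unfolding c_def by simp
  qed
  have "msq M (%om. \<eta> om - sc 0 n om) = msq M (%om. S om + R om)" unfolding R_def by simp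
  also have "... <= 2 * msq M S + 2 * msq M R" by (rule msq_add[OF Sm Rm])
  also have "... <= 2 * (of_nat CARD('r) * (\<Sum>k\<in>(UNIV::'r set). ennreal (4 * (T * (c * (T / real n))\<^sup>2))))
    + 2 * ennreal ((c * (sig_bd + C) * T * (T / real n))\<^sup>2)"
  proof (intro add_mono mult_left_mono msq_bound[OF prob_space_axioms Rb])
   show "msq M S <= of_nat CARD('r) * (\<Sum>k\<in>(UNIV::'r set). ennreal (4 * (T * (c * (T / real n))\<^sup>2)))"
    unfolding S_def[abs_def] using J'm fim
    by (intro order_trans[OF msq_sum] mult_left_mono sum_mono dist) auto
  qed auto
  also have "... = ennreal (2 * (r * (r * (4 * (T * (c * (T / real n))\<^sup>2)))) + 2 * (c * (sig_bd + C) * T * (T / real n))\<^sup>2)"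
  proof -
   have e: "2 * (of_nat CARD('r) * (\<Sum>k\<in>(UNIV::'r set). ennreal x)) + 2 * ennreal y = ennreal (2 * (r * (r * x)) + 2 * y)" if "0 <= x" "0 <= y" for x y
    unfolding r_def using that by (simp add: ennreal_mult' ennreal_of_nat_eq_real_of_nat)
   show ?thesis by (rule e) (use T in auto)
  qed
  also have "... <= ennreal (\<kappa> / real n)"
  proof (rule ennreal_leI)
   have alg: "2 * (r * (r * (4 * (T * (c * x)\<^sup>2)))) + 2 * (c * b * T * x)\<^sup>2 = x\<^sup>2 * (8 * r\<^sup>2 * T * c\<^sup>2 + 2 * (c * b * T)\<^sup>2)" for x b :: real
    by (simp add: power_mult_distrib power2_eq_square algebra_simps)
   have "(T / real n)\<^sup>2 <= T\<^sup>2 / real n"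
    using n by (simp add: power2_eq_square divide_left_mono)
   then have "(T / real n)\<^sup>2 * (8 * r\<^sup>2 * T * c\<^sup>2 + 2 * (c * (sig_bd + C) * T)\<^sup>2) <= T\<^sup>2 / real n * (8 * r\<^sup>2 * T * c\<^sup>2 + 2 * (c * (sig_bd + C) * T)\<^sup>2)"
    using T by (intro mult_right_mono) auto
   then show "2 * (r * (r * (4 * (T * (c * (T / real n))\<^sup>2)))) + 2 * (c * (sig_bd + C) * T * (T / real n))\<^sup>2 <= \<kappa> / real n"
    unfolding alg[of "T / real n"] \<kappa>_def by simp
  qed
  finally show "msq M (%om. \<eta> om - sc 0 n om) <= ennreal (\<kappa> / real n)" .
 qed
qed

end

section \<open>Central limit theorem for the discrete score\<close>

lemma ennreal_twice_add: "0 <= x ==> 0 <= y ==> 2 * ennreal x + 2 * ennreal y = ennreal (2 * x + 2 * y)"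
 by (simp add: ennreal_mult')

lemma prod_eq_power:
 fixes f :: "nat => 'v::comm_monoid_mult"
 assumes "!!i. i < n ==> f i = c" shows "(\<Prod>i<n. f i) = c ^ n"
 using assms by (simp add: prod.cong[of "{..<n}" "{..<n}" f "%_. c"])

context observed_regular begin

lemma score_ZN: "score n (%t. ZN N t om) = (1 / real N) *\<^sub>R (\<Sum>i<N. sc i n om)"
proof -
 have "score n (%t. ZN N t om) $ a = ((1 / real N) *\<^sub>R (\<Sum>i<N. sc i n om)) $ a" for a
 proof -
  have "score n (%t. ZN N t om) $ a = (\<Sum>j<n. (1 / real N) * (\<Sum>i<N. g a (\<tau> n j) \<theta>0 \<bullet> (Z i (\<tau> n (Suc j)) om - Z i (\<tau> n j) om)))"
   unfolding score_def ZN_def vec_lambda_beta scaleR_diff_right[symmetric] sum_subtractf[symmetric] inner_scaleR_right inner_sum_right by simp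
  also have "... = (1 / real N) * (\<Sum>i<N. \<Sum>j<n. g a (\<tau> n j) \<theta>0 \<bullet> (Z i (\<tau> n (Suc j)) om - Z i (\<tau> n j) om))"
   unfolding sum_distrib_left[symmetric] by (subst sum.swap) simp
  finally show ?thesis by (simp add: sc_def score_def)
 qed
 then show ?thesis by (simp add: vec_eq_iff)
qed

lemma iexp_lipschitz:
 fixes X Y :: "'a => 'v::euclidean_space"
 assumes [measurable]: "X \<in> borel_measurable M" "Y \<in> borel_measurable M" and d: "msq M (%om. X om - Y om) <= ennreal e" and e: "0 <= e"
 shows "cmod (expectation (%om. iexp (u \<bullet> X om)) - expectation (%om. iexp (u \<bullet> Y om))) <= norm u * sqrt e"
proof -
 let ?n = "%om. norm (X om - Y om)"
 have nm: "msq M ?n = msq M (%om. X om - Y om)" unfolding msq_def by simp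
 have m: "?n \<in> borel_measurable M" by measurable
 have "msq M ?n < \<infinity>" using d unfolding nm by (rule order_le_less_trans) simp
 note sq = msq_finite_integrable[OF prob_space_axioms m this]
 have "expectation (%om. (norm (?n om))\<^sup>2) <= e" using d e unfolding nm[symmetric] sq(3) by simp
 then have E: "expectation ?n <= sqrt e" using sq(4) by (intro real_le_rsqrt) simp
 note i = iexp_integrable[OF prob_space_axioms, of X u] iexp_integrable[OF prob_space_axioms, of Y u]
 have "cmod (expectation (%om. iexp (u \<bullet> X om)) - expectation (%om. iexp (u \<bullet> Y om))) = cmod (expectation (%om. iexp (u \<bullet> X om) - iexp (u \<bullet> Y om)))"
  using i by simp
 also have "... <= expectation (%om. norm u * ?n om)"
 proof (rule integral_norm_le)
  fix om
  have "iexp (u \<bullet> X om) - iexp (u \<bullet> Y om) = iexp (u \<bullet> Y om) * (iexp (u \<bullet> (X om - Y om)) - 1)"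
   by (simp add: inner_diff_right right_diff_distrib exp_add[symmetric] algebra_simps)
  then have "cmod (iexp (u \<bullet> X om) - iexp (u \<bullet> Y om)) = cmod (iexp (u \<bullet> (X om - Y om)) - 1)" by (simp add: norm_mult)
  also have "... <= \<bar>u \<bullet> (X om - Y om)\<bar>" using iexp_approx1[of "u \<bullet> (X om - Y om)" 0] by simp
  also have "... <= norm u * ?n om" by (rule Cauchy_Schwarz_ineq2)
  finally show "cmod (iexp (u \<bullet> X om) - iexp (u \<bullet> Y om)) <= norm u * ?n om" .
 qed (use i sq(2) in auto)
 also have "... = norm u * expectation ?n" by simp
 also have "... <= norm u * sqrt e" by (rule mult_left_mono[OF E norm_ge_zero])
 finally show ?thesis .
qed

text \<open>Independence factorizes the characteristic function of the sum, and equality of the laws makes the factors equal.\<close>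

lemma char_iid_sum:
 fixes V :: "nat => 'a => real^'p"
 assumes V: "!!i. V i \<in> borel_measurable (FT i)" and law: "!!i. distr M borel (V i) = distr M borel (V 0)"
 shows "expectation (%om. iexp (u \<bullet> (s *\<^sub>R (\<Sum>i<N. V i om - x)))) = (expectation (%om. iexp (s * (u \<bullet> (V 0 om - x))))) ^ N"
proof -
 define Y where "Y i om = s * (u \<bullet> (V i om - x))" for i om
 have Vm[measurable]: "V i \<in> borel_measurable M" for i by (rule FT_M[OF V])
 have Ym[measurable]: "Y i \<in> borel_measurable M" for i unfolding Y_def[abs_def] by measurable
 have "indep_vars (%_. borel) Y UNIV"
  by (rule indep_copies) (unfold Y_def[abs_def], use V in measurable)
 then have ind: "indep_vars (%_. borel) Y {..<N}" by (rule indep_vars_subset) auto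
 have ch: "char (distr M borel Z) 1 = expectation (%om. iexp (Z om))" if "Z \<in> borel_measurable M" for Z
  unfolding char_def using that by (subst integral_distr) auto
 have same: "expectation (%om. iexp (Y i om)) = expectation (%om. iexp (Y 0 om))" for i
 proof -
  have "expectation (%om. iexp (Y i om)) = (LINT v|distr M borel (V i). iexp (s * (u \<bullet> (v - x))))" for i
   unfolding Y_def by (subst integral_distr) auto
  then show ?thesis using law[of i] by simp
 qed
 have "u \<bullet> (s *\<^sub>R (\<Sum>i<N. V i om - x)) = (\<Sum>i<N. Y i om)" for om
  unfolding Y_def inner_scaleR_right inner_sum_right sum_distrib_left by simp
 then have "expectation (%om. iexp (u \<bullet> (s *\<^sub>R (\<Sum>i<N. V i om - x)))) = expectation (%om. iexp (\<Sum>i<N. Y i om))" by simp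
 also have "... = char (distr M borel (%om. \<Sum>i<N. Y i om)) 1" by (rule ch[symmetric]) measurable
 also have "... = (\<Prod>i<N. expectation (%om. iexp (Y i om)))" unfolding char_distr_sum[OF ind] ch[OF Ym] ..
 also have "... = (expectation (%om. iexp (Y 0 om))) ^ N" by (rule prod_eq_power[OF same])
 finally show ?thesis unfolding Y_def .
qed

text \<open>The score \<open>\<eta>\<close> is a mean square limit of the centred discrete scores.\<close>

lemma score_properties:
 assumes score: "has_score M T L \<rho> W \<theta>0 \<theta>0 0 \<eta>"
 shows "\<eta> \<in> borel_measurable M" "integrable M \<eta>" "expectation \<eta> = 0" "msq M \<eta> < \<infinity>"
proof -
 show m[measurable]: "\<eta> \<in> borel_measurable M" using score unfolding has_score_def by blast
 obtain K where K0: "0 <= K" and K: "!!n. 0 < n ==> msq M (%om. \<eta> om - sc 0 n om) <= ennreal (K / real n)"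
  using eta_close[OF score] by blast
 have scm[measurable]: "sc 0 n \<in> borel_measurable M" for n by (rule FT_M[OF sc_FT])
 have fin: "msq M (%om. \<eta> om - sc 0 n om) < \<infinity>" if "0 < n" for n using K[OF that] by (rule order_le_less_trans) simp
 have dm: "(%om. \<eta> om - sc 0 n om) \<in> borel_measurable M" for n by measurable
 note sq = msq_finite_integrable[OF prob_space_axioms dm fin]
 have "integrable M (%om. (\<eta> om - sc 0 1 om) + sc 0 1 om)" using sq(2)[of 1] sc_mean(1) by (intro Bochner_Integration.integrable_add) auto
 then show i: "integrable M \<eta>" by simp
 have e: "(norm (expectation \<eta>))\<^sup>2 <= K / real n" if n: "0 < n" for n
 proof -
  have "expectation (%om. \<eta> om - sc 0 n om) = expectation \<eta>" using i sc_mean by simp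
  then have "(norm (expectation \<eta>))\<^sup>2 <= expectation (%om. (norm (\<eta> om - sc 0 n om))\<^sup>2)" using sq(4)[OF n] by simp
  also have "... <= K / real n" using K[OF n] K0 unfolding sq(3)[OF n] by simp
  finally show ?thesis .
 qed
 have "(%n. K / real n) \<longlonglongrightarrow> 0" by real_asymp
 then have "(norm (expectation \<eta>))\<^sup>2 <= 0"
  by (rule LIMSEQ_le_const) (use e in \<open>auto intro: exI[of _ 1]\<close>)
 then show "expectation \<eta> = 0" by simp
 \<comment> \<open>the discrete score on the one-cell grid suffices as a square integrable reference\<close>
 have z: "msq M (Z 0 (\<tau> 1 j)) < \<infinity>" if "j <= 1" for j
  using Z_msq[OF tau_in[OF that], of 0] by (rule order_le_less_trans) simp
 have "msq M (sc 0 1) < \<infinity>"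
 proof -
  have "fluct 1 (%j. Z 0 (\<tau> 1 j) om) = 2 * norm (Z 0 (\<tau> 1 1) om)" for om unfolding fluct_def by simp
  have b: "norm (sc 0 1 om) <= norm ((\<Sum>a\<in>(UNIV::'p set). C) *\<^sub>R (Z 0 (\<tau> 1 1) om - Z 0 (\<tau> 1 0) om))" for om
  proof -
   have "norm (sc 0 1 om) <= (\<Sum>a\<in>UNIV. norm (sc 0 1 om $ a))" by (rule norm_vec_le_sum)
   also have "... <= (\<Sum>a\<in>(UNIV::'p set). C * norm (Z 0 (\<tau> 1 1) om - Z 0 (\<tau> 1 0) om))"
   proof (rule sum_mono)
    fix a
    have "norm (sc 0 1 om $ a) = \<bar>g a (\<tau> 1 0) \<theta>0 \<bullet> (Z 0 (\<tau> 1 1) om - Z 0 (\<tau> 1 0) om)\<bar>" unfolding sc_def score_def by simp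
    also have "... <= norm (g a (\<tau> 1 0) \<theta>0) * norm (Z 0 (\<tau> 1 1) om - Z 0 (\<tau> 1 0) om)" by (rule Cauchy_Schwarz_ineq2)
    also have "... <= C * norm (Z 0 (\<tau> 1 1) om - Z 0 (\<tau> 1 0) om)" by (intro mult_right_mono g_bdd tau_in observed_model.\<theta>0_cl[OF observed_model_axioms]) auto
    finally show "norm (sc 0 1 om $ a) <= C * norm (Z 0 (\<tau> 1 1) om - Z 0 (\<tau> 1 0) om)" .
   qed
   finally show ?thesis using C0 by (simp add: abs_mult mult.assoc)
  qed
  have zm: "Z 0 (\<tau> 1 1) \<in> borel_measurable M" "Z 0 (\<tau> 1 0) \<in> borel_measurable M" by (rule FT_M[OF Z_FT[OF tau_in]]; simp)+
  have "msq M (sc 0 1) <= msq M (%om. (\<Sum>a\<in>(UNIV::'p set). C) *\<^sub>R (Z 0 (\<tau> 1 1) om - Z 0 (\<tau> 1 0) om))"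
   using b by (intro msq_mono_AE AE_I2)
  also have "... = ennreal ((\<Sum>a\<in>(UNIV::'p set). C)\<^sup>2) * msq M (%om. Z 0 (\<tau> 1 1) om - Z 0 (\<tau> 1 0) om)"
   using zm by (intro msq_scaleR) measurable
  also have "... <= ennreal ((\<Sum>a\<in>(UNIV::'p set). C)\<^sup>2) * (2 * msq M (Z 0 (\<tau> 1 1)) + 2 * msq M (Z 0 (\<tau> 1 0)))"
   by (intro mult_left_mono msq_diff zm) simp
  also have "... < \<infinity>" using z[of 0] z[of 1] by (simp add: ennreal_mult_less_top)
  finally show ?thesis .
 qed
 then have "2 * msq M (%om. \<eta> om - sc 0 1 om) + 2 * msq M (sc 0 1) < \<infinity>" using fin[of 1] by (simp add: ennreal_mult_less_top)
 moreover have "msq M (%om. (\<eta> om - sc 0 1 om) + sc 0 1 om) <= 2 * msq M (%om. \<eta> om - sc 0 1 om) + 2 * msq M (sc 0 1)" by (rule msq_add) measurable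
 then have "msq M \<eta> <= 2 * msq M (%om. \<eta> om - sc 0 1 om) + 2 * msq M (sc 0 1)" by simp
 ultimately show "msq M \<eta> < \<infinity>" by (rule order_le_less_trans[rotated])
qed

lemma inner_sq:
 fixes Q :: "'a => real^'p"
 assumes Q: "Q \<in> borel_measurable M" "msq M Q <= ennreal k" and k: "0 <= k"
 shows "integrable M (%om. (u \<bullet> Q om)\<^sup>2)" "expectation (%om. (u \<bullet> Q om)\<^sup>2) <= (norm u)\<^sup>2 * k"
proof -
 have "msq M Q < \<infinity>" using Q(2) by (rule order_le_less_trans) simp
 note sq = msq_finite_integrable[OF prob_space_axioms Q(1) this]
 have le: "(u \<bullet> Q om)\<^sup>2 <= (norm u)\<^sup>2 * (norm (Q om))\<^sup>2" for om
  using power_mono[OF Cauchy_Schwarz_ineq2[of u "Q om"], of 2] by (simp add: power_mult_distrib)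
 show i: "integrable M (%om. (u \<bullet> Q om)\<^sup>2)"
  by (rule Bochner_Integration.integrable_bound[of M "%om. (norm u)\<^sup>2 * (norm (Q om))\<^sup>2"]) (use sq(1) Q(1) le in auto)
 have "expectation (%om. (u \<bullet> Q om)\<^sup>2) <= expectation (%om. (norm u)\<^sup>2 * (norm (Q om))\<^sup>2)"
  by (rule integral_mono[OF i]) (use sq(1) le in auto)
 also have "... <= (norm u)\<^sup>2 * k" using Q(2) k unfolding sq(3) by (simp add: mult_left_mono)
 finally show "expectation (%om. (u \<bullet> Q om)\<^sup>2) <= (norm u)\<^sup>2 * k" .
qed

text \<open>Two replacements. In the normalized sum each score is replaced by its centred Euler copy; as the differences are centred
and independent, the mean square of the normalized sum of differences is that of a single one, $O(1/n)$. The sum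
of the copies has an \<open>N\<close>-th power as its characteristic function, and its base is compared with that of \<open>\<eta>\<close> by
\<open>char_compare\<close>, with weight $s = n^{-1/2}$.\<close>

lemma score_char_bound:
 assumes score: "has_score M T L \<rho> W \<theta>0 \<theta>0 0 \<eta>"
 shows "\<exists>B. \<forall>N>0. \<forall>n>0. cmod (expectation (%om. iexp (u \<bullet> (sqrt (real N) *\<^sub>R score n (%t. ZN N t om))))
   - (expectation (%om. iexp ((u \<bullet> \<eta> om) / sqrt (real N)))) ^ N) <= B / sqrt (real n)"
proof -
 note \<eta> = score_properties[OF score]
 note \<eta>m[measurable] = \<eta>(1)
 obtain K1 where K10: "0 <= K1" and K1: "!!n. 0 < n ==> msq M (%om. \<eta> om - sc 0 n om) <= ennreal (K1 / real n)"
  using eta_close[OF score] by blast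
 obtain K2 where K20: "0 <= K2" and K2: "!!n. 0 < n ==> \<exists>G :: nat => 'a => real^'p. (\<forall>i. G i \<in> borel_measurable (FT i)) \<and> (\<forall>i. distr M borel (G i) = distr M borel (G 0))
  \<and> (\<forall>i. msq M (%om. sc i n om - G i om) <= ennreal (K2 / real n))"
  using euler_copy by blast
 define k3 where "k3 = 2 * K1 + 2 * (4 * K2)"
 have k30: "0 <= k3" unfolding k3_def using K10 K20 by simp
 define m2 where "m2 = expectation (%om. (norm (\<eta> om))\<^sup>2)"
 have m2: "msq M \<eta> = ennreal m2" "0 <= m2" unfolding m2_def using msq_finite_integrable(3)[OF prob_space_axioms \<eta>m \<eta>(4)] by auto
 define B where "B = norm u * sqrt (4 * K2) + (norm u)\<^sup>2 * (k3 + 2 * (2 * k3 + 3 * m2))"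
 show ?thesis
 proof (intro exI[of _ B] allI impI)
  fix N n :: nat assume N: "0 < N" and n: "0 < n"
  obtain G :: "nat => 'a => real^'p" where GF: "!!i. G i \<in> borel_measurable (FT i)" and law: "!!i. distr M borel (G i) = distr M borel (G 0)"
   and GK: "!!i. msq M (%om. sc i n om - G i om) <= ennreal (K2 / real n)" using K2[OF n] by blast
  have Gm[measurable]: "G i \<in> borel_measurable M" for i by (rule FT_M[OF GF])
  have scm[measurable]: "sc i n \<in> borel_measurable M" for i by (rule FT_M[OF sc_FT])
  define D where "D i om = sc i n om - G i om" for i om
  have Dm[measurable]: "D i \<in> borel_measurable M" for i unfolding D_def[abs_def] by measurable
  have DK: "msq M (D i) <= ennreal (K2 / real n)" for i using GK[of i] unfolding D_def .
  have "msq M (D i) < \<infinity>" for i using DK[of i] by (rule order_le_less_trans) simp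
  note sq = msq_finite_integrable[OF prob_space_axioms Dm this]
  have "integrable M (%om. sc i n om - D i om)" for i using sq(2) sc_mean(1) by (intro Bochner_Integration.integrable_diff)
  then have Gi: "integrable M (G i)" for i unfolding D_def by simp
  define x where "x = expectation (G 0)"
  have Gx: "expectation (G i) = x" for i
  proof -
   have "expectation (G i) = (LINT v|distr M borel (G i). v)" for i by (subst integral_distr) auto
   then show ?thesis unfolding x_def using law[of i] by simp
  qed
  have Dx: "expectation (D i) = - x" for i unfolding D_def using sc_mean Gi Gx by simp
  have xK: "(norm x)\<^sup>2 <= K2 / real n"
  proof -
   have "(norm x)\<^sup>2 <= expectation (%om. (norm (D 0 om))\<^sup>2)" using sq(4)[of 0] Dx by simp
   also have "... <= K2 / real n" using DK[of 0] K20 unfolding sq(3) by simp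
   finally show ?thesis .
  qed
  \<comment> \<open>the score minus its centred Euler copy\<close>
  define V where "V i om = D i om + x" for i om
  have VF: "V i \<in> borel_measurable (FT i)" for i unfolding V_def[abs_def] D_def using GF sc_FT by measurable
  have V0: "expectation (V i) = 0" for i unfolding V_def using sq(2) Dx by (simp add: prob_space)
  have VK: "msq M (V i) <= ennreal (4 * K2 / real n)" for i
  proof -
   have "msq M (V i) <= 2 * msq M (D i) + 2 * msq M (%_. x)" unfolding V_def by (rule msq_add) auto
   also have "... <= 2 * ennreal (K2 / real n) + 2 * ennreal (K2 / real n)"
    using DK[of i] order_trans[OF msq_bound[OF prob_space_axioms, of "%_. x" "norm x"] ennreal_leI[OF xK]]
    by (intro add_mono mult_left_mono) auto
   also have "... = ennreal (2 * (K2 / real n) + 2 * (K2 / real n))" by (rule ennreal_twice_add) (use K20 in auto)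
   finally show ?thesis by simp
  qed
  have mean: "msq M (%om. (1 / real N) *\<^sub>R (\<Sum>i<N. V i om)) <= ennreal (4 * K2 / real n / real N)"
   by (rule indep_mean_msq[OF VF V0 VK _ N]) (use K20 in auto)
  define X Y where "X om = sqrt (real N) *\<^sub>R score n (%t. ZN N t om)" and "Y om = (1 / sqrt (real N)) *\<^sub>R (\<Sum>i<N. G i om - x)" for om
  have Vm[measurable]: "V i \<in> borel_measurable M" for i by (rule FT_M[OF VF])
  have Xm[measurable]: "X \<in> borel_measurable M" unfolding X_def[abs_def] score_ZN by measurable
  have Ym[measurable]: "Y \<in> borel_measurable M" unfolding Y_def[abs_def] by measurable
  have sN: "sqrt (real N) * (1 / real N) = 1 / sqrt (real N)" using N by (simp add: field_simps)
  have XY: "X om - Y om = sqrt (real N) *\<^sub>R ((1 / real N) *\<^sub>R (\<Sum>i<N. V i om))" for om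
  proof -
   have v: "V i om = sc i n om - (G i om - x)" for i unfolding V_def D_def by simp
   show ?thesis unfolding X_def Y_def score_ZN scaleR_scaleR sN v sum_subtractf[of "%i. sc i n om"] scaleR_diff_right ..
  qed
  have "msq M (%om. X om - Y om) <= ennreal (real N) * ennreal (4 * K2 / real n / real N)"
   unfolding XY using mean by (subst msq_scaleR) (auto intro: mult_left_mono)
  also have "... = ennreal (4 * K2 / real n)" using N K20 by (subst ennreal_mult[symmetric]) auto
  finally have "msq M (%om. X om - Y om) <= ennreal (4 * K2 / real n)" .
  from iexp_lipschitz[OF Xm Ym this, of u] have 1: "cmod (expectation (%om. iexp (u \<bullet> X om)) - expectation (%om. iexp (u \<bullet> Y om))) <= norm u * sqrt (4 * K2) / sqrt (real n)"
   using K20 by (simp add: real_sqrt_divide)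
  define \<phi> \<psi> where "\<phi> = expectation (%om. iexp ((1 / sqrt (real N)) * (u \<bullet> (G 0 om - x))))" and "\<psi> = expectation (%om. iexp ((u \<bullet> \<eta> om) / sqrt (real N)))"
  have Y\<phi>: "expectation (%om. iexp (u \<bullet> Y om)) = \<phi> ^ N" unfolding Y_def \<phi>_def by (rule char_iid_sum[OF GF law])
  have le1: "cmod (expectation (%om. iexp (Q om))) <= 1" if "Q \<in> borel_measurable M" for Q
  proof -
   have "cmod (expectation (%om. iexp (Q om))) <= expectation (%om. 1)"
    by (rule integral_norm_le) (use iexp_integrable[OF prob_space_axioms that, of 1] in auto)
   then show ?thesis by (simp add: prob_space)
  qed
  have 2: "cmod (\<phi> ^ N - \<psi> ^ N) <= real N * cmod (\<phi> - \<psi>)"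
   unfolding \<phi>_def \<psi>_def by (intro norm_power_diff le1) measurable
  define A where "A om = G 0 om - x" for om
  have Am[measurable]: "A \<in> borel_measurable M" unfolding A_def[abs_def] by measurable
  have AK: "msq M (%om. A om - \<eta> om) <= ennreal (k3 / real n)"
  proof -
   have "msq M (%om. A om - \<eta> om) = msq M (%om. - (\<eta> om - sc 0 n om) - V 0 om)" unfolding A_def V_def D_def by simp
   also have "... <= 2 * msq M (%om. - (\<eta> om - sc 0 n om)) + 2 * msq M (V 0)" by (rule msq_diff) measurable
   also have "... <= 2 * ennreal (K1 / real n) + 2 * ennreal (4 * K2 / real n)"
    unfolding msq_uminus using K1[OF n] VK[of 0] by (intro add_mono mult_left_mono) auto
   also have "... = ennreal (2 * (K1 / real n) + 2 * (4 * K2 / real n))"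
    by (rule ennreal_twice_add) (use K10 K20 in auto)
   finally show ?thesis unfolding k3_def by (simp add: add_divide_distrib)
  qed
  have A2: "msq M A <= ennreal (2 * (k3 / real n) + 2 * m2)"
  proof -
   have "msq M A = msq M (%om. (A om - \<eta> om) + \<eta> om)" by simp
   also have "... <= 2 * msq M (%om. A om - \<eta> om) + 2 * msq M \<eta>" by (rule msq_add) measurable
   also have "... <= 2 * ennreal (k3 / real n) + 2 * ennreal m2" unfolding m2(1) using AK by (intro add_mono mult_left_mono) auto
   also have "... = ennreal (2 * (k3 / real n) + 2 * m2)" by (rule ennreal_twice_add) (use k30 m2(2) in auto)
   finally show ?thesis .
  qed
  define v where "v = 1 / sqrt (real N)"
  have v2: "v\<^sup>2 = 1 / real N" unfolding v_def by (simp add: power_divide)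
  have q0: "0 <= 2 * (k3 / real n) + 2 * m2" "0 <= k3 / real n" using k30 m2(2) by auto
  have dm: "(%om. A om - \<eta> om) \<in> borel_measurable M" by measurable
  note iA = inner_sq[OF Am A2 q0(1), of u] and i\<eta> = inner_sq[OF \<eta>m eq_refl[OF m2(1)] m2(2), of u] and iD = inner_sq[OF dm AK q0(2), of u]
  have Ai: "integrable M A" "expectation A = 0" unfolding A_def[abs_def] using Gi Gx by (auto simp: prob_space)
  have "cmod (\<phi> - \<psi>) <= (1 / (1 / sqrt (real n))) * expectation (%om. (v * (u \<bullet> A om) - v * (u \<bullet> \<eta> om))\<^sup>2)
   + 2 * (1 / sqrt (real n)) * (expectation (%om. (v * (u \<bullet> A om))\<^sup>2) + expectation (%om. (v * (u \<bullet> \<eta> om))\<^sup>2))"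
  proof -
   have e: "\<phi> = expectation (%om. iexp (v * (u \<bullet> A om)))" "\<psi> = expectation (%om. iexp (v * (u \<bullet> \<eta> om)))"
    unfolding \<phi>_def \<psi>_def v_def A_def by simp_all
   show ?thesis
    unfolding e
   proof (rule char_compare)
    show "integrable M (%om. (v * (u \<bullet> A om))\<^sup>2)" "integrable M (%om. (v * (u \<bullet> \<eta> om))\<^sup>2)"
     unfolding power_mult_distrib using iA(1) i\<eta>(1) by auto
    show "integrable M (%om. v * (u \<bullet> A om))" "integrable M (%om. v * (u \<bullet> \<eta> om))"
     using Ai \<eta>(2) by auto
    show "expectation (%om. v * (u \<bullet> A om)) = expectation (%om. v * (u \<bullet> \<eta> om))"
     using Ai \<eta>(2,3) by simp
   qed (use n in auto)
  qed
  also have "... = (1 / real N) * (sqrt (real n) * expectation (%om. (u \<bullet> (A om - \<eta> om))\<^sup>2)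
   + 2 / sqrt (real n) * (expectation (%om. (u \<bullet> A om)\<^sup>2) + expectation (%om. (u \<bullet> \<eta> om)\<^sup>2)))"
   unfolding right_diff_distrib[symmetric] inner_diff_right[symmetric] power_mult_distrib integral_mult_right_zero v2 by (simp add: algebra_simps)
  also have "... <= (1 / real N) * (sqrt (real n) * ((norm u)\<^sup>2 * (k3 / real n))
   + 2 / sqrt (real n) * ((norm u)\<^sup>2 * (2 * (k3 / real n) + 2 * m2) + (norm u)\<^sup>2 * m2))"
   using iA(2) i\<eta>(2) iD(2) by (intro mult_left_mono add_mono) auto
  also have "... <= (1 / real N) * ((norm u)\<^sup>2 * (k3 + 2 * (2 * k3 + 3 * m2)) / sqrt (real n))"
  proof (rule mult_left_mono)
   have e2: "(norm u)\<^sup>2 * (k3 / sqrt (real n)) + 2 / sqrt (real n) * ((norm u)\<^sup>2 * (2 * k3 + 2 * m2) + (norm u)\<^sup>2 * m2)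
    = (norm u)\<^sup>2 * (k3 + 2 * (2 * k3 + 3 * m2)) / sqrt (real n)" using n by (simp add: field_simps)
   have "sqrt (real n) * (k3 / real n) = k3 / sqrt (real n)" using n by (simp add: field_simps)
   moreover have "k3 / real n <= k3" using mult_left_mono[of 1 "real n" k3] n k30 by (simp add: divide_le_eq)
   then have "2 / sqrt (real n) * ((norm u)\<^sup>2 * (2 * (k3 / real n) + 2 * m2) + (norm u)\<^sup>2 * m2) <= 2 / sqrt (real n) * ((norm u)\<^sup>2 * (2 * k3 + 2 * m2) + (norm u)\<^sup>2 * m2)"
    by (intro mult_left_mono add_right_mono) auto
   ultimately show "sqrt (real n) * ((norm u)\<^sup>2 * (k3 / real n)) + 2 / sqrt (real n) * ((norm u)\<^sup>2 * (2 * (k3 / real n) + 2 * m2) + (norm u)\<^sup>2 * m2)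
    <= (norm u)\<^sup>2 * (k3 + 2 * (2 * k3 + 3 * m2)) / sqrt (real n)"
    unfolding e2[symmetric] mult.left_commute[of "sqrt (real n)"] by simp
  qed simp
  finally have "cmod (\<phi> - \<psi>) <= (1 / real N) * ((norm u)\<^sup>2 * (k3 + 2 * (2 * k3 + 3 * m2)) / sqrt (real n))" .
  from mult_left_mono[OF this, of "real N"]
  have "real N * cmod (\<phi> - \<psi>) <= (norm u)\<^sup>2 * (k3 + 2 * (2 * k3 + 3 * m2)) / sqrt (real n)" using N by simp
  with 2 have 3: "cmod (\<phi> ^ N - \<psi> ^ N) <= (norm u)\<^sup>2 * (k3 + 2 * (2 * k3 + 3 * m2)) / sqrt (real n)" by linarith
  have "cmod (expectation (%om. iexp (u \<bullet> X om)) - \<psi> ^ N) <= B / sqrt (real n)"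
   using norm_triangle_ineq[of "expectation (%om. iexp (u \<bullet> X om)) - \<phi> ^ N" "\<phi> ^ N - \<psi> ^ N"] 1 3
   unfolding Y\<phi> B_def by (simp add: add_divide_distrib)
  then show "cmod (expectation (%om. iexp (u \<bullet> (sqrt (real N) *\<^sub>R score n (%t. ZN N t om))))
   - (expectation (%om. iexp ((u \<bullet> \<eta> om) / sqrt (real N)))) ^ N) <= B / sqrt (real n)" unfolding X_def \<psi>_def .
 qed
qed

lemma score_clt:
 assumes score: "has_score M T L \<rho> W \<theta>0 \<theta>0 0 \<eta>"
  and Ns: "filterlim Ns at_top sequentially" and ns: "filterlim ns at_top sequentially"
 shows "(%m. expectation (%om. iexp (u \<bullet> (sqrt (real (Ns m)) *\<^sub>R score (ns m) (%t. ZN (Ns m) t om)))))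
  \<longlonglongrightarrow> exp (- (LINT om|M. (u \<bullet> \<eta> om)\<^sup>2) / 2)"
proof -
 note \<eta> = score_properties[OF score]
 let ?E = "%N n. expectation (%om. iexp (u \<bullet> (sqrt (real N) *\<^sub>R score n (%t. ZN N t om))))"
 let ?P = "%N. (expectation (%om. iexp ((u \<bullet> \<eta> om) / sqrt (real N)))) ^ N"
 obtain B where B: "!!N n. 0 < N ==> 0 < n ==> cmod (?E N n - ?P N) <= B / sqrt (real n)"
  using score_char_bound[OF score, of u] by blast
 have um: "(%om. u \<bullet> \<eta> om) \<in> borel_measurable M" using \<eta>(1) by measurable
 have fin: "msq M \<eta> <= ennreal (expectation (%om. (norm (\<eta> om))\<^sup>2))"
  using msq_finite_integrable(3)[OF prob_space_axioms \<eta>(1) \<eta>(4)] by simp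
 have "?P \<longlonglongrightarrow> exp (- (LINT om|M. (u \<bullet> \<eta> om)\<^sup>2) / 2)"
  using inner_sq(1)[OF \<eta>(1) fin, of u] \<eta>(2,3) by (intro char_power_limit[OF prob_space_axioms um]) auto
 then have lim: "(%m. ?P (Ns m)) \<longlonglongrightarrow> exp (- (LINT om|M. (u \<bullet> \<eta> om)\<^sup>2) / 2)" by (rule filterlim_compose[OF _ Ns])
 have "(%n. B / sqrt (real n)) \<longlonglongrightarrow> 0" by real_asymp
 then have l0: "(%m. B / sqrt (real (ns m))) \<longlonglongrightarrow> 0" by (rule filterlim_compose[OF _ ns])
 have "(%m. ?E (Ns m) (ns m) - ?P (Ns m)) \<longlonglongrightarrow> 0"
 proof (rule Lim_null_comparison[OF _ l0])
  have "eventually (%m. 1 <= Ns m) sequentially" "eventually (%m. 1 <= ns m) sequentially"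
   using Ns ns by (auto simp: filterlim_at_top)
  then show "eventually (%m. norm (?E (Ns m) (ns m) - ?P (Ns m)) <= B / sqrt (real (ns m))) sequentially"
   by eventually_elim (rule B, auto)
 qed
 from tendsto_add[OF this lim] show ?thesis by simp
qed

end

section \<open>Asymptotic normality of the estimator\<close>

lemma inner_symmetric_matrix:
 fixes Q :: "real^'n^'n"
 assumes "transpose Q = Q" shows "u \<bullet> (Q *v y) = (Q *v u) \<bullet> y"
 using dot_lmul_matrix[of u Q y] transpose_matrix_vector[of Q u] assms by simp

context observed_regular begin

text \<open>The quadratic form of the covariance matrix is the second moment of a linear functional.\<close>

lemma score_covariance:
 assumes score: "has_score M T L \<rho> W \<theta>0 \<theta>0 0 \<eta>"
 defines "S \<equiv> (LINT om|M. outer (\<eta> om))"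
 shows "transpose S = S" "u \<bullet> (S *v u) = expectation (%om. (u \<bullet> \<eta> om)\<^sup>2)"
proof -
 note \<eta> = score_properties[OF score]
 have row: "outer x $ i = x $ i *\<^sub>R x" for x :: "real^'p" and i unfolding outer_def by (simp add: vec_eq_iff)
 have nb: "norm (outer x) <= real CARD('p) * (norm x)\<^sup>2" for x :: "real^'p"
 proof -
  have "norm (outer x) <= (\<Sum>i\<in>UNIV. norm (outer x $ i))" by (rule norm_vec_le_sum)
  also have "... <= (\<Sum>i\<in>(UNIV::'p set). (norm x)\<^sup>2)"
  proof (rule sum_mono)
   fix i
   have "\<bar>x $ i\<bar> * norm x <= norm x * norm x" by (intro mult_right_mono component_le_norm_cart) simp
   then show "norm (outer x $ i) <= (norm x)\<^sup>2" unfolding row by (simp add: power2_eq_square)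
  qed
  finally show ?thesis by simp
 qed
 have "outer \<in> borel_measurable (borel :: (real^'p) measure)"
  unfolding outer_def[abs_def] by (intro borel_measurable_continuous_onI continuous_intros)
 from measurable_compose[OF \<eta>(1) this] have om: "(%om. outer (\<eta> om)) \<in> borel_measurable M" .
 have oi: "integrable M (%om. outer (\<eta> om))"
  by (rule Bochner_Integration.integrable_bound[of M "%om. real CARD('p) * (norm (\<eta> om))\<^sup>2", OF _ om])
   (use msq_finite_integrable(1)[OF prob_space_axioms \<eta>(1) \<eta>(4)] nb in auto)
 have "linear (transpose :: real^'p^'p => real^'p^'p)"
  by (intro linearI) (auto simp: transpose_def vec_eq_iff)
 from integral_bounded_linear[OF linear_conv_bounded_linear[THEN iffD1, OF this] oi]
 have "transpose S = expectation (%om. transpose (outer (\<eta> om)))" unfolding S_def by simp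
 moreover have "transpose (outer x) = outer x" for x :: "real^'p" unfolding transpose_def outer_def by (simp add: vec_eq_iff mult.commute)
 ultimately show "transpose S = S" unfolding S_def by simp
 have "linear (%A :: real^'p^'p. u \<bullet> (A *v u))"
  by (intro linearI) (auto simp: matrix_vector_mult_add_rdistrib inner_add_right scaleR_matrix_vector_assoc[symmetric])
 from integral_bounded_linear[OF linear_conv_bounded_linear[THEN iffD1, OF this] oi]
 have "u \<bullet> (S *v u) = expectation (%om. u \<bullet> (outer (\<eta> om) *v u))" unfolding S_def by simp
 moreover have "u \<bullet> (outer x *v u) = (u \<bullet> x)\<^sup>2" for x :: "real^'p"
 proof -
  have "outer x *v u = (x \<bullet> u) *\<^sub>R x"
   unfolding matrix_vector_mult_def outer_def inner_vec_def by (simp add: vec_eq_iff sum_distrib_left sum_distrib_right mult_ac)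
  then show ?thesis by (simp add: power2_eq_square inner_commute)
 qed
 ultimately show "u \<bullet> (S *v u) = expectation (%om. (u \<bullet> \<eta> om)\<^sup>2)" by simp
qed

lemma information_I0: "information_matrix T h \<theta>0 = I0"
proof -
 have e: "(grad (h t) \<theta>0 ** transpose (grad (h t) \<theta>0)) $ i $ l = g i t \<theta>0 \<bullet> g l t \<theta>0" if "t \<in> {0..T}" for t i l
  unfolding matrix_matrix_mult_def transpose_def inner_vec_def using grad_g[OF that] by simp
 have "continuous_on {0..T} (%t. \<chi> i l. g i t \<theta>0 \<bullet> g l t \<theta>0)"
  by (intro continuous_intros g_continuous order_refl)
 then have "continuous_on {0..T} (%t. grad (h t) \<theta>0 ** transpose (grad (h t) \<theta>0))"
  by (rule continuous_on_cong[THEN iffD1, rotated 2]) (auto simp: vec_eq_iff e)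
 then have i: "integrable (leb T) (%t. grad (h t) \<theta>0 ** transpose (grad (h t) \<theta>0))" by (rule leb_continuous_integrable)
 have "information_matrix T h \<theta>0 $ a $ l = I0 $ a $ l" for a l
 proof -
  have bl: "bounded_linear (%A :: real^'p^'p. A $ a $ l)"
   by (rule bounded_linear_compose[OF bounded_linear_vec_nth bounded_linear_vec_nth])
  have "information_matrix T h \<theta>0 $ a $ l = (LINT t|leb T. (grad (h t) \<theta>0 ** transpose (grad (h t) \<theta>0)) $ a $ l)"
   unfolding information_matrix_def set_integral_leb using integral_bounded_linear[OF bl i] by simp
  also have "... = (LINT t|leb T. g a t \<theta>0 \<bullet> g l t \<theta>0)"
   by (intro Bochner_Integration.integral_cong refl) (simp add: e)
  finally show ?thesis unfolding I0_def set_integral_leb by simp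
 qed
 then show ?thesis by (simp add: vec_eq_iff)
qed

abbreviation "mean_rec N om \<equiv> (%t. mean_record (obs_record L \<rho> W \<theta>0) N t om)"

lemma mean_rec_0: "AE om in M. \<forall>N. mean_rec N om 0 = 0"
proof -
 have "AE om in M. \<forall>i. W i 0 om = 0" using wiener unfolding wiener_process_def by (simp add: AE_all_countable)
 then show ?thesis
  unfolding mean_record_def obs_record_def set_integral_point by eventually_elim simp
qed

lemma iexp_diff_le: "cmod (iexp x - iexp y) <= \<bar>x - y\<bar>" "cmod (iexp x - iexp y) <= 2"
proof -
 have "iexp x - iexp y = iexp y * (iexp (x - y) - 1)" by (simp add: right_diff_distrib exp_add[symmetric] algebra_simps)
 then show "cmod (iexp x - iexp y) <= \<bar>x - y\<bar>" using iexp_approx1[of "x - y" 0] by (simp add: norm_mult)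
 show "cmod (iexp x - iexp y) <= 2" using norm_triangle_ineq4[of "iexp x" "iexp y"] by simp
qed

text \<open>On the event \<open>fluct < \<delta>\<close> the deterministic expansion applies. On its complement the exponentials differ by at
most \<open>2\<close>, which Markov's inequality turns into a multiple of \<open>fluct / \<delta>\<close>. Adding both bounds gives an estimate valid
everywhere, whose expectation is controlled by \<open>fluct_ZN\<close>.\<close>

lemma estimator_char_bound:
 assumes info: "pos_def_matrix I0"
  and est: "!!N n. 0 < N ==> 0 < n ==> est N n \<in> borel_measurable M"
  and max: "!!N n. 0 < N ==> 0 < n ==> AE om in M. est N n om \<in> closure U \<and> (\<forall>\<theta>\<in>closure U. contrast T h (mean_rec N om) n \<theta> <= contrast T h (mean_rec N om) n (est N n om))"
 shows "\<exists>B\<ge>0. \<forall>w>0. \<exists>\<delta>>0. \<exists>n0. \<forall>N>0. \<forall>n\<ge>n0. 0 < n \<longrightarrow>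
  cmod (expectation (%om. iexp (u \<bullet> (sqrt (real N) *\<^sub>R (est N n om - \<theta>0))))
   - expectation (%om. iexp ((matrix_inv I0 *v u) \<bullet> (sqrt (real N) *\<^sub>R score n (%t. ZN N t om)))))
  <= B * w + B * (sqrt (real N) * (T / real n)) + 4 * sqrt Z_bd / \<delta> / sqrt (real N)"
proof -
 note Qs = pos_def_inverse(4)[OF info]
 obtain B0 where B0: "\<forall>w>0. \<exists>\<delta>>0. \<exists>n0. \<forall>n\<ge>n0. 0 < n --> (\<forall>y \<theta>. y 0 = 0 --> \<theta> \<in> closure U \<longrightarrow>
  (\<forall>\<theta>'\<in>closure U. contrast T h y n \<theta>' <= contrast T h y n \<theta>) --> fluct n (%j. fl y (\<tau> n j)) < \<delta> \<longrightarrow>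
   norm (\<theta> - \<theta>0 - matrix_inv I0 *v score n (fl y)) <= B0 * (w * fluct n (%j. fl y (\<tau> n j)) + T / real n))"
  using estimator_expansion[OF info] by (elim exE) (rule that)
 define B where "B = norm u * \<bar>B0\<bar> * (2 * sqrt Z_bd + 1)"
 have B: "0 <= B" "norm u * \<bar>B0\<bar> <= B" "norm u * \<bar>B0\<bar> * (2 * sqrt Z_bd) <= B"
 proof -
  have "0 <= norm u * \<bar>B0\<bar>" "0 <= norm u * \<bar>B0\<bar> * (2 * sqrt Z_bd)" using Z_bd_nonneg by auto
  then show "0 <= B" "norm u * \<bar>B0\<bar> <= B" "norm u * \<bar>B0\<bar> * (2 * sqrt Z_bd) <= B" unfolding B_def distrib_left by linarith+
 qed
 show ?thesis
 proof (rule exI[of _ B], intro conjI allI impI B(1))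
  fix w :: real assume w: "0 < w"
  obtain \<delta> n0 where \<delta>: "0 < \<delta>" and ex: "\<forall>n\<ge>n0. 0 < n --> (\<forall>y \<theta>. y 0 = 0 --> \<theta> \<in> closure U \<longrightarrow>
  (\<forall>\<theta>'\<in>closure U. contrast T h y n \<theta>' <= contrast T h y n \<theta>) --> fluct n (%j. fl y (\<tau> n j)) < \<delta> \<longrightarrow>
   norm (\<theta> - \<theta>0 - matrix_inv I0 *v score n (fl y)) <= B0 * (w * fluct n (%j. fl y (\<tau> n j)) + T / real n))"
   using B0[THEN spec, THEN mp, OF w] by (elim exE conjE) (rule that)
  show "\<exists>\<delta>>0. \<exists>n0. \<forall>N>0. \<forall>n\<ge>n0. 0 < n \<longrightarrow>
  cmod (expectation (%om. iexp (u \<bullet> (sqrt (real N) *\<^sub>R (est N n om - \<theta>0))))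
   - expectation (%om. iexp ((matrix_inv I0 *v u) \<bullet> (sqrt (real N) *\<^sub>R score n (%t. ZN N t om)))))
  <= B * w + B * (sqrt (real N) * (T / real n)) + 4 * sqrt Z_bd / \<delta> / sqrt (real N)"
  proof (intro exI[of _ \<delta>] exI[of _ n0] conjI allI impI \<delta>)
   fix N n :: nat assume N: "0 < N" and n0: "n0 <= n" and n: "0 < n"
   define x y where "x om = u \<bullet> (sqrt (real N) *\<^sub>R (est N n om - \<theta>0))" and "y om = (matrix_inv I0 *v u) \<bullet> (sqrt (real N) *\<^sub>R score n (%t. ZN N t om))" for om
   define F where "F om = fluct n (%j. ZN N (\<tau> n j) om)" for om
   note F = fluct_ZN[OF N n, folded F_def]
   have F0: "0 <= F om" for om unfolding F_def by (rule fluct_nonneg)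
   have [measurable]: "est N n \<in> borel_measurable M" by (rule est[OF N n])
   have scm[measurable]: "sc i n \<in> borel_measurable M" for i by (rule FT_M[OF sc_FT])
   have xm: "x \<in> borel_measurable M" unfolding x_def[abs_def] by measurable
   have ym: "y \<in> borel_measurable M" unfolding y_def[abs_def] score_ZN by measurable
   have i: "integrable M (%om. iexp (x om))" "integrable M (%om. iexp (y om))"
    using iexp_integrable[OF prob_space_axioms xm, of 1] iexp_integrable[OF prob_space_axioms ym, of 1] by simp_all
   define c where "c = norm u * \<bar>B0\<bar>"
   have c0: "0 <= c" unfolding c_def by simp
   have ae: "AE om in M. cmod (iexp (x om) - iexp (y om)) <= sqrt (real N) * (c * w) * F om + c * (sqrt (real N) * (T / real n)) + 2 / \<delta> * F om"
    using mean_rec_0 max[OF N n]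
   proof eventually_elim
    case (elim om)
    have fy: "fl (mean_rec N om) = (%t. ZN N t om)" by (rule ext) (rule ZN_eq[OF N])
    have nn: "0 <= sqrt (real N) * (c * w) * F om" "0 <= c * (sqrt (real N) * (T / real n))" "0 <= 2 / \<delta> * F om"
     using c0 w T \<delta> F0[of om] by auto
    show ?case
    proof (cases "F om < \<delta>")
     case True
     have "norm (est N n om - \<theta>0 - matrix_inv I0 *v score n (%t. ZN N t om)) <= B0 * (w * F om + T / real n)"
      using ex[THEN spec, THEN mp, OF n0, THEN mp, OF n, THEN spec[where x="mean_rec N om"], THEN spec[where x="est N n om"]] elim True
      unfolding fy F_def by simp
     also have "... <= \<bar>B0\<bar> * (w * F om + T / real n)" using w T F0[of om] by (intro mult_right_mono) auto
     finally have nb: "norm (est N n om - \<theta>0 - matrix_inv I0 *v score n (%t. ZN N t om)) <= \<bar>B0\<bar> * (w * F om + T / real n)" .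
     have "x om - y om = sqrt (real N) * (u \<bullet> (est N n om - \<theta>0 - matrix_inv I0 *v score n (%t. ZN N t om)))"
      unfolding x_def y_def inner_symmetric_matrix[OF Qs, symmetric] by (simp add: inner_diff_right right_diff_distrib matrix_vector_mult_scaleR)
     then have "\<bar>x om - y om\<bar> = sqrt (real N) * \<bar>u \<bullet> (est N n om - \<theta>0 - matrix_inv I0 *v score n (%t. ZN N t om))\<bar>" by (simp add: abs_mult)
     also have "... <= sqrt (real N) * (norm u * (\<bar>B0\<bar> * (w * F om + T / real n)))"
      using nb by (intro mult_left_mono order_trans[OF Cauchy_Schwarz_ineq2]) auto
     also have "... = sqrt (real N) * (c * w) * F om + c * (sqrt (real N) * (T / real n))" unfolding c_def by (simp add: algebra_simps)
     finally show ?thesis using iexp_diff_le(1)[of "x om" "y om"] nn by linarith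
    next
     case False
     then have "2 <= 2 / \<delta> * F om" using \<delta> by (simp add: field_simps)
     then show ?thesis using iexp_diff_le(2)[of "x om" "y om"] nn by linarith
    qed
   qed
   have "cmod (expectation (%om. iexp (x om)) - expectation (%om. iexp (y om))) = cmod (expectation (%om. iexp (x om) - iexp (y om)))"
    using i by simp
   also have "... <= expectation (%om. cmod (iexp (x om) - iexp (y om)))" by (rule integral_norm_bound)
   also have "... <= expectation (%om. sqrt (real N) * (c * w) * F om + c * (sqrt (real N) * (T / real n)) + 2 / \<delta> * F om)"
    by (rule integral_mono_AE[OF _ _ ae]) (use i F(1) in auto)
   also have "... = (sqrt (real N) * (c * w) + 2 / \<delta>) * expectation F + c * (sqrt (real N) * (T / real n))"
    using F(1) by (simp add: prob_space distrib_right)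
   also have "... <= (sqrt (real N) * (c * w) + 2 / \<delta>) * (2 * sqrt (Z_bd / real N)) + c * (sqrt (real N) * (T / real n))"
    using c0 w \<delta> by (intro add_right_mono mult_left_mono F(2)) auto
   also have "... = c * (2 * sqrt Z_bd) * w + 4 * sqrt Z_bd / \<delta> / sqrt (real N) + c * (sqrt (real N) * (T / real n))"
    using N by (simp add: real_sqrt_divide field_simps)
   also have "... <= B * w + 4 * sqrt Z_bd / \<delta> / sqrt (real N) + B * (sqrt (real N) * (T / real n))"
    unfolding c_def using B(2,3) w T by (intro add_mono mult_right_mono order_refl) auto
   finally show "cmod (expectation (%om. iexp (u \<bullet> (sqrt (real N) *\<^sub>R (est N n om - \<theta>0))))
    - expectation (%om. iexp ((matrix_inv I0 *v u) \<bullet> (sqrt (real N) *\<^sub>R score n (%t. ZN N t om)))))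
    <= B * w + B * (sqrt (real N) * (T / real n)) + 4 * sqrt Z_bd / \<delta> / sqrt (real N)" unfolding x_def y_def by linarith
  qed
 qed
qed

text \<open>By symmetry of the inverse information matrix the functional \<open>u\<close> of the estimation error becomes the functional
$I(\theta_0)^{-1}u$ of the score, whose limiting variance is the quadratic form of the sandwich matrix at \<open>u\<close>.\<close>

theorem estimator_clt:
 assumes info: "pos_def_matrix I0" and score: "has_score M T L \<rho> W \<theta>0 \<theta>0 0 \<eta>"
  and est: "!!N n. 0 < N ==> 0 < n ==> est N n \<in> borel_measurable M"
  and max: "!!N n. 0 < N ==> 0 < n ==> AE om in M. est N n om \<in> closure U \<and> (\<forall>\<theta>\<in>closure U. contrast T h (mean_rec N om) n \<theta> <= contrast T h (mean_rec N om) n (est N n om))"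
  and Ns: "filterlim Ns at_top sequentially" and ns: "filterlim ns at_top sequentially"
  and Ns_ns: "(%m. sqrt (real (Ns m)) * (T / real (ns m))) \<longlonglongrightarrow> 0"
 shows "converges_in_distribution M (%m om. sqrt (real (Ns m)) *\<^sub>R (est (Ns m) (ns m) om - \<theta>0))
     (normal_law 0 (matrix_inv I0 ** (LINT om|M. outer (\<eta> om)) ** matrix_inv I0))"
proof -
 define S where "S = (LINT om|M. outer (\<eta> om))"
 \<comment> \<open>the sandwich covariance, with the symmetric inverse kept abstract\<close>
 define Q where "Q = matrix_inv I0"
 define V where "V = Q ** S ** Q"
 have Qs: "transpose Q = Q" unfolding Q_def by (rule pos_def_inverse(4)[OF info])
 note S = score_covariance[OF score, folded S_def]
 have VV: "u \<bullet> (V *v u) = expectation (%om. ((Q *v u) \<bullet> \<eta> om)\<^sup>2)" for u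
  unfolding V_def matrix_vector_mul_assoc[symmetric] inner_symmetric_matrix[OF Qs] by (rule S(2))
 have psd: "psd_matrix V"
  unfolding psd_matrix_def VV
 proof (intro conjI allI)
  show "transpose V = V" unfolding V_def by (simp add: matrix_transpose_mul Qs S(1) matrix_mul_assoc)
 qed simp
 note nl = normal_law_char[OF psd]
 define X where "X m om = sqrt (real (Ns m)) *\<^sub>R (est (Ns m) (ns m) om - \<theta>0)" for m om
 have ev: "eventually (%m. n0 <= Ns m) sequentially" "eventually (%m. n0 <= ns m) sequentially" for n0
  using Ns ns by (auto simp: filterlim_at_top)
 have "eventually (%m. 1 <= Ns m \<and> 1 <= ns m) sequentially" using ev[of 1] by eventually_elim simp
 \<comment> \<open>the estimator is measurable only for positive indices, so the first terms of the sequence are dropped\<close>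
 then obtain m0 where m0: "!!m. m0 <= m ==> 0 < Ns m \<and> 0 < ns m" unfolding eventually_sequentially by fastforce
 have Xm: "X (m + m0) \<in> borel_measurable M" for m
 proof -
  have [measurable]: "est (Ns (m + m0)) (ns (m + m0)) \<in> borel_measurable M" using m0[of "m + m0"] by (intro est) auto
  show ?thesis unfolding X_def[abs_def] by measurable
 qed
 have char: "(%m. expectation (%om. iexp (u \<bullet> X m om))) \<longlonglongrightarrow> (LINT x|normal_law 0 V. iexp (u \<bullet> x))" for u
 proof -
  let ?E = "%m. expectation (%om. iexp (u \<bullet> X m om))"
  let ?P = "%m. expectation (%om. iexp ((Q *v u) \<bullet> (sqrt (real (Ns m)) *\<^sub>R score (ns m) (%t. ZN (Ns m) t om))))"
  have P: "?P \<longlonglongrightarrow> (LINT x|normal_law 0 V. iexp (u \<bullet> x))"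
   unfolding nl(3) VV by (rule score_clt[OF score Ns ns])
  have "\<exists>B\<ge>0. \<forall>w>0. \<exists>\<delta>>0. \<exists>n0. \<forall>N>0. \<forall>n\<ge>n0. 0 < n \<longrightarrow>
    cmod (expectation (%om. iexp (u \<bullet> (sqrt (real N) *\<^sub>R (est N n om - \<theta>0))))
     - expectation (%om. iexp ((Q *v u) \<bullet> (sqrt (real N) *\<^sub>R score n (%t. ZN N t om)))))
    <= B * w + B * (sqrt (real N) * (T / real n)) + 4 * sqrt Z_bd / \<delta> / sqrt (real N)"
   unfolding Q_def by (rule estimator_char_bound[where est=est, OF info]) (rule est max; assumption)+
  then obtain B where B: "0 <= B" and bd: "\<forall>w>0. \<exists>\<delta>>0. \<exists>n0. \<forall>N>0. \<forall>n\<ge>n0. 0 < n \<longrightarrow>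
    cmod (expectation (%om. iexp (u \<bullet> (sqrt (real N) *\<^sub>R (est N n om - \<theta>0))))
     - expectation (%om. iexp ((Q *v u) \<bullet> (sqrt (real N) *\<^sub>R score n (%t. ZN N t om)))))
    <= B * w + B * (sqrt (real N) * (T / real n)) + 4 * sqrt Z_bd / \<delta> / sqrt (real N)"
   by (elim exE conjE) (rule that)
  have "(%m. ?E m - ?P m) \<longlonglongrightarrow> 0"
  proof (rule tendstoI)
   fix e :: real assume e: "0 < e"
   \<comment> \<open>half of the tolerance goes to the linearization error, half to the mesh and the fluctuation tail\<close>
   define w where "w = e / (2 * (B + 1))"
   have w: "0 < w" unfolding w_def using e B by simp
   have Bw: "B * w <= e / 2" unfolding w_def using e B by (simp add: field_simps)
   obtain \<delta> n0 where bound: "\<forall>N>0. \<forall>n\<ge>n0. 0 < n \<longrightarrow>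
    cmod (expectation (%om. iexp (u \<bullet> (sqrt (real N) *\<^sub>R (est N n om - \<theta>0))))
     - expectation (%om. iexp ((Q *v u) \<bullet> (sqrt (real N) *\<^sub>R score n (%t. ZN N t om)))))
    <= B * w + B * (sqrt (real N) * (T / real n)) + 4 * sqrt Z_bd / \<delta> / sqrt (real N)"
    using bd[THEN spec, THEN mp, OF w] by (elim exE conjE) (rule that)
   have "(%N. a / sqrt (real N)) \<longlonglongrightarrow> 0" for a :: real by real_asymp
   from filterlim_compose[OF this Ns, of "4 * sqrt Z_bd / \<delta>"] tendsto_mult_left[OF Ns_ns, of B]
   have "(%m. B * (sqrt (real (Ns m)) * (T / real (ns m))) + 4 * sqrt Z_bd / \<delta> / sqrt (real (Ns m))) \<longlonglongrightarrow> B * 0 + 0"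
    by (intro tendsto_add)
   then have "eventually (%m. B * (sqrt (real (Ns m)) * (T / real (ns m))) + 4 * sqrt Z_bd / \<delta> / sqrt (real (Ns m)) < e / 2) sequentially"
    by (rule order_tendstoD(2)) (use e in simp)
   then show "eventually (%m. dist (?E m - ?P m) 0 < e) sequentially"
    using ev(1)[of 1] ev(2)[of 1] ev(2)[of n0]
   proof eventually_elim
    case (elim m)
    have "cmod (?E m - ?P m) <= B * w + B * (sqrt (real (Ns m)) * (T / real (ns m))) + 4 * sqrt Z_bd / \<delta> / sqrt (real (Ns m))"
     unfolding X_def using elim by (intro bound[rule_format]) auto
    then show ?case using elim(1) Bw by (simp only: dist_norm diff_0_right)
   qed
  qed
  from tendsto_add[OF this P] show ?thesis by simp
 qed
 have "converges_in_distribution M (%m. X (m + m0)) (normal_law 0 V)"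
  by (rule levy_continuity_vec[OF prob_space_axioms Xm nl(1,2)]) (rule LIMSEQ_ignore_initial_segment[OF char])
 then have "converges_in_distribution M X (normal_law 0 V)"
  unfolding converges_in_distribution_def by (auto intro: LIMSEQ_offset)
 then show ?thesis unfolding X_def[abs_def] V_def Q_def S_def .
qed

end

theorem theorem3p5:
  fixes M :: "'a measure"
    and T :: real
    and \<Theta>o \<Theta> :: "(real^'p) set"
    and \<theta>0 :: "real^'p"
    and A :: "'p set"
    and H :: "real^'p \<Rightarrow> complex^'d^'d"
    and L :: "real^'p \<Rightarrow> 'r::finite \<Rightarrow> complex^'d^'d"
    and W :: "nat \<Rightarrow> real \<Rightarrow> 'a \<Rightarrow> real^'r"
    and \<rho>0 :: "complex^'d^'d"
    and \<rho> :: "real^'p \<Rightarrow> nat \<Rightarrow> real \<Rightarrow> 'a \<Rightarrow> complex^'d^'d"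
    and \<eta> :: "'a \<Rightarrow> real^'p"
    and est :: "nat \<Rightarrow> nat \<Rightarrow> 'a \<Rightarrow> real^'p"
    and Ns ns :: "nat \<Rightarrow> nat"
  defines "h \<equiv> mean_signal M L \<rho>"
    and "Y \<equiv> obs_record L \<rho> W \<theta>0"
    and "I0 \<equiv> information_matrix T (mean_signal M L \<rho>) \<theta>0"
    and "\<Sigma> \<equiv> (LINT \<omega>|M. outer (\<eta> \<omega>))"
  assumes M: "prob_space M" and T: "0 < T"
    and Theta: "open \<Theta>o" "convex \<Theta>o" "bounded \<Theta>o" "\<Theta> = closure \<Theta>o" "\<theta>0 \<in> \<Theta>o"
    and H_alpha: "depends_only_on A \<Theta> H"
    and L_beta: "\<And>k. depends_only_on (- A) \<Theta> (\<lambda>\<theta>. L \<theta> k)"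
    and H_self_adjoint: "\<And>\<theta>. \<theta> \<in> \<Theta> \<Longrightarrow> self_adjoint (H \<theta>)"
    and rho0: "density_matrix \<rho>0"
    and wiener: "\<And>i. wiener_process M T (W i)"
    and indep: "prob_space.indep_vars M (\<lambda>i. PiM {0..T} (\<lambda>_. borel))
                  (\<lambda>i \<omega>. \<lambda>t\<in>{0..T}. W i t \<omega>) UNIV"
    and solution: "\<And>\<theta> i. \<theta> \<in> \<Theta> \<Longrightarrow> belavkin_solution M T (H \<theta>) (L \<theta>) \<rho>0 (W i) (\<rho> \<theta> i)"
    and smooth_H: "cont_diff_closure 3 \<Theta>o H"
    and smooth_L: "\<And>k. cont_diff_closure 3 \<Theta>o (\<lambda>\<theta>. L \<theta> k)"
    and identifiable: "\<And>\<theta>. \<theta> \<in> \<Theta> \<Longrightarrow> \<theta> \<noteq> \<theta>0 \<Longrightarrow>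
        \<exists>t\<in>{0..T}. bvec (L \<theta>) (mean_state M \<rho> \<theta> t) \<noteq> bvec (L \<theta>0) (mean_state M \<rho> \<theta>0 t)"
    and information: "pos_def_matrix I0"
    and score: "has_score M T L \<rho> W \<theta>0 \<theta>0 0 \<eta>"
    and est_measurable: "\<And>N n. 1 \<le> N \<Longrightarrow> 1 \<le> n \<Longrightarrow> est N n \<in> borel_measurable M"
    and est_maximizer: "\<And>N n. 1 \<le> N \<Longrightarrow> 1 \<le> n \<Longrightarrow> AE \<omega> in M.
        is_arg_max (contrast T h (\<lambda>t. mean_record Y N t \<omega>) n) (\<lambda>\<theta>. \<theta> \<in> \<Theta>) (est N n \<omega>)"
    and Ns: "filterlim Ns at_top sequentially"
    and ns: "filterlim ns at_top sequentially"
    and Ns_ns: "(\<lambda>m. sqrt (real (Ns m)) * (T / real (ns m))) \<longlonglongrightarrow> 0"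
  shows "converges_in_distribution M
           (\<lambda>m \<omega>. sqrt (real (Ns m)) *\<^sub>R (est (Ns m) (ns m) \<omega> - \<theta>0))
           (normal_law 0 (matrix_inv I0 ** \<Sigma> ** matrix_inv I0))"
proof -
  note defs = h_def Y_def and I0_eq = I0_def and \<Sigma>_eq = \<Sigma>_def
  have smooth: "\<exists>D. C1_on \<Theta>o f D" if "cont_diff_closure 3 \<Theta>o f" for f :: "real^'p \<Rightarrow> complex^'d^'d"
    using C1_onI_cont_diff[of "Suc (Suc 0)" \<Theta>o f] that by (metis numeral_3_eq_3)
  interpret observed_model M T \<Theta>o \<theta>0 H L W \<rho>0 \<rho>
  proof (intro observed_model.intro observed_model_axioms.intro)
    show "\<exists>t\<in>{0..T}. mean_signal M L \<rho> t \<theta> \<noteq> mean_signal M L \<rho> t \<theta>0" if "\<theta> \<in> closure \<Theta>o" "\<theta> \<noteq> \<theta>0" for \<theta>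
      using identifiable that Theta(4) unfolding mean_signal_def by simp
    show "belavkin_solution M T (H \<theta>) (L \<theta>) \<rho>0 (W i) (\<rho> \<theta> i)" if "\<theta> \<in> closure \<Theta>o" for \<theta> i
      using solution that Theta(4) by simp
    show "\<exists>D. C1_on \<Theta>o H D" "\<exists>D. C1_on \<Theta>o (\<lambda>\<theta>. L \<theta> k) D" for k by (rule smooth smooth_H smooth_L)+
  qed (fact M T Theta wiener indep)+
  obtain g C md where "regular_signal T \<Theta>o \<theta>0 (mean_signal M L \<rho>) g C md" using regular by blast
  then interpret observed_regular M T \<Theta>o \<theta>0 H L W \<rho>0 \<rho> g C md
    by (intro observed_regular.intro observed_model_axioms)
  have I0: "I0 = regular_signal.I0 T \<theta>0 g" unfolding I0_eq by (rule information_I0)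
  have max: "AE \<omega> in M. est N n \<omega> \<in> closure \<Theta>o \<and> (\<forall>\<theta>\<in>closure \<Theta>o. contrast T h (\<lambda>t. mean_record Y N t \<omega>) n \<theta> \<le> contrast T h (\<lambda>t. mean_record Y N t \<omega>) n (est N n \<omega>))"
    if "0 < N" "0 < n" for N n
  proof -
    have "AE \<omega> in M. is_arg_max (contrast T h (\<lambda>t. mean_record Y N t \<omega>) n) (\<lambda>\<theta>. \<theta> \<in> \<Theta>) (est N n \<omega>)"
      using est_maximizer[of N n] that by simp
    then show ?thesis by eventually_elim (auto simp: is_arg_max_def Theta(4) not_less)
  qed
  show ?thesis
    unfolding I0 \<Sigma>_eq
    by (rule estimator_clt) (use information score est_measurable max Ns ns Ns_ns in \<open>auto simp: I0 defs Suc_le_eq\<close>)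
qed

end
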